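(* Let $X$ be a random element of the Hilbert sphere $\mathcal S^\infty$ whose support $\mathcal U\subset\mathcal S^\infty$ satisfies $P(X\in\mathcal U)=1$ and $\sup_{x,y\in\mathcal U}\rho(x,y)\le \pi/2$. Let $\mu$ be the intrinsic mean of $X$, $\hat\mu$ the sample intrinsic mean of independent copies $X_1,\dots,X_n$ of $X$, and $V=\log_\mu X$. Let $x\in\mathcal S^\infty$ be any point with $\rho(x,\mu)<\pi$. Then $v=\log_\mu x$ is well defined and $\hat v=\log_{\hat\mu}x$ is well defined almost surely as $n\to\infty$ (i.e. almost surely for all sufficiently large $n$). Moreover, $$\sqrt n\,(P_{\hat\mu}^{\mu}\hat v-v)\to Z_v\quad\text{in distribution as }n\to\infty,$$ where $Z_v$ is a Gaussian random element in $T_\mu\mathcal S^\infty$ with mean $0$ and covariance operator $\Lambda_{x1}\Lambda_1^{-1}E[V\otimes V]\Lambda_1^{-1}\Lambda_{x1}$.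
   Context: $\mathbb H$ is a separable infinite-dimensional real Hilbert space with inner product $\langle\cdot,\cdot\rangle$ and norm $\|\cdot\|$. The Hilbert sphere is $\mathcal S^\infty=\{f\in\mathbb H : \|f\|=1\}$, with geodesic distance $\rho(f,g)=\arccos\langle f,g\rangle$. A random element $X$ of $\mathcal S^\infty$ is a map from a complete probability space to $\mathcal S^\infty$, measurable with respect to the Borel $\sigma$-algebra induced by $\rho$. The intrinsic (Fréchet) mean of $X$ is the unique minimizer $\mu$ over $p\in\mathcal S^\infty$ of $M(p)=E\rho^2(X,p)$; the sample intrinsic mean $\hat\mu$ is the unique minimizer over $p\in\mathcal S^\infty$ of $M_n(p)=n^{-1}\sum_{i=1}^n\rho^2(X_i,p)$. Under the stated condition on the support, $\mu$ exists and is unique, and almost surely so does $\hat\mu$; moreover $\hat\mu\to\mu$ almost surely and $P(\rho(\mu,X)<\pi/2)=1$. The tangent space at $p$ is the Hilbert space $T_p\mathcal S^\infty=\{v\in\mathbb H:\langle v,p\rangle=0\}$ with the inner product of $\mathbb H$. The exponential map is $\exp_p v=\cos(\|v\|)p+\sin(\|v\|)\|v\|^{-1}v$, and the logarithm map $\log_p:\mathcal S^\infty\setminus\{-p\}\to T_p\mathcal S^\infty$ is $\log_p x=\arccos(\langle p,x\rangle)\|u\|^{-1}u$ with $u=x-\langle p,x\rangle p$ (and $\log_pp=0$). For $x,y\in\mathcal S^\infty$ with $y\ne -x$, $P_x^y:T_x\mathcal S^\infty\to T_y\mathcal S^\infty$ is parallel transport (for the Levi-Civita connection) along the unique minimizing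 geodesic from $x$ to $y$; explicitly $P_x^yw=w-\frac{\langle w,y\rangle}{1+\langle x,y\rangle}(x+y)$. The tensor product on $T_\mu\mathcal S^\infty$ is $(f\otimes g)h=\langle f,h\rangle g$. For $x$ with $\rho(x,\mu)<\pi$, $\Lambda_x=D_2^2\rho^2(x,\mu)\in\mathcal B(T_\mu\mathcal S^\infty,\mathcal B(T_\mu\mathcal S^\infty,\mathbb R))$ denotes the second Fréchet derivative at $v=0$ of $v\mapsto\rho^2(x,\exp_\mu v)$, $v\in T_\mu\mathcal S^\infty$, and $\Lambda_{x1}\in\mathcal B(T_\mu\mathcal S^\infty,T_\mu\mathcal S^\infty)$ is defined by $\Lambda_xv=\langle\Lambda_{x1}v,\cdot\rangle$. Likewise $\Lambda=E\,D_2^2\rho^2(X,\mu)$ and $\Lambda_1$ is defined by $\Lambda v=\langle\Lambda_1v,\cdot\rangle$; $\Lambda_1$ is continuously invertible. *)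

theory Defs
  imports "HOL-Probability.Probability"
begin

section \<open>Geometry of the Hilbert sphere\<close>

text \<open>
  The separable Hilbert space is a type of sort
  \<open>{real_inner, banach, second_countable_topology}\<close>; the Hilbert sphere is \<open>sphere 0 1\<close>.
\<close>

definition infinite_dimensional :: "'h::real_vector itself \<Rightarrow> bool" where
  "infinite_dimensional _ \<longleftrightarrow> \<not> (\<exists>B :: 'h set. finite B \<and> span B = UNIV)"

definition rho :: "'h::real_inner \<Rightarrow> 'h \<Rightarrow> real" where
  "rho x y = arccos (x \<bullet> y)"

definition tangent :: "'h::real_inner \<Rightarrow> 'h set" where
  "tangent p = {v. v \<bullet> p = 0}"

text \<open>Since \<open>0 / 0 = 0\<close>, the next two formulas give \<open>sexp p 0 = p\<close> and \<open>slog p p = 0\<close>.\<close>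

definition sexp :: "'h::real_inner \<Rightarrow> 'h \<Rightarrow> 'h" where
  "sexp p v = cos (norm v) *\<^sub>R p + (sin (norm v) / norm v) *\<^sub>R v"

definition slog :: "'h::real_inner \<Rightarrow> 'h \<Rightarrow> 'h" where
  "slog p x = (let u = x - (p \<bullet> x) *\<^sub>R p in (arccos (p \<bullet> x) / norm u) *\<^sub>R u)"

definition slog_domain :: "'h::real_inner \<Rightarrow> 'h set" where
  "slog_domain p = sphere 0 1 - {- p}"

text \<open>
  Parallel transport from the tangent space at \<open>x\<close> to that at \<open>y\<close> along the minimizing
  geodesic, meaningful for \<open>y \<noteq> - x\<close> and tangent vectors \<open>w\<close> at \<open>x\<close>.
\<close>

definition ptransport :: "'h::real_inner \<Rightarrow> 'h \<Rightarrow> 'h \<Rightarrow> 'h" where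
  "ptransport x y w = w - ((w \<bullet> y) / (1 + x \<bullet> y)) *\<^sub>R (x + y)"


section \<open>Random elements of the sphere and intrinsic means\<close>

text \<open>The Borel sigma-algebra generated by the sets that are open with respect to \<^const>\<open>rho\<close>.\<close>

definition rho_open :: "'h::real_inner set \<Rightarrow> bool" where
  "rho_open G \<longleftrightarrow> G \<subseteq> sphere 0 1 \<and>
     (\<forall>x\<in>G. \<exists>e>0. \<forall>y\<in>sphere 0 1. rho x y < e \<longrightarrow> y \<in> G)"

definition sphere_borel :: "'h::real_inner measure" where
  "sphere_borel = sigma (sphere 0 1) (Collect rho_open)"

definition rv_support :: "'w measure \<Rightarrow> ('w \<Rightarrow> 'h::real_inner) \<Rightarrow> 'h set" where
  "rv_support M X = {x \<in> sphere 0 1.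
     \<forall>G. rho_open G \<and> x \<in> G \<longrightarrow> measure M {\<omega> \<in> space M. X \<omega> \<in> G} > 0}"

definition unique_minimizer :: "'b set \<Rightarrow> ('b \<Rightarrow> real) \<Rightarrow> 'b \<Rightarrow> bool" where
  "unique_minimizer S f m \<longleftrightarrow>
     is_arg_min f (\<lambda>p. p \<in> S) m \<and> (\<forall>p. is_arg_min f (\<lambda>p. p \<in> S) p \<longrightarrow> p = m)"

definition is_intrinsic_mean :: "'w measure \<Rightarrow> ('w \<Rightarrow> 'h::real_inner) \<Rightarrow> 'h \<Rightarrow> bool" where
  "is_intrinsic_mean M X m \<longleftrightarrow>
     unique_minimizer (sphere 0 1) (\<lambda>p. \<integral>\<omega>. (rho (X \<omega>) p)\<^sup>2 \<partial>M) m"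

definition is_sample_intrinsic_mean :: "nat \<Rightarrow> (nat \<Rightarrow> 'h::real_inner) \<Rightarrow> 'h \<Rightarrow> bool" where
  "is_sample_intrinsic_mean n xs m \<longleftrightarrow>
     unique_minimizer (sphere 0 1) (\<lambda>p. (\<Sum>i<n. (rho (xs i) p)\<^sup>2) / real n) m"


section \<open>Operators on a tangent space\<close>

text \<open>
  A bounded operator on \<open>tangent p\<close> is represented by its extension to the whole space that
  vanishes at \<open>p\<close>.  For \<open>norm p = 1\<close> the orthogonal projection onto \<open>tangent p\<close> has norm at
  most one, so this identification preserves the operator norm.
  Thus \<open>tangent_hom p\<close> is \<open>B(T, Y)\<close>, \<open>tangent_op p\<close> is \<open>B(T, T)\<close> and \<open>tangent_bilin p\<close> is
  \<open>B(T, B(T, R))\<close>, where \<open>T = tangent p\<close>.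
\<close>

definition tangent_hom :: "'h::real_inner \<Rightarrow> ('h \<Rightarrow>\<^sub>L 'b::real_normed_vector) set" where
  "tangent_hom p = {A. blinfun_apply A p = 0}"

definition tangent_op :: "'h::real_inner \<Rightarrow> ('h \<Rightarrow>\<^sub>L 'h) set" where
  "tangent_op p = {A \<in> tangent_hom p. range (blinfun_apply A) \<subseteq> tangent p}"

definition tangent_bilin :: "'h::real_inner \<Rightarrow> ('h \<Rightarrow>\<^sub>L 'h \<Rightarrow>\<^sub>L real) set" where
  "tangent_bilin p = {D \<in> tangent_hom p. range (blinfun_apply D) \<subseteq> tangent_hom p}"

definition tangent_inverse :: "'h::real_inner \<Rightarrow> ('h \<Rightarrow>\<^sub>L 'h) \<Rightarrow> ('h \<Rightarrow>\<^sub>L 'h)" where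
  "tangent_inverse p A = (THE B. B \<in> tangent_op p \<and>
     (\<forall>v\<in>tangent p. blinfun_apply A (blinfun_apply B v) = v \<and>
                     blinfun_apply B (blinfun_apply A v) = v))"

text \<open>The operator \<open>L\<close> with \<open>D v = \<langle>L v, \<cdot>\<rangle>\<close>.\<close>

definition riesz_op :: "'h::real_inner \<Rightarrow> ('h \<Rightarrow>\<^sub>L 'h \<Rightarrow>\<^sub>L real) \<Rightarrow> ('h \<Rightarrow>\<^sub>L 'h)" where
  "riesz_op p D = (THE L. L \<in> tangent_op p \<and>
     (\<forall>v\<in>tangent p. \<forall>w\<in>tangent p.
        blinfun_apply (blinfun_apply D v) w = blinfun_apply L v \<bullet> w))"

lift_definition tensor :: "'h::real_inner \<Rightarrow> 'h \<Rightarrow> 'h \<Rightarrow>\<^sub>L 'h"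
  is "\<lambda>f g h. (f \<bullet> h) *\<^sub>R g"
  by (intro bounded_linear_compose[OF bounded_linear_scaleR_left] bounded_linear_inner_right)

text \<open>
  \<open>D\<close> is the second Frechet derivative at \<open>0\<close> of a real function \<open>F\<close> on the Hilbert space
  \<open>tangent p\<close>: \<open>DF\<close> is the first derivative near \<open>0\<close>, with values in the dual of \<open>tangent p\<close>.
  The memberships in \<open>tangent_hom p\<close> and \<open>tangent_bilin p\<close> make the derivatives unique, since
  \<open>at v within tangent p\<close> only determines them on \<open>tangent p\<close>.
\<close>

definition has_second_derivative_on_tangent ::
  "'h::real_inner \<Rightarrow> ('h \<Rightarrow> real) \<Rightarrow> ('h \<Rightarrow>\<^sub>L 'h \<Rightarrow>\<^sub>L real) \<Rightarrow> bool" where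
  "has_second_derivative_on_tangent p F D \<longleftrightarrow> D \<in> tangent_bilin p \<and>
     (\<exists>DF :: 'h \<Rightarrow> 'h \<Rightarrow>\<^sub>L real.
        (\<exists>e>0. \<forall>v\<in>tangent p. norm v < e \<longrightarrow>
           DF v \<in> tangent_hom p \<and>
           (F has_derivative blinfun_apply (DF v)) (at v within tangent p)) \<and>
        (DF has_derivative blinfun_apply D) (at 0 within tangent p))"

definition D2_rho2 :: "'h::real_inner \<Rightarrow> 'h \<Rightarrow> ('h \<Rightarrow>\<^sub>L 'h \<Rightarrow>\<^sub>L real)" where
  "D2_rho2 p x =
     (THE D. has_second_derivative_on_tangent p (\<lambda>v. (rho x (sexp p v))\<^sup>2) D)"


section \<open>Expectation, Gaussian elements, convergence in distribution\<close>

text \<open>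
  The Bochner integral in operator norm.  The clauses are those of \<^const>\<open>has_bochner_integral\<close>,
  which itself does not apply because spaces of bounded operators are not second countable.
\<close>

definition has_expectation :: "'w measure \<Rightarrow> ('w \<Rightarrow> 'b::real_normed_vector) \<Rightarrow> 'b \<Rightarrow> bool" where
  "has_expectation M f m \<longleftrightarrow> f \<in> borel_measurable M \<and>
     (\<exists>s. (\<forall>i. Bochner_Integration.simple_bochner_integrable M (s i)) \<and>
          (\<lambda>i. \<integral>\<^sup>+\<omega>. ennreal (norm (f \<omega> - s i \<omega>)) \<partial>M) \<longlonglongrightarrow> 0 \<and>
          (\<lambda>i. Bochner_Integration.simple_bochner_integral M (s i)) \<longlonglongrightarrow> m)"

definition op_expectation :: "'w measure \<Rightarrow> ('w \<Rightarrow> 'b::real_normed_vector) \<Rightarrow> 'b" where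
  "op_expectation M f = (THE m. has_expectation M f m)"

text \<open>The normal law with mean \<open>a\<close> and standard deviation \<open>s\<close>, degenerate if \<open>s = 0\<close>.\<close>

definition normal_law :: "real \<Rightarrow> real \<Rightarrow> real measure" where
  "normal_law a s = (if s = 0 then return borel a else density lborel (normal_density a s))"

definition gaussian_element ::
  "'h::{real_inner, banach, second_countable_topology} \<Rightarrow> 'z measure \<Rightarrow> ('z \<Rightarrow> 'h) \<Rightarrow>
   'h \<Rightarrow> ('h \<Rightarrow>\<^sub>L 'h) \<Rightarrow> bool" where
  "gaussian_element p N Z m C \<longleftrightarrow>
     prob_space N \<and> Z \<in> N \<rightarrow>\<^sub>M restrict_space borel (tangent p) \<and>
     (\<forall>h\<in>tangent p. \<exists>a s. s \<ge> 0 \<and> distr N borel (\<lambda>\<omega>. Z \<omega> \<bullet> h) = normal_law a s) \<and>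
     has_bochner_integral N Z m \<and>
     has_expectation N (\<lambda>\<omega>. tensor (Z \<omega> - m) (Z \<omega> - m)) C"

text \<open>
  As \<open>tangent p\<close> is closed, every bounded continuous function on it extends to the whole space
  (compose with the orthogonal projection), so for \<open>tangent p\<close>-valued random elements this is
  convergence in distribution in \<open>tangent p\<close>.
\<close>

definition converges_in_distribution ::
  "'w measure \<Rightarrow> (nat \<Rightarrow> 'w \<Rightarrow> 'b::topological_space) \<Rightarrow> 'z measure \<Rightarrow> ('z \<Rightarrow> 'b) \<Rightarrow> bool" where
  "converges_in_distribution M Y N Z \<longleftrightarrow>
     (\<forall>n. Y n \<in> borel_measurable M) \<and> Z \<in> borel_measurable N \<and>
     (\<forall>f :: 'b \<Rightarrow> real. continuous_on UNIV f \<and> bounded (range f) \<longrightarrow>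
        (\<lambda>n. \<integral>\<omega>. f (Y n \<omega>) \<partial>M) \<longlonglongrightarrow> (\<integral>\<omega>. f (Z \<omega>) \<partial>N))"


section \<open>The limiting covariance operator\<close>

definition Lambda_pt :: "'h::real_inner \<Rightarrow> 'h \<Rightarrow> ('h \<Rightarrow>\<^sub>L 'h)" where
  "Lambda_pt \<mu> x = riesz_op \<mu> (D2_rho2 \<mu> x)"

definition Lambda_mean :: "'w measure \<Rightarrow> ('w \<Rightarrow> 'h::real_inner) \<Rightarrow> 'h \<Rightarrow> ('h \<Rightarrow>\<^sub>L 'h)" where
  "Lambda_mean M X \<mu> = riesz_op \<mu> (op_expectation M (\<lambda>\<omega>. D2_rho2 \<mu> (X \<omega>)))"

definition limit_covariance ::
  "'w measure \<Rightarrow> ('w \<Rightarrow> 'h::real_inner) \<Rightarrow> 'h \<Rightarrow> 'h \<Rightarrow> ('h \<Rightarrow>\<^sub>L 'h)" where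
  "limit_covariance M X \<mu> x =
     Lambda_pt \<mu> x o\<^sub>L tangent_inverse \<mu> (Lambda_mean M X \<mu>) o\<^sub>L
     op_expectation M (\<lambda>\<omega>. tensor (slog \<mu> (X \<omega>)) (slog \<mu> (X \<omega>))) o\<^sub>L
     tangent_inverse \<mu> (Lambda_mean M X \<mu>) o\<^sub>L Lambda_pt \<mu> x"

end

theory Submission
  imports Defs "HOL-Library.Discrete_Functions" "HOL-Real_Asymp.Real_Asymp"
begin

text \<open>
  The intrinsic mean \<open>p\<close> of a law on the sphere is a critical point: with
  \<open>ag t = arccos t / sqrt (1 - t\<^sup>2)\<close>, the vector \<open>E (ag \<langle>X, p\<rangle> X)\<close> is a multiple of \<open>p\<close>.
  At \<open>\<mu>\<close> the multiplier \<open>\<lambda>\<close> is positive because the support has diameter at most \<open>\<pi>/2\<close>, and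
  \<open>ag\<close> decreases; this gives \<open>(\<lambda>/2) |\<mu>hat - \<mu>| \<le> |G\<^sub>n|\<close>, where \<open>G\<^sub>n\<close> is the average of the independent
  centered bounded vectors \<open>ag \<langle>X\<^sub>i, \<mu>\<rangle> X\<^sub>i - \<lambda> \<mu>\<close>.  Expanding the first-order condition of the sample around
  \<open>\<mu>\<close>, and the transported logarithm as \<open>v - (1/2) \<Lambda>\<^sub>x\<^sub>1 (\<mu>hat - \<mu>)\<close>, shows that
  \<open>sqrt n (P vhat - v)\<close> and \<open>- sqrt n \<Lambda>\<^sub>x\<^sub>1 \<Lambda>\<^sub>1\<^sup>-\<^sup>1 G\<^sub>n\<close> differ by a sequence tending to \<open>0\<close> in \<open>L\<^sup>1\<close>, so the
  claim reduces to the central limit theorem for bounded random elements of a Hilbert space.  For the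
  latter, Gram--Schmidt orthogonalization of the summands in \<open>L\<^sup>2\<close> provides almost finite-dimensional
  approximations and the Gaussian limit, and the characteristic functions determine the limits
  of expectations on the compact sets that result.
\<close>

section \<open>Expectations in non-separable Banach spaces\<close>

text \<open>Spaces of operators are not separable, so sums of measurable operator-valued maps need
  not be measurable, while the averaged Hessians must converge in operator norm. Operator
  expectations are therefore built from simple functions and identified through scalar integrals of
  matrix entries. A comparison in L1 needs estimates for every sample, not only for sample means
  near \<open>\<mu>\<close>. Each expansion thus holds for all p, with an error eta |p - \<mu>| + C
  |p - \<mu>|^2: the first term is the Taylor error close to \<open>\<mu>\<close>, the second
  absorbs whatever happens at a distance bounded below. The second moment of the averaged vectors is
  O(1/n), so the quadratic part disappears after multiplication by sqrt n, and eta is arbitrary.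
  Almost sure consistency only serves the domain of the logarithm. The calculus uses ambient
  coordinates and the chord p - \<mu>, whose component along \<open>\<mu>\<close> is -|p - \<mu>|^2
  / 2 and hence of second order. The singularity of \<open>ag\<close> at -1 stays away, because
  inner products of means with support points lie in [0, 1].\<close>

lemma has_expectation_iff_has_bochner_integral:
  fixes m :: "'b::{real_normed_vector, second_countable_topology}"
  shows "has_expectation M f m \<longleftrightarrow> has_bochner_integral M f m"
  unfolding has_expectation_def has_bochner_integral.simps by blast

text \<open>Differences of measurable maps may fail to be measurable in a non-separable space. As
  \<open>s\<close> has finitely many values, the norm is a finite sum of indicators times distances
  from constants.\<close>

lemma borel_measurable_norm_diff_simple:
  fixes f :: "'a \<Rightarrow> 'b::real_normed_vector"
  assumes f: "f \<in> borel_measurable M" and s: "simple_function M s"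
  shows "(\<lambda>x. norm (f x - s x)) \<in> borel_measurable M"
proof -
  have fin: "finite (s ` space M)" using s by (rule simple_functionD)
  have [measurable]: "s -` {c} \<inter> space M \<in> sets M" for c
    using s by (rule simple_functionD)
  have "(\<lambda>x. norm (f x - c)) \<in> borel_measurable M" for c
    by (rule measurable_compose[OF f], rule borel_measurable_continuous_onI)
       (intro continuous_intros)
  note [measurable] = this
  have "(\<lambda>x. \<Sum>c\<in>s ` space M. indicat_real (s -` {c} \<inter> space M) x * norm (f x - c))
      \<in> borel_measurable M"
    by measurable
  also have "?this \<longleftrightarrow> ?thesis"
  proof (rule measurable_cong)
    fix x assume x: "x \<in> space M"
    have "(\<Sum>c\<in>s ` space M. indicat_real (s -` {c} \<inter> space M) x * norm (f x - c))
        = (\<Sum>c\<in>{s x}. indicat_real (s -` {c} \<inter> space M) x * norm (f x - c))"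
      using x fin by (intro sum.mono_neutral_right) (auto simp: indicator_def)
    then show "(\<Sum>c\<in>s ` space M. indicat_real (s -` {c} \<inter> space M) x * norm (f x - c))
        = norm (f x - s x)"
      using x by simp
  qed
  finally show ?thesis .
qed

text \<open>\<open>T\<close> maps simple approximations to simple approximations and enlarges the
  error by at most a constant factor. Applied to evaluations, this turns operator expectations into
  scalar integrals.\<close>

lemma has_expectation_bounded_linear:
  fixes f :: "'a \<Rightarrow> 'b::real_normed_vector" and T :: "'b \<Rightarrow> 'c::real_normed_vector"
  assumes T: "bounded_linear T" and f: "has_expectation M f m"
  shows "has_expectation M (\<lambda>x. T (f x)) (T m)"
proof -
  interpret T: bounded_linear T by fact
  from f obtain s where fm: "f \<in> borel_measurable M"
    and s: "\<And>i. Bochner_Integration.simple_bochner_integrable M (s i)"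
    and s0: "(\<lambda>i. \<integral>\<^sup>+\<omega>. ennreal (norm (f \<omega> - s i \<omega>)) \<partial>M) \<longlonglongrightarrow> 0"
    and sm: "(\<lambda>i. Bochner_Integration.simple_bochner_integral M (s i)) \<longlonglongrightarrow> m"
    unfolding has_expectation_def by blast
  have ss: "simple_function M (s i)" for i
    using s[of i] by (auto elim: simple_bochner_integrable.cases)
  obtain K where K: "K > 0" "\<And>x. norm (T x) \<le> norm x * K"
    using T.pos_bounded by blast
  have 1: "(\<lambda>x. T (f x)) \<in> borel_measurable M"
    using fm by (rule measurable_compose)
      (rule borel_measurable_continuous_onI[OF T.continuous_on[OF continuous_on_id]])
  have 2: "Bochner_Integration.simple_bochner_integrable M (\<lambda>x. T (s i x))" for i
    using simple_bochner_integrable_compose2[of "\<lambda>x y. T x" M "s i" "s i"] s by (auto simp: T.zero)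
  have 3: "(\<lambda>i. \<integral>\<^sup>+\<omega>. ennreal (norm (T (f \<omega>) - T (s i \<omega>))) \<partial>M) \<longlonglongrightarrow> 0"
  proof (rule tendsto_sandwich)
    show "\<forall>\<^sub>F n in sequentially. 0 \<le> (\<integral>\<^sup>+\<omega>. ennreal (norm (T (f \<omega>) - T (s n \<omega>))) \<partial>M)" by simp
    have "(\<integral>\<^sup>+\<omega>. ennreal (norm (T (f \<omega>) - T (s n \<omega>))) \<partial>M)
        \<le> ennreal K * (\<integral>\<^sup>+\<omega>. ennreal (norm (f \<omega> - s n \<omega>)) \<partial>M)" for n
    proof -
      have "(\<integral>\<^sup>+\<omega>. ennreal (norm (T (f \<omega>) - T (s n \<omega>))) \<partial>M)
        \<le> (\<integral>\<^sup>+\<omega>. ennreal K * ennreal (norm (f \<omega> - s n \<omega>)) \<partial>M)"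
        using K by (intro nn_integral_mono)
          (simp add: T.diff[symmetric] ennreal_mult''[symmetric] mult.commute)
      also have "\<dots> = ennreal K * (\<integral>\<^sup>+\<omega>. ennreal (norm (f \<omega> - s n \<omega>)) \<partial>M)"
        using borel_measurable_norm_diff_simple[OF fm ss] by (intro nn_integral_cmult) simp
      finally show ?thesis .
    qed
    then show "\<forall>\<^sub>F n in sequentially. (\<integral>\<^sup>+\<omega>. ennreal (norm (T (f \<omega>) - T (s n \<omega>))) \<partial>M)
        \<le> ennreal K * (\<integral>\<^sup>+\<omega>. ennreal (norm (f \<omega> - s n \<omega>)) \<partial>M)" by simp
    show "(\<lambda>n. ennreal K * (\<integral>\<^sup>+\<omega>. ennreal (norm (f \<omega> - s n \<omega>)) \<partial>M)) \<longlonglongrightarrow> 0"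
      using ennreal_tendsto_cmult[OF _ s0, of "ennreal K"] by simp
  qed simp
  have 4: "(\<lambda>i. Bochner_Integration.simple_bochner_integral M (\<lambda>x. T (s i x))) \<longlonglongrightarrow> T m"
    using T.tendsto[OF sm] by (simp add: simple_bochner_integral_linear[OF T.linear_axioms s])
  show ?thesis unfolding has_expectation_def
    using 1 2 3 4 by (intro conjI exI[of _ "\<lambda>i x. T (s i x)"]) auto
qed

lemma has_expectation_integral:
  fixes T :: "'b::real_normed_vector \<Rightarrow> 'c::{banach, second_countable_topology}"
  assumes "has_expectation M f m" "bounded_linear T"
  shows "integrable M (\<lambda>x. T (f x))" "(\<integral>x. T (f x) \<partial>M) = T m"
  using has_expectation_bounded_linear[OF assms(2,1)]
  by (auto simp: has_expectation_iff_has_bochner_integral has_bochner_integral_iff)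

text \<open>The definite description in \<open>op_expectation\<close> calls for uniqueness; an
  operator is determined by its values, and \<open>e v\<close> is the value that every candidate is
  forced to take at \<open>v\<close>.\<close>

lemma has_expectation_blinfun_unique:
  fixes m m' :: "'a::real_normed_vector \<Rightarrow>\<^sub>L 'b::real_normed_vector"
  assumes "\<And>m v. has_expectation M f m \<Longrightarrow> blinfun_apply m v = e v"
    and "has_expectation M f m"
  shows "op_expectation M f = m"
  unfolding op_expectation_def
  by (rule the_equality) (auto intro!: blinfun_eqI simp: assms)

text \<open>Only the domain of \<open>q\<close> is separable. Simple approximations
  \<open>F i\<close> of \<open>Z\<close> yield simple functions \<open>q (F i x)\<close> in the
  target; these converge pointwise by continuity and in L1 by domination, and completeness provides
  the limit of their integrals.\<close>

lemma has_expectation_compose_continuous: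
  fixes Z :: "'w \<Rightarrow> 'a::{real_normed_vector, second_countable_topology}" and q :: "'a \<Rightarrow> 'b::banach"
  assumes M: "finite_measure M" and Z: "Z \<in> borel_measurable M"
    and Z2: "integrable M (\<lambda>\<omega>. (norm (Z \<omega>))\<^sup>2)"
    and q: "continuous_on UNIV q" and qb: "\<And>z. norm (q z) \<le> C * (1 + (norm z)\<^sup>2)"
  shows "\<exists>m. has_expectation M (\<lambda>\<omega>. q (Z \<omega>)) m"
proof -
  interpret finite_measure M by fact
  obtain F where F: "\<And>i. simple_function M (F i)"
    and lim: "\<And>x. x \<in> space M \<Longrightarrow> (\<lambda>i. F i x) \<longlonglongrightarrow> Z x"
    and bd: "\<And>i x. x \<in> space M \<Longrightarrow> norm (F i x) \<le> 2 * norm (Z x)"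
    using borel_measurable_implies_sequence_metric[OF Z, of 0] unfolding dist_0_norm dist_norm diff_0_right by blast
  have C: "C \<ge> 0" using qb[of 0] by (simp add: order_trans[OF norm_ge_zero])
  have qZ: "(\<lambda>\<omega>. q (Z \<omega>)) \<in> borel_measurable M"
    by (rule measurable_compose[OF Z borel_measurable_continuous_onI[OF q]])
  define s where "s i x = q (F i x)" for i x
  have ss: "simple_function M (s i)" for i
    unfolding s_def using simple_function_compose1[OF F, of q] by simp
  have sb: "Bochner_Integration.simple_bochner_integrable M (s i)" for i
    by (intro simple_bochner_integrable.intros ss) (simp add: emeasure_eq_measure)
  define D where "D i x = norm (q (Z x) - s i x)" for i x
  have Dm[measurable]: "D i \<in> borel_measurable M" for i
    unfolding D_def by (rule borel_measurable_norm_diff_simple[OF qZ ss])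
  have D0: "(\<lambda>i. D i x) \<longlonglongrightarrow> 0" if "x \<in> space M" for x
  proof -
    have "(\<lambda>i. q (F i x)) \<longlonglongrightarrow> q (Z x)"
      using q lim[OF that] by (auto simp: continuous_on_eq_continuous_at intro: isCont_tendsto_compose)
    then have "(\<lambda>i. q (Z x) - q (F i x)) \<longlonglongrightarrow> q (Z x) - q (Z x)" by (intro tendsto_intros)
    then show ?thesis unfolding D_def s_def by (intro tendsto_norm_zero) simp
  qed
  \<comment> \<open>The factor 5 is 1 + 4: the approximations satisfy |F i x| \<le> 2 |Z x|, so
    their squares cost a factor 4.\<close>
  have Db: "D i x \<le> C * (2 + 5 * (norm (Z x))\<^sup>2)" if "x \<in> space M" for i x
  proof -
    have "(norm (F i x))\<^sup>2 \<le> (2 * norm (Z x))\<^sup>2" using bd[OF that] by (intro power_mono) auto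
    then have "C * (1 + (norm (F i x))\<^sup>2) \<le> C * (1 + 4 * (norm (Z x))\<^sup>2)"
      using C by (intro mult_left_mono) (auto simp: power_mult_distrib)
    moreover have "D i x \<le> norm (q (Z x)) + norm (q (F i x))" unfolding D_def s_def by (rule norm_triangle_ineq4)
    ultimately show ?thesis using qb[of "Z x"] qb[of "F i x"] by (simp add: algebra_simps)
  qed
  have dom: "integrable M (\<lambda>x. C * (2 + 5 * (norm (Z x))\<^sup>2))"
    using Z2 by (intro integrable_mult_right integrable_add) auto
  have Di: "integrable M (D i)" for i
    by (rule Bochner_Integration.integrable_bound[OF dom]) (use Db C in \<open>auto simp: D_def intro!: AE_I2 order_trans[OF _ abs_ge_self]\<close>)
  have D_lim: "(\<lambda>i. integral\<^sup>L M (D i)) \<longlonglongrightarrow> 0"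
    using integral_dominated_convergence[of "\<lambda>_. 0" M D, OF _ Dm dom] D0 Db
    by (auto simp: D_def)
  have nnD: "(\<integral>\<^sup>+\<omega>. ennreal (norm (q (Z \<omega>) - s i \<omega>)) \<partial>M) = ennreal (integral\<^sup>L M (D i))" for i
    using nn_integral_eq_integral[OF Di] by (simp add: D_def)
  have diff: "norm (Bochner_Integration.simple_bochner_integral M (s i) - Bochner_Integration.simple_bochner_integral M (s j))
      \<le> integral\<^sup>L M (D i) + integral\<^sup>L M (D j)" for i j
  proof -
    have sij: "Bochner_Integration.simple_bochner_integrable M (\<lambda>x. s i x - s j x)"
      using simple_bochner_integrable_compose2[of "\<lambda>x y. x - y" M "s i" "s j"] sb by simp
    have nij: "Bochner_Integration.simple_bochner_integrable M (\<lambda>x. norm (s i x - s j x))"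
      using simple_bochner_integrable_compose2[of "\<lambda>x y. norm (x - y)" M "s i" "s j"] sb by simp
    have int: "integrable M (\<lambda>x. norm (s i x - s j x))"
      using has_bochner_integral_simple_bochner_integrable[OF nij] by (simp add: has_bochner_integral_iff)
    have "norm (Bochner_Integration.simple_bochner_integral M (s i) - Bochner_Integration.simple_bochner_integral M (s j))
      = norm (Bochner_Integration.simple_bochner_integral M (\<lambda>x. s i x - s j x))"
      using sb by (simp add: simple_bochner_integral_diff)
    also have "\<dots> \<le> Bochner_Integration.simple_bochner_integral M (\<lambda>x. norm (s i x - s j x))"
      by (rule simple_bochner_integral_norm_bound[OF sij])
    also have "\<dots> = (\<integral>x. norm (s i x - s j x) \<partial>M)"
      using nij by (rule simple_bochner_integrable_eq_integral)
    also have "\<dots> \<le> (\<integral>x. D i x + D j x \<partial>M)"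
    proof (rule integral_mono[OF int])
      show "integrable M (\<lambda>x. D i x + D j x)" using Di by simp
      show "norm (s i x - s j x) \<le> D i x + D j x" for x
        unfolding D_def using norm_triangle_ineq4[of "q (Z x) - s j x" "q (Z x) - s i x"] by (simp add: norm_minus_commute)
    qed
    finally show ?thesis using Di by simp
  qed
  have "Cauchy (\<lambda>i. Bochner_Integration.simple_bochner_integral M (s i))"
  proof (rule CauchyI)
    fix e :: real assume "e > 0"
    then have "eventually (\<lambda>i. integral\<^sup>L M (D i) < e / 2) sequentially"
      using order_tendstoD(2)[OF D_lim, of "e / 2"] by simp
    then obtain N where N: "\<And>i. i \<ge> N \<Longrightarrow> integral\<^sup>L M (D i) < e / 2"
      by (auto simp: eventually_sequentially)
    show "\<exists>N. \<forall>m\<ge>N. \<forall>n\<ge>N. norm (Bochner_Integration.simple_bochner_integral M (s m) - Bochner_Integration.simple_bochner_integral M (s n)) < e"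
    proof (intro exI[of _ N] allI impI)
      fix m n assume "m \<ge> N" "n \<ge> N"
      then show "norm (Bochner_Integration.simple_bochner_integral M (s m) - Bochner_Integration.simple_bochner_integral M (s n)) < e"
        using N[of m] N[of n] diff[of m n] by linarith
    qed
  qed
  then obtain m where "(\<lambda>i. Bochner_Integration.simple_bochner_integral M (s i)) \<longlonglongrightarrow> m"
    using Cauchy_convergent_iff convergent_def by blast
  moreover have "(\<lambda>i. \<integral>\<^sup>+\<omega>. ennreal (norm (q (Z \<omega>) - s i \<omega>)) \<partial>M) \<longlonglongrightarrow> 0"
    unfolding nnD using tendsto_ennrealI[OF D_lim] by simp
  ultimately show ?thesis unfolding has_expectation_def using qZ sb by blast
qed

section \<open>Averages of independent bounded random elements\<close>

text \<open>The joint law is a product measure, so by Fubini \<open>V\<close> can be integrated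
  first, which leaves the inner product with its mean.\<close>

lemma (in prob_space) indep_expectation_inner_eq_0:
  fixes U V :: "'a \<Rightarrow> 'h::{real_inner, banach, second_countable_topology}"
  assumes ind: "indep_var borel U borel V"
    and U: "AE \<omega> in M. norm (U \<omega>) \<le> K" and V: "AE \<omega> in M. norm (V \<omega>) \<le> K"
    and V0: "expectation V = 0"
  shows "expectation (\<lambda>\<omega>. U \<omega> \<bullet> V \<omega>) = 0"
proof -
  have [measurable]: "U \<in> borel_measurable M" "V \<in> borel_measurable M"
    using ind by (auto simp: indep_var_rv1 indep_var_rv2)
  interpret DU: prob_space "distr M borel U" by (rule prob_space_distr) simp
  interpret DV: prob_space "distr M borel V" by (rule prob_space_distr) simp
  interpret P: pair_prob_space "distr M borel U" "distr M borel V" ..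
  have eq: "distr M borel U \<Otimes>\<^sub>M distr M borel V = distr M (borel \<Otimes>\<^sub>M borel) (\<lambda>x. (U x, V x))"
    using ind by (simp add: indep_var_distribution_eq)
  have Vi: "integrable M V"
    using V by (intro integrable_const_bound[of _ K]) auto
  have int: "integrable M (\<lambda>\<omega>. U \<omega> \<bullet> V \<omega>)"
  proof (rule integrable_const_bound[of _ "K * K"])
    show "AE \<omega> in M. norm (U \<omega> \<bullet> V \<omega>) \<le> K * K" using U V
    proof eventually_elim
      case (elim \<omega>)
      then have "norm (U \<omega>) * norm (V \<omega>) \<le> K * K"
        by (intro mult_mono) (auto intro: order_trans[OF norm_ge_zero])
      then show ?case using Cauchy_Schwarz_ineq2[of "U \<omega>" "V \<omega>"] by simp
    qed
  qed simp
  have "expectation (\<lambda>\<omega>. U \<omega> \<bullet> V \<omega>)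
      = (\<integral>p. fst p \<bullet> snd p \<partial>distr M (borel \<Otimes>\<^sub>M borel) (\<lambda>x. (U x, V x)))"
    by (subst integral_distr) auto
  also have "\<dots> = (\<integral>p. fst p \<bullet> snd p \<partial>(distr M borel U \<Otimes>\<^sub>M distr M borel V))"
    by (simp only: eq)
  also have "\<dots> = (\<integral>u. (\<integral>v. u \<bullet> v \<partial>distr M borel V) \<partial>distr M borel U)"
  proof -
    have "integrable (distr M borel U \<Otimes>\<^sub>M distr M borel V) (\<lambda>p. fst p \<bullet> snd p)"
      unfolding eq using int by (subst integrable_distr_eq) auto
    then show ?thesis using P.integral_fst'[of "\<lambda>p. fst p \<bullet> snd p"] by simp
  qed
  also have "(\<lambda>u. \<integral>v. u \<bullet> v \<partial>distr M borel V) = (\<lambda>u. 0)"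
  proof
    fix u
    have "(\<integral>v. u \<bullet> v \<partial>distr M borel V) = expectation (\<lambda>\<omega>. u \<bullet> V \<omega>)" by (subst integral_distr) auto
    also have "\<dots> = u \<bullet> expectation V" using Vi by simp
    finally show "(\<integral>v. u \<bullet> v \<partial>distr M borel V) = 0" using V0 by simp
  qed
  finally show ?thesis by simp
qed

text \<open>Independent centered summands are orthogonal in L2, so only the diagonal of the double
  sum survives.\<close>

lemma (in prob_space) expectation_norm_sum_square_le:
  fixes W :: "nat \<Rightarrow> 'a \<Rightarrow> 'h::{real_inner, banach, second_countable_topology}"
  assumes ind: "indep_vars (\<lambda>_. borel) W UNIV"
    and b: "\<And>i. AE \<omega> in M. norm (W i \<omega>) \<le> K" and W0: "\<And>i. expectation (W i) = 0"
    and c: "\<And>i. expectation (\<lambda>\<omega>. (norm (W i \<omega>))\<^sup>2) \<le> c"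
  shows "integrable M (\<lambda>\<omega>. (norm (\<Sum>i<n. W i \<omega>))\<^sup>2)"
    and "expectation (\<lambda>\<omega>. (norm (\<Sum>i<n. W i \<omega>))\<^sup>2) \<le> real n * c"
proof -
  have [measurable]: "W i \<in> borel_measurable M" for i using ind by (simp add: indep_vars_def)
  have int: "integrable M (\<lambda>\<omega>. W i \<omega> \<bullet> W j \<omega>)" for i j
  proof (rule integrable_const_bound[of _ "K * K"])
    show "AE \<omega> in M. norm (W i \<omega> \<bullet> W j \<omega>) \<le> K * K" using b[of i] b[of j]
    proof eventually_elim
      case (elim \<omega>)
      then have "norm (W i \<omega>) * norm (W j \<omega>) \<le> K * K"
        by (intro mult_mono) (auto intro: order_trans[OF norm_ge_zero])
      then show ?case using Cauchy_Schwarz_ineq2[of "W i \<omega>" "W j \<omega>"] by simp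
    qed
  qed simp
  have exp: "(norm (\<Sum>i<n. W i \<omega>))\<^sup>2 = (\<Sum>i<n. \<Sum>j<n. W i \<omega> \<bullet> W j \<omega>)" for \<omega>
    unfolding power2_norm_eq_inner inner_sum_left inner_sum_right by (rule sum.swap)
  show "integrable M (\<lambda>\<omega>. (norm (\<Sum>i<n. W i \<omega>))\<^sup>2)" unfolding exp using int by simp
  have zero: "expectation (\<lambda>\<omega>. W i \<omega> \<bullet> W j \<omega>) = 0" if "i \<noteq> j" for i j
  proof (rule indep_expectation_inner_eq_0[OF _ b b W0])
    \<comment> \<open>Pairwise independence comes from restricting the family to the disjoint index
      sets \<open>{i}\<close> and \<open>{j}\<close>.\<close>
    have "indep_var borel ((\<lambda>f. f i) \<circ> (\<lambda>\<omega>. restrict (\<lambda>k. W k \<omega>) {i}))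
        borel ((\<lambda>f. f j) \<circ> (\<lambda>\<omega>. restrict (\<lambda>k. W k \<omega>) {j}))"
      using that by (intro indep_var_compose[OF indep_var_restrict[OF ind]]) auto
    then show "indep_var borel (W i) borel (W j)" by (simp add: comp_def)
  qed
  have "expectation (\<lambda>\<omega>. (norm (\<Sum>i<n. W i \<omega>))\<^sup>2) = (\<Sum>i<n. \<Sum>j<n. expectation (\<lambda>\<omega>. W i \<omega> \<bullet> W j \<omega>))"
    unfolding exp using int by simp
  also have "\<dots> = (\<Sum>i<n. expectation (\<lambda>\<omega>. (norm (W i \<omega>))\<^sup>2))"
  proof (rule sum.cong[OF refl])
    fix i assume i: "i \<in> {..<n}"
    have "(\<Sum>j<n. expectation (\<lambda>\<omega>. W i \<omega> \<bullet> W j \<omega>)) = (\<Sum>j\<in>{i}. expectation (\<lambda>\<omega>. W i \<omega> \<bullet> W j \<omega>))"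
      using i zero[of i] by (intro sum.mono_neutral_right) auto
    then show "(\<Sum>j<n. expectation (\<lambda>\<omega>. W i \<omega> \<bullet> W j \<omega>)) = expectation (\<lambda>\<omega>. (norm (W i \<omega>))\<^sup>2)"
      by (simp add: power2_norm_eq_inner)
  qed
  also have "\<dots> \<le> real n * c" using sum_bounded_above[of "{..<n}" _ c] c by simp
  finally show "expectation (\<lambda>\<omega>. (norm (\<Sum>i<n. W i \<omega>))\<^sup>2) \<le> real n * c" .
qed



text \<open>For a simple function the average is a finite combination of empirical frequencies, each
  with L1 error of order 1 / sqrt n. The general case follows by approximation. The limit is stated
  with the nonnegative integral because its monotonicity holds without measurability of the
  averages.\<close>

lemma (in prob_space) LLN_L1_has_expectation:
  fixes f :: "'c \<Rightarrow> 'b::real_normed_vector" and Xs :: "nat \<Rightarrow> 'a \<Rightarrow> 'c"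
  assumes ind: "indep_vars (\<lambda>_. S) Xs UNIV" and D: "\<And>i. distr M S (Xs i) = D"
    and f: "has_expectation D f m"
  shows "(\<lambda>n. \<integral>\<^sup>+\<omega>. ennreal (norm ((1 / real n) *\<^sub>R (\<Sum>i<n. f (Xs i \<omega>)) - m)) \<partial>M) \<longlonglongrightarrow> 0"
proof -
  have X[measurable]: "Xs i \<in> M \<rightarrow>\<^sub>M S" for i using ind by (simp add: indep_vars_def)
  have sD[measurable_cong, simp]: "sets D = sets S" and spD: "space D = space S"
    using D[of 0] by (auto simp flip: D[of 0])
  interpret D: prob_space D unfolding D[of 0, symmetric] by (rule prob_space_distr) simp
  from f obtain s where fm: "f \<in> borel_measurable D"
    and s: "\<And>i. Bochner_Integration.simple_bochner_integrable D (s i)"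
    and s0: "(\<lambda>i. \<integral>\<^sup>+\<omega>. ennreal (norm (f \<omega> - s i \<omega>)) \<partial>D) \<longlonglongrightarrow> 0"
    and sm: "(\<lambda>i. Bochner_Integration.simple_bochner_integral D (s i)) \<longlonglongrightarrow> m"
    unfolding has_expectation_def by blast
  have ss: "simple_function D (s i)" for i
    using s[of i] by (auto elim: simple_bochner_integrable.cases)
  define p where "p k c = measure D {x \<in> space D. s k x = c}" for k c
  \<comment> \<open>The centered indicator of the event that observation \<open>i\<close> lies in
    the level set of \<open>s k\<close> at \<open>c\<close>.\<close>
  define V where "V k c i \<omega> = indicat_real {x \<in> space D. s k x = c} (Xs i \<omega>) - p k c" for k c i \<omega>
  have set_c[measurable]: "{x \<in> space D. s k x = c} \<in> sets S" for k c
    using ss[of k] simple_functionD(2)[OF ss, of k "{c}"] by (simp add: vimage_def Int_def conj_commute)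
  have Vm[measurable]: "V k c i \<in> borel_measurable M" for k c i
    unfolding V_def by measurable
  have V_avg: "expectation (\<lambda>\<omega>. \<bar>\<Sum>i<n. V k c i \<omega>\<bar>) \<le> sqrt (real n)" for k c n
  proof -
    have pb: "0 \<le> p k c" "p k c \<le> 1" unfolding p_def by auto
    have ib: "integrable M (\<lambda>\<omega>. indicat_real {x \<in> space D. s k x = c} (Xs i \<omega>))" for i
      by (rule integrable_const_bound[of _ 1]) auto
    have iv: "indep_vars (\<lambda>_. borel) (V k c) UNIV"
      unfolding V_def[abs_def]
      by (rule indep_vars_compose2[OF ind]) measurable
    have b: "norm (V k c i \<omega>) \<le> 1" for i \<omega>
      using pb by (auto simp: V_def indicator_def)
    have e0: "expectation (V k c i) = 0" for i
    proof -
      have "expectation (\<lambda>\<omega>. indicat_real {x \<in> space D. s k x = c} (Xs i \<omega>))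
          = (\<integral>x. indicat_real {x \<in> space D. s k x = c} x \<partial>distr M S (Xs i))"
        by (subst integral_distr) auto
      also have "\<dots> = p k c" by (simp add: D p_def)
      finally show ?thesis unfolding V_def using ib by (simp add: prob_space)
    qed
    have c1: "expectation (\<lambda>\<omega>. (norm (V k c i \<omega>))\<^sup>2) \<le> 1" for i
    proof -
      have "expectation (\<lambda>\<omega>. (norm (V k c i \<omega>))\<^sup>2) \<le> expectation (\<lambda>\<omega>. 1)"
      proof (rule integral_mono)
        show "(norm (V k c i \<omega>))\<^sup>2 \<le> 1" for \<omega> using b[of i \<omega>] by (simp add: abs_square_le_1)
        show "integrable M (\<lambda>\<omega>. (norm (V k c i \<omega>))\<^sup>2)"
          using b by (intro integrable_const_bound[of _ 1]) (auto simp: abs_square_le_1)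
      qed simp
      then show ?thesis by (simp add: prob_space)
    qed
    have sq: "integrable M (\<lambda>\<omega>. (\<Sum>i<n. V k c i \<omega>)\<^sup>2)" "expectation (\<lambda>\<omega>. (\<Sum>i<n. V k c i \<omega>)\<^sup>2) \<le> real n"
      using expectation_norm_sum_square_le[OF iv AE_I2[OF b] e0 c1, of n] by auto
    have int: "integrable M (\<lambda>\<omega>. \<bar>\<Sum>i<n. V k c i \<omega>\<bar>)"
      using square_integrable_imp_integrable[OF _ sq(1)] by auto
    have "(expectation (\<lambda>\<omega>. \<bar>\<Sum>i<n. V k c i \<omega>\<bar>))\<^sup>2 \<le> expectation (\<lambda>\<omega>. (\<bar>\<Sum>i<n. V k c i \<omega>\<bar>)\<^sup>2)"
    proof -
      have "0 \<le> variance (\<lambda>\<omega>. \<bar>\<Sum>i<n. V k c i \<omega>\<bar>)" by (rule variance_positive)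
      also have "\<dots> = expectation (\<lambda>\<omega>. (\<bar>\<Sum>i<n. V k c i \<omega>\<bar>)\<^sup>2) - (expectation (\<lambda>\<omega>. \<bar>\<Sum>i<n. V k c i \<omega>\<bar>))\<^sup>2"
        using int sq(1) by (intro variance_eq) auto
      finally show ?thesis by simp
    qed
    then show ?thesis using sq(2) by (simp add: real_le_rsqrt)
  qed
  \<comment> \<open>\<open>A k\<close> bounds the approximation error for every sample size, since
    all observations have the same law; \<open>C k\<close> over sqrt n bounds the fluctuation of the
    frequencies; \<open>B k\<close> is the error of the mean.\<close>
  define A where "A k = (\<integral>\<^sup>+x. ennreal (norm (f x - s k x)) \<partial>D)" for k
  define B where "B k = norm (Bochner_Integration.simple_bochner_integral D (s k) - m)" for k
  define C where "C k = (\<Sum>c\<in>s k ` space D. norm c)" for k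
  define L where "L n = (\<integral>\<^sup>+\<omega>. ennreal (norm ((1 / real n) *\<^sub>R (\<Sum>i<n. f (Xs i \<omega>)) - m)) \<partial>M)" for n
  have bound: "L n \<le> A k + ennreal (C k * (1 / sqrt (real n)) + B k)" if n: "n \<ge> 1" for n k
  proof -
    have fin: "finite (s k ` space D)" using ss by (rule simple_functionD)
    define h1 where "h1 \<omega> = (\<Sum>i<n. (1 / real n) * norm (f (Xs i \<omega>) - s k (Xs i \<omega>)))" for \<omega>
    define h2 where "h2 \<omega> = (\<Sum>c\<in>s k ` space D. norm c * ((1 / real n) * \<bar>\<Sum>i<n. V k c i \<omega>\<bar>))" for \<omega>
    have nf[measurable]: "(\<lambda>x. norm (f x - s k x)) \<in> borel_measurable S"
      using borel_measurable_norm_diff_simple[OF fm ss] by simp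
    have h1m[measurable]: "h1 \<in> borel_measurable M" and [measurable]: "h2 \<in> borel_measurable M"
      unfolding h1_def h2_def by measurable
    have pw: "norm ((1 / real n) *\<^sub>R (\<Sum>i<n. f (Xs i \<omega>)) - m) \<le> h1 \<omega> + (h2 \<omega> + B k)" if \<omega>: "\<omega> \<in> space M" for \<omega>
    proof -
      have sx: "s k (Xs i \<omega>) = (\<Sum>c\<in>s k ` space D. (V k c i \<omega> + p k c) *\<^sub>R c)" for i
      proof -
        have Xi: "Xs i \<omega> \<in> space D" using measurable_space[OF X \<omega>] by (simp add: spD)
        have "(\<Sum>c\<in>s k ` space D. (V k c i \<omega> + p k c) *\<^sub>R c) = (\<Sum>c\<in>{s k (Xs i \<omega>)}. (V k c i \<omega> + p k c) *\<^sub>R c)"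
          using Xi fin by (intro sum.mono_neutral_right) (auto simp: V_def indicator_def)
        then show ?thesis using Xi by (simp add: V_def)
      qed
      have I: "Bochner_Integration.simple_bochner_integral D (s k) = (\<Sum>c\<in>s k ` space D. p k c *\<^sub>R c)"
        by (simp add: simple_bochner_integral_def p_def)
      have "(1 / real n) *\<^sub>R (\<Sum>i<n. s k (Xs i \<omega>)) - Bochner_Integration.simple_bochner_integral D (s k)
          = (\<Sum>c\<in>s k ` space D. ((1 / real n) * (\<Sum>i<n. V k c i \<omega>)) *\<^sub>R c)"
      proof -
        have "(\<Sum>i<n. s k (Xs i \<omega>)) = (\<Sum>c\<in>s k ` space D. (\<Sum>i<n. V k c i \<omega> + p k c) *\<^sub>R c)"
          unfolding sx by (subst sum.swap) (simp add: scaleR_left.sum)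
        also have "(1 / real n) *\<^sub>R \<dots> = (\<Sum>c\<in>s k ` space D. ((1 / real n) * (\<Sum>i<n. V k c i \<omega>)) *\<^sub>R c + p k c *\<^sub>R c)"
          unfolding scaleR_right.sum using n
          by (intro sum.cong refl) (simp add: sum.distrib algebra_simps add_divide_distrib flip: scaleR_add_left)
        finally show ?thesis unfolding I by (simp add: sum.distrib)
      qed
      then have "norm ((1 / real n) *\<^sub>R (\<Sum>i<n. s k (Xs i \<omega>)) - Bochner_Integration.simple_bochner_integral D (s k)) \<le> h2 \<omega>"
        unfolding h2_def by (auto intro!: sum_norm_le simp: abs_mult mult.commute)
      moreover have "norm ((1 / real n) *\<^sub>R (\<Sum>i<n. f (Xs i \<omega>)) - (1 / real n) *\<^sub>R (\<Sum>i<n. s k (Xs i \<omega>))) \<le> h1 \<omega>"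
        unfolding h1_def scaleR_diff_right[symmetric] sum_subtractf[symmetric] scaleR_right.sum
        by (intro sum_norm_le) simp
      moreover have "norm (a - m) \<le> norm (a - b) + (norm (b - c) + norm (c - m))" for a b c
        using norm_triangle_ineq[of "a - b" "b - m"] norm_triangle_ineq[of "b - c" "c - m"] by simp
      ultimately show ?thesis unfolding B_def by (smt (verit))
    qed
    have h1i: "(\<integral>\<^sup>+\<omega>. ennreal (h1 \<omega>) \<partial>M) = A k"
    proof -
      have "(\<integral>\<^sup>+\<omega>. ennreal (h1 \<omega>) \<partial>M) = (\<Sum>i<n. \<integral>\<^sup>+\<omega>. ennreal (1 / real n) * ennreal (norm (f (Xs i \<omega>) - s k (Xs i \<omega>))) \<partial>M)"
        unfolding h1_def
        by (subst nn_integral_sum[symmetric]) (auto simp: ennreal_mult'[symmetric] sum_nonneg)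
      also have "\<dots> = (\<Sum>i<n. ennreal (1 / real n) * A k)"
      proof (intro sum.cong refl)
        fix i
        have "(\<integral>\<^sup>+\<omega>. ennreal (norm (f (Xs i \<omega>) - s k (Xs i \<omega>))) \<partial>M) = (\<integral>\<^sup>+x. ennreal (norm (f x - s k x)) \<partial>distr M S (Xs i))"
          by (subst nn_integral_distr) auto
        then show "(\<integral>\<^sup>+\<omega>. ennreal (1 / real n) * ennreal (norm (f (Xs i \<omega>) - s k (Xs i \<omega>))) \<partial>M) = ennreal (1 / real n) * A k"
          by (subst nn_integral_cmult) (auto simp: D A_def)
      qed
      also have "\<dots> = ennreal (real n) * ennreal (1 / real n) * A k"
        by (simp add: mult.assoc ennreal_of_nat_eq_real_of_nat)
      also have "ennreal (real n) * ennreal (1 / real n) = 1"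
        using n by (simp flip: ennreal_mult)
      finally show ?thesis by simp
    qed
    have h2i: "(\<integral>\<^sup>+\<omega>. ennreal (h2 \<omega>) \<partial>M) \<le> ennreal (C k * (1 / sqrt (real n)))"
    proof -
      have Vi: "integrable M (\<lambda>\<omega>. \<bar>\<Sum>i<n. V k c i \<omega>\<bar>)" for c
      proof -
        have "norm (V k c i \<omega>) \<le> 1 + \<bar>p k c\<bar>" for i \<omega> by (auto simp: V_def indicator_def)
        then have "integrable M (V k c i)" for i by (intro integrable_const_bound[of _ "1 + \<bar>p k c\<bar>"]) auto
        then show ?thesis by (intro integrable_abs Bochner_Integration.integrable_sum)
      qed
      have h2int: "integrable M h2" unfolding h2_def using Vi by auto
      have "(\<integral>\<^sup>+\<omega>. ennreal (h2 \<omega>) \<partial>M) = ennreal (expectation h2)"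
        by (intro nn_integral_eq_integral h2int AE_I2) (auto simp: h2_def intro!: sum_nonneg)
      also have "expectation h2 = (\<Sum>c\<in>s k ` space D. norm c * ((1 / real n) * expectation (\<lambda>\<omega>. \<bar>\<Sum>i<n. V k c i \<omega>\<bar>)))"
        unfolding h2_def using Vi by simp
      also have "\<dots> \<le> (\<Sum>c\<in>s k ` space D. norm c * ((1 / real n) * sqrt (real n)))"
        using V_avg by (intro sum_mono mult_left_mono) auto
      also have "\<dots> = C k * (1 / sqrt (real n))"
      proof -
        have "(1 / real n) * sqrt (real n) = 1 / sqrt (real n)" using n by (simp add: field_simps)
        then show ?thesis by (simp only: C_def sum_distrib_right)
      qed
      finally show ?thesis by (simp add: ennreal_leI)
    qed
    have "L n \<le> (\<integral>\<^sup>+\<omega>. ennreal (h1 \<omega>) + (ennreal (h2 \<omega>) + ennreal (B k)) \<partial>M)"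
      unfolding L_def
      by (intro nn_integral_mono)
         (use pw in \<open>auto simp: h1_def h2_def B_def sum_nonneg ennreal_plus[symmetric] simp del: ennreal_plus intro!: ennreal_leI\<close>)
    also have "\<dots> = A k + ((\<integral>\<^sup>+\<omega>. ennreal (h2 \<omega>) \<partial>M) + ennreal (B k))"
      by (subst nn_integral_add) (auto simp: nn_integral_add h1i emeasure_space_1)
    also have "\<dots> \<le> A k + (ennreal (C k * (1 / sqrt (real n))) + ennreal (B k))"
      using h2i by (intro add_mono) auto
    also have "\<dots> = A k + ennreal (C k * (1 / sqrt (real n)) + B k)"
      by (subst ennreal_plus[symmetric]) (auto simp: C_def B_def sum_nonneg)
    finally show ?thesis .
  qed
  have A0: "A \<longlonglongrightarrow> 0" using s0 by (simp add: A_def[abs_def])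
  have B0: "B \<longlonglongrightarrow> 0" unfolding B_def using LIM_zero[OF sm] by (rule tendsto_norm_zero)
  have "L \<longlonglongrightarrow> 0"
  proof (rule order_tendstoI)
    fix a :: ennreal assume "0 < a"
    then obtain e :: real where e: "0 < e" "ennreal e < a"
      by (metis ennreal_less_zero_iff dense ennreal_cases ennreal_top_neq_zero less_top_ennreal not_less_iff_gr_or_eq)
    \<comment> \<open>The approximation index \<open>k\<close> is fixed before the sample size; the
      shares e/2, e/4 and e/4 add up to \<open>e\<close>.\<close>
    have "eventually (\<lambda>k. A k < ennreal (e / 2)) sequentially" "eventually (\<lambda>k. B k < e / 4) sequentially"
      using order_tendstoD(2)[OF A0, of "ennreal (e / 2)"] order_tendstoD(2)[OF B0, of "e / 4"] e by auto
    then have "eventually (\<lambda>k. A k < ennreal (e / 2) \<and> B k < e / 4) sequentially" by (rule eventually_conj)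
    then obtain k where k: "A k < ennreal (e / 2)" "B k < e / 4"
      by (auto simp: eventually_sequentially)
    have "(\<lambda>n. C k * (1 / sqrt (real n))) \<longlonglongrightarrow> C k * 0"
      by (intro tendsto_intros tendsto_divide_0[OF tendsto_const] filterlim_at_top_imp_at_infinity
          filterlim_compose[OF sqrt_at_top filterlim_real_sequentially])
    then have "eventually (\<lambda>n. C k * (1 / sqrt (real n)) < e / 4) sequentially"
      using e by (intro order_tendstoD(2)) auto
    then show "eventually (\<lambda>n. L n < a) sequentially"
      using eventually_ge_at_top[of 1]
    proof eventually_elim
      case (elim n)
      have "L n \<le> A k + ennreal (C k * (1 / sqrt (real n)) + B k)" using bound[OF elim(2)] .
      also have "\<dots> \<le> ennreal (e / 2) + ennreal (e / 2)"
      proof (intro add_mono ennreal_leI)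
        show "A k \<le> ennreal (e / 2)" using k(1) by simp
        show "C k * (1 / sqrt (real n)) + B k \<le> e / 2" using k(2) elim(1) by linarith
      qed
      also have "\<dots> = ennreal e" using e by (subst ennreal_plus[symmetric]) auto
      finally show ?case using e by simp
    qed
  qed simp
  then show ?thesis by (simp add: L_def[abs_def])
qed

text \<open>Along the squares the second moments of the averages are summable, which gives almost
  sure convergence there. Up to the next square at most 2 k summands are added, each of norm at most
  \<open>K\<close>, against a divisor of at least k^2.\<close>

lemma (in prob_space) SLLN_bounded_mean_0:
  fixes W :: "nat \<Rightarrow> 'a \<Rightarrow> 'h::{real_inner, banach, second_countable_topology}"
  assumes ind: "indep_vars (\<lambda>_. borel) W UNIV"
    and b: "\<And>i. AE \<omega> in M. norm (W i \<omega>) \<le> K" and W0: "\<And>i. expectation (W i) = 0"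
  shows "AE \<omega> in M. (\<lambda>n. (1 / real n) *\<^sub>R (\<Sum>i<n. W i \<omega>)) \<longlonglongrightarrow> 0"
proof -
  have [measurable]: "W i \<in> borel_measurable M" for i using ind by (simp add: indep_vars_def)
  have K: "K \<ge> 0"
  proof -
    have "AE \<omega> in M. 0 \<le> K"
      using b[of 0] by eventually_elim (rule order_trans[OF norm_ge_zero])
    then show ?thesis by simp
  qed
  have c: "expectation (\<lambda>\<omega>. (norm (W i \<omega>))\<^sup>2) \<le> K\<^sup>2" for i
  proof -
    have "expectation (\<lambda>\<omega>. (norm (W i \<omega>))\<^sup>2) \<le> expectation (\<lambda>\<omega>. K\<^sup>2)"
    proof (rule integral_mono_AE)
      show "AE \<omega> in M. (norm (W i \<omega>))\<^sup>2 \<le> K\<^sup>2"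
        using b[of i] by eventually_elim (auto intro: power_mono)
      then show "integrable M (\<lambda>\<omega>. (norm (W i \<omega>))\<^sup>2)"
        by (intro integrable_const_bound[of _ "K\<^sup>2"]) auto
    qed simp
    then show ?thesis by (simp add: prob_space)
  qed
  define S where "S n \<omega> = (\<Sum>i<n. W i \<omega>)" for n \<omega>
  have [measurable]: "S n \<in> borel_measurable M" for n unfolding S_def by measurable
  \<comment> \<open>The index is shifted by one to avoid division by 0. A sum of m terms has second
    moment at most m K^2, so \<open>T k\<close> has expectation at most K^2 / (k + 1)^2.\<close>
  define T where "T k \<omega> = (norm (S ((Suc k)\<^sup>2) \<omega>) / real ((Suc k)\<^sup>2))\<^sup>2" for k \<omega>
  have [measurable]: "T k \<in> borel_measurable M" for k unfolding T_def by measurable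
  have Ti: "integrable M (T k)" "expectation (T k) \<le> K\<^sup>2 * (1 / real (Suc k) ^ 2)" for k
  proof -
    note * = expectation_norm_sum_square_le[OF ind b W0 c, of "(Suc k)\<^sup>2", folded S_def]
    have T: "T k \<omega> = (norm (S ((Suc k)\<^sup>2) \<omega>))\<^sup>2 / (real ((Suc k)\<^sup>2))\<^sup>2" for \<omega>
      by (simp add: T_def power_divide)
    show "integrable M (T k)" unfolding T using *(1) by simp
    have "expectation (T k) = expectation (\<lambda>\<omega>. (norm (S ((Suc k)\<^sup>2) \<omega>))\<^sup>2) / (real ((Suc k)\<^sup>2))\<^sup>2"
      unfolding T by simp
    also have "\<dots> \<le> (real ((Suc k)\<^sup>2) * K\<^sup>2) / (real ((Suc k)\<^sup>2))\<^sup>2"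
      using *(2) by (intro divide_right_mono) auto
    also have "\<dots> = K\<^sup>2 * (1 / real (Suc k) ^ 2)"
    proof -
      have "(a * K\<^sup>2) / a\<^sup>2 = K\<^sup>2 * (1 / a)" if "a \<noteq> 0" for a :: real
        using that by (simp add: power2_eq_square)
      from this[of "real ((Suc k)\<^sup>2)"] show ?thesis by (simp del: of_nat_Suc)
    qed
    finally show "expectation (T k) \<le> K\<^sup>2 * (1 / real (Suc k) ^ 2)" .
  qed
  have sumK: "summable (\<lambda>k. K\<^sup>2 * (1 / real (Suc k) ^ 2))"
    using inverse_power_summable[of 2, where 'a = real] summable_Suc_iff[of "\<lambda>n. inverse (real n ^ 2)"]
    by (intro summable_mult) (simp add: inverse_eq_divide)
  have T0: "0 \<le> expectation (T k)" for k
    by (intro integral_nonneg_AE) (simp add: T_def)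
  have "norm (expectation (T k)) \<le> K\<^sup>2 * (1 / real (Suc k) ^ 2)" for k
    using Ti(2)[of k] T0[of k] by (simp only: real_norm_def abs_of_nonneg)
  then have summ: "summable (\<lambda>k. expectation (T k))"
    by (rule summable_comparison_test'[OF sumK])
  have "(\<integral>\<^sup>+\<omega>. (\<Sum>k. ennreal (T k \<omega>)) \<partial>M) = (\<Sum>k. \<integral>\<^sup>+\<omega>. ennreal (T k \<omega>) \<partial>M)"
    by (rule nn_integral_suminf) simp
  also have "\<dots> = (\<Sum>k. ennreal (expectation (T k)))"
    by (intro suminf_cong nn_integral_eq_integral Ti(1) AE_I2) (simp add: T_def)
  also have "\<dots> \<noteq> \<infinity>"
    using summ T0 by (subst suminf_ennreal2) auto
  finally have "AE \<omega> in M. (\<Sum>k. ennreal (T k \<omega>)) \<noteq> \<infinity>"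
    by (intro nn_integral_PInf_AE) auto
  then have Tsum: "AE \<omega> in M. summable (\<lambda>k. T k \<omega>)"
    by eventually_elim (auto intro!: summable_suminf_not_top simp: T_def)
  have "AE \<omega> in M. \<forall>i. norm (W i \<omega>) \<le> K" using b by (simp add: AE_all_countable)
  with Tsum show ?thesis
  proof eventually_elim
    case (elim \<omega>)
    have "(\<lambda>k. T k \<omega>) \<longlonglongrightarrow> 0" using elim(1) by (rule summable_LIMSEQ_zero)
    then have "(\<lambda>k. sqrt (T k \<omega>)) \<longlonglongrightarrow> sqrt 0" by (intro tendsto_intros)
    then have "(\<lambda>k. norm (S ((Suc k)\<^sup>2) \<omega>) / real ((Suc k)\<^sup>2)) \<longlonglongrightarrow> 0"
      by (simp add: T_def real_sqrt_abs del: of_nat_power)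
    then have sub: "(\<lambda>k. norm (S (k\<^sup>2) \<omega>) / real (k\<^sup>2)) \<longlonglongrightarrow> 0"
      by (simp only: filterlim_sequentially_Suc[where f = "\<lambda>k. norm (S (k\<^sup>2) \<omega>) / real (k\<^sup>2)"])
    define q where "q n = floor_sqrt n" for n
    have q_top: "filterlim q at_top sequentially"
    proof (unfold filterlim_at_top, safe)
      fix Z :: nat
      show "eventually (\<lambda>n. Z \<le> q n) sequentially"
        unfolding q_def using eventually_ge_at_top[of "Z\<^sup>2"]
        by eventually_elim (metis floor_sqrt_inverse_power2 mono_floor_sqrt')
    qed
    have "(\<lambda>n. norm (S ((q n)\<^sup>2) \<omega>) / real ((q n)\<^sup>2) + 2 * K / real (q n)) \<longlonglongrightarrow> 0 + 0"
      by (intro tendsto_add filterlim_compose[OF sub q_top] tendsto_divide_0[OF tendsto_const]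
          filterlim_at_top_imp_at_infinity filterlim_compose[OF filterlim_real_sequentially q_top])
    then have lim: "(\<lambda>n. norm (S ((q n)\<^sup>2) \<omega>) / real ((q n)\<^sup>2) + 2 * K / real (q n)) \<longlonglongrightarrow> 0" by simp
    have "eventually (\<lambda>n. norm ((1 / real n) *\<^sub>R S n \<omega>) \<le> norm (S ((q n)\<^sup>2) \<omega>) / real ((q n)\<^sup>2) + 2 * K / real (q n)) sequentially"
      using eventually_ge_at_top[of 1]
    proof eventually_elim
      case n: (elim n)
      let ?k = "q n"
      have k1: "?k \<ge> 1" using n unfolding q_def by (metis floor_sqrt_one mono_floor_sqrt')
      have kn: "?k\<^sup>2 \<le> n" unfolding q_def by (rule floor_sqrt_power2_le)
      have "n < (Suc ?k)\<^sup>2" unfolding q_def by (rule Suc_floor_sqrt_power2_gt)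
      then have n2: "n - ?k\<^sup>2 \<le> 2 * ?k" by (simp add: power2_eq_square)
      have tri: "norm (a + b) \<le> norm a + z" if "norm b \<le> y" "y \<le> z" for a b :: 'h and y z
        using norm_triangle_ineq[of a b] that by linarith
      have Seq: "S n \<omega> = S (?k\<^sup>2) \<omega> + (\<Sum>i\<in>{?k\<^sup>2..<n}. W i \<omega>)"
        unfolding S_def lessThan_atLeast0 using kn by (simp add: sum.atLeastLessThan_concat)
      have s1: "norm (\<Sum>i\<in>{?k\<^sup>2..<n}. W i \<omega>) \<le> real (n - ?k\<^sup>2) * K"
        using elim(2) sum_norm_bound[of "{?k\<^sup>2..<n}" "\<lambda>i. W i \<omega>" K] by simp
      have s2: "real (n - ?k\<^sup>2) * K \<le> real (2 * ?k) * K"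
        using n2 K by (intro mult_right_mono) (simp_all only: of_nat_le_iff)
      have Sn: "norm (S n \<omega>) \<le> norm (S (?k\<^sup>2) \<omega>) + real (2 * ?k) * K"
        unfolding Seq by (rule tri[OF s1 s2])
      have "norm (S n \<omega>) / real n \<le> (norm (S (?k\<^sup>2) \<omega>) + real (2 * ?k) * K) / real (?k\<^sup>2)"
      proof (rule frac_le[OF _ Sn])
        show "0 \<le> norm (S (?k\<^sup>2) \<omega>) + real (2 * ?k) * K" using K by simp
        show "0 < real (?k\<^sup>2)" using k1 by simp
        show "real (?k\<^sup>2) \<le> real n" using kn by (simp only: of_nat_le_iff)
      qed
      also have "\<dots> = norm (S (?k\<^sup>2) \<omega>) / real (?k\<^sup>2) + 2 * K / real ?k"
      proof -
        have "(2 * a) * K / a\<^sup>2 = 2 * K / a" if "a > 0" for a :: real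
          using that by (simp add: power2_eq_square)
        from this[of "real ?k"] k1 show ?thesis by (simp only: add_divide_distrib) simp
      qed
      finally show ?case by simp
    qed
    then show ?case unfolding S_def[symmetric] by (rule Lim_null_comparison[OF _ lim])
  qed
qed

section \<open>Convergence in distribution from characteristic functions\<close>

text \<open>The case v = 0 is included because the law may be degenerate in some directions; there
  the summands vanish almost surely. Otherwise the classical theorem is normalized by the standard
  deviation, which is undone by evaluating the characteristic function at
  \<open>t * \<sigma>\<close>.\<close>

lemma (in prob_space) CLT_iexp:
  fixes X :: "nat \<Rightarrow> 'a \<Rightarrow> real"
  assumes ind: "indep_vars (\<lambda>_. borel) X UNIV" and mean: "\<And>i. expectation (X i) = 0"
    and sq: "\<And>i. integrable M (\<lambda>\<omega>. (X i \<omega>)\<^sup>2)" and v: "\<And>i. expectation (\<lambda>\<omega>. (X i \<omega>)\<^sup>2) = v"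
    and dist: "\<And>i. distr M borel (X i) = D"
  shows "(\<lambda>n. expectation (\<lambda>\<omega>. iexp (t * ((1 / sqrt (real n)) * (\<Sum>i<n. X i \<omega>))))) \<longlonglongrightarrow> exp (- (v * t\<^sup>2) / 2)"
proof -
  have [measurable]: "X i \<in> borel_measurable M" for i using ind by (simp add: indep_vars_def)
  have v0: "v \<ge> 0" unfolding v[of 0, symmetric] by (intro integral_nonneg_AE) auto
  show ?thesis
  proof (cases "v = 0")
    case True
    have "AE \<omega> in M. X i \<omega> = 0" for i
      using integral_nonneg_eq_0_iff_AE[OF sq[of i]] v[of i] True by auto
    then have "AE \<omega> in M. \<forall>i. X i \<omega> = 0" by (simp add: AE_all_countable)
    then have "expectation (\<lambda>\<omega>. iexp (t * ((1 / sqrt (real n)) * (\<Sum>i<n. X i \<omega>)))) = expectation (\<lambda>\<omega>. 1 :: complex)" for n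
      by (intro integral_cong_AE) (auto elim!: AE_mp)
    then show ?thesis using True by (simp add: prob_space)
  next
    case False
    define \<sigma> where "\<sigma> = sqrt v"
    have s: "\<sigma> > 0" "\<sigma>\<^sup>2 = v" using False v0 by (auto simp: \<sigma>_def)
    have w: "weak_conv_m (\<lambda>n. distr M borel (\<lambda>x. (\<Sum>i<n. X i x) / sqrt (real n * \<sigma>\<^sup>2))) std_normal_distribution"
      by (rule central_limit_theorem_zero_mean[OF ind mean s(1) sq _ dist]) (simp add: mean v s(2))
    have "(\<lambda>n. char (distr M borel (\<lambda>x. (\<Sum>i<n. X i x) / sqrt (real n * \<sigma>\<^sup>2))) (t * \<sigma>)) \<longlonglongrightarrow> char std_normal_distribution (t * \<sigma>)"
      by (rule levy_continuity1[OF _ real_dist_normal_dist w]) (auto intro!: real_distribution_distr)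
    moreover have "char (distr M borel (\<lambda>x. (\<Sum>i<n. X i x) / sqrt (real n * \<sigma>\<^sup>2))) (t * \<sigma>)
        = expectation (\<lambda>\<omega>. iexp (t * ((1 / sqrt (real n)) * (\<Sum>i<n. X i \<omega>))))" for n
    proof -
      have "(t * \<sigma>) * (z / sqrt (real n * \<sigma>\<^sup>2)) = t * ((1 / sqrt (real n)) * z)" for z
        using s(1) by (simp add: real_sqrt_mult)
      then show ?thesis unfolding char_def by (subst integral_distr) auto
    qed
    moreover have "char std_normal_distribution (t * \<sigma>) = exp (- (v * t\<^sup>2) / 2)"
      unfolding char_std_normal_distribution s(2)[symmetric]
      by (simp add: power_mult_distrib mult.commute exp_of_real[symmetric])
    ultimately show ?thesis by simp
  qed
qed

text \<open>Real trigonometric polynomials. The phase \<open>c\<close> supplies sines and constants,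
  and products reduce to sums of cosines, so closure under addition already gives an algebra for
  Stone--Weierstrass. Expectations of its members are linear in characteristic functions.\<close>

inductive_set trig :: "('h::real_inner \<Rightarrow> real) set" where
  trig_cos: "(\<lambda>y. a * cos (t \<bullet> y + c)) \<in> trig"
| trig_add: "p \<in> trig \<Longrightarrow> q \<in> trig \<Longrightarrow> (\<lambda>y. p y + q y) \<in> trig"

lemma trig_const: "(\<lambda>y. c) \<in> trig"
  using trig_cos[of c 0 0] by simp

lemma trig_continuous: "p \<in> trig \<Longrightarrow> continuous_on S p"
  by (induction rule: trig.induct) (auto intro!: continuous_intros)

lemma trig_bounded: "p \<in> trig \<Longrightarrow> \<exists>B. \<forall>y. \<bar>p y\<bar> \<le> B"
proof (induction rule: trig.induct)
  case (trig_cos a t c)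
  have "\<bar>a * cos (t \<bullet> y + c)\<bar> \<le> \<bar>a\<bar>" for y
    using abs_cos_le_one[of "t \<bullet> y + c"] by (simp add: abs_mult mult_left_le)
  then show ?case by blast
next
  case (trig_add p q)
  then obtain B C where "\<forall>y. \<bar>p y\<bar> \<le> B" "\<forall>y. \<bar>q y\<bar> \<le> C" by blast
  then have "\<forall>y. \<bar>p y + q y\<bar> \<le> B + C" by (meson abs_triangle_ineq add_mono order_trans)
  then show ?case by blast
qed

lemma trig_mult:
  assumes "p \<in> trig" "q \<in> trig"
  shows "(\<lambda>y. p y * q y) \<in> trig"
  using assms(1)
proof (induction rule: trig.induct)
  case (trig_cos a t c)
  show ?case using assms(2)
  proof (induction rule: trig.induct)
    case (trig_cos b s d)
    have eq: "(\<lambda>y. a * cos (t \<bullet> y + c) * (b * cos (s \<bullet> y + d)))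
      = (\<lambda>y. (a * b / 2) * cos ((t - s) \<bullet> y + (c - d)) + (a * b / 2) * cos ((t + s) \<bullet> y + (c + d)))"
    proof
      fix y
      have "cos (t \<bullet> y + c) * cos (s \<bullet> y + d) = (cos ((t \<bullet> y + c) - (s \<bullet> y + d)) + cos ((t \<bullet> y + c) + (s \<bullet> y + d))) / 2"
        by (rule cos_times_cos)
      also have "(t \<bullet> y + c) - (s \<bullet> y + d) = (t - s) \<bullet> y + (c - d)" by (simp add: inner_diff_left)
      also have "(t \<bullet> y + c) + (s \<bullet> y + d) = (t + s) \<bullet> y + (c + d)" by (simp add: inner_add_left)
      finally have "a * b * (cos (t \<bullet> y + c) * cos (s \<bullet> y + d))
          = a * b * ((cos ((t - s) \<bullet> y + (c - d)) + cos ((t + s) \<bullet> y + (c + d))) / 2)" by simp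
      then show "a * cos (t \<bullet> y + c) * (b * cos (s \<bullet> y + d))
          = (a * b / 2) * cos ((t - s) \<bullet> y + (c - d)) + (a * b / 2) * cos ((t + s) \<bullet> y + (c + d))"
        by (simp add: algebra_simps)
    qed
    show ?case unfolding eq by (intro trig.intros)
  next
    case (trig_add p q)
    then show ?case using trig.trig_add by (fastforce simp: distrib_left)
  qed
next
  case (trig_add p1 p2)
  then show ?case using trig.trig_add by (fastforce simp: distrib_right)
qed

lemma trig_separates:
  assumes "y \<noteq> z"
  shows "\<exists>p\<in>trig. p y \<noteq> p z"
proof -
  \<comment> \<open>Scaled so that the phases at \<open>y\<close> and \<open>z\<close> become 1 and
    0, where the cosine differs.\<close>
  define t where "t = (1 / ((y - z) \<bullet> (y - z))) *\<^sub>R (y - z)"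
  have "t \<bullet> y + - (t \<bullet> z) = t \<bullet> (y - z)" by (simp add: inner_diff_right)
  also have "\<dots> = 1" using assms by (simp add: t_def)
  finally have 1: "t \<bullet> y + - (t \<bullet> z) = 1" .
  have "cos (1::real) < cos 0" using pi_gt3 by (intro cos_monotone_0_pi) auto
  then show ?thesis
    using 1 by (intro bexI[OF _ trig_cos[of 1 t "- (t \<bullet> z)"]]) auto
qed

lemma trig_expectation_tendsto:
  fixes Y :: "nat \<Rightarrow> 'w \<Rightarrow> 'h::{real_inner, second_countable_topology}"
  assumes M: "prob_space M" and N: "prob_space N"
    and Y: "\<And>n. Y n \<in> borel_measurable M" and Z: "Z \<in> borel_measurable N"
    and conv: "\<And>t c. (\<lambda>n. \<integral>\<omega>. cos (t \<bullet> Y n \<omega> + c) \<partial>M) \<longlonglongrightarrow> (\<integral>\<omega>. cos (t \<bullet> Z \<omega> + c) \<partial>N)"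
    and p: "p \<in> trig"
  shows "(\<lambda>n. \<integral>\<omega>. p (Y n \<omega>) \<partial>M) \<longlonglongrightarrow> (\<integral>\<omega>. p (Z \<omega>) \<partial>N)"
proof -
  interpret M: prob_space M by fact
  interpret N: prob_space N by fact
  note [measurable] = Y Z
  have int: "integrable M (\<lambda>\<omega>. q (Y n \<omega>))" "integrable N (\<lambda>\<omega>. q (Z \<omega>))" if q: "q \<in> trig" for q n
  proof -
    obtain B where B: "\<And>y. \<bar>q y\<bar> \<le> B" using trig_bounded[OF q] by blast
    have [measurable]: "q \<in> borel_measurable borel"
      using trig_continuous[OF q] by (rule borel_measurable_continuous_onI)
    show "integrable M (\<lambda>\<omega>. q (Y n \<omega>))" using B by (intro M.integrable_const_bound[of _ B]) auto
    show "integrable N (\<lambda>\<omega>. q (Z \<omega>))" using B by (intro N.integrable_const_bound[of _ B]) auto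
  qed
  show ?thesis using p
  proof (induction rule: trig.induct)
    case (trig_cos a t c)
    show ?case using tendsto_mult_left[OF conv, of a] by simp
  next
    case (trig_add p q)
    then show ?case using tendsto_add by (simp add: int) blast
  qed
qed

text \<open>On the compact set the test function is approximated by a trigonometric polynomial, which
  may be large off the compact set.  Clipping it to \<open>[-1, 1]\<close> cures this, and the clipped function
  is again a uniform limit of trigonometric polynomials: by Stone--Weierstrass on the line, clipping
  is uniformly approximated by functions \<open>u\<close> that preserve trigonometric polynomials.\<close>

lemma cos_tendsto_imp_eventually_expectation_close:
  fixes Y :: "nat \<Rightarrow> 'w \<Rightarrow> 'h::{real_inner, second_countable_topology}" and f :: "'h \<Rightarrow> real"
  assumes M: "prob_space M" and N: "prob_space N"
    and Y: "\<And>n. Y n \<in> borel_measurable M" and Z: "Z \<in> borel_measurable N"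
    and conv: "\<And>t c. (\<lambda>n. \<integral>\<omega>. cos (t \<bullet> Y n \<omega> + c) \<partial>M) \<longlonglongrightarrow> (\<integral>\<omega>. cos (t \<bullet> Z \<omega> + c) \<partial>N)"
    and K: "compact K" and \<epsilon>: "\<epsilon> > 0"
    and YK: "\<And>n. measure M {\<omega>\<in>space M. Y n \<omega> \<notin> K} \<le> \<epsilon>" and ZK: "measure N {\<omega>\<in>space N. Z \<omega> \<notin> K} \<le> \<epsilon>"
    and f: "continuous_on UNIV f" and fb: "\<And>y. \<bar>f y\<bar> \<le> 1"
  shows "\<forall>\<^sub>F n in sequentially. \<bar>(\<integral>\<omega>. f (Y n \<omega>) \<partial>M) - (\<integral>\<omega>. f (Z \<omega>) \<partial>N)\<bar> \<le> 9 * \<epsilon>"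
proof -
  interpret M: prob_space M by fact
  interpret N: prob_space N by fact
  note [measurable] = Y Z
  interpret R: function_ring_on "trig :: ('h \<Rightarrow> real) set" K
    by unfold_locales (auto intro: K trig_continuous trig_add trig_mult trig_const trig_separates)
  obtain p where p: "p \<in> trig" "\<And>y. y \<in> K \<Longrightarrow> \<bar>f y - p y\<bar> < \<epsilon>"
    using R.Stone_Weierstrass_basic[OF continuous_on_subset[OF f] \<epsilon>] by blast
  obtain B where B: "\<And>y. \<bar>p y\<bar> \<le> B" using trig_bounded[OF p(1)] by blast
  define clip :: "real \<Rightarrow> real" where "clip s = max (-1) (min 1 s)" for s
  have clip_cont: "continuous_on S clip" for S unfolding clip_def by (intro continuous_intros)
  interpret R2: function_ring_on "{u. continuous_on UNIV u \<and> (\<lambda>y. u (p y)) \<in> trig} :: (real \<Rightarrow> real) set" "{-B..B}"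
  proof unfold_locales
    fix x y :: real assume "x \<noteq> y"
    then show "\<exists>u\<in>{u. continuous_on UNIV u \<and> (\<lambda>y. u (p y)) \<in> trig}. u x \<noteq> u y"
      using p(1) by (intro bexI[of _ "\<lambda>x. x"]) (auto intro: continuous_intros)
  qed (auto intro: trig_add trig_mult trig_const continuous_intros continuous_on_subset)
  obtain u where u: "continuous_on UNIV u" "(\<lambda>y. u (p y)) \<in> trig" "\<And>s. s \<in> {-B..B} \<Longrightarrow> \<bar>clip s - u s\<bar> < \<epsilon>"
    using R2.Stone_Weierstrass_basic[OF clip_cont \<epsilon>] by blast
  define g where "g y = u (p y)" for y
  have gb: "\<bar>clip (p y) - g y\<bar> \<le> \<epsilon>" for y
    using u(3)[of "p y"] B[of y] by (auto simp: g_def abs_le_iff)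
  have clipb: "\<bar>clip s\<bar> \<le> 1" for s by (auto simp: clip_def)
  have fclip: "\<bar>f y - clip (p y)\<bar> \<le> \<epsilon>" if "y \<in> K" for y
    using p(2)[OF that] fb[of y] by (auto simp: clip_def abs_le_iff)
  have fg: "\<bar>f y - g y\<bar> \<le> 2 * \<epsilon> + 2 * indicat_real (- K) y" for y
  proof (cases "y \<in> K")
    case True then show ?thesis using gb[of y] fclip[of y] by auto
  next
    case False then show ?thesis using gb[of y] clipb[of "p y"] fb[of y] \<epsilon> by auto
  qed
  have Kc: "closed K" using K by (rule compact_imp_closed)
  then have [measurable]: "K \<in> sets borel" by simp
  have [measurable]: "f \<in> borel_measurable borel" "g \<in> borel_measurable borel"
    using f trig_continuous[OF u(2)] by (auto intro: borel_measurable_continuous_onI simp: g_def[abs_def])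
  obtain G where G: "\<And>y. \<bar>g y\<bar> \<le> G" using trig_bounded[OF u(2)] by (auto simp: g_def)
  \<comment> \<open>The error is at most 2 \<epsilon> everywhere plus 2 off \<open>K\<close>, an
    event of probability at most \<epsilon>; this makes 4 \<epsilon>. One such error for each law
    and \<epsilon> for the convergence of \<open>g\<close> give the 9 \<epsilon> of the
    statement.\<close>
  have est: "\<bar>(\<integral>\<omega>. f (V \<omega>) \<partial>Q) - (\<integral>\<omega>. g (V \<omega>) \<partial>Q)\<bar> \<le> 4 * \<epsilon>"
    if Q: "prob_space Q" and V[measurable]: "V \<in> borel_measurable Q"
      and VK: "measure Q {\<omega>\<in>space Q. V \<omega> \<notin> K} \<le> \<epsilon>" for Q :: "'q measure" and V
  proof -
    interpret Q: prob_space Q by fact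
    have i: "integrable Q (\<lambda>\<omega>. f (V \<omega>))" "integrable Q (\<lambda>\<omega>. g (V \<omega>))"
      using fb G by (auto intro: Q.integrable_const_bound[of _ 1] Q.integrable_const_bound[of _ G])
    have ind: "integrable Q (\<lambda>\<omega>. indicat_real (- K) (V \<omega>))"
      by (rule Q.integrable_const_bound[of _ 1]) auto
    have "\<bar>(\<integral>\<omega>. f (V \<omega>) \<partial>Q) - (\<integral>\<omega>. g (V \<omega>) \<partial>Q)\<bar> = \<bar>\<integral>\<omega>. f (V \<omega>) - g (V \<omega>) \<partial>Q\<bar>"
      using i by simp
    also have "\<dots> \<le> (\<integral>\<omega>. \<bar>f (V \<omega>) - g (V \<omega>)\<bar> \<partial>Q)" by (rule integral_abs_bound)
    also have "\<dots> \<le> (\<integral>\<omega>. 2 * \<epsilon> + 2 * indicat_real (- K) (V \<omega>) \<partial>Q)"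
      using i ind fg by (intro integral_mono) auto
    also have "\<dots> = 2 * \<epsilon> + 2 * (\<integral>\<omega>. indicat_real (- K) (V \<omega>) \<partial>Q)"
      using ind by (simp add: Q.prob_space)
    also have "(\<integral>\<omega>. indicat_real (- K) (V \<omega>) \<partial>Q) = (\<integral>\<omega>. indicat_real {\<omega>\<in>space Q. V \<omega> \<notin> K} \<omega> \<partial>Q)"
      by (intro Bochner_Integration.integral_cong) (auto simp: indicator_def)
    also have "\<dots> = measure Q {\<omega>\<in>space Q. V \<omega> \<notin> K}"
      by (simp add: Int_absorb2 subset_eq)
    finally show ?thesis using VK by simp
  qed
  have "(\<lambda>n. \<integral>\<omega>. g (Y n \<omega>) \<partial>M) \<longlonglongrightarrow> (\<integral>\<omega>. g (Z \<omega>) \<partial>N)"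
    using trig_expectation_tendsto[OF M N Y Z conv u(2)] by (simp add: g_def)
  then have "\<forall>\<^sub>F n in sequentially. \<bar>(\<integral>\<omega>. g (Y n \<omega>) \<partial>M) - (\<integral>\<omega>. g (Z \<omega>) \<partial>N)\<bar> < \<epsilon>"
    using \<epsilon> by (auto simp: tendsto_iff dist_real_def)
  then show ?thesis
  proof eventually_elim
    case (elim n)
    then show ?case using est[OF M Y YK, of n] est[OF N Z ZK] by linarith
  qed
qed

text \<open>The Lipschitz minorants are the Moreau--Yosida type envelopes
  \<open>y \<mapsto> inf\<^sub>z (f z + m * dist y z)\<close>.\<close>

lemma lipschitz_minorants:
  fixes f :: "'h::metric_space \<Rightarrow> real"
  assumes f: "continuous_on UNIV f" and b: "\<And>y. \<bar>f y\<bar> \<le> B"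
  obtains F :: "nat \<Rightarrow> 'h \<Rightarrow> real"
  where "\<And>m y z. \<bar>F m y - F m z\<bar> \<le> real m * dist y z" "\<And>m y. \<bar>F m y\<bar> \<le> B"
    "\<And>m y. F m y \<le> f y" "\<And>y. (\<lambda>m. F m y) \<longlonglongrightarrow> f y"
proof -
  define F where "F m y = (INF z. f z + real m * dist y z)" for m :: nat and y
  have lb: "- B \<le> f z + real m * dist y z" for m y z
    using b[of z] by (simp add: abs_le_iff add_increasing2)
  have bdd: "bdd_below (range (\<lambda>z. f z + real m * dist y z))" for m y
    using lb by (intro bdd_belowI2[of _ "- B"])
  have Fle: "F m y \<le> f z + real m * dist y z" for m y z
    unfolding F_def by (rule cINF_lower[OF bdd]) simp
  have Fge: "c \<le> F m y" if "\<And>z. c \<le> f z + real m * dist y z" for c m y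
    unfolding F_def by (rule cINF_greatest) (use that in auto)
  have le: "F m y \<le> f y" for m y using Fle[of m y y] by simp
  have half: "F m y - real m * dist y z \<le> F m z" for m y z
  proof (rule Fge)
    fix w
    have "real m * dist y w \<le> real m * dist y z + real m * dist z w"
      using mult_left_mono[OF dist_triangle[of y w z], of "real m"] by (simp add: distrib_left)
    then show "F m y - real m * dist y z \<le> f w + real m * dist z w"
      using Fle[of m y w] by linarith
  qed
  show ?thesis
  proof
    show "\<bar>F m y - F m z\<bar> \<le> real m * dist y z" for m y z
      using half[of m y z] half[of m z y] by (simp add: dist_commute abs_le_iff)
    show "\<bar>F m y\<bar> \<le> B" for m y
      using Fge[OF lb, of m y] le[of m y] b[of y] by (simp add: abs_le_iff)
    show "F m y \<le> f y" for m y by (rule le)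
    show "(\<lambda>m. F m y) \<longlonglongrightarrow> f y" for y
    proof (rule LIMSEQ_I)
      fix r :: real assume r: "0 < r"
      obtain d where d: "d > 0" "\<And>z. dist z y < d \<Longrightarrow> dist (f z) (f y) < r / 2"
        using f r unfolding continuous_on_iff by (metis UNIV_I half_gt_zero)
      \<comment> \<open>From distance \<open>d\<close> on the penalty \<open>m0 * d\<close> is at
        least \<open>2 * B\<close>, which exceeds any drop of \<open>f\<close>.\<close>
      obtain m0 :: nat where m0: "2 * B / d \<le> real m0" using real_arch_simple by blast
      show "\<exists>no. \<forall>n\<ge>no. norm (F n y - f y) < r"
      proof (intro exI[of _ m0] allI impI)
        fix n assume n: "m0 \<le> n"
        have "f y - r / 2 \<le> F n y"
        proof (rule Fge)
          fix z
          show "f y - r / 2 \<le> f z + real n * dist y z"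
          proof (cases "dist z y < d")
            case True
            have "0 \<le> real n * dist y z" by simp
            moreover have "f y - f z < r / 2" using d(2)[OF True] by (simp add: dist_real_def abs_if split: if_splits)
            ultimately show ?thesis by linarith
          next
            case False
            have "2 * B \<le> real m0 * d" using m0 d(1) by (simp add: field_simps)
            also have "\<dots> \<le> real n * dist y z"
              using n False d(1) by (intro mult_mono) (auto simp: dist_commute)
            finally show ?thesis using b[of y] b[of z] r by (simp add: abs_le_iff)
          qed
        qed
        then show "norm (F n y - f y) < r" using le[of n y] r by simp
      qed
    qed
  qed
qed

text \<open>Lipschitz minorants increase the lower bound up to \<open>f\<close> by dominated
  convergence under the limit law, which gives the lower half of the convergence. Applying it to - f
  gives the upper half.\<close>

lemma lipschitz_convergence_imp_converges_in_distribution: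
  fixes Y :: "nat \<Rightarrow> 'w \<Rightarrow> 'h::metric_space"
  assumes M: "prob_space M" and N: "prob_space N"
    and Y: "\<And>n. Y n \<in> borel_measurable M" and Z: "Z \<in> borel_measurable N"
    and conv: "\<And>f L B. (\<And>y z. \<bar>f y - f z\<bar> \<le> L * dist y z) \<Longrightarrow> (\<And>y. \<bar>f y\<bar> \<le> B) \<Longrightarrow>
      (\<lambda>n. \<integral>\<omega>. f (Y n \<omega>) \<partial>M) \<longlonglongrightarrow> (\<integral>\<omega>. f (Z \<omega>) \<partial>N)"
  shows "converges_in_distribution M Y N Z"
proof -
  interpret M: prob_space M by fact
  interpret N: prob_space N by fact
  note [measurable] = Y Z
  have lower: "\<forall>\<^sub>F n in sequentially. (\<integral>\<omega>. f (Z \<omega>) \<partial>N) - e < (\<integral>\<omega>. f (Y n \<omega>) \<partial>M)"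
    if f: "continuous_on UNIV f" and b: "\<And>y. \<bar>f y\<bar> \<le> B" and e: "e > 0" for f :: "'h \<Rightarrow> real" and e B
  proof -
    obtain F where F: "\<And>m y z. \<bar>F m y - F m z\<bar> \<le> real m * dist y z" "\<And>m y. \<bar>F m y\<bar> \<le> B"
      "\<And>m y. F m y \<le> f y" "\<And>y. (\<lambda>m. F m y) \<longlonglongrightarrow> f y"
      using lipschitz_minorants[OF f b] by metis
    have [measurable]: "f \<in> borel_measurable borel" by (rule borel_measurable_continuous_onI[OF f])
    have Fc: "continuous_on UNIV (F m)" for m
    proof (unfold continuous_on_iff, safe)
      fix x :: 'h and r :: real assume r: "0 < r"
      have "dist (F m z) (F m x) < r" if "dist z x < r / (real m + 1)" for z
      proof -
        have "real m * dist z x \<le> (real m + 1) * dist z x" by (intro mult_right_mono) auto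
        also have "\<dots> < r" using that by (simp add: field_simps)
        finally show ?thesis using F(1)[of m z x] by (simp add: dist_real_def)
      qed
      then show "\<exists>d>0. \<forall>x'\<in>UNIV. dist x' x < d \<longrightarrow> dist (F m x') (F m x) < r"
        using r by (intro exI[of _ "r / (real m + 1)"]) auto
    qed
    have [measurable]: "F m \<in> borel_measurable borel" for m by (rule borel_measurable_continuous_onI[OF Fc])
    have "(\<lambda>m. \<integral>\<omega>. F m (Z \<omega>) \<partial>N) \<longlonglongrightarrow> (\<integral>\<omega>. f (Z \<omega>) \<partial>N)"
      by (rule integral_dominated_convergence[where w = "\<lambda>_. B"]) (auto simp: F)
    then have "\<forall>\<^sub>F m in sequentially. (\<integral>\<omega>. f (Z \<omega>) \<partial>N) - e / 2 < (\<integral>\<omega>. F m (Z \<omega>) \<partial>N)"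
      using e by (intro order_tendstoD(1)) auto
    then obtain m where m: "(\<integral>\<omega>. f (Z \<omega>) \<partial>N) - e / 2 < (\<integral>\<omega>. F m (Z \<omega>) \<partial>N)"
      by (auto simp: eventually_sequentially)
    have "(\<lambda>n. \<integral>\<omega>. F m (Y n \<omega>) \<partial>M) \<longlonglongrightarrow> (\<integral>\<omega>. F m (Z \<omega>) \<partial>N)"
      by (rule conv[OF F(1) F(2)])
    then have "\<forall>\<^sub>F n in sequentially. (\<integral>\<omega>. F m (Z \<omega>) \<partial>N) - e / 2 < (\<integral>\<omega>. F m (Y n \<omega>) \<partial>M)"
      using e by (intro order_tendstoD(1)) auto
    then show ?thesis
    proof eventually_elim
      case (elim n)
      have "(\<integral>\<omega>. F m (Y n \<omega>) \<partial>M) \<le> (\<integral>\<omega>. f (Y n \<omega>) \<partial>M)"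
        using F b by (intro integral_mono M.integrable_const_bound[of _ B]) auto
      then show ?case using m elim by linarith
    qed
  qed
  have "(\<lambda>n. \<integral>\<omega>. f (Y n \<omega>) \<partial>M) \<longlonglongrightarrow> (\<integral>\<omega>. f (Z \<omega>) \<partial>N)"
    if f: "continuous_on UNIV f" and "bounded (range f)" for f :: "'h \<Rightarrow> real"
  proof -
    obtain B where B: "\<And>y. \<bar>f y\<bar> \<le> B" using \<open>bounded (range f)\<close> by (auto simp: bounded_iff)
    show ?thesis
    proof (rule LIMSEQ_I)
      fix r :: real assume r: "0 < r"
      have "continuous_on UNIV (\<lambda>y. - f y)" using f by (intro continuous_intros)
      from lower[OF this _ r, of B] B
      have "\<forall>\<^sub>F n in sequentially. (\<integral>\<omega>. f (Y n \<omega>) \<partial>M) < (\<integral>\<omega>. f (Z \<omega>) \<partial>N) + r"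
        by (auto elim: eventually_mono)
      with lower[OF f B r]
      have "\<forall>\<^sub>F n in sequentially. norm ((\<integral>\<omega>. f (Y n \<omega>) \<partial>M) - (\<integral>\<omega>. f (Z \<omega>) \<partial>N)) < r"
        by eventually_elim auto
      then show "\<exists>no. \<forall>n\<ge>no. norm ((\<integral>\<omega>. f (Y n \<omega>) \<partial>M) - (\<integral>\<omega>. f (Z \<omega>) \<partial>N)) < r"
        by (simp add: eventually_sequentially)
    qed
  qed
  then show ?thesis unfolding converges_in_distribution_def using Y Z by blast
qed

section \<open>Gram--Schmidt orthogonalization of a bounded random element\<close>

text \<open>A class closed under all algebraic operations of the orthogonalization, so that every
  integrability condition there becomes a syntactic check.\<close>

definition ess_bounded :: "'a measure \<Rightarrow> ('a \<Rightarrow> 'b::real_normed_vector) \<Rightarrow> bool" where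
  "ess_bounded M f \<longleftrightarrow> f \<in> borel_measurable M \<and> (\<exists>C. AE x in M. norm (f x) \<le> C)"

lemma ess_bounded_measurable: "ess_bounded M f \<Longrightarrow> f \<in> borel_measurable M"
  by (simp add: ess_bounded_def)

lemma ess_bounded_bilinear:
  fixes f :: "'w \<Rightarrow> 'a::{real_normed_vector, second_countable_topology}"
    and g :: "'w \<Rightarrow> 'b::{real_normed_vector, second_countable_topology}"
    and pr :: "'a \<Rightarrow> 'b \<Rightarrow> 'c::real_normed_vector"
  assumes b: "bounded_bilinear pr" and f: "ess_bounded M f" and g: "ess_bounded M g"
  shows "ess_bounded M (\<lambda>x. pr (f x) (g x))"
proof -
  interpret bounded_bilinear pr by fact
  obtain K where K: "K > 0" "\<And>a b. norm (pr a b) \<le> norm a * norm b * K" using pos_bounded by blast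
  from f g obtain A B where A: "AE x in M. norm (f x) \<le> A" and B: "AE x in M. norm (g x) \<le> B"
    unfolding ess_bounded_def by blast
  have "AE x in M. norm (pr (f x) (g x)) \<le> A * B * K" using A B
  proof eventually_elim
    case (elim x)
    then have "norm (f x) * norm (g x) * K \<le> A * B * K"
      using K(1) by (intro mult_right_mono mult_mono) (auto intro: order_trans[OF norm_ge_zero])
    then show ?case using K(2)[of "f x" "g x"] by simp
  qed
  moreover have "(\<lambda>x. pr (f x) (g x)) \<in> borel_measurable M"
  proof (rule borel_measurable_continuous_Pair[of f M g "\<lambda>a b. pr a b"])
    show "continuous_on UNIV (\<lambda>x. pr (fst x) (snd x))" by (intro continuous_on continuous_intros)
  qed (use f g in \<open>auto simp: ess_bounded_def\<close>)
  ultimately show ?thesis unfolding ess_bounded_def by blast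
qed

lemma ess_bounded_const: "ess_bounded M (\<lambda>_. c)"
  unfolding ess_bounded_def by (auto intro!: exI[of _ "norm c"])

lemma ess_bounded_add:
  fixes f g :: "'w \<Rightarrow> 'a::{real_normed_vector, second_countable_topology}"
  assumes f: "ess_bounded M f" and g: "ess_bounded M g"
  shows "ess_bounded M (\<lambda>x. f x + g x)"
proof -
  from f g obtain A B where A: "AE x in M. norm (f x) \<le> A" and B: "AE x in M. norm (g x) \<le> B"
    unfolding ess_bounded_def by blast
  have "AE x in M. norm (f x + g x) \<le> A + B" using A B
    by eventually_elim (rule norm_triangle_mono)
  then show ?thesis using f g unfolding ess_bounded_def by (auto intro!: borel_measurable_add)
qed

lemmas ess_bounded_scaleR = ess_bounded_bilinear[OF bounded_bilinear_scaleR]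
lemmas ess_bounded_mult = ess_bounded_bilinear[OF bounded_bilinear_mult]
lemmas ess_bounded_inner = ess_bounded_bilinear[OF bounded_bilinear_inner]

lemma ess_bounded_diff:
  fixes f g :: "'w \<Rightarrow> 'a::{real_normed_vector, second_countable_topology}"
  assumes "ess_bounded M f" "ess_bounded M g"
  shows "ess_bounded M (\<lambda>x. f x - g x)"
  using ess_bounded_add[OF assms(1) ess_bounded_scaleR[OF ess_bounded_const[of M "-1"] assms(2)]] by simp

lemma ess_bounded_power2:
  fixes f :: "'w \<Rightarrow> real"
  assumes "ess_bounded M f"
  shows "ess_bounded M (\<lambda>x. (f x)\<^sup>2)"
  unfolding power2_eq_square by (rule ess_bounded_mult[OF assms assms])

lemma ess_bounded_sum:
  fixes f :: "'i \<Rightarrow> 'w \<Rightarrow> 'a::{real_normed_vector, second_countable_topology}"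
  assumes "\<And>i. i \<in> I \<Longrightarrow> ess_bounded M (f i)"
  shows "ess_bounded M (\<lambda>x. \<Sum>i\<in>I. f i x)"
  using assms by (induction I rule: infinite_finite_induct) (auto intro: ess_bounded_add ess_bounded_const)

lemma (in finite_measure) ess_bounded_integrable:
  fixes f :: "'a \<Rightarrow> 'b::{banach, second_countable_topology}"
  assumes "ess_bounded M f"
  shows "integrable M f"
  using assms unfolding ess_bounded_def by (auto intro: integrable_const_bound)

lemmas ess_bounded_intros = ess_bounded_const ess_bounded_add ess_bounded_diff ess_bounded_scaleR
  ess_bounded_mult ess_bounded_inner ess_bounded_power2 ess_bounded_sum

text \<open>\<open>D\<close> is the law of one summand and \<open>d\<close> runs through a dense
  set. Gram--Schmidt takes place in L2(D), on the scalar functions \<open>y \<bullet> d k\<close>,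
  while vectors of the Hilbert space appear as coefficients. No orthonormal basis of the space
  enters.\<close>

locale centered_law = prob_space D
  for D :: "'h::{real_inner, banach, second_countable_topology} measure" +
  fixes K :: real and d :: "nat \<Rightarrow> 'h"
  assumes sets_D[measurable_cong]: "sets D = sets borel"
    and AE_le: "AE y in D. norm y \<le> K"
    and mean_0: "(\<integral>y. y \<partial>D) = 0"
    and dense: "e > 0 \<Longrightarrow> \<exists>k. dist (d k) y < e"
begin

definition gs_coeff :: "('h \<Rightarrow> 'h) \<Rightarrow> 'h \<Rightarrow> 'h \<Rightarrow> real" where
  "gs_coeff r e y = (r y \<bullet> e) / sqrt (\<integral>y. (r y \<bullet> e)\<^sup>2 \<partial>D)"

text \<open>Where a residual has no component along \<open>d k\<close>, the coefficient is \<open>x / 0 = 0\<close>.\<close>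

primrec gs_res :: "nat \<Rightarrow> 'h \<Rightarrow> 'h" where
  "gs_res 0 = (\<lambda>y. y)"
| "gs_res (Suc k) = (\<lambda>y. gs_res k y -
     gs_coeff (gs_res k) (d k) y *\<^sub>R (\<integral>y. gs_coeff (gs_res k) (d k) y *\<^sub>R gs_res k y \<partial>D))"

definition gs_fun :: "nat \<Rightarrow> 'h \<Rightarrow> real" where
  "gs_fun k = gs_coeff (gs_res k) (d k)"

text \<open>The vector-valued Fourier coefficient of the residual with respect to
  \<open>gs_fun k\<close>; subtracting it projects all coordinates of the residual off
  \<open>gs_fun k\<close> simultaneously.\<close>

definition gs_vec :: "nat \<Rightarrow> 'h" where
  "gs_vec k = (\<integral>y. gs_fun k y *\<^sub>R gs_res k y \<partial>D)"

lemma gs_res_Suc: "gs_res (Suc k) y = gs_res k y - gs_fun k y *\<^sub>R gs_vec k"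
  by (simp add: gs_fun_def gs_vec_def)

declare gs_res.simps(2) [simp del]

lemma K_nonneg: "K \<ge> 0"
proof -
  have "AE y in D. 0 \<le> K" using AE_le by eventually_elim (rule order_trans[OF norm_ge_zero])
  then show ?thesis by simp
qed

lemma ess_bounded_id: "ess_bounded D (\<lambda>y. y)"
  unfolding ess_bounded_def using AE_le by auto

lemma ess_bounded_coeff: "ess_bounded D r \<Longrightarrow> ess_bounded D (gs_coeff r e)"
  unfolding gs_coeff_def[abs_def] divide_inverse by (intro ess_bounded_intros)

lemma ess_bounded_res: "ess_bounded D (gs_res k)"
  by (induction k) (auto simp: gs_res.simps(2) intro!: ess_bounded_id ess_bounded_intros ess_bounded_coeff)

lemma ess_bounded_fun: "ess_bounded D (gs_fun k)"
  unfolding gs_fun_def by (rule ess_bounded_coeff[OF ess_bounded_res])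

lemmas gs_int = ess_bounded_integrable[OF ess_bounded_id] ess_bounded_integrable[OF ess_bounded_res]
  ess_bounded_integrable[OF ess_bounded_fun]
lemmas gs_intros = ess_bounded_integrable ess_bounded_intros ess_bounded_res ess_bounded_fun ess_bounded_id

text \<open>If the second moment vanishes, so does the component almost everywhere, and the equation
  reads 0 = 0; otherwise it is the normalization.\<close>

lemma gs_fun_inner:
  "AE y in D. gs_res k y \<bullet> d k = sqrt (\<integral>y. (gs_res k y \<bullet> d k)\<^sup>2 \<partial>D) * gs_fun k y"
proof (cases "(\<integral>y. (gs_res k y \<bullet> d k)\<^sup>2 \<partial>D) = 0")
  case True
  have "integrable D (\<lambda>y. (gs_res k y \<bullet> d k)\<^sup>2)" by (intro gs_intros)
  from integral_nonneg_eq_0_iff_AE[OF this] True show ?thesis by auto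
next
  case False
  then show ?thesis by (simp add: gs_fun_def gs_coeff_def)
qed

text \<open>In both cases the second moment of \<open>gs_fun k\<close> times \<open>gs_vec k\<close>
  is \<open>gs_vec k\<close>, so exhausted directions need no separate treatment later.\<close>

lemma gs_fun_cases: "(\<integral>y. (gs_fun k y)\<^sup>2 \<partial>D) = 1 \<or> (gs_fun k = (\<lambda>_. 0) \<and> gs_vec k = 0)"
proof (cases "(\<integral>y. (gs_res k y \<bullet> d k)\<^sup>2 \<partial>D) = 0")
  case True
  then have "gs_fun k = (\<lambda>_. 0)" by (auto simp: gs_fun_def gs_coeff_def)
  then show ?thesis by (simp add: gs_vec_def)
next
  case False
  have "(\<integral>y. (gs_res k y \<bullet> d k)\<^sup>2 \<partial>D) \<ge> 0" by (intro integral_nonneg_AE) auto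
  then have "(gs_fun k y)\<^sup>2 = (gs_res k y \<bullet> d k)\<^sup>2 / (\<integral>y. (gs_res k y \<bullet> d k)\<^sup>2 \<partial>D)" for y
    by (simp add: gs_fun_def gs_coeff_def power_divide)
  then show ?thesis using False by simp
qed

lemma gs_fun_sq_le: "(\<integral>y. (gs_fun k y)\<^sup>2 \<partial>D) \<le> 1"
  using gs_fun_cases[of k] by auto

lemma gs_vec_inner: "gs_vec k \<bullet> h = (\<integral>y. gs_fun k y * (gs_res k y \<bullet> h) \<partial>D)"
proof -
  have "integrable D (\<lambda>y. gs_fun k y *\<^sub>R gs_res k y)" by (intro gs_intros)
  then show ?thesis unfolding gs_vec_def by (subst integral_inner_left[symmetric]) auto
qed

text \<open>Step \<open>k\<close> removes the component along \<open>d k\<close> because that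
  component is a multiple of \<open>gs_fun k\<close>. Components removed earlier do not return: for
  them the residual is already orthogonal, and hence \<open>gs_vec k\<close> is too.\<close>

lemma gs_res_inner_0: "j < k \<Longrightarrow> AE y in D. gs_res k y \<bullet> d j = 0"
proof (induction k)
  case (Suc k)
  show ?case
  proof (cases "j = k")
    case True
    define c where "c = sqrt (\<integral>y. (gs_res k y \<bullet> d k)\<^sup>2 \<partial>D)"
    have eq: "AE y in D. gs_res k y \<bullet> d k = c * gs_fun k y" unfolding c_def by (rule gs_fun_inner)
    have "gs_vec k \<bullet> d k = (\<integral>y. c * (gs_fun k y)\<^sup>2 \<partial>D)"
      unfolding gs_vec_inner
    proof (rule integral_cong_AE)
      show "AE y in D. gs_fun k y * (gs_res k y \<bullet> d k) = c * (gs_fun k y)\<^sup>2"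
        using eq by eventually_elim (simp add: power2_eq_square)
    qed (intro ess_bounded_measurable gs_intros)+
    then have v: "gs_vec k \<bullet> d k = c * (\<integral>y. (gs_fun k y)\<^sup>2 \<partial>D)" by simp
    show ?thesis using eq
    proof eventually_elim
      case (elim y)
      have "gs_fun k y * (gs_vec k \<bullet> d k) = c * gs_fun k y"
        using gs_fun_cases[of k] v by auto
      then show ?case using elim True by (auto simp: gs_res_Suc inner_diff_left)
    qed
  next
    case False
    then have IH: "AE y in D. gs_res k y \<bullet> d j = 0" using Suc by simp
    have "gs_vec k \<bullet> d j = (\<integral>y. 0 \<partial>D)"
      unfolding gs_vec_inner
    proof (rule integral_cong_AE)
      show "AE y in D. gs_fun k y * (gs_res k y \<bullet> d j) = 0" using IH by eventually_elim simp
    qed (intro ess_bounded_measurable gs_intros)+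
    then show ?thesis using IH by (auto simp: gs_res_Suc inner_diff_left)
  qed
qed simp

lemma gs_mean_0: "(\<integral>y. gs_res k y \<partial>D) = 0" "(\<integral>y. gs_fun k y \<partial>D) = 0"
proof -
  have f: "(\<integral>y. gs_fun k y \<partial>D) = 0" if "(\<integral>y. gs_res k y \<partial>D) = 0" for k
  proof -
    have "(\<integral>y. gs_res k y \<bullet> d k \<partial>D) = 0" using that gs_int(2)[of k] by simp
    then show ?thesis by (simp add: gs_fun_def gs_coeff_def[abs_def])
  qed
  show r: "(\<integral>y. gs_res k y \<partial>D) = 0"
  proof (induction k)
    case 0 then show ?case using mean_0 by simp
  next
    case (Suc k)
    have "(\<integral>y. gs_res (Suc k) y \<partial>D) = (\<integral>y. gs_res k y \<partial>D) - (\<integral>y. gs_fun k y *\<^sub>R gs_vec k \<partial>D)"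
      unfolding gs_res_Suc by (intro Bochner_Integration.integral_diff gs_intros)
    then show ?case using Suc f[OF Suc] gs_int(3) by simp
  qed
  then show "(\<integral>y. gs_fun k y \<partial>D) = 0" by (rule f)
qed

text \<open>Each \<open>gs_fun k\<close> is a multiple of a coordinate of its own residual, so
  orthogonality of \<open>gs_fun j\<close> to all coordinates of the residual gives orthogonality to
  \<open>gs_fun k\<close>, and the next residual inherits it.\<close>

lemma gs_orthogonal: "j < k \<Longrightarrow> (\<integral>y. gs_fun j y * (gs_res k y \<bullet> h) \<partial>D) = 0"
proof (induction k arbitrary: h)
  case (Suc k)
  have eq: "(\<integral>y. gs_fun j y * (gs_res (Suc k) y \<bullet> h) \<partial>D)
      = (\<integral>y. gs_fun j y * (gs_res k y \<bullet> h) \<partial>D) - (\<integral>y. gs_fun j y * gs_fun k y \<partial>D) * (gs_vec k \<bullet> h)"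
  proof -
    have "(\<integral>y. gs_fun j y * (gs_res (Suc k) y \<bullet> h) \<partial>D)
      = (\<integral>y. gs_fun j y * (gs_res k y \<bullet> h) - (gs_fun j y * gs_fun k y) * (gs_vec k \<bullet> h) \<partial>D)"
      by (intro Bochner_Integration.integral_cong) (auto simp: gs_res_Suc inner_diff_left algebra_simps)
    also have "\<dots> = (\<integral>y. gs_fun j y * (gs_res k y \<bullet> h) \<partial>D) - (\<integral>y. (gs_fun j y * gs_fun k y) * (gs_vec k \<bullet> h) \<partial>D)"
      by (intro Bochner_Integration.integral_diff gs_intros)
    finally show ?thesis by simp
  qed
  show ?case
  proof (cases "j = k")
    case True
    then show ?thesis unfolding eq using gs_fun_cases[of k]
      by (auto simp: gs_vec_inner[symmetric] power2_eq_square)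
  next
    case False
    then have j: "j < k" using Suc by simp
    have "(\<integral>y. gs_fun j y * gs_fun k y \<partial>D) = 0"
      using Suc.IH[OF j, of "d k"] by (simp add: gs_fun_def[of k] gs_coeff_def)
    then show ?thesis unfolding eq using Suc.IH[OF j] by simp
  qed
qed simp

text \<open>Pythagoras: the removed part has second moment
  \<open>(gs_vec k \<bullet> h)\<^sup>2\<close> and is orthogonal to what remains.\<close>

lemma gs_var_Suc: "(\<integral>y. (gs_res (Suc k) y \<bullet> h)\<^sup>2 \<partial>D) = (\<integral>y. (gs_res k y \<bullet> h)\<^sup>2 \<partial>D) - (gs_vec k \<bullet> h)\<^sup>2"
proof -
  have "(\<integral>y. (gs_res (Suc k) y \<bullet> h)\<^sup>2 \<partial>D)
      = (\<integral>y. (gs_res k y \<bullet> h)\<^sup>2 + ((gs_fun k y)\<^sup>2 * (gs_vec k \<bullet> h)\<^sup>2 - 2 * (gs_vec k \<bullet> h) * (gs_fun k y * (gs_res k y \<bullet> h))) \<partial>D)"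
    by (intro Bochner_Integration.integral_cong) (auto simp: gs_res_Suc inner_diff_left power2_eq_square algebra_simps)
  also have "\<dots> = (\<integral>y. (gs_res k y \<bullet> h)\<^sup>2 \<partial>D) + ((\<integral>y. (gs_fun k y)\<^sup>2 * (gs_vec k \<bullet> h)\<^sup>2 \<partial>D) - (\<integral>y. 2 * (gs_vec k \<bullet> h) * (gs_fun k y * (gs_res k y \<bullet> h)) \<partial>D))"
    by (subst Bochner_Integration.integral_add Bochner_Integration.integral_diff, (intro gs_intros)+)+ simp
  also have "\<dots> = (\<integral>y. (gs_res k y \<bullet> h)\<^sup>2 \<partial>D) + ((\<integral>y. (gs_fun k y)\<^sup>2 \<partial>D) * (gs_vec k \<bullet> h)\<^sup>2 - 2 * (gs_vec k \<bullet> h) * (gs_vec k \<bullet> h))"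
    by (simp add: gs_vec_inner[symmetric])
  also have "\<dots> = (\<integral>y. (gs_res k y \<bullet> h)\<^sup>2 \<partial>D) - (gs_vec k \<bullet> h)\<^sup>2"
    using gs_fun_cases[of k] by (auto simp: power2_eq_square)
  finally show ?thesis .
qed

lemma gs_norm_Suc: "(\<integral>y. (norm (gs_res (Suc k) y))\<^sup>2 \<partial>D) = (\<integral>y. (norm (gs_res k y))\<^sup>2 \<partial>D) - (norm (gs_vec k))\<^sup>2"
proof -
  have "(\<integral>y. (norm (gs_res (Suc k) y))\<^sup>2 \<partial>D)
      = (\<integral>y. gs_res k y \<bullet> gs_res k y + ((gs_fun k y)\<^sup>2 * (gs_vec k \<bullet> gs_vec k) - 2 * (gs_fun k y * (gs_res k y \<bullet> gs_vec k))) \<partial>D)"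
    unfolding power2_norm_eq_inner
    by (intro Bochner_Integration.integral_cong)
       (auto simp: gs_res_Suc inner_diff_left inner_diff_right inner_commute power2_eq_square algebra_simps)
  also have "\<dots> = (\<integral>y. gs_res k y \<bullet> gs_res k y \<partial>D) + ((\<integral>y. (gs_fun k y)\<^sup>2 * (gs_vec k \<bullet> gs_vec k) \<partial>D) - (\<integral>y. 2 * (gs_fun k y * (gs_res k y \<bullet> gs_vec k)) \<partial>D))"
    by (subst Bochner_Integration.integral_add Bochner_Integration.integral_diff, (intro gs_intros)+)+ simp
  also have "\<dots> = (\<integral>y. gs_res k y \<bullet> gs_res k y \<partial>D) + ((\<integral>y. (gs_fun k y)\<^sup>2 \<partial>D) * (gs_vec k \<bullet> gs_vec k) - 2 * (gs_vec k \<bullet> gs_vec k))"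
    by (simp add: gs_vec_inner[symmetric])
  also have "\<dots> = (\<integral>y. (norm (gs_res k y))\<^sup>2 \<partial>D) - (norm (gs_vec k))\<^sup>2"
    using gs_fun_cases[of k] by (auto simp: power2_norm_eq_inner)
  finally show ?thesis .
qed

lemma gs_var: "(\<integral>y. (gs_res k y \<bullet> h)\<^sup>2 \<partial>D) = (\<integral>y. (y \<bullet> h)\<^sup>2 \<partial>D) - (\<Sum>j<k. (gs_vec j \<bullet> h)\<^sup>2)"
proof (induction k)
  case (Suc k) then show ?case using gs_var_Suc[of k h] by simp
qed simp

lemma gs_norm: "(\<integral>y. (norm (gs_res k y))\<^sup>2 \<partial>D) = (\<integral>y. (norm y)\<^sup>2 \<partial>D) - (\<Sum>j<k. (norm (gs_vec j))\<^sup>2)"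
proof (induction k)
  case (Suc k) then show ?case using gs_norm_Suc[of k] by simp
qed simp

lemma gs_decomp: "y = (\<Sum>j<k. gs_fun j y *\<^sub>R gs_vec j) + gs_res k y"
proof (induction k)
  case (Suc k)
  have "(\<Sum>j<Suc k. gs_fun j y *\<^sub>R gs_vec j) + gs_res (Suc k) y = (\<Sum>j<k. gs_fun j y *\<^sub>R gs_vec j) + gs_res k y"
    by (simp add: gs_res_Suc)
  then show ?case using Suc.IH by simp
qed simp

lemma integrable_norm_sq_res: "integrable D (\<lambda>y. (norm (gs_res k y))\<^sup>2)"
  unfolding power2_norm_eq_inner by (intro gs_intros)

text \<open>Bessel's inequality; its second part makes the Gaussian series with coefficients
  \<open>gs_vec\<close> converge.\<close>

lemma gs_norm_bounds:
  "(\<integral>y. (norm (gs_res k y))\<^sup>2 \<partial>D) \<le> K\<^sup>2" "(\<Sum>j<k. (norm (gs_vec j))\<^sup>2) \<le> K\<^sup>2"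
proof -
  have "(\<integral>y. (norm y)\<^sup>2 \<partial>D) \<le> (\<integral>y. K\<^sup>2 \<partial>D)"
  proof (rule integral_mono_AE)
    show "integrable D (\<lambda>y. (norm y)\<^sup>2)" using integrable_norm_sq_res[of 0] by simp
    show "AE y in D. (norm y)\<^sup>2 \<le> K\<^sup>2" using AE_le by eventually_elim (auto intro: power_mono)
  qed simp
  then have 1: "(\<integral>y. (norm y)\<^sup>2 \<partial>D) \<le> K\<^sup>2" by (simp add: prob_space)
  have "0 \<le> (\<integral>y. (norm (gs_res k y))\<^sup>2 \<partial>D)" by (intro integral_nonneg_AE) auto
  then show "(\<Sum>j<k. (norm (gs_vec j))\<^sup>2) \<le> K\<^sup>2" using 1 gs_norm[of k] by simp
  have "0 \<le> (\<Sum>j<k. (norm (gs_vec j))\<^sup>2)" by (simp add: sum_nonneg)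
  then show "(\<integral>y. (norm (gs_res k y))\<^sup>2 \<partial>D) \<le> K\<^sup>2" using 1 gs_norm[of k] by simp
qed

text \<open>The remaining terms in the decomposition of \<open>y\<close> are orthogonal to the
  residual. One factor of the squared norm thus becomes \<open>y\<close> itself, which can be
  compared with a point \<open>d j\<close> orthogonal to the residual.\<close>

lemma gs_res_inner_id: "(\<integral>y. gs_res k y \<bullet> y \<partial>D) = (\<integral>y. (norm (gs_res k y))\<^sup>2 \<partial>D)"
proof -
  have "(\<integral>y. gs_res k y \<bullet> y \<partial>D) = (\<integral>y. (\<Sum>j<k. gs_fun j y * (gs_res k y \<bullet> gs_vec j)) + gs_res k y \<bullet> gs_res k y \<partial>D)"
    by (intro Bochner_Integration.integral_cong refl, subst (2) gs_decomp[of _ k])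
       (simp add: inner_add_right inner_sum_right)
  also have "\<dots> = (\<Sum>j<k. \<integral>y. gs_fun j y * (gs_res k y \<bullet> gs_vec j) \<partial>D) + (\<integral>y. gs_res k y \<bullet> gs_res k y \<partial>D)"
    by (subst Bochner_Integration.integral_add, (intro gs_intros)+)
       (subst Bochner_Integration.integral_sum, (intro gs_intros)+, simp)
  finally show ?thesis by (simp add: gs_orthogonal power2_norm_eq_inner)
qed

text \<open>The residual is orthogonal to \<open>d 0, \<dots>, d (k - 1)\<close>, and with high probability \<open>y\<close> itself is
  close to one of these points.\<close>

lemma gs_res_tendsto_0: "(\<lambda>k. \<integral>y. (norm (gs_res k y))\<^sup>2 \<partial>D) \<longlonglongrightarrow> 0"
proof (rule LIMSEQ_I)
  fix r :: real assume r: "0 < r"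
  \<comment> \<open>The terms of the final estimate add up to \<eta> C / 2, which the choice of
    \<open>\<eta>\<close> turns into r / 2.\<close>
  define C where "C = 1 + K\<^sup>2 + K ^ 3 + K"
  have C: "C > 0" using K_nonneg by (auto simp: C_def intro!: add_pos_nonneg)
  define \<eta> where "\<eta> = r / C"
  have eta: "\<eta> > 0" using r C by (simp add: \<eta>_def)
  define A where "A m = (\<Union>i<m. ball (d i) \<eta>)" for m :: nat
  have [measurable]: "A m \<in> sets D" for m unfolding A_def by measurable
  have "(\<lambda>m. measure D (A m)) \<longlonglongrightarrow> measure D (\<Union>m. A m)"
    by (intro finite_Lim_measure_incseq) (auto simp: A_def incseq_def intro: less_le_trans)
  also have "(\<Union>m. A m) = space D"
  proof -
    have "\<exists>m. y \<in> A m" for y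
    proof -
      obtain k where "dist (d k) y < \<eta>" using dense[OF eta] by blast
      then have "y \<in> A (Suc k)" by (auto simp: A_def)
      then show ?thesis ..
    qed
    then show ?thesis using sets_eq_imp_space_eq[OF sets_D] by auto
  qed
  finally have "(\<lambda>m. measure D (A m)) \<longlonglongrightarrow> 1" by (simp add: prob_space)
  then have "\<forall>\<^sub>F m in sequentially. 1 - \<eta>\<^sup>2 < measure D (A m)"
    using eta by (intro order_tendstoD(1)) auto
  then obtain m where m: "1 - \<eta>\<^sup>2 < measure D (A m)" by (auto simp: eventually_sequentially)
  have mc: "measure D (space D - A m) < \<eta>\<^sup>2" using m by (simp add: prob_compl)
  show "\<exists>no. \<forall>n\<ge>no. norm ((\<integral>y. (norm (gs_res n y))\<^sup>2 \<partial>D) - 0) < r"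
  proof (intro exI[of _ m] allI impI)
    fix k assume k: "m \<le> k"
    let ?R = "\<lambda>y. norm (gs_res k y)"
    have "AE y in D. \<forall>j<m. gs_res k y \<bullet> d j = 0"
      using k gs_res_inner_0[of _ k] by (auto simp: AE_all_countable)
    \<comment> \<open>Young's inequality in two regimes. Close to some \<open>d j\<close> the
      product is at most \<eta> |r| for the residual r; elsewhere it is at most K |r|, and the
      weight 1 / \<eta> is harmless because the exceptional set has measure below \<eta>^2.\<close>
    then have pw: "AE y in D. gs_res k y \<bullet> y \<le> \<eta> / 2 * (1 + (?R y)\<^sup>2) + K / 2 * (\<eta> * (?R y)\<^sup>2 + (1 / \<eta>) * indicat_real (space D - A m) y)"
      using AE_le AE_space
    proof eventually_elim
      case (elim y)
      show ?case
      proof (cases "y \<in> A m")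
        case True
        then obtain j where j: "j < m" "norm (y - d j) < \<eta>" by (auto simp: A_def dist_norm norm_minus_commute)
        have "gs_res k y \<bullet> y = gs_res k y \<bullet> (y - d j)" using elim(1) j(1) by (simp add: inner_diff_right)
        also have "\<dots> \<le> ?R y * \<eta>"
          using norm_cauchy_schwarz[of "gs_res k y" "y - d j"] mult_left_mono[of "norm (y - d j)" \<eta> "?R y"] j(2) by simp
        also have "\<dots> \<le> \<eta> / 2 * (1 + (?R y)\<^sup>2)"
        proof -
          have "0 \<le> (1 - ?R y)\<^sup>2 * \<eta>" using eta by simp
          then show ?thesis by (simp add: power2_eq_square algebra_simps)
        qed
        also have "\<dots> \<le> \<eta> / 2 * (1 + (?R y)\<^sup>2) + K / 2 * (\<eta> * (?R y)\<^sup>2 + (1 / \<eta>) * indicat_real (space D - A m) y)"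
          using K_nonneg eta by (auto intro!: mult_nonneg_nonneg add_nonneg_nonneg)
        finally show ?thesis .
      next
        case False
        have "gs_res k y \<bullet> y \<le> ?R y * K"
          using norm_cauchy_schwarz[of "gs_res k y" y] mult_left_mono[of "norm y" K "?R y"] elim(2) by simp
        also have "\<dots> \<le> K / 2 * (\<eta> * (?R y)\<^sup>2 + (1 / \<eta>))"
        proof -
          have "2 * ?R y \<le> \<eta> * (?R y)\<^sup>2 + 1 / \<eta>"
          proof -
            have "0 \<le> (\<eta> * ?R y - 1)\<^sup>2 / \<eta>" using eta by simp
            also have "\<dots> = \<eta> * (?R y)\<^sup>2 + 1 / \<eta> - 2 * ?R y"
              using eta by (simp add: power2_eq_square field_simps)
            finally show ?thesis by simp
          qed
          from mult_left_mono[OF this, of "K / 2"] K_nonneg show ?thesis by (simp add: mult.commute)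
        qed
        also have "\<dots> \<le> \<eta> / 2 * (1 + (?R y)\<^sup>2) + K / 2 * (\<eta> * (?R y)\<^sup>2 + (1 / \<eta>) * indicat_real (space D - A m) y)"
          using False elim(3) eta by (auto intro!: mult_nonneg_nonneg add_nonneg_nonneg)
        finally show ?thesis .
      qed
    qed
    note i = integrable_norm_sq_res[of k]
    have i2: "integrable D (indicat_real (space D - A m))" by (rule integrable_const_bound[of _ 1]) auto
    have "(\<integral>y. (?R y)\<^sup>2 \<partial>D) = (\<integral>y. gs_res k y \<bullet> y \<partial>D)" by (rule gs_res_inner_id[symmetric])
    also have "\<dots> \<le> (\<integral>y. \<eta> / 2 * (1 + (?R y)\<^sup>2) + K / 2 * (\<eta> * (?R y)\<^sup>2 + (1 / \<eta>) * indicat_real (space D - A m) y) \<partial>D)"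
    proof (rule integral_mono_AE[OF _ _ pw])
      show "integrable D (\<lambda>y. gs_res k y \<bullet> y)" by (intro gs_intros)
    qed (use i i2 in auto)
    also have "\<dots> = \<eta> / 2 * (1 + (\<integral>y. (?R y)\<^sup>2 \<partial>D)) + K / 2 * (\<eta> * (\<integral>y. (?R y)\<^sup>2 \<partial>D) + (1 / \<eta>) * measure D (space D - A m))"
      using i i2 by (simp add: prob_space)
    also have "\<dots> \<le> \<eta> / 2 * (1 + K\<^sup>2) + K / 2 * (\<eta> * K\<^sup>2 + (1 / \<eta>) * \<eta>\<^sup>2)"
      using gs_norm_bounds(1)[of k] eta K_nonneg mc by (intro add_mono mult_left_mono) auto
    also have "\<dots> = \<eta> * C / 2" using eta by (simp add: C_def power2_eq_square power3_eq_cube algebra_simps)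
    also have "\<dots> = r / 2" using C by (simp add: \<eta>_def)
    also have "\<dots> < r" using r by simp
    finally have "(\<integral>y. (?R y)\<^sup>2 \<partial>D) < r" .
    moreover have "0 \<le> (\<integral>y. (?R y)\<^sup>2 \<partial>D)" by (intro integral_nonneg_AE) auto
    ultimately show "norm ((\<integral>y. (?R y)\<^sup>2 \<partial>D) - 0) < r" by simp
  qed
qed

end

section \<open>Gaussian series\<close>

definition gauss_space :: "(nat \<Rightarrow> real) measure" where
  "gauss_space = PiM UNIV (\<lambda>_. std_normal_distribution)"

interpretation gauss: prob_space gauss_space
  unfolding gauss_space_def by (intro prob_space_PiM prob_space_normal_density) simp

lemma gauss_coord_measurable [measurable]: "(\<lambda>\<omega>. \<omega> i) \<in> borel_measurable gauss_space"
proof -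
  have "(\<lambda>\<omega>. \<omega> i) \<in> gauss_space \<rightarrow>\<^sub>M std_normal_distribution"
    unfolding gauss_space_def by (rule measurable_component_singleton) simp
  then show ?thesis by simp
qed

lemma gauss_coord_distr: "distr gauss_space borel (\<lambda>\<omega>. \<omega> i) = std_normal_distribution"
proof -
  have "distr gauss_space std_normal_distribution (\<lambda>\<omega>. \<omega> i) = std_normal_distribution"
    unfolding gauss_space_def by (rule distr_PiM_component) (auto intro: prob_space_normal_density)
  moreover have "distr gauss_space borel (\<lambda>\<omega>. \<omega> i) = distr gauss_space std_normal_distribution (\<lambda>\<omega>. \<omega> i)"
    by (rule distr_cong) auto
  ultimately show ?thesis by simp
qed

lemma gauss_indep: "gauss.indep_vars (\<lambda>_. borel) (\<lambda>i \<omega>. \<omega> i) UNIV"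
proof -
  have S: "sets (PiM UNIV (\<lambda>_::nat. borel :: real measure)) = sets (PiM UNIV (\<lambda>_. std_normal_distribution))"
    by (rule sets_PiM_cong) auto
  have "distr gauss_space (PiM UNIV (\<lambda>_. borel)) (\<lambda>x. \<lambda>i\<in>UNIV. x i) = distr gauss_space gauss_space (\<lambda>x. x)"
    by (rule distr_cong) (auto simp: S gauss_space_def)
  also have "\<dots> = PiM UNIV (\<lambda>i. distr gauss_space borel (\<lambda>\<omega>. \<omega> i))"
    unfolding gauss_coord_distr by (simp add: distr_id2 gauss_space_def)
  finally show ?thesis
    by (subst gauss.indep_vars_iff_distr_eq_PiM) auto
qed

lemma gauss_coord_integrable:
  "integrable gauss_space (\<lambda>\<omega>. (\<omega> i) ^ k)" "integrable gauss_space (\<lambda>\<omega>. \<omega> i)"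
proof -
  have "integrable (distr gauss_space borel (\<lambda>\<omega>. \<omega> i)) (\<lambda>x. x ^ k)" for k
    unfolding gauss_coord_distr by (rule integrable_std_normal_distribution_moment)
  then show "integrable gauss_space (\<lambda>\<omega>. (\<omega> i) ^ k)" for k by (subst (asm) integrable_distr_eq) auto
  from this[of 1] show "integrable gauss_space (\<lambda>\<omega>. \<omega> i)" by simp
qed

lemma gauss_coord_moments: "(\<integral>\<omega>. \<omega> i \<partial>gauss_space) = 0" "(\<integral>\<omega>. (\<omega> i)\<^sup>2 \<partial>gauss_space) = 1"
proof -
  have "(\<integral>\<omega>. (\<omega> i) ^ k \<partial>gauss_space) = (\<integral>x. x ^ k \<partial>std_normal_distribution)" for k
    by (subst gauss_coord_distr[symmetric, of i], subst integral_distr) auto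
  from this[of 1] this[of 2] show "(\<integral>\<omega>. \<omega> i \<partial>gauss_space) = 0" "(\<integral>\<omega>. (\<omega> i)\<^sup>2 \<partial>gauss_space) = 1"
    using integral_std_normal_distribution_moment_odd[of 1] std_normal_distribution_even_moments[of 1]
    by (auto simp: has_bochner_integral_iff)
qed

lemma gauss_coord_prod:
  "integrable gauss_space (\<lambda>\<omega>. \<omega> i * \<omega> j)" "(\<integral>\<omega>. \<omega> i * \<omega> j \<partial>gauss_space) = (if i = j then 1 else 0)"
proof -
  have ind: "gauss.indep_var borel (\<lambda>\<omega>. \<omega> i) borel (\<lambda>\<omega>. \<omega> j)" if "i \<noteq> j"
  proof -
    have "gauss.indep_var borel ((\<lambda>f. f i) \<circ> (\<lambda>\<omega>. restrict (\<lambda>k. \<omega> k) {i}))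
        borel ((\<lambda>f. f j) \<circ> (\<lambda>\<omega>. restrict (\<lambda>k. \<omega> k) {j}))"
      using that by (intro gauss.indep_var_compose[OF gauss.indep_var_restrict[OF gauss_indep]]) auto
    then show ?thesis by (simp add: comp_def)
  qed
  show "integrable gauss_space (\<lambda>\<omega>. \<omega> i * \<omega> j)"
    using gauss.indep_var_integrable[OF ind] gauss_coord_integrable(2) gauss_coord_integrable(1)[of i 2]
    by (cases "i = j") (auto simp: power2_eq_square)
  show "(\<integral>\<omega>. \<omega> i * \<omega> j \<partial>gauss_space) = (if i = j then 1 else 0)"
    using gauss.indep_var_lebesgue_integral[OF ind] gauss_coord_integrable(2) gauss_coord_moments
    by (auto simp: power2_eq_square)
qed

lemma gauss_sum_iexp:
  "(\<integral>\<omega>. iexp (\<Sum>j<k. \<omega> j * c j) \<partial>gauss_space) = complex_of_real (exp (- (\<Sum>j<k. (c j)\<^sup>2) / 2))"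
proof -
  have iv: "gauss.indep_vars (\<lambda>_. borel) (\<lambda>j \<omega>. \<omega> j * c j) {..<k}"
    by (rule gauss.indep_vars_compose2[OF gauss.indep_vars_subset[OF gauss_indep]]) auto
  have ch: "char (distr gauss_space borel (\<lambda>\<omega>. \<omega> j * c j)) 1 = complex_of_real (exp (- (c j)\<^sup>2 / 2))" for j
  proof -
    have "char (distr gauss_space borel (\<lambda>\<omega>. \<omega> j * c j)) 1 = (\<integral>\<omega>. iexp (c j * \<omega> j) \<partial>gauss_space)"
      unfolding char_def by (subst integral_distr) (auto simp: mult.commute)
    also have "\<dots> = char (distr gauss_space borel (\<lambda>\<omega>. \<omega> j)) (c j)"
      unfolding char_def by (subst integral_distr) auto
    finally show ?thesis by (simp add: gauss_coord_distr char_std_normal_distribution)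
  qed
  have "(\<integral>\<omega>. iexp (\<Sum>j<k. \<omega> j * c j) \<partial>gauss_space) = char (distr gauss_space borel (\<lambda>\<omega>. \<Sum>j<k. \<omega> j * c j)) 1"
    unfolding char_def by (subst integral_distr) auto
  also have "\<dots> = (\<Prod>j<k. complex_of_real (exp (- (c j)\<^sup>2 / 2)))"
    by (subst gauss.char_distr_sum[OF iv]) (simp add: ch)
  also have "\<dots> = complex_of_real (exp (\<Sum>j<k. - (c j)\<^sup>2 / 2))"
    by (simp only: of_real_prod[symmetric] exp_sum[OF finite_lessThan])
  also have "(\<Sum>j<k. - (c j)\<^sup>2 / 2) = - (\<Sum>j<k. (c j)\<^sup>2) / 2"
    by (simp add: sum_divide_distrib sum_negf)
  finally show ?thesis .
qed

lemma gauss_sum_norm_square: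
  fixes b :: "nat \<Rightarrow> 'h::{real_inner, banach, second_countable_topology}"
  assumes "finite A"
  shows "integrable gauss_space (\<lambda>\<omega>. (norm (\<Sum>j\<in>A. \<omega> j *\<^sub>R b j))\<^sup>2)"
    and "(\<integral>\<omega>. (norm (\<Sum>j\<in>A. \<omega> j *\<^sub>R b j))\<^sup>2 \<partial>gauss_space) = (\<Sum>j\<in>A. (norm (b j))\<^sup>2)"
proof -
  have exp: "(norm (\<Sum>j\<in>A. \<omega> j *\<^sub>R b j))\<^sup>2 = (\<Sum>i\<in>A. \<Sum>j\<in>A. (\<omega> i * \<omega> j) * (b i \<bullet> b j))" for \<omega>
    unfolding power2_norm_eq_inner inner_sum_left inner_sum_right
    by (intro sum.cong refl) (simp add: inner_commute mult_ac)
  show "integrable gauss_space (\<lambda>\<omega>. (norm (\<Sum>j\<in>A. \<omega> j *\<^sub>R b j))\<^sup>2)"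
    unfolding exp by (intro Bochner_Integration.integrable_sum integrable_mult_left gauss_coord_prod)
  have "(\<integral>\<omega>. (norm (\<Sum>j\<in>A. \<omega> j *\<^sub>R b j))\<^sup>2 \<partial>gauss_space)
      = (\<Sum>i\<in>A. \<Sum>j\<in>A. (if i = j then 1 else 0) * (b i \<bullet> b j))"
    unfolding exp by (simp add: gauss_coord_prod integrable_mult_left del: mult_eq_0_iff)
  also have "\<dots> = (\<Sum>j\<in>A. (norm (b j))\<^sup>2)"
    using assms by (intro sum.cong refl) (simp add: power2_norm_eq_inner if_distrib[where f = "\<lambda>x. x * _"] cong: if_cong)
  finally show "(\<integral>\<omega>. (norm (\<Sum>j\<in>A. \<omega> j *\<^sub>R b j))\<^sup>2 \<partial>gauss_space) = (\<Sum>j\<in>A. (norm (b j))\<^sup>2)" .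
qed

lemma (in prob_space) expectation_norm_le_sqrt:
  fixes f :: "'a \<Rightarrow> 'b::{banach, second_countable_topology}"
  assumes [measurable]: "f \<in> borel_measurable M" and i: "integrable M (\<lambda>x. (norm (f x))\<^sup>2)"
  shows "integrable M f" "expectation (\<lambda>x. norm (f x)) \<le> sqrt (expectation (\<lambda>x. (norm (f x))\<^sup>2))"
proof -
  have n: "integrable M (\<lambda>x. norm (f x))" by (rule square_integrable_imp_integrable[OF _ i]) simp
  then show "integrable M f" by (simp add: integrable_norm_iff)
  have "0 \<le> variance (\<lambda>x. norm (f x))" by (rule variance_positive)
  also have "\<dots> = expectation (\<lambda>x. (norm (f x))\<^sup>2) - (expectation (\<lambda>x. norm (f x)))\<^sup>2"
    by (rule variance_eq[OF n i])
  finally show "expectation (\<lambda>x. norm (f x)) \<le> sqrt (expectation (\<lambda>x. (norm (f x))\<^sup>2))"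
    by (simp add: real_le_rsqrt)
qed

lemma gauss_sum_norm_le:
  fixes b :: "nat \<Rightarrow> 'h::{real_inner, banach, second_countable_topology}"
  assumes "finite A"
  shows "integrable gauss_space (\<lambda>\<omega>. \<Sum>j\<in>A. \<omega> j *\<^sub>R b j)"
    and "(\<integral>\<omega>. norm (\<Sum>j\<in>A. \<omega> j *\<^sub>R b j) \<partial>gauss_space) \<le> sqrt (\<Sum>j\<in>A. (norm (b j))\<^sup>2)"
  using gauss.expectation_norm_le_sqrt[OF _ gauss_sum_norm_square(1)[OF assms], of b] gauss_sum_norm_square(2)[OF assms, of b]
  by auto

text \<open>Along a sufficiently sparse sequence of partial sums the \<open>L\<^sup>1\<close> norms of the increments are
  summable, so the series converges almost surely.\<close>

lemma gaussian_series:
  fixes b :: "nat \<Rightarrow> 'h::{real_inner, banach, second_countable_topology}"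
  assumes C: "\<And>k. (\<Sum>j<k. (norm (b j))\<^sup>2) \<le> C"
  obtains Z r where "Z \<in> borel_measurable gauss_space" "filterlim r at_top sequentially"
    "integrable gauss_space (\<lambda>\<omega>. (norm (Z \<omega>))\<^sup>2)"
    "\<And>m. integrable gauss_space (\<lambda>\<omega>. Z \<omega> - (\<Sum>j<r m. \<omega> j *\<^sub>R b j))"
    "(\<lambda>m. \<integral>\<omega>. norm (Z \<omega> - (\<Sum>j<r m. \<omega> j *\<^sub>R b j)) \<partial>gauss_space) \<longlonglongrightarrow> 0"
    "\<And>h v. (\<lambda>k. \<Sum>j<k. (b j \<bullet> h)\<^sup>2) \<longlonglongrightarrow> v \<Longrightarrow>
      (\<integral>\<omega>. iexp (Z \<omega> \<bullet> h) \<partial>gauss_space) = complex_of_real (exp (- v / 2))"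
    "\<And>h \<omega>. (\<And>j. b j \<bullet> h = 0) \<Longrightarrow> Z \<omega> \<bullet> h = 0"
proof -
  have "summable (\<lambda>j. (norm (b j))\<^sup>2)"
    by (rule bounded_imp_summable[of _ C]) (simp_all only: lessThan_Suc_atMost[symmetric] C zero_le_power2)
  then have cau: "\<exists>N. \<forall>m\<ge>N. \<forall>n. norm (\<Sum>j\<in>{m..<n}. (norm (b j))\<^sup>2) < e" if "e > 0" for e
    using that by (simp add: summable_Cauchy)
  \<comment> \<open>Tails below (1/4)^i of the squared norms become increments below (1/2)^i in L1
    after taking the root.\<close>
  have "\<exists>N. \<forall>m\<ge>N. \<forall>n. (\<Sum>j\<in>{m..<n}. (norm (b j))\<^sup>2) \<le> (1/4) ^ i" for i
  proof -
    obtain N where "\<forall>m\<ge>N. \<forall>n. norm (\<Sum>j\<in>{m..<n}. (norm (b j))\<^sup>2) < (1/4) ^ i"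
      using cau[of "(1/4) ^ i"] by auto
    then have "\<forall>m\<ge>N. \<forall>n. (\<Sum>j\<in>{m..<n}. (norm (b j))\<^sup>2) \<le> (1/4) ^ i"
      by (simp add: sum_nonneg less_imp_le)
    then show ?thesis ..
  qed
  then obtain N where N: "\<And>i m n. m \<ge> N i \<Longrightarrow> (\<Sum>j\<in>{m..<n}. (norm (b j))\<^sup>2) \<le> (1/4) ^ i"
    by metis
  \<comment> \<open>The sum dominates \<open>N m\<close> and keeps the sequence increasing; the
    summand \<open>m\<close> forces it to infinity.\<close>
  define r where "r m = m + (\<Sum>i\<le>m. N i)" for m
  have rN: "r m \<ge> N m" for m
    unfolding r_def using member_le_sum[of m "{..m}" N] by simp
  have r_Suc: "r m \<le> r (Suc m)" for m by (simp add: r_def)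
  have r_top: "filterlim r at_top sequentially"
    by (rule filterlim_at_top_mono[OF filterlim_ident]) (simp add: r_def)
  define \<Delta> where "\<Delta> m \<omega> = (\<Sum>j\<in>{r m..<r (Suc m)}. \<omega> j *\<^sub>R b j)" for m and \<omega> :: "nat \<Rightarrow> real"
  define P where "P m \<omega> = (\<Sum>j<r m. \<omega> j *\<^sub>R b j)" for m and \<omega> :: "nat \<Rightarrow> real"
  have [measurable]: "\<Delta> m \<in> borel_measurable gauss_space" "P m \<in> borel_measurable gauss_space" for m
    unfolding \<Delta>_def P_def by measurable
  have \<Delta>i: "integrable gauss_space (\<Delta> m)" for m unfolding \<Delta>_def by (rule gauss_sum_norm_le) simp
  have \<Delta>b: "(\<integral>\<omega>. norm (\<Delta> m \<omega>) \<partial>gauss_space) \<le> (1/2) ^ m" for m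
  proof -
    have "(\<integral>\<omega>. norm (\<Delta> m \<omega>) \<partial>gauss_space) \<le> sqrt (\<Sum>j\<in>{r m..<r (Suc m)}. (norm (b j))\<^sup>2)"
      unfolding \<Delta>_def by (rule gauss_sum_norm_le) simp
    also have "\<dots> \<le> sqrt ((1/4) ^ m)" using N[OF rN] by simp
    also have "\<dots> = (1/2) ^ m"
    proof -
      have "sqrt (1/4) = 1/2" by (rule real_sqrt_unique) (auto simp: power2_eq_square)
      then show ?thesis by (simp only: real_sqrt_power)
    qed
    finally show ?thesis .
  qed
  have P_tel: "P (m + k) \<omega> = P m \<omega> + (\<Sum>i<k. \<Delta> (i + m) \<omega>)" for m k \<omega>
  proof (induction k)
    case (Suc k)
    have "P (m + Suc k) \<omega> = P (m + k) \<omega> + \<Delta> (m + k) \<omega>"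
      unfolding P_def \<Delta>_def lessThan_atLeast0 add_Suc_right
      using r_Suc by (simp add: sum.atLeastLessThan_concat)
    then show ?case using Suc by (simp add: add.commute)
  qed simp
  have geo: "summable (\<lambda>i. (1/2 :: real) ^ i)" by (rule summable_geometric) simp
  have norm_sum: "summable (\<lambda>i. \<integral>\<omega>. norm (\<Delta> (i + m) \<omega>) \<partial>gauss_space)"
    and norm_tail: "(\<Sum>i. \<integral>\<omega>. norm (\<Delta> (i + m) \<omega>) \<partial>gauss_space) \<le> 2 * (1/2) ^ m" for m
  proof -
    have g: "summable (\<lambda>i. (1/2 :: real) ^ (i + m))" using geo by (rule summable_ignore_initial_segment)
    show s: "summable (\<lambda>i. \<integral>\<omega>. norm (\<Delta> (i + m) \<omega>) \<partial>gauss_space)"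
      using \<Delta>b by (intro summable_comparison_test'[OF g, where N = 0]) (simp add: integral_nonneg_AE)
    have "(\<Sum>i. \<integral>\<omega>. norm (\<Delta> (i + m) \<omega>) \<partial>gauss_space) \<le> (\<Sum>i. (1/2 :: real) ^ (i + m))"
      using \<Delta>b by (intro suminf_le s g)
    also have "\<dots> = (\<Sum>i. (1/2 :: real) ^ i * (1/2) ^ m)" by (simp add: power_add)
    also have "\<dots> = (\<Sum>i. (1/2 :: real) ^ i) * (1/2) ^ m" using geo by (rule suminf_mult2[symmetric])
    also have "\<dots> = 2 * (1/2) ^ m" by (subst suminf_geometric) auto
    finally show "(\<Sum>i. \<integral>\<omega>. norm (\<Delta> (i + m) \<omega>) \<partial>gauss_space) \<le> 2 * (1/2) ^ m" .
  qed
  have "(\<integral>\<^sup>+\<omega>. (\<Sum>i. ennreal (norm (\<Delta> i \<omega>))) \<partial>gauss_space) = (\<Sum>i. \<integral>\<^sup>+\<omega>. ennreal (norm (\<Delta> i \<omega>)) \<partial>gauss_space)"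
    by (rule nn_integral_suminf) simp
  also have "\<dots> = (\<Sum>i. ennreal (\<integral>\<omega>. norm (\<Delta> i \<omega>) \<partial>gauss_space))"
    by (intro suminf_cong nn_integral_eq_integral integrable_norm \<Delta>i) simp
  also have "\<dots> \<noteq> \<infinity>" using norm_sum[of 0] by (subst suminf_ennreal2) (auto intro!: integral_nonneg_AE)
  finally have "AE \<omega> in gauss_space. (\<Sum>i. ennreal (norm (\<Delta> i \<omega>))) \<noteq> \<infinity>"
    by (intro nn_integral_PInf_AE) auto
  then have AEs: "AE \<omega> in gauss_space. summable (\<lambda>i. norm (\<Delta> i \<omega>))"
    by eventually_elim (auto intro!: summable_suminf_not_top)
  \<comment> \<open>The value 0 on the null set without convergence makes the orthogonality clause
    hold for every point, not merely almost surely.\<close>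
  define Z where "Z \<omega> = (if summable (\<lambda>i. norm (\<Delta> i \<omega>)) then P 0 \<omega> + (\<Sum>i. \<Delta> i \<omega>) else 0)" for \<omega>
  have [measurable]: "Z \<in> borel_measurable gauss_space"
  proof -
    have [measurable]: "Measurable.pred gauss_space (\<lambda>\<omega>. summable (\<lambda>i. norm (\<Delta> i \<omega>)))"
      unfolding pred_def summable_iff_convergent Cauchy_convergent_iff[symmetric]
      by (rule sets_Collect_Cauchy) measurable
    show ?thesis unfolding Z_def[abs_def] by measurable
  qed
  have Zm: "AE \<omega> in gauss_space. summable (\<lambda>i. norm (\<Delta> (i + m) \<omega>)) \<and> Z \<omega> - P m \<omega> = (\<Sum>i. \<Delta> (i + m) \<omega>)" for m
    using AEs
  proof eventually_elim
    case (elim \<omega>)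
    have s: "summable (\<lambda>i. \<Delta> i \<omega>)" using elim by (rule summable_norm_cancel)
    have "Z \<omega> = P 0 \<omega> + ((\<Sum>i. \<Delta> (i + m) \<omega>) + (\<Sum>i<m. \<Delta> i \<omega>))"
      using elim suminf_split_initial_segment[OF s, of m] by (simp add: Z_def)
    then show ?case using P_tel[of 0 m \<omega>] summable_ignore_initial_segment[OF elim, of m] by simp
  qed
  have dint: "integrable gauss_space (\<lambda>\<omega>. \<Sum>i. \<Delta> (i + m) \<omega>)" for m
    using Zm[of m] by (intro integrable_suminf \<Delta>i norm_sum) auto
  have ZP: "integrable gauss_space (\<lambda>\<omega>. Z \<omega> - P m \<omega>)" for m
    by (rule integrable_cong_AE_imp[OF dint[of m]]) (use Zm[of m] in auto)
  have ZPb: "(\<integral>\<omega>. norm (Z \<omega> - P m \<omega>) \<partial>gauss_space) \<le> 2 * (1/2) ^ m" for m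
  proof -
    have "(\<integral>\<omega>. norm (Z \<omega> - P m \<omega>) \<partial>gauss_space) \<le> (\<integral>\<omega>. (\<Sum>i. norm (\<Delta> (i + m) \<omega>)) \<partial>gauss_space)"
    proof (rule integral_mono_AE)
      show "integrable gauss_space (\<lambda>\<omega>. \<Sum>i. norm (\<Delta> (i + m) \<omega>))"
        using Zm[of m] norm_sum[of m] by (intro integrable_suminf integrable_norm \<Delta>i) auto
      show "AE \<omega> in gauss_space. norm (Z \<omega> - P m \<omega>) \<le> (\<Sum>i. norm (\<Delta> (i + m) \<omega>))"
        using Zm[of m] by eventually_elim (auto intro: summable_norm)
    qed (intro integrable_norm ZP)
    also have "\<dots> = (\<Sum>i. \<integral>\<omega>. norm (\<Delta> (i + m) \<omega>) \<partial>gauss_space)"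
      using Zm[of m] norm_sum[of m] by (intro integral_suminf integrable_norm \<Delta>i) auto
    finally show ?thesis using norm_tail[of m] by simp
  qed
  have ZP0: "(\<lambda>m. \<integral>\<omega>. norm (Z \<omega> - P m \<omega>) \<partial>gauss_space) \<longlonglongrightarrow> 0"
  proof (rule Lim_null_comparison[where g = "\<lambda>m. 2 * (1/2 :: real) ^ m"])
    show "\<forall>\<^sub>F n in sequentially. norm (\<integral>\<omega>. norm (Z \<omega> - P n \<omega>) \<partial>gauss_space) \<le> 2 * (1/2) ^ n"
      using ZPb by (auto simp: integral_nonneg_AE)
    show "(\<lambda>m. 2 * (1/2 :: real) ^ m) \<longlonglongrightarrow> 0"
      using tendsto_mult_left[OF LIMSEQ_power_zero[of "1/2 :: real"], of 2] by simp
  qed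
  have Plim: "AE \<omega> in gauss_space. (\<lambda>m. P m \<omega>) \<longlonglongrightarrow> Z \<omega>"
    using AEs
  proof eventually_elim
    case (elim \<omega>)
    have "(\<lambda>m. P 0 \<omega> + (\<Sum>i<m. \<Delta> i \<omega>)) \<longlonglongrightarrow> P 0 \<omega> + (\<Sum>i. \<Delta> i \<omega>)"
      by (rule tendsto_add[OF tendsto_const summable_LIMSEQ[OF summable_norm_cancel[OF elim]]])
    moreover have "P 0 \<omega> + (\<Sum>i<m. \<Delta> i \<omega>) = P m \<omega>" for m using P_tel[of 0 m \<omega>] by simp
    ultimately show ?case using elim by (simp add: Z_def)
  qed
  have Z2: "integrable gauss_space (\<lambda>\<omega>. (norm (Z \<omega>))\<^sup>2)"
  proof (rule integrableI_bounded)
    \<comment> \<open>Fatou's lemma: the second moments of the partial sums are bounded by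
      \<open>C\<close>.\<close>
    have "(\<integral>\<^sup>+\<omega>. ennreal ((norm (Z \<omega>))\<^sup>2) \<partial>gauss_space)
        = (\<integral>\<^sup>+\<omega>. liminf (\<lambda>m. ennreal ((norm (P m \<omega>))\<^sup>2)) \<partial>gauss_space)"
    proof (rule nn_integral_cong_AE)
      show "AE \<omega> in gauss_space. ennreal ((norm (Z \<omega>))\<^sup>2) = liminf (\<lambda>m. ennreal ((norm (P m \<omega>))\<^sup>2))"
        using Plim
      proof eventually_elim
        case (elim \<omega>)
        have "(\<lambda>m. ennreal ((norm (P m \<omega>))\<^sup>2)) \<longlonglongrightarrow> ennreal ((norm (Z \<omega>))\<^sup>2)"
          by (intro tendsto_ennrealI tendsto_intros elim)
        then show ?case by (intro lim_imp_Liminf[symmetric]) auto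
      qed
    qed
    also have "\<dots> \<le> liminf (\<lambda>m. \<integral>\<^sup>+\<omega>. ennreal ((norm (P m \<omega>))\<^sup>2) \<partial>gauss_space)"
      by (rule nn_integral_liminf) simp
    also have "\<dots> \<le> ennreal C"
    proof (rule Liminf_le)
      have "(\<integral>\<^sup>+\<omega>. ennreal ((norm (P m \<omega>))\<^sup>2) \<partial>gauss_space) \<le> ennreal C" for m
      proof -
        have "(\<integral>\<^sup>+\<omega>. ennreal ((norm (P m \<omega>))\<^sup>2) \<partial>gauss_space) = ennreal (\<Sum>j<r m. (norm (b j))\<^sup>2)"
          unfolding P_def gauss_sum_norm_square(2)[OF finite_lessThan, symmetric]
          by (intro nn_integral_eq_integral gauss_sum_norm_square) auto
        then show ?thesis using C by (simp add: ennreal_leI)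
      qed
      then show "\<forall>\<^sub>F m in sequentially. (\<integral>\<^sup>+\<omega>. ennreal ((norm (P m \<omega>))\<^sup>2) \<partial>gauss_space) \<le> ennreal C" by simp
    qed simp
    finally show "(\<integral>\<^sup>+\<omega>. ennreal (norm ((norm (Z \<omega>))\<^sup>2)) \<partial>gauss_space) < \<infinity>"
      by (simp add: le_less_trans)
  qed simp
  have ch: "(\<integral>\<omega>. iexp (Z \<omega> \<bullet> h) \<partial>gauss_space) = complex_of_real (exp (- v / 2))"
    if v: "(\<lambda>k. \<Sum>j<k. (b j \<bullet> h)\<^sup>2) \<longlonglongrightarrow> v" for h v
  proof (rule LIMSEQ_unique)
    show "(\<lambda>m. \<integral>\<omega>. iexp (P m \<omega> \<bullet> h) \<partial>gauss_space) \<longlonglongrightarrow> (\<integral>\<omega>. iexp (Z \<omega> \<bullet> h) \<partial>gauss_space)"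
    proof (rule integral_dominated_convergence[where w = "\<lambda>_. 1"])
      show "AE \<omega> in gauss_space. (\<lambda>m. iexp (P m \<omega> \<bullet> h)) \<longlonglongrightarrow> iexp (Z \<omega> \<bullet> h)"
        using Plim by eventually_elim (intro tendsto_intros)
    qed auto
    have "(\<integral>\<omega>. iexp (P m \<omega> \<bullet> h) \<partial>gauss_space) = complex_of_real (exp (- (\<Sum>j<r m. (b j \<bullet> h)\<^sup>2) / 2))" for m
      using gauss_sum_iexp[of "\<lambda>j. b j \<bullet> h" "r m"] by (simp add: P_def inner_sum_left)
    moreover have "(\<lambda>m. complex_of_real (exp (- (\<Sum>j<r m. (b j \<bullet> h)\<^sup>2) / 2))) \<longlonglongrightarrow> complex_of_real (exp (- v / 2))"
      by (intro tendsto_intros filterlim_compose[OF v r_top]) auto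
    ultimately show "(\<lambda>m. \<integral>\<omega>. iexp (P m \<omega> \<bullet> h) \<partial>gauss_space) \<longlonglongrightarrow> complex_of_real (exp (- v / 2))" by simp
  qed
  have sub: "Z \<omega> \<bullet> h = 0" if h: "\<And>j. b j \<bullet> h = 0" for h \<omega>
  proof (cases "summable (\<lambda>i. norm (\<Delta> i \<omega>))")
    case True
    have s: "summable (\<lambda>i. \<Delta> i \<omega>)" using True by (rule summable_norm_cancel)
    have "(\<Sum>i. \<Delta> i \<omega>) \<bullet> h = (\<Sum>i. \<Delta> i \<omega> \<bullet> h)"
      by (rule bounded_linear.suminf[OF bounded_linear_inner_left s])
    then show ?thesis using True h by (simp add: Z_def inner_add_left P_def \<Delta>_def inner_sum_left)
  qed (simp add: Z_def)
  show thesis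
    by (rule that[of Z r]) (use ZP ZP0 Z2 ch sub r_top in \<open>auto simp: P_def\<close>)
qed

section \<open>The central limit theorem in Hilbert space\<close>

lemma (in centered_law) gs_cross: "(\<integral>y. (gs_res k y \<bullet> h) * (y \<bullet> h) \<partial>D) = (\<integral>y. (gs_res k y \<bullet> h)\<^sup>2 \<partial>D)"
proof -
  have "(\<integral>y. (gs_res k y \<bullet> h) * (y \<bullet> h) \<partial>D)
      = (\<integral>y. (\<Sum>j<k. (gs_fun j y * (gs_res k y \<bullet> h)) * (gs_vec j \<bullet> h)) + (gs_res k y \<bullet> h)\<^sup>2 \<partial>D)"
    by (intro Bochner_Integration.integral_cong refl, subst (2) gs_decomp[of _ k])
       (simp add: inner_add_left inner_sum_left sum_distrib_left power2_eq_square algebra_simps)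
  also have "\<dots> = (\<Sum>j<k. \<integral>y. (gs_fun j y * (gs_res k y \<bullet> h)) * (gs_vec j \<bullet> h) \<partial>D) + (\<integral>y. (gs_res k y \<bullet> h)\<^sup>2 \<partial>D)"
    by (subst Bochner_Integration.integral_add, (intro gs_intros)+)
       (subst Bochner_Integration.integral_sum, (intro gs_intros)+, simp)
  finally show ?thesis by (simp add: gs_orthogonal)
qed

text \<open>The partial sum is \<open>y \<bullet> h\<close> minus its residual, and by
  \<open>gs_cross\<close> their mixed moment is the second moment of the residual.\<close>

lemma (in centered_law) gs_partial_var:
  "(\<integral>y. (\<Sum>j<k. gs_fun j y * (gs_vec j \<bullet> h))\<^sup>2 \<partial>D) = (\<Sum>j<k. (gs_vec j \<bullet> h)\<^sup>2)"
proof -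
  have eq: "(\<Sum>j<k. gs_fun j y * (gs_vec j \<bullet> h)) = y \<bullet> h - gs_res k y \<bullet> h" for y
    by (subst (2) gs_decomp[of y k]) (simp add: inner_add_left inner_sum_left)
  have "(\<integral>y. (\<Sum>j<k. gs_fun j y * (gs_vec j \<bullet> h))\<^sup>2 \<partial>D)
      = (\<integral>y. (y \<bullet> h)\<^sup>2 + ((gs_res k y \<bullet> h)\<^sup>2 - 2 * ((gs_res k y \<bullet> h) * (y \<bullet> h))) \<partial>D)"
    by (intro Bochner_Integration.integral_cong refl) (simp add: eq power2_eq_square algebra_simps)
  also have "\<dots> = (\<integral>y. (y \<bullet> h)\<^sup>2 \<partial>D) + ((\<integral>y. (gs_res k y \<bullet> h)\<^sup>2 \<partial>D) - (\<integral>y. 2 * ((gs_res k y \<bullet> h) * (y \<bullet> h)) \<partial>D))"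
    by (subst Bochner_Integration.integral_add Bochner_Integration.integral_diff, (intro gs_intros)+)+ simp
  also have "\<dots> = (\<integral>y. (y \<bullet> h)\<^sup>2 \<partial>D) - (\<integral>y. (gs_res k y \<bullet> h)\<^sup>2 \<partial>D)"
    by (simp add: gs_cross)
  finally show ?thesis by (simp add: gs_var)
qed

text \<open>Parseval's identity, since the residual tends to 0 in L2. It shows that the Gaussian
  series has the variances of \<open>D\<close>.\<close>

lemma (in centered_law) gs_partial_var_tendsto:
  "(\<lambda>k. \<Sum>j<k. (gs_vec j \<bullet> h)\<^sup>2) \<longlonglongrightarrow> (\<integral>y. (y \<bullet> h)\<^sup>2 \<partial>D)"
proof -
  have "(\<lambda>k. \<integral>y. (gs_res k y \<bullet> h)\<^sup>2 \<partial>D) \<longlonglongrightarrow> 0"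
  proof (rule Lim_null_comparison)
    show "(\<lambda>k. (\<integral>y. (norm (gs_res k y))\<^sup>2 \<partial>D) * (norm h)\<^sup>2) \<longlonglongrightarrow> 0"
      using tendsto_mult_right[OF gs_res_tendsto_0] by simp
    have "norm (\<integral>y. (gs_res k y \<bullet> h)\<^sup>2 \<partial>D) \<le> (\<integral>y. (norm (gs_res k y))\<^sup>2 \<partial>D) * (norm h)\<^sup>2" for k
    proof -
      have "(\<integral>y. (gs_res k y \<bullet> h)\<^sup>2 \<partial>D) \<le> (\<integral>y. (norm (gs_res k y))\<^sup>2 * (norm h)\<^sup>2 \<partial>D)"
      proof (rule integral_mono)
        show "(gs_res k y \<bullet> h)\<^sup>2 \<le> (norm (gs_res k y))\<^sup>2 * (norm h)\<^sup>2" for y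
          using Cauchy_Schwarz_ineq[of "gs_res k y" h] by (simp add: power2_norm_eq_inner)
        show "integrable D (\<lambda>y. (norm (gs_res k y))\<^sup>2 * (norm h)\<^sup>2)"
          by (intro integrable_mult_left integrable_norm_sq_res)
      qed (intro gs_intros)
      then show ?thesis by (simp add: integral_nonneg_AE)
    qed
    then show "\<forall>\<^sub>F k in sequentially. norm (\<integral>y. (gs_res k y \<bullet> h)\<^sup>2 \<partial>D) \<le> (\<integral>y. (norm (gs_res k y))\<^sup>2 \<partial>D) * (norm h)\<^sup>2"
      by simp
  qed
  from tendsto_diff[OF tendsto_const[of "\<integral>y. (y \<bullet> h)\<^sup>2 \<partial>D"] this]
  show ?thesis by (simp add: gs_var)
qed

text \<open>The cosine with phase \<open>c\<close> is the real part of the exponential multiplied by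
  the constant \<open>iexp c\<close>.\<close>

lemma iexp_tendsto_imp_cos_tendsto:
  fixes Y :: "nat \<Rightarrow> 'w \<Rightarrow> real"
  assumes M: "prob_space M" and N: "prob_space N"
    and Y[measurable]: "\<And>n. Y n \<in> borel_measurable M" and Z[measurable]: "Z \<in> borel_measurable N"
    and conv: "(\<lambda>n. \<integral>\<omega>. iexp (Y n \<omega>) \<partial>M) \<longlonglongrightarrow> (\<integral>\<omega>. iexp (Z \<omega>) \<partial>N)"
  shows "(\<lambda>n. \<integral>\<omega>. cos (Y n \<omega> + c) \<partial>M) \<longlonglongrightarrow> (\<integral>\<omega>. cos (Z \<omega> + c) \<partial>N)"
proof -
  have eq: "(\<integral>\<omega>. cos (V \<omega> + c) \<partial>Q) = Re (iexp c * (\<integral>\<omega>. iexp (V \<omega>) \<partial>Q))"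
    if Q: "prob_space Q" and [measurable]: "V \<in> borel_measurable Q" for Q :: "'q measure" and V :: "'q \<Rightarrow> real"
  proof -
    interpret Q: prob_space Q by fact
    have i: "integrable Q (\<lambda>\<omega>. iexp (V \<omega>))" by (rule Q.integrable_const_bound[of _ 1]) auto
    have "iexp c * (\<integral>\<omega>. iexp (V \<omega>) \<partial>Q) = (\<integral>\<omega>. iexp c * iexp (V \<omega>) \<partial>Q)" by simp
    also have "\<dots> = (\<integral>\<omega>. iexp (V \<omega> + c) \<partial>Q)"
      by (intro Bochner_Integration.integral_cong) (auto simp: exp_add[symmetric] algebra_simps)
    finally have "Re (iexp c * (\<integral>\<omega>. iexp (V \<omega>) \<partial>Q)) = Re (\<integral>\<omega>. iexp (V \<omega> + c) \<partial>Q)" by simp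
    also have "\<dots> = (\<integral>\<omega>. Re (iexp (V \<omega> + c)) \<partial>Q)"
      by (rule integral_Re[symmetric], rule Q.integrable_const_bound[of _ 1]) auto
    also have "(\<lambda>\<omega>. Re (iexp (V \<omega> + c))) = (\<lambda>\<omega>. cos (V \<omega> + c))" by (simp add: Re_exp)
    finally show ?thesis by simp
  qed
  show ?thesis
    unfolding eq[OF M Y] eq[OF N Z] by (intro tendsto_intros conv)
qed

text \<open>By induction it is the sum of a compact set and a compact segment; no linear
  independence of the \<open>b j\<close> is involved.\<close>

lemma compact_parallelepiped:
  fixes b :: "nat \<Rightarrow> 'h::real_normed_vector"
  shows "compact {\<Sum>j<k. a j *\<^sub>R b j | a. \<forall>j<k. \<bar>a j\<bar> \<le> l}"
proof (induction k)
  case (Suc k)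
  let ?S = "\<lambda>k. {\<Sum>j<k. a j *\<^sub>R b j | a. \<forall>j<k. \<bar>a j\<bar> \<le> l}"
  have "compact ((\<lambda>s. s *\<^sub>R b k) ` {-l..l})"
    by (intro compact_continuous_image continuous_intros compact_Icc)
  then have "compact {x + y | x y. x \<in> ?S k \<and> y \<in> (\<lambda>s. s *\<^sub>R b k) ` {-l..l}}"
    by (intro compact_sums Suc.IH)
  also have "{x + y | x y. x \<in> ?S k \<and> y \<in> (\<lambda>s. s *\<^sub>R b k) ` {-l..l}} = ?S (Suc k)"
  proof (intro equalityI subsetI)
    fix z assume "z \<in> {x + y | x y. x \<in> ?S k \<and> y \<in> (\<lambda>s. s *\<^sub>R b k) ` {-l..l}}"
    then obtain x s where x: "x \<in> ?S k" "s \<in> {-l..l}" "z = x + s *\<^sub>R b k" by blast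
    then obtain a where "\<forall>j<k. \<bar>a j\<bar> \<le> l" "x = (\<Sum>j<k. a j *\<^sub>R b j)" by blast
    with x have a: "\<forall>j<k. \<bar>a j\<bar> \<le> l" "\<bar>s\<bar> \<le> l" "z = (\<Sum>j<k. a j *\<^sub>R b j) + s *\<^sub>R b k"
      by (auto simp: abs_le_iff)
    then show "z \<in> ?S (Suc k)"
      by (intro CollectI exI[of _ "a(k := s)"]) (auto simp: less_Suc_eq)
  next
    fix z assume "z \<in> ?S (Suc k)"
    then obtain a where a: "\<forall>j<Suc k. \<bar>a j\<bar> \<le> l" "z = (\<Sum>j<Suc k. a j *\<^sub>R b j)" by blast
    then have "\<bar>a k\<bar> \<le> l" by simp
    then have "a k *\<^sub>R b k \<in> (\<lambda>s. s *\<^sub>R b k) ` {-l..l}" by (auto simp: abs_le_iff intro!: imageI)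
    moreover have "(\<Sum>j<k. a j *\<^sub>R b j) \<in> ?S k" using a(1) by auto
    ultimately show "z \<in> {x + y | x y. x \<in> ?S k \<and> y \<in> (\<lambda>s. s *\<^sub>R b k) ` {-l..l}}"
      using a(2) by auto
  qed
  finally show ?case .
qed simp

text \<open>A sum outside the set has some coefficient exceeding \<open>l\<close>; a union bound and
  Chebyshev's inequality apply to the coefficients, with no assumption on their dependence.\<close>

lemma (in prob_space) prob_notin_parallelepiped:
  fixes b :: "nat \<Rightarrow> 'h::real_normed_vector"
  assumes [measurable]: "\<And>j. a j \<in> borel_measurable M" and sq: "\<And>j. integrable M (\<lambda>\<omega>. (a j \<omega>)\<^sup>2)"
    and le: "\<And>j. expectation (\<lambda>\<omega>. (a j \<omega>)\<^sup>2) \<le> 1" and l: "l > 0"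
  shows "prob {\<omega>\<in>space M. (\<Sum>j<k. a j \<omega> *\<^sub>R b j) \<notin> {\<Sum>j<k. a j *\<^sub>R b j | a. \<forall>j<k. \<bar>a j\<bar> \<le> l}} \<le> real k / l\<^sup>2"
proof -
  have "prob {\<omega>\<in>space M. (\<Sum>j<k. a j \<omega> *\<^sub>R b j) \<notin> {\<Sum>j<k. a j *\<^sub>R b j | a. \<forall>j<k. \<bar>a j\<bar> \<le> l}}
      \<le> prob (\<Union>j<k. {\<omega>\<in>space M. l \<le> \<bar>a j \<omega>\<bar>})"
  proof (rule finite_measure_mono)
    show "{\<omega>\<in>space M. (\<Sum>j<k. a j \<omega> *\<^sub>R b j) \<notin> {\<Sum>j<k. a j *\<^sub>R b j | a. \<forall>j<k. \<bar>a j\<bar> \<le> l}}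
      \<subseteq> (\<Union>j<k. {\<omega>\<in>space M. l \<le> \<bar>a j \<omega>\<bar>})"
    proof
      fix \<omega> assume \<omega>: "\<omega> \<in> {\<omega>\<in>space M. (\<Sum>j<k. a j \<omega> *\<^sub>R b j) \<notin> {\<Sum>j<k. a j *\<^sub>R b j | a. \<forall>j<k. \<bar>a j\<bar> \<le> l}}"
      have "(\<Sum>j<k. a j \<omega> *\<^sub>R b j) \<in> {\<Sum>j<k. a j *\<^sub>R b j | a. \<forall>j<k. \<bar>a j\<bar> \<le> l}" if "\<forall>j<k. \<bar>a j \<omega>\<bar> \<le> l"
        using that by (intro CollectI exI[of _ "\<lambda>j. a j \<omega>"]) simp
      then have "\<not> (\<forall>j<k. \<bar>a j \<omega>\<bar> \<le> l)" using \<omega> by blast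
      then show "\<omega> \<in> (\<Union>j<k. {\<omega>\<in>space M. l \<le> \<bar>a j \<omega>\<bar>})" using \<omega> by force
    qed
  qed measurable
  also have "\<dots> \<le> (\<Sum>j<k. prob {\<omega>\<in>space M. l \<le> \<bar>a j \<omega>\<bar>})"
    by (rule finite_measure_subadditive_finite) auto
  also have "\<dots> \<le> (\<Sum>j<k. 1 / l\<^sup>2)"
  proof (rule sum_mono)
    fix j
    have "prob {\<omega>\<in>space M. l \<le> \<bar>a j \<omega>\<bar>} \<le> expectation (\<lambda>\<omega>. (a j \<omega>)\<^sup>2) / l\<^sup>2"
      using sq l by (intro second_moment_method) auto
    also have "\<dots> \<le> 1 / l\<^sup>2" using le l by (intro divide_right_mono) auto
    finally show "prob {\<omega>\<in>space M. l \<le> \<bar>a j \<omega>\<bar>} \<le> 1 / l\<^sup>2" .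
  qed
  finally show ?thesis by simp
qed

lemma (in prob_space) abs_expectation_diff_le_lipschitz:
  fixes U V :: "'a \<Rightarrow> 'h::{real_normed_vector, second_countable_topology}" and f :: "'h \<Rightarrow> real"
  assumes [measurable]: "U \<in> borel_measurable M" "V \<in> borel_measurable M"
    and f: "\<And>y z. \<bar>f y - f z\<bar> \<le> L * dist y z" and fb: "\<And>y. \<bar>f y\<bar> \<le> B"
    and fm[measurable]: "f \<in> borel_measurable borel"
    and i: "integrable M (\<lambda>\<omega>. norm (U \<omega> - V \<omega>))"
  shows "\<bar>expectation (\<lambda>\<omega>. f (U \<omega>)) - expectation (\<lambda>\<omega>. f (V \<omega>))\<bar> \<le> L * expectation (\<lambda>\<omega>. norm (U \<omega> - V \<omega>))"
proof -
  have fi: "integrable M (\<lambda>\<omega>. f (U \<omega>))" "integrable M (\<lambda>\<omega>. f (V \<omega>))"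
    using fb by (auto intro!: integrable_const_bound[of _ B])
  then have "\<bar>expectation (\<lambda>\<omega>. f (U \<omega>)) - expectation (\<lambda>\<omega>. f (V \<omega>))\<bar> = \<bar>expectation (\<lambda>\<omega>. f (U \<omega>) - f (V \<omega>))\<bar>"
    by simp
  also have "\<dots> \<le> expectation (\<lambda>\<omega>. \<bar>f (U \<omega>) - f (V \<omega>)\<bar>)" by (rule integral_abs_bound)
  also have "\<dots> \<le> expectation (\<lambda>\<omega>. L * norm (U \<omega> - V \<omega>))"
    using fi i f by (intro integral_mono) (auto simp: dist_norm)
  finally show ?thesis by simp
qed

lemma lipschitz_borel_measurable:
  fixes f :: "'h::metric_space \<Rightarrow> real"
  assumes "\<And>y z. \<bar>f y - f z\<bar> \<le> L * dist y z"
  shows "continuous_on UNIV f" "f \<in> borel_measurable borel"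
proof -
  have "\<bar>f y - f z\<bar> \<le> max L 0 * dist y z" for y z
    using assms[of y z] mult_right_mono[of L "max L 0" "dist y z"] by simp
  then have "(max L 0)-lipschitz_on UNIV f" by (intro lipschitz_onI) (auto simp: dist_real_def)
  then show "continuous_on UNIV f" by (rule lipschitz_on_continuous_on)
  then show "f \<in> borel_measurable borel" by (rule borel_measurable_continuous_onI)
qed

text \<open>The normalized sum and the Gaussian series are cut after the same number k of
  Gram--Schmidt terms. The rest of the sum is small in L1 uniformly in n, because its second moment
  is that of a single residual. The truncated parts live, up to small probability, in one compact
  parallelepiped, and their characteristic functions converge by the scalar theorem.\<close>

theorem (in prob_space) hilbert_CLT:
  fixes W :: "nat \<Rightarrow> 'a \<Rightarrow> 'h::{real_inner, banach, second_countable_topology}"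
  assumes ind: "indep_vars (\<lambda>_. borel) W UNIV" and D: "\<And>i. distr M borel (W i) = D"
    and b: "AE \<omega> in M. norm (W 0 \<omega>) \<le> K" and mean: "expectation (W 0) = 0"
  obtains Z where "Z \<in> borel_measurable gauss_space"
    "integrable gauss_space (\<lambda>\<omega>. (norm (Z \<omega>))\<^sup>2)"
    "\<And>h. (\<integral>\<omega>. iexp (Z \<omega> \<bullet> h) \<partial>gauss_space) = complex_of_real (exp (- expectation (\<lambda>\<omega>. (W 0 \<omega> \<bullet> h)\<^sup>2) / 2))"
    "\<And>h \<omega>. AE \<omega> in M. W 0 \<omega> \<bullet> h = 0 \<Longrightarrow> Z \<omega> \<bullet> h = 0"
    "converges_in_distribution M (\<lambda>n \<omega>. (1 / sqrt (real n)) *\<^sub>R (\<Sum>i<n. W i \<omega>)) gauss_space Z"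
proof -
  have Wm[measurable]: "W i \<in> borel_measurable M" for i using ind by (simp add: indep_vars_def)
  have sD[measurable_cong]: "sets D = sets borel" unfolding D[of 0, symmetric] by simp
  obtain Q :: "'h set" where Q: "countable Q" "\<And>X. open X \<Longrightarrow> X \<noteq> {} \<Longrightarrow> \<exists>q\<in>Q. q \<in> X"
    by (erule countable_dense_setE)
  define d where "d = from_nat_into Q"
  have "Q \<noteq> {}" using Q(2)[of UNIV] by auto
  have dense: "\<exists>k. dist (d k) y < e" if e: "e > 0" for y e
  proof -
    obtain q where "q \<in> Q" "q \<in> ball y e" using Q(2)[of "ball y e"] e by auto
    moreover then obtain k where "q = d k" unfolding d_def using Q(1) by (metis from_nat_into_surj)
    ultimately show ?thesis by (auto simp: dist_commute)
  qed
  have transfer: "(\<integral>y. g y \<partial>D) = expectation (\<lambda>\<omega>. g (W i \<omega>))" if "g \<in> borel_measurable borel"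
    for g :: "'h \<Rightarrow> 'c::{banach, second_countable_topology}" and i
    unfolding D[of i, symmetric] using that by (subst integral_distr) auto
  have AE_transfer: "AE \<omega> in M. P (W i \<omega>)" if "AE y in D. P y" for P i
    using that unfolding D[of i, symmetric] by (rule AE_distrD[OF Wm])
  interpret D: prob_space D unfolding D[of 0, symmetric] by (rule prob_space_distr) simp
  interpret L: centered_law D K d
  proof unfold_locales
    show "AE y in D. norm y \<le> K" unfolding D[of 0, symmetric] using b by (subst AE_distr_iff) auto
    show "(\<integral>y. y \<partial>D) = 0" using transfer[of "\<lambda>y. y" 0] mean by simp
  qed (use sD dense in auto)
  note [measurable] = ess_bounded_measurable[OF L.ess_bounded_res] ess_bounded_measurable[OF L.ess_bounded_fun]
  have resm[measurable]: "L.gs_res k \<in> borel_measurable borel" "L.gs_fun k \<in> borel_measurable borel" for k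
    using ess_bounded_measurable[OF L.ess_bounded_res, of k] ess_bounded_measurable[OF L.ess_bounded_fun, of k]
    by (simp_all add: measurable_cong_sets[OF sD refl])
  obtain Z r where Z: "Z \<in> borel_measurable gauss_space" "filterlim r at_top sequentially"
    "integrable gauss_space (\<lambda>\<omega>. (norm (Z \<omega>))\<^sup>2)"
    "\<And>m. integrable gauss_space (\<lambda>\<omega>. Z \<omega> - (\<Sum>j<r m. \<omega> j *\<^sub>R L.gs_vec j))"
    "(\<lambda>m. \<integral>\<omega>. norm (Z \<omega> - (\<Sum>j<r m. \<omega> j *\<^sub>R L.gs_vec j)) \<partial>gauss_space) \<longlonglongrightarrow> 0"
    "\<And>h v. (\<lambda>k. \<Sum>j<k. (L.gs_vec j \<bullet> h)\<^sup>2) \<longlonglongrightarrow> v \<Longrightarrow>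
      (\<integral>\<omega>. iexp (Z \<omega> \<bullet> h) \<partial>gauss_space) = complex_of_real (exp (- v / 2))"
    "\<And>h \<omega>. (\<And>j. L.gs_vec j \<bullet> h = 0) \<Longrightarrow> Z \<omega> \<bullet> h = 0"
    by (rule gaussian_series[of L.gs_vec "K\<^sup>2"]) (use L.gs_norm_bounds(2) in blast)+
  note [measurable] = Z(1)
  have comp_indep: "indep_vars (\<lambda>_. borel) (\<lambda>i \<omega>. g (W i \<omega>)) UNIV" if "g \<in> borel_measurable borel"
    for g :: "'h \<Rightarrow> 'c::topological_space"
    by (rule indep_vars_compose2[OF ind]) (use that in simp)
  have comp_distr: "distr M borel (\<lambda>\<omega>. g (W i \<omega>)) = distr D borel g" if "g \<in> borel_measurable borel"
    for g :: "'h \<Rightarrow> 'c::topological_space" and i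
    unfolding D[of i, symmetric] using that by (subst distr_distr) (auto simp: comp_def)
  define T where "T n \<omega> = (1 / sqrt (real n)) *\<^sub>R (\<Sum>i<n. W i \<omega>)" for n \<omega>
  \<comment> \<open>The coefficients have second moment at most 1 for all \<open>n\<close>, which
    makes the parallelepiped independent of \<open>n\<close>.\<close>
  define a where "a n j \<omega> = (1 / sqrt (real n)) * (\<Sum>i<n. L.gs_fun j (W i \<omega>))" for n j \<omega>
  define Tk where "Tk k n \<omega> = (\<Sum>j<k. a n j \<omega> *\<^sub>R L.gs_vec j)" for k n \<omega>
  define Zk where "Zk k \<omega> = (\<Sum>j<k. \<omega> j *\<^sub>R L.gs_vec j)" for k and \<omega> :: "nat \<Rightarrow> real"
  have [measurable]: "T n \<in> borel_measurable M" "a n j \<in> borel_measurable M" "Tk k n \<in> borel_measurable M"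
    "Zk k \<in> borel_measurable gauss_space" for n j k
    unfolding T_def a_def Tk_def Zk_def by measurable
  have TTk: "integrable M (\<lambda>\<omega>. norm (T n \<omega> - Tk k n \<omega>))"
    "expectation (\<lambda>\<omega>. norm (T n \<omega> - Tk k n \<omega>)) \<le> sqrt (\<integral>y. (norm (L.gs_res k y))\<^sup>2 \<partial>D)" for n k
  proof -
    have eq: "T n \<omega> - Tk k n \<omega> = (1 / sqrt (real n)) *\<^sub>R (\<Sum>i<n. L.gs_res k (W i \<omega>))" for \<omega>
    proof -
      have "Tk k n \<omega> = (1 / sqrt (real n)) *\<^sub>R (\<Sum>i<n. \<Sum>j<k. L.gs_fun j (W i \<omega>) *\<^sub>R L.gs_vec j)"
        unfolding Tk_def a_def
        by (subst sum.swap) (simp add: scaleR_sum_right scaleR_sum_left sum_distrib_left)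
      then have "T n \<omega> - Tk k n \<omega> = (1 / sqrt (real n)) *\<^sub>R (\<Sum>i<n. W i \<omega> - (\<Sum>j<k. L.gs_fun j (W i \<omega>) *\<^sub>R L.gs_vec j))"
        by (simp add: T_def scaleR_diff_right sum_subtractf)
      also have "(\<Sum>i<n. W i \<omega> - (\<Sum>j<k. L.gs_fun j (W i \<omega>) *\<^sub>R L.gs_vec j)) = (\<Sum>i<n. L.gs_res k (W i \<omega>))"
      proof (rule sum.cong[OF refl])
        fix i
        show "W i \<omega> - (\<Sum>j<k. L.gs_fun j (W i \<omega>) *\<^sub>R L.gs_vec j) = L.gs_res k (W i \<omega>)"
          using L.gs_decomp[of "W i \<omega>" k] by (metis add_diff_cancel_left')
      qed
      finally show ?thesis .
    qed
    obtain C where C: "AE y in D. norm (L.gs_res k y) \<le> C"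
      using L.ess_bounded_res[of k] by (auto simp: ess_bounded_def)
    have m0: "expectation (\<lambda>\<omega>. L.gs_res k (W i \<omega>)) = 0" for i
      using L.gs_mean_0(1)[of k] transfer[of "L.gs_res k" i] by simp
    have c: "expectation (\<lambda>\<omega>. (norm (L.gs_res k (W i \<omega>)))\<^sup>2) \<le> (\<integral>y. (norm (L.gs_res k y))\<^sup>2 \<partial>D)" for i
      by (subst transfer[of "\<lambda>y. (norm (L.gs_res k y))\<^sup>2" i]) auto
    note sq = expectation_norm_sum_square_le[OF comp_indep[of "L.gs_res k"] AE_transfer[OF C] m0 c, of n]
    have sqn: "(norm (T n \<omega> - Tk k n \<omega>))\<^sup>2 = (norm (\<Sum>i<n. L.gs_res k (W i \<omega>)))\<^sup>2 / real n" for \<omega>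
      unfolding eq by (simp add: power_divide)
    have isq: "integrable M (\<lambda>\<omega>. (norm (T n \<omega> - Tk k n \<omega>))\<^sup>2)" unfolding sqn using sq(1) by simp
    have Tm: "(\<lambda>\<omega>. T n \<omega> - Tk k n \<omega>) \<in> borel_measurable M" by measurable
    show "integrable M (\<lambda>\<omega>. norm (T n \<omega> - Tk k n \<omega>))"
      using expectation_norm_le_sqrt(1)[OF Tm isq] by (rule integrable_norm)
    have "expectation (\<lambda>\<omega>. norm (T n \<omega> - Tk k n \<omega>)) \<le> sqrt (expectation (\<lambda>\<omega>. (norm (T n \<omega> - Tk k n \<omega>))\<^sup>2))"
      by (rule expectation_norm_le_sqrt(2)[OF Tm isq])
    also have "\<dots> \<le> sqrt (\<integral>y. (norm (L.gs_res k y))\<^sup>2 \<partial>D)"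
    proof (cases "n = 0")
      case True then show ?thesis unfolding sqn by (simp add: integral_nonneg_AE)
    next
      case False
      then show ?thesis unfolding sqn using sq(2) by (simp add: field_simps)
    qed
    finally show "expectation (\<lambda>\<omega>. norm (T n \<omega> - Tk k n \<omega>)) \<le> sqrt (\<integral>y. (norm (L.gs_res k y))\<^sup>2 \<partial>D)" .
  qed
  have a_sq: "integrable M (\<lambda>\<omega>. (a n j \<omega>)\<^sup>2)" "expectation (\<lambda>\<omega>. (a n j \<omega>)\<^sup>2) \<le> 1" for n j
  proof -
    obtain C where C: "AE y in D. norm (L.gs_fun j y) \<le> C"
      using L.ess_bounded_fun[of j] by (auto simp: ess_bounded_def)
    have m0: "expectation (\<lambda>\<omega>. L.gs_fun j (W i \<omega>)) = 0" for i
      using L.gs_mean_0(2)[of j] transfer[of "L.gs_fun j" i] by simp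
    have c: "expectation (\<lambda>\<omega>. (norm (L.gs_fun j (W i \<omega>)))\<^sup>2) \<le> 1" for i
      using L.gs_fun_sq_le[of j] transfer[of "\<lambda>y. (L.gs_fun j y)\<^sup>2" i] by simp
    note sq = expectation_norm_sum_square_le[OF comp_indep[of "L.gs_fun j"] AE_transfer[OF C] m0 c, of n]
    have eq: "(a n j \<omega>)\<^sup>2 = (norm (\<Sum>i<n. L.gs_fun j (W i \<omega>)))\<^sup>2 / real n" for \<omega>
      unfolding a_def by (simp add: power_mult_distrib power_divide)
    show "integrable M (\<lambda>\<omega>. (a n j \<omega>)\<^sup>2)" unfolding eq using sq(1) by simp
    show "expectation (\<lambda>\<omega>. (a n j \<omega>)\<^sup>2) \<le> 1"
      unfolding eq using sq(2) by (cases "n = 0") (auto simp: field_simps)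
  qed
  have Tk_cos: "(\<lambda>n. \<integral>\<omega>. cos (t \<bullet> Tk k n \<omega> + c) \<partial>M) \<longlonglongrightarrow> (\<integral>\<omega>. cos (t \<bullet> Zk k \<omega> + c) \<partial>gauss_space)" for k t c
  proof (rule iexp_tendsto_imp_cos_tendsto)
    \<comment> \<open>With this scalar function \<open>t \<bullet> Tk k n \<omega>\<close> is a
      normalized sum of independent copies.\<close>
    define \<psi> where "\<psi> y = (\<Sum>j<k. L.gs_fun j y * (L.gs_vec j \<bullet> t))" for y
    have [measurable]: "\<psi> \<in> borel_measurable borel" unfolding \<psi>_def by measurable
    have pb: "ess_bounded D \<psi>" unfolding \<psi>_def by (intro L.gs_intros)
    then obtain C where C: "AE y in D. norm (\<psi> y) \<le> C" by (auto simp: ess_bounded_def)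
    have "D.expectation \<psi> = 0"
      unfolding \<psi>_def by (subst Bochner_Integration.integral_sum, (intro L.gs_intros)+) (simp add: L.gs_mean_0)
    then have m0: "expectation (\<lambda>\<omega>. \<psi> (W i \<omega>)) = 0" for i using transfer[of \<psi> i] by simp
    have isq: "integrable M (\<lambda>\<omega>. (\<psi> (W i \<omega>))\<^sup>2)" for i
    proof (rule integrable_const_bound[of _ "C\<^sup>2"])
      show "AE \<omega> in M. norm ((\<psi> (W i \<omega>))\<^sup>2) \<le> C\<^sup>2"
        using AE_transfer[OF C, of i]
      proof eventually_elim
        case (elim \<omega>)
        then have "\<bar>\<psi> (W i \<omega>)\<bar>\<^sup>2 \<le> C\<^sup>2" by (intro power_mono) auto
        then show ?case by simp
      qed
    qed simp
    have v: "expectation (\<lambda>\<omega>. (\<psi> (W i \<omega>))\<^sup>2) = (\<Sum>j<k. (L.gs_vec j \<bullet> t)\<^sup>2)" for i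
      using transfer[of "\<lambda>y. (\<psi> y)\<^sup>2" i] L.gs_partial_var[where k=k and h=t] by (simp add: \<psi>_def)
    have "(\<lambda>n. expectation (\<lambda>\<omega>. iexp (1 * ((1 / sqrt (real n)) * (\<Sum>i<n. \<psi> (W i \<omega>)))))) \<longlonglongrightarrow>
        exp (- ((\<Sum>j<k. (L.gs_vec j \<bullet> t)\<^sup>2) * 1\<^sup>2) / 2)"
      by (rule CLT_iexp[OF comp_indep m0 isq v comp_distr]) simp_all
    moreover have "1 * ((1 / sqrt (real n)) * (\<Sum>i<n. \<psi> (W i \<omega>))) = t \<bullet> Tk k n \<omega>" for n \<omega>
    proof -
      have "(\<Sum>i<n. \<psi> (W i \<omega>)) = (\<Sum>j<k. (\<Sum>i<n. L.gs_fun j (W i \<omega>)) * (L.gs_vec j \<bullet> t))"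
        unfolding \<psi>_def by (subst sum.swap) (simp add: sum_distrib_right)
      moreover have "t \<bullet> Tk k n \<omega> = (\<Sum>j<k. ((1 / sqrt (real n)) * (\<Sum>i<n. L.gs_fun j (W i \<omega>))) * (L.gs_vec j \<bullet> t))"
        unfolding Tk_def a_def inner_sum_right inner_scaleR_right by (simp only: inner_commute)
      moreover have "\<dots> = (1 / sqrt (real n)) * (\<Sum>j<k. (\<Sum>i<n. L.gs_fun j (W i \<omega>)) * (L.gs_vec j \<bullet> t))"
        unfolding sum_distrib_left[where r = "1 / sqrt (real n)" and A = "{..<k}"] by (simp only: mult.assoc)
      ultimately show ?thesis by (simp only: mult_1)
    qed
    moreover have "(\<integral>\<omega>. iexp (t \<bullet> Zk k \<omega>) \<partial>gauss_space) = exp (- ((\<Sum>j<k. (L.gs_vec j \<bullet> t)\<^sup>2) * 1\<^sup>2) / 2)"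
      using gauss_sum_iexp[of "\<lambda>j. L.gs_vec j \<bullet> t" k] by (simp add: Zk_def inner_sum_right inner_commute)
    ultimately show "(\<lambda>n. expectation (\<lambda>\<omega>. iexp (t \<bullet> Tk k n \<omega>))) \<longlonglongrightarrow> (\<integral>\<omega>. iexp (t \<bullet> Zk k \<omega>) \<partial>gauss_space)"
      by (simp only:)
  qed (auto intro: prob_space_axioms gauss.prob_space_axioms)
  have conv1: "(\<lambda>n. \<integral>\<omega>. f (T n \<omega>) \<partial>M) \<longlonglongrightarrow> (\<integral>\<omega>. f (Z \<omega>) \<partial>gauss_space)"
    if f: "\<And>y z. \<bar>f y - f z\<bar> \<le> L * dist y z" and fb: "\<And>y. \<bar>f y\<bar> \<le> 1" and L: "L \<ge> 0" for f L
  proof (rule LIMSEQ_I)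
    fix e :: real assume e: "0 < e"
    \<comment> \<open>The total error is 11 \<epsilon>: 9 \<epsilon> on the truncated parts and
      \<epsilon> for each of the two truncations.\<close>
    define \<epsilon> where "\<epsilon> = e / 12"
    have eps: "\<epsilon> > 0" using e by (simp add: \<epsilon>_def)
    note fc = lipschitz_borel_measurable[OF f]
    have "(\<lambda>m. L * sqrt (\<integral>y. (norm (L.gs_res (r m) y))\<^sup>2 \<partial>D)) \<longlonglongrightarrow> L * sqrt 0"
      by (intro tendsto_intros filterlim_compose[OF L.gs_res_tendsto_0 Z(2)])
    then have "\<forall>\<^sub>F m in sequentially. L * sqrt (\<integral>y. (norm (L.gs_res (r m) y))\<^sup>2 \<partial>D) < \<epsilon>"
      using eps by (intro order_tendstoD(2)) auto
    moreover have "(\<lambda>m. L * (\<integral>\<omega>. norm (Z \<omega> - (\<Sum>j<r m. \<omega> j *\<^sub>R L.gs_vec j)) \<partial>gauss_space)) \<longlonglongrightarrow> L * 0"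
      by (intro tendsto_intros Z(5))
    then have "\<forall>\<^sub>F m in sequentially. L * (\<integral>\<omega>. norm (Z \<omega> - (\<Sum>j<r m. \<omega> j *\<^sub>R L.gs_vec j)) \<partial>gauss_space) < \<epsilon>"
      using eps by (intro order_tendstoD(2)) auto
    ultimately have "\<forall>\<^sub>F m in sequentially. L * sqrt (\<integral>y. (norm (L.gs_res (r m) y))\<^sup>2 \<partial>D) < \<epsilon> \<and>
        L * (\<integral>\<omega>. norm (Z \<omega> - (\<Sum>j<r m. \<omega> j *\<^sub>R L.gs_vec j)) \<partial>gauss_space) < \<epsilon>"
      by (rule eventually_conj)
    then obtain m where m: "L * sqrt (\<integral>y. (norm (L.gs_res (r m) y))\<^sup>2 \<partial>D) < \<epsilon>"
        "L * (\<integral>\<omega>. norm (Z \<omega> - Zk (r m) \<omega>) \<partial>gauss_space) < \<epsilon>"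
      by (auto simp: eventually_sequentially Zk_def)
    define k where "k = r m"
    \<comment> \<open>Large enough for k / l^2 \<le> \<epsilon>; the summand 1 keeps
      \<open>l\<close> positive when \<open>k = 0\<close>.\<close>
    define l where "l = sqrt (real k / \<epsilon>) + 1"
    have l: "l > 0" by (simp add: l_def add_nonneg_pos eps less_imp_le)
    have "real k / \<epsilon> \<le> l\<^sup>2"
    proof -
      have "real k / \<epsilon> = (sqrt (real k / \<epsilon>))\<^sup>2" using eps by simp
      also have "\<dots> \<le> l\<^sup>2" unfolding l_def using eps by (intro power_mono) auto
      finally show ?thesis .
    qed
    then have kl: "real k / l\<^sup>2 \<le> \<epsilon>" using l eps by (simp add: field_simps)
    let ?K = "{\<Sum>j<k. a j *\<^sub>R L.gs_vec j | a. \<forall>j<k. \<bar>a j\<bar> \<le> l}"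
    have "\<forall>\<^sub>F n in sequentially. \<bar>(\<integral>\<omega>. f (Tk k n \<omega>) \<partial>M) - (\<integral>\<omega>. f (Zk k \<omega>) \<partial>gauss_space)\<bar> \<le> 9 * \<epsilon>"
    proof (rule cos_tendsto_imp_eventually_expectation_close[OF prob_space_axioms gauss.prob_space_axioms _ _ Tk_cos _ eps _ _ fc(1) fb])
      show "compact ?K" by (rule compact_parallelepiped)
      show "prob {\<omega>\<in>space M. Tk k n \<omega> \<notin> ?K} \<le> \<epsilon>" for n
        using prob_notin_parallelepiped[where a = "a n" and k = k and b = L.gs_vec, OF _ a_sq l] kl unfolding Tk_def by simp
      have "gauss.prob {\<omega>\<in>space gauss_space. Zk k \<omega> \<notin> ?K} \<le> real k / l\<^sup>2"
        unfolding Zk_def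
        by (rule gauss.prob_notin_parallelepiped[where a = "\<lambda>j \<omega>. \<omega> j"])
           (auto simp: gauss_coord_integrable gauss_coord_moments l)
      then show "gauss.prob {\<omega>\<in>space gauss_space. Zk k \<omega> \<notin> ?K} \<le> \<epsilon>" using kl by simp
    qed simp_all
    then have "\<forall>\<^sub>F n in sequentially. norm ((\<integral>\<omega>. f (T n \<omega>) \<partial>M) - (\<integral>\<omega>. f (Z \<omega>) \<partial>gauss_space)) < e"
    proof eventually_elim
      case (elim n)
      have "\<bar>(\<integral>\<omega>. f (T n \<omega>) \<partial>M) - (\<integral>\<omega>. f (Tk k n \<omega>) \<partial>M)\<bar> \<le> L * expectation (\<lambda>\<omega>. norm (T n \<omega> - Tk k n \<omega>))"
        by (rule abs_expectation_diff_le_lipschitz[OF _ _ f fb fc(2) TTk(1)]) simp_all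
      also have "\<dots> \<le> L * sqrt (\<integral>y. (norm (L.gs_res k y))\<^sup>2 \<partial>D)"
        by (intro mult_left_mono TTk L)
      finally have 1: "\<bar>(\<integral>\<omega>. f (T n \<omega>) \<partial>M) - (\<integral>\<omega>. f (Tk k n \<omega>) \<partial>M)\<bar> < \<epsilon>" using m(1) by (simp add: k_def)
      have "integrable gauss_space (\<lambda>\<omega>. norm (Z \<omega> - Zk k \<omega>))"
        using Z(4)[of m] unfolding Zk_def k_def by (rule integrable_norm)
      then have "\<bar>(\<integral>\<omega>. f (Z \<omega>) \<partial>gauss_space) - (\<integral>\<omega>. f (Zk k \<omega>) \<partial>gauss_space)\<bar> \<le> L * (\<integral>\<omega>. norm (Z \<omega> - Zk k \<omega>) \<partial>gauss_space)"
        by (intro gauss.abs_expectation_diff_le_lipschitz[OF _ _ f fb fc(2)]) simp_all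
      then have 2: "\<bar>(\<integral>\<omega>. f (Z \<omega>) \<partial>gauss_space) - (\<integral>\<omega>. f (Zk k \<omega>) \<partial>gauss_space)\<bar> < \<epsilon>" using m(2) by (simp add: k_def)
      show ?case using 1 2 elim eps unfolding \<epsilon>_def real_norm_def by linarith
    qed
    then show "\<exists>no. \<forall>n\<ge>no. norm ((\<integral>\<omega>. f (T n \<omega>) \<partial>M) - (\<integral>\<omega>. f (Z \<omega>) \<partial>gauss_space)) < e"
      by (simp add: eventually_sequentially)
  qed
  have "converges_in_distribution M T gauss_space Z"
  proof (rule lipschitz_convergence_imp_converges_in_distribution[OF prob_space_axioms gauss.prob_space_axioms])
    fix f :: "'h \<Rightarrow> real" and L B
    assume f: "\<And>y z. \<bar>f y - f z\<bar> \<le> L * dist y z" and fb: "\<And>y. \<bar>f y\<bar> \<le> B"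
    \<comment> \<open>Rescaling reduces to test functions bounded by 1; the maximum with 1 avoids
      division by 0.\<close>
    define B' where "B' = max B 1"
    have B': "B' > 0" "B \<le> B'" by (auto simp: B'_def)
    have f': "\<bar>f y / B' - f z / B'\<bar> \<le> (max L 0 / B') * dist y z" for y z
    proof -
      have "\<bar>f y - f z\<bar> \<le> max L 0 * dist y z"
        using f[of y z] mult_right_mono[of L "max L 0" "dist y z"] by simp
      then have "\<bar>f y - f z\<bar> / B' \<le> max L 0 * dist y z / B'" using B' by (intro divide_right_mono) auto
      then show ?thesis using B' by (simp add: diff_divide_distrib[symmetric] abs_divide)
    qed
    have fb': "\<bar>f y / B'\<bar> \<le> 1" for y using fb[of y] B' by (simp add: abs_divide)
    have "(\<lambda>n. \<integral>\<omega>. f (T n \<omega>) / B' \<partial>M) \<longlonglongrightarrow> (\<integral>\<omega>. f (Z \<omega>) / B' \<partial>gauss_space)"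
      by (rule conv1[OF f' fb']) (use B' in auto)
    from tendsto_mult_left[OF this, of B'] B'
    show "(\<lambda>n. \<integral>\<omega>. f (T n \<omega>) \<partial>M) \<longlonglongrightarrow> (\<integral>\<omega>. f (Z \<omega>) \<partial>gauss_space)" by simp
  qed simp_all
  moreover have "(\<integral>\<omega>. iexp (Z \<omega> \<bullet> h) \<partial>gauss_space) = complex_of_real (exp (- expectation (\<lambda>\<omega>. (W 0 \<omega> \<bullet> h)\<^sup>2) / 2))" for h
    using Z(6)[OF L.gs_partial_var_tendsto[of h]] transfer[of "\<lambda>y. (y \<bullet> h)\<^sup>2" 0] by simp
  moreover have "Z \<omega> \<bullet> h = 0" if h: "AE \<omega> in M. W 0 \<omega> \<bullet> h = 0" for h \<omega>
  proof (rule Z(7))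
    fix j
    \<comment> \<open>When the variance in direction \<open>h\<close> is 0, Pythagoras forces every
      coefficient \<open>L.gs_vec j \<bullet> h\<close> to vanish.\<close>
    have "(\<integral>y. (y \<bullet> h)\<^sup>2 \<partial>D) = expectation (\<lambda>\<omega>. 0)"
      unfolding transfer[of "\<lambda>y. (y \<bullet> h)\<^sup>2" 0, simplified] using h by (intro integral_cong_AE) auto
    moreover have "0 \<le> (\<integral>y. (L.gs_res (Suc j) y \<bullet> h)\<^sup>2 \<partial>D)" by (intro integral_nonneg_AE) auto
    ultimately have "(\<Sum>i<Suc j. (L.gs_vec i \<bullet> h)\<^sup>2) \<le> 0" using L.gs_var[of "Suc j" h] by simp
    moreover have "(L.gs_vec j \<bullet> h)\<^sup>2 \<le> (\<Sum>i<Suc j. (L.gs_vec i \<bullet> h)\<^sup>2)"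
      by (rule member_le_sum) auto
    ultimately have "(L.gs_vec j \<bullet> h)\<^sup>2 \<le> 0" by linarith
    then show "L.gs_vec j \<bullet> h = 0" by simp
  qed
  ultimately show thesis using that[of Z] Z(1,3) unfolding T_def[abs_def] by blast
qed

text \<open>For a Lipschitz test function the two expectations differ by at most the constant times
  the L1 distance, and bounded Lipschitz functions suffice for convergence in distribution.\<close>

lemma converges_in_distribution_L1_perturbation:
  fixes Y T :: "nat \<Rightarrow> 'w \<Rightarrow> 'h::{real_normed_vector, second_countable_topology}"
  assumes M: "prob_space M" and N: "prob_space N" and T: "converges_in_distribution M T N Z"
    and Y: "\<And>n. Y n \<in> borel_measurable M" and i: "\<And>n. integrable M (\<lambda>\<omega>. norm (Y n \<omega> - T n \<omega>))"
    and lim: "(\<lambda>n. \<integral>\<omega>. norm (Y n \<omega> - T n \<omega>) \<partial>M) \<longlonglongrightarrow> 0"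
  shows "converges_in_distribution M Y N Z"
proof -
  interpret prob_space M by fact
  have Tm: "T n \<in> borel_measurable M" and Zm: "Z \<in> borel_measurable N" for n
    using T by (auto simp: converges_in_distribution_def)
  show ?thesis
  proof (rule lipschitz_convergence_imp_converges_in_distribution[OF M N Y Zm])
    fix f :: "'h \<Rightarrow> real" and L B
    assume f: "\<And>y z. \<bar>f y - f z\<bar> \<le> L * dist y z" and fb: "\<And>y. \<bar>f y\<bar> \<le> B"
    note fc = lipschitz_borel_measurable[OF f]
    have "bounded (range f)" using fb by (auto simp: bounded_iff)
    then have 1: "(\<lambda>n. \<integral>\<omega>. f (T n \<omega>) \<partial>M) \<longlonglongrightarrow> (\<integral>\<omega>. f (Z \<omega>) \<partial>N)"
      using T fc(1) by (auto simp: converges_in_distribution_def)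
    have 2: "(\<lambda>n. (\<integral>\<omega>. f (Y n \<omega>) \<partial>M) - (\<integral>\<omega>. f (T n \<omega>) \<partial>M)) \<longlonglongrightarrow> 0"
    proof (rule Lim_null_comparison)
      show "\<forall>\<^sub>F n in sequentially. norm ((\<integral>\<omega>. f (Y n \<omega>) \<partial>M) - (\<integral>\<omega>. f (T n \<omega>) \<partial>M)) \<le> L * (\<integral>\<omega>. norm (Y n \<omega> - T n \<omega>) \<partial>M)"
        using abs_expectation_diff_le_lipschitz[OF Y Tm f fb fc(2) i] by simp
      show "(\<lambda>n. L * (\<integral>\<omega>. norm (Y n \<omega> - T n \<omega>) \<partial>M)) \<longlonglongrightarrow> 0"
        using tendsto_mult_left[OF lim, of L] by simp
    qed
    from tendsto_add[OF 2 1] show "(\<lambda>n. \<integral>\<omega>. f (Y n \<omega>) \<partial>M) \<longlonglongrightarrow> (\<integral>\<omega>. f (Z \<omega>) \<partial>N)" by simp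
  qed
qed

section \<open>The function \<open>arccos t / sqrt (1 - t\<^sup>2)\<close>\<close>

text \<open>With \<open>\<theta> = arccos t\<close> these are \<open>\<theta> / sin \<theta>\<close> and \<open>(sin \<theta> - \<theta> cos \<theta>) / sin\<^sup>3 \<theta>\<close>, extended continuously
  to \<open>\<theta> = 0\<close>; moreover \<open>arccos\<^sup>2\<close> has derivative \<open>- 2 * ag\<close>, and \<open>ag\<close> has derivative \<open>- akap\<close>.\<close>

definition ag :: "real \<Rightarrow> real" where
  "ag t = (if t = 1 then 1 else arccos t / sqrt (1 - t\<^sup>2))"

definition akap :: "real \<Rightarrow> real" where
  "akap t = (if t = 1 then 1/3 else (1 - t * ag t) / (1 - t\<^sup>2))"

lemma ag_1 [simp]: "ag 1 = 1" and ag_0: "ag 0 = pi / 2"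
  by (auto simp: ag_def)

lemma one_minus_sq_pos: "- 1 < t \<Longrightarrow> t < 1 \<Longrightarrow> 0 < 1 - (t::real)\<^sup>2"
  by (simp add: abs_square_less_1)

lemma arccos_less_pi: "- 1 < t \<Longrightarrow> t \<le> 1 \<Longrightarrow> arccos t < pi"
  using arccos_less_arccos[of "-1" t] by simp

lemma isCont_removable:
  fixes f :: "real \<Rightarrow> real"
  assumes "(f \<longlongrightarrow> c) (at 0)"
  shows "isCont (\<lambda>x. if x = 0 then c else f x) 0"
proof -
  have "((\<lambda>x. if x = 0 then c else f x) \<longlongrightarrow> c) (at 0)"
    using assms by (rule Lim_transform_eventually) (auto simp: eventually_at_filter)
  then show ?thesis by (simp add: isCont_def)
qed

text \<open>In the angle x = arccos t the singularity at t = 1 becomes a removable one at x = 0,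
  where a Taylor limit settles it.\<close>

lemma continuous_on_removable_arccos:
  fixes f :: "real \<Rightarrow> real"
  assumes lim: "(f \<longlongrightarrow> c) (at 0)" and f: "\<And>x. 0 < x \<Longrightarrow> x < pi \<Longrightarrow> isCont f x"
  shows "continuous_on {-1<..1} (\<lambda>t. if t = 1 then c else f (arccos t))"
proof -
  let ?g = "\<lambda>x. if x = 0 then c else f x"
  have "isCont ?g x" if "x \<in> {0..<pi}" for x
  proof (cases "x = 0")
    case True then show ?thesis using isCont_removable[OF lim] by simp
  next
    case False
    then have "\<forall>\<^sub>F y in nhds x. y \<noteq> 0" by (auto intro!: t1_space_nhds)
    then have "\<forall>\<^sub>F y in nhds x. ?g y = f y" by eventually_elim simp
    then show ?thesis using f[of x] that False by (subst isCont_cong) auto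
  qed
  then have "continuous_on {0..<pi} ?g" by (simp add: continuous_at_imp_continuous_on)
  moreover have "continuous_on {-1<..1} arccos"
    by (rule continuous_on_subset[OF continuous_on_arccos']) auto
  moreover have "arccos ` {-1<..1} \<subseteq> {0..<pi}"
    by (auto simp: arccos_lbound arccos_less_pi)
  ultimately have "continuous_on {-1<..1} (\<lambda>t. ?g (arccos t))"
    by (rule continuous_on_compose2)
  then show ?thesis
    by (rule continuous_on_eq) (auto simp: arccos_eq_0_iff)
qed

lemma continuous_on_ag: "continuous_on {-1<..1} ag"
proof -
  have "continuous_on {-1<..1} (\<lambda>t. if t = 1 then 1 else arccos t / sin (arccos t))"
  proof (rule continuous_on_removable_arccos[where f = "\<lambda>x. x / sin x"])
    show "((\<lambda>x::real. x / sin x) \<longlongrightarrow> 1) (at 0)" by real_asymp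
    show "isCont (\<lambda>x. x / sin x) x" if "0 < x" "x < pi" for x :: real
      using sin_gt_zero[OF that] by (intro continuous_intros) auto
  qed
  then show ?thesis by (rule continuous_on_eq) (auto simp: ag_def sin_arccos)
qed

lemma continuous_on_akap: "continuous_on {-1<..1} akap"
proof -
  have "continuous_on {-1<..1} (\<lambda>t. if t = 1 then 1/3 else
      (sin (arccos t) - arccos t * cos (arccos t)) / (sin (arccos t)) ^ 3)"
  proof (rule continuous_on_removable_arccos[where f = "\<lambda>x. (sin x - x * cos x) / (sin x) ^ 3"])
    \<comment> \<open>sin x - x cos x behaves like x^3 / 3, which explains the value 1/3 of
      \<open>akap\<close> at 1.\<close>
    show "((\<lambda>x::real. (sin x - x * cos x) / (sin x) ^ 3) \<longlongrightarrow> 1/3) (at 0)" by real_asymp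
    show "isCont (\<lambda>x. (sin x - x * cos x) / (sin x) ^ 3) x" if "0 < x" "x < pi" for x :: real
      using sin_gt_zero[OF that] by (intro continuous_intros) auto
  qed
  then show ?thesis
  proof (rule continuous_on_eq)
    fix t :: real assume t: "t \<in> {-1<..1}"
    show "(if t = 1 then 1/3 else (sin (arccos t) - arccos t * cos (arccos t)) / (sin (arccos t)) ^ 3) = akap t"
    proof (cases "t = 1")
      case False
      define s where "s = sqrt (1 - t\<^sup>2)"
      have "s > 0" "s\<^sup>2 = 1 - t\<^sup>2" using t False one_minus_sq_pos[of t] by (auto simp: s_def)
      moreover then have "(s - arccos t * t) / s ^ 3 = (1 - t * (arccos t / s)) / s\<^sup>2"
        by (simp add: power2_eq_square power3_eq_cube field_simps)
      ultimately show ?thesis using t False by (simp add: akap_def ag_def sin_arccos s_def[symmetric])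
    qed (simp add: akap_def)
  qed
qed

lemma ag_has_derivative_interior:
  assumes "- 1 < t" "t < 1"
  shows "(ag has_real_derivative - akap t) (at t)"
proof -
  define s where "s = sqrt (1 - t\<^sup>2)"
  have s: "s > 0" "s\<^sup>2 = 1 - t\<^sup>2" using assms one_minus_sq_pos[of t] by (auto simp: s_def)
  have "((\<lambda>t. arccos t / sqrt (1 - t\<^sup>2)) has_real_derivative
      ((inverse (- s)) * s - arccos t * ((- 2 * t) * (inverse s / 2))) / (s * s)) (at t)"
    unfolding s_def using assms one_minus_sq_pos[of t]
    by (auto intro!: derivative_eq_intros)
  also have "((inverse (- s)) * s - arccos t * ((- 2 * t) * (inverse s / 2))) / (s * s) = - akap t"
  proof -
    have "inverse (- s) * s = - 1" "arccos t * ((- 2 * t) * (inverse s / 2)) = - (t * (arccos t / s))"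
      using s(1) by (simp_all add: field_simps)
    moreover have ak: "akap t = (1 - t * (arccos t / s)) / s\<^sup>2"
      using assms by (simp add: akap_def ag_def s_def[symmetric] s(2))
    have "(- 1 - - X) / Y = - ((1 - X) / Y)" for X Y :: real by (simp add: diff_divide_distrib)
    ultimately show ?thesis unfolding ak by (simp only: power2_eq_square)
  qed
  finally show ?thesis
  proof (rule has_field_derivative_transform_within_open)
    show "open {..<1::real}" by simp
  qed (use assms in \<open>auto simp: ag_def\<close>)
qed

lemma arccos_sq_has_derivative_interior:
  assumes "- 1 < t" "t < 1"
  shows "((\<lambda>t. (arccos t)\<^sup>2) has_real_derivative - 2 * ag t) (at t)"
proof -
  have "((\<lambda>t. (arccos t)\<^sup>2) has_real_derivative 2 * arccos t * inverse (- sqrt (1 - t\<^sup>2))) (at t)"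
    using assms by (auto intro!: derivative_eq_intros)
  then show ?thesis using assms by (simp add: ag_def field_simps)
qed

lemma sin_ge_mult_cos:
  assumes "0 \<le> x" "x \<le> pi"
  shows "x * cos x \<le> sin (x::real)"
proof -
  have "sin 0 - 0 * cos 0 \<le> sin x - x * cos x"
  proof (rule DERIV_nonneg_imp_nondecreasing[OF assms(1)])
    fix y assume y: "0 \<le> y" "y \<le> x"
    have "((\<lambda>x. sin x - x * cos x) has_real_derivative y * sin y) (at y)"
      by (auto intro!: derivative_eq_intros)
    moreover have "0 \<le> y * sin y" using y assms by (intro mult_nonneg_nonneg sin_ge_zero) auto
    ultimately show "\<exists>d. ((\<lambda>x. sin x - x * cos x) has_real_derivative d) (at y) \<and> 0 \<le> d" by blast
  qed
  then show ?thesis by simp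
qed

text \<open>In the angle this is x cos x \<le> sin x. It makes \<open>ag\<close> decreasing and the
  first term of the Hessian nonnegative.\<close>

lemma akap_nonneg:
  assumes "- 1 < t" "t \<le> 1"
  shows "0 \<le> akap t"
proof (cases "t = 1")
  case False
  define s where "s = sqrt (1 - t\<^sup>2)"
  have s: "s > 0" using assms False one_minus_sq_pos[of t] by (auto simp: s_def)
  have "arccos t * t \<le> s"
    using sin_ge_mult_cos[of "arccos t"] assms by (simp add: sin_arccos s_def arccos_lbound arccos_ubound)
  then have "t * ag t \<le> 1" using s False by (simp add: ag_def s_def[symmetric] field_simps)
  then show ?thesis using False one_minus_sq_pos[of t] assms by (simp add: akap_def)
qed (simp add: akap_def)

lemma real_mvt_between:
  fixes f f' :: "real \<Rightarrow> real"
  assumes c: "continuous_on {-1<..1} f" and d: "\<And>t. - 1 < t \<Longrightarrow> t < 1 \<Longrightarrow> (f has_real_derivative f' t) (at t)"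
    and s: "s \<in> {-1<..1}" and t: "t \<in> {-1<..1}"
  obtains z where "min s t \<le> z" "z \<le> max s t" "f s - f t = f' z * (s - t)"
proof -
  have aux: "\<exists>z. a \<le> z \<and> z \<le> b \<and> f b - f a = f' z * (b - a)" if ab: "a < b" "a \<in> {-1<..1}" "b \<in> {-1<..1}" for a b
  proof -
    have dz: "(f has_real_derivative f' z) (at z)" if "a < z" "z < b" for z
      using that ab by (intro d) auto
    then have "\<exists>l z. a < z \<and> z < b \<and> DERIV f z :> l \<and> f b - f a = (b - a) * l"
      using ab by (intro MVT continuous_on_subset[OF c]) (auto simp: real_differentiable_def)
    then obtain l z where z: "a < z" "z < b" "DERIV f z :> l" "f b - f a = (b - a) * l" by blast
    moreover then have "l = f' z" using DERIV_unique[OF z(3) dz] by simp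
    ultimately show ?thesis by (intro exI[of _ z]) (auto simp: mult.commute)
  qed
  consider "s < t" | "s = t" | "t < s" by linarith
  then show thesis
  proof cases
    case 1
    then obtain z where "s \<le> z" "z \<le> t" "f t - f s = f' z * (t - s)" using aux[of s t] s t by blast
    moreover then have "f s - f t = f' z * (s - t)" by (simp add: algebra_simps)
    ultimately show thesis using that[of z] 1 by simp
  next
    case 2 then show thesis using that[of s] by simp
  next
    case 3
    then obtain z where "t \<le> z" "z \<le> s" "f s - f t = f' z * (s - t)" using aux[of t s] s t by blast
    then show thesis using that[of z] 3 by simp
  qed
qed

lemma ag_mvt:
  assumes "s \<in> {-1<..1}" "t \<in> {-1<..1}"
  obtains z where "min s t \<le> z" "z \<le> max s t" "ag s - ag t = - akap z * (s - t)"
  by (rule real_mvt_between[OF continuous_on_ag ag_has_derivative_interior assms])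

lemma arccos_sq_mvt:
  assumes "s \<in> {-1<..1}" "t \<in> {-1<..1}"
  obtains z where "min s t \<le> z" "z \<le> max s t" "(arccos s)\<^sup>2 - (arccos t)\<^sup>2 = - 2 * ag z * (s - t)"
proof (rule real_mvt_between[OF _ arccos_sq_has_derivative_interior assms])
  show "continuous_on {-1<..1} (\<lambda>t. (arccos t)\<^sup>2)"
    by (intro continuous_on_power continuous_on_subset[OF continuous_on_arccos']) auto
qed

lemma ag_antimono:
  assumes "- 1 < s" "s \<le> t" "t \<le> 1"
  shows "ag t \<le> ag s"
proof -
  obtain z where z: "min s t \<le> z" "z \<le> max s t" "ag s - ag t = - akap z * (s - t)"
    using ag_mvt[of s t] assms by auto
  have "0 \<le> akap z" using z assms by (intro akap_nonneg) auto
  then have "0 \<le> akap z * (t - s)" using assms by simp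
  then show ?thesis using z(3) by (simp add: algebra_simps)
qed

lemma ag_ge_1: "- 1 < t \<Longrightarrow> t \<le> 1 \<Longrightarrow> 1 \<le> ag t"
  using ag_antimono[of t 1] by simp

lemma ag_le_2: "0 \<le> t \<Longrightarrow> t \<le> 1 \<Longrightarrow> ag t \<le> 2"
  using ag_antimono[of 0 t] pi_less_4 by (simp add: ag_0)

lemma ag_monotone:
  assumes "s \<in> {-1<..1}" "t \<in> {-1<..1}"
  shows "(ag s - ag t) * (s - t) \<le> 0"
  using ag_antimono[of s t] ag_antimono[of t s] assms
  by (cases "s \<le> t") (auto intro: mult_nonneg_nonpos mult_nonpos_nonneg)

text \<open>\<open>arccos\<^sup>2\<close> is convex in the inner product because its derivative -2
  ag increases. The slope is taken at \<open>s\<close>, which bounds the increment from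
  above.\<close>

lemma arccos_sq_convex:
  assumes "s \<in> {-1<..1}" "t \<in> {-1<..1}"
  shows "(arccos s)\<^sup>2 - (arccos t)\<^sup>2 \<le> - 2 * ag s * (s - t)"
proof -
  obtain z where z: "min s t \<le> z" "z \<le> max s t" "(arccos s)\<^sup>2 - (arccos t)\<^sup>2 = - 2 * ag z * (s - t)"
    using arccos_sq_mvt[OF assms] by blast
  have "ag s * (s - t) \<le> ag z * (s - t)"
  proof (cases "s \<le> t")
    case True
    then show ?thesis using z assms by (intro mult_right_mono_neg ag_antimono) auto
  next
    case False
    then show ?thesis using z assms by (intro mult_right_mono ag_antimono) auto
  qed
  then show ?thesis using z(3) by simp
qed

text \<open>The lower limit -1/2 leaves room for test points within distance 1/2 of a mean whose
  inner products with the support are nonnegative.\<close>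

lemma akap_bounded:
  obtains K where "K > 0" "\<And>t. - 1/2 \<le> t \<Longrightarrow> t \<le> 1 \<Longrightarrow> akap t \<le> K"
proof -
  have "compact (akap ` {-1/2..1})"
    by (intro compact_continuous_image continuous_on_subset[OF continuous_on_akap]) auto
  then obtain B where "\<forall>x\<in>akap ` {-1/2..1}. norm x \<le> B" using compact_imp_bounded bounded_iff by metis
  then have "akap t \<le> max B 1" if "- 1/2 \<le> t" "t \<le> 1" for t using that by force
  then show thesis using that[of "max B 1"] by simp
qed

lemma ag_lipschitz:
  obtains K where "K > 0" "\<And>s t. s \<in> {-1/2..1} \<Longrightarrow> t \<in> {-1/2..1} \<Longrightarrow> \<bar>ag s - ag t\<bar> \<le> K * \<bar>s - t\<bar>"
proof -
  obtain K where K: "K > 0" "\<And>t. - 1/2 \<le> t \<Longrightarrow> t \<le> 1 \<Longrightarrow> akap t \<le> K" by (rule akap_bounded) (rule that)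
  have "\<bar>ag s - ag t\<bar> \<le> K * \<bar>s - t\<bar>" if st: "s \<in> {-1/2..1}" "t \<in> {-1/2..1}" for s t
  proof -
    obtain z where z: "min s t \<le> z" "z \<le> max s t" "ag s - ag t = - akap z * (s - t)"
      using ag_mvt[of s t] st by auto
    have "0 \<le> akap z" "akap z \<le> K" using z st by (auto intro!: K akap_nonneg)
    then have "akap z * \<bar>s - t\<bar> \<le> K * \<bar>s - t\<bar>" by (intro mult_right_mono) auto
    then show ?thesis using z(3) \<open>0 \<le> akap z\<close> by (simp add: abs_mult)
  qed
  then show thesis using that K(1) by blast
qed

text \<open>Uniform continuity of \<open>akap\<close> gives the factor \<eta> for |s - t| < d. For
  larger increments |s - t| \<le> (s - t)^2 / d, so boundedness of \<open>akap\<close>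
  suffices.\<close>

lemma ag_linearization:
  assumes "\<eta> > 0"
  obtains C where "C \<ge> 0"
    "\<And>s t. s \<in> {0..1} \<Longrightarrow> t \<in> {0..1} \<Longrightarrow> \<bar>ag s - ag t + akap t * (s - t)\<bar> \<le> \<eta> * \<bar>s - t\<bar> + C * (s - t)\<^sup>2"
proof -
  obtain K where K: "K > 0" "\<And>t. - 1/2 \<le> t \<Longrightarrow> t \<le> 1 \<Longrightarrow> akap t \<le> K" by (rule akap_bounded) (rule that)
  have "uniformly_continuous_on {0..1} akap"
    by (intro compact_uniformly_continuous continuous_on_subset[OF continuous_on_akap]) auto
  then obtain d where d: "d > 0" "\<And>x y. x \<in> {0..1} \<Longrightarrow> y \<in> {0..1} \<Longrightarrow> dist y x < d \<Longrightarrow> dist (akap y) (akap x) < \<eta>"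
    using assms unfolding uniformly_continuous_on_def by metis
  have "\<bar>ag s - ag t + akap t * (s - t)\<bar> \<le> \<eta> * \<bar>s - t\<bar> + (K / d) * (s - t)\<^sup>2" if st: "s \<in> {0..1}" "t \<in> {0..1}" for s t
  proof -
    obtain z where z: "min s t \<le> z" "z \<le> max s t" "ag s - ag t = - akap z * (s - t)"
      using ag_mvt[of s t] st by auto
    have eq: "\<bar>ag s - ag t + akap t * (s - t)\<bar> = \<bar>akap t - akap z\<bar> * \<bar>s - t\<bar>"
      unfolding abs_mult[symmetric] using z(3) by (simp add: algebra_simps)
    show ?thesis
    proof (cases "\<bar>s - t\<bar> < d")
      case True
      then have "z \<in> {0..1}" "dist t z < d"
        using z(1,2) st by (auto simp: dist_real_def min_def max_def split: if_splits)
      then have "\<bar>akap t - akap z\<bar> \<le> \<eta>" using d(2)[of z t] st by (simp add: dist_real_def)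
      then have "\<bar>akap t - akap z\<bar> * \<bar>s - t\<bar> \<le> \<eta> * \<bar>s - t\<bar>" by (intro mult_right_mono) auto
      moreover have "0 \<le> (K / d) * (s - t)\<^sup>2" using K d by simp
      ultimately show ?thesis using eq by linarith
    next
      case False
      have "0 \<le> akap t" "akap t \<le> K" "0 \<le> akap z" "akap z \<le> K"
        using z st by (auto intro!: K akap_nonneg)
      then have "\<bar>akap t - akap z\<bar> \<le> K" by linarith
      then have "\<bar>akap t - akap z\<bar> * \<bar>s - t\<bar> \<le> K * \<bar>s - t\<bar>" by (intro mult_right_mono) auto
      also have "\<dots> \<le> (K / d) * (s - t)\<^sup>2"
      proof -
        have "d * \<bar>s - t\<bar> \<le> \<bar>s - t\<bar> * \<bar>s - t\<bar>" using False by (intro mult_right_mono) auto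
        then have "K * (d * \<bar>s - t\<bar>) \<le> K * (s - t)\<^sup>2"
          using K(1) by (intro mult_left_mono) (auto simp: power2_eq_square abs_mult[symmetric])
        then show ?thesis using d(1) by (simp add: field_simps)
      qed
      finally show ?thesis using eq assms by (smt (verit) mult_nonneg_nonneg abs_ge_zero)
    qed
  qed
  then show thesis using that[of "K / d"] K d by simp
qed

text \<open>The mean value theorem and continuity of \<open>akap\<close> include the one-sided
  derivative at t = 1, which occurs when \<open>x = \<mu>\<close>.\<close>

lemma ag_has_derivative_within:
  assumes t: "t \<in> {-1<..1}"
  shows "(ag has_real_derivative - akap t) (at t within {-1<..1})"
proof -
  have "((\<lambda>s. (ag s - ag t) / (s - t)) \<longlongrightarrow> - akap t) (at t within {-1<..1})"
  proof (rule tendstoI)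
    fix e :: real assume e: "e > 0"
    obtain d where d: "d > 0" "\<And>z. z \<in> {-1<..1} \<Longrightarrow> dist z t < d \<Longrightarrow> dist (akap z) (akap t) < e"
      using continuous_on_akap t e unfolding continuous_on_iff by metis
    show "\<forall>\<^sub>F s in at t within {-1<..1}. dist ((ag s - ag t) / (s - t)) (- akap t) < e"
      unfolding eventually_at
    proof (intro exI[of _ d] conjI ballI impI d(1))
      fix s assume s: "s \<in> {-1<..1}" "s \<noteq> t \<and> dist s t < d"
      obtain z where z: "min s t \<le> z" "z \<le> max s t" "ag s - ag t = - akap z * (s - t)"
        using ag_mvt[OF s(1) t] by blast
      have "dist (akap z) (akap t) < e"
        using z s t by (intro d(2)) (auto simp: dist_real_def)
      then show "dist ((ag s - ag t) / (s - t)) (- akap t) < e"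
        using z(3) s by (simp add: dist_real_def abs_minus_commute)
    qed
  qed
  then show ?thesis by (simp add: has_field_derivative_iff)
qed

section \<open>The Hessian of the squared distance\<close>

lemma tensor_apply [simp]: "blinfun_apply (tensor f g) h = (f \<bullet> h) *\<^sub>R g"
  by (simp add: tensor.rep_eq)

lemma norm_tensor_le: "norm (tensor f g) \<le> norm f * norm g"
proof (rule norm_blinfun_bound)
  fix h
  have "\<bar>f \<bullet> h\<bar> * norm g \<le> (norm f * norm h) * norm g"
    by (intro mult_right_mono Cauchy_Schwarz_ineq2) auto
  then show "norm (blinfun_apply (tensor f g) h) \<le> norm f * norm g * norm h" by (simp add: mult_ac)
qed simp

lemma bounded_bilinear_tensor: "bounded_bilinear tensor"
proof
  show "\<exists>K. \<forall>a b. norm (tensor a b) \<le> norm a * norm b * K"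
    by (intro exI[of _ 1]) (auto intro: norm_tensor_le)
qed (auto intro!: blinfun_eqI simp: blinfun.bilinear_simps inner_add_left scaleR_add_left scaleR_add_right)

definition tproj :: "'h::real_inner \<Rightarrow> 'h \<Rightarrow>\<^sub>L 'h" where
  "tproj p = id_blinfun - tensor p p"

lemma tproj_apply: "blinfun_apply (tproj p) v = v - (p \<bullet> v) *\<^sub>R p"
  by (simp add: tproj_def blinfun.bilinear_simps)

lemma tproj_tangent: "v \<in> tangent p \<Longrightarrow> blinfun_apply (tproj p) v = v"
  by (simp add: tproj_apply tangent_def inner_commute)

lemma tproj_in_tangent: "norm p = 1 \<Longrightarrow> blinfun_apply (tproj p) v \<in> tangent p"
  by (simp add: tproj_apply tangent_def inner_diff_left norm_eq_1 inner_commute[of v p])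

lemma tproj_self: "norm p = 1 \<Longrightarrow> blinfun_apply (tproj p) p = 0"
  by (simp add: tproj_apply power2_norm_eq_inner[symmetric])

lemma tproj_inner: "blinfun_apply (tproj p) v \<bullet> w = v \<bullet> blinfun_apply (tproj p) w"
  by (simp add: tproj_apply inner_diff_left inner_diff_right inner_commute)

lemma tproj_inner_tangent: "v \<in> tangent p \<Longrightarrow> blinfun_apply (tproj p) w \<bullet> v = w \<bullet> v"
  by (simp add: tproj_inner tproj_tangent)

text \<open>Composition with \<open>riesz\<close> turns an operator into a bilinear form; on
  tangential operators \<open>riesz_op\<close> inverts it.\<close>

lift_definition riesz :: "'h::real_inner \<Rightarrow>\<^sub>L 'h \<Rightarrow>\<^sub>L real" is blinfun_inner_left
  by (rule bounded_linear_blinfun_inner_left)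

lemma riesz_apply [simp]: "blinfun_apply (blinfun_apply riesz v) w = v \<bullet> w"
  by (simp add: riesz.rep_eq inner_commute)

text \<open>Second derivative of arccos^2 along v -> <x, exp v>. The change of the outer slope -2 ag
  gives the \<open>akap\<close> term along the tangential part of \<open>x\<close>; the outer slope
  times the second derivative -t of the t cos |v| part gives the multiple of the projection.\<close>

definition Hess :: "'h::real_inner \<Rightarrow> 'h \<Rightarrow> 'h \<Rightarrow>\<^sub>L 'h" where
  "Hess p x = (2 * akap (x \<bullet> p)) *\<^sub>R tensor (tproj p x) (tproj p x) + (2 * ag (x \<bullet> p) * (x \<bullet> p)) *\<^sub>R tproj p"

lemma Hess_apply: "blinfun_apply (Hess p x) v =
    (2 * akap (x \<bullet> p) * (tproj p x \<bullet> v)) *\<^sub>R tproj p x + (2 * ag (x \<bullet> p) * (x \<bullet> p)) *\<^sub>R tproj p v"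
  by (simp add: Hess_def blinfun.bilinear_simps)

lemma Hess_tangent_op:
  assumes "norm p = 1"
  shows "Hess p x \<in> tangent_op p"
proof -
  have "tproj p x \<bullet> p = 0" "tproj p v \<bullet> p = 0" for v
    using tproj_in_tangent[OF assms, of x] tproj_in_tangent[OF assms, of v] by (auto simp: tangent_def)
  then show ?thesis
    using assms by (auto simp: tangent_op_def tangent_hom_def tangent_def Hess_apply tproj_self inner_add_left)
qed

lemma Hess_symmetric: "blinfun_apply (Hess p x) v \<bullet> w = v \<bullet> blinfun_apply (Hess p x) w"
  using tproj_inner[of p v w] by (simp add: Hess_apply inner_add_left inner_add_right inner_commute[of v "tproj p x"])

lemma tangent_op_apply_tproj:
  assumes "A \<in> tangent_hom p"
  shows "blinfun_apply A (tproj p v) = blinfun_apply A v"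
  using assms by (simp add: tproj_apply tangent_hom_def blinfun.bilinear_simps)

lemma riesz_op_riesz:
  assumes p: "norm p = 1" and A: "A \<in> tangent_op p"
  shows "riesz_op p (riesz o\<^sub>L A) = A"
  unfolding riesz_op_def
proof (rule the_equality)
  fix L assume L: "L \<in> tangent_op p \<and> (\<forall>v\<in>tangent p. \<forall>w\<in>tangent p.
    blinfun_apply (blinfun_apply (riesz o\<^sub>L A) v) w = blinfun_apply L v \<bullet> w)"
  show "L = A"
  proof (rule blinfun_eqI)
    fix v
    let ?v = "tproj p v" and ?d = "blinfun_apply A (tproj p v) - blinfun_apply L (tproj p v)"
    have t: "?v \<in> tangent p" by (rule tproj_in_tangent[OF p])
    have "blinfun_apply A z \<in> tangent p" "blinfun_apply L z \<in> tangent p" for z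
      using A L by (auto simp: tangent_op_def)
    then have d: "?d \<in> tangent p" by (simp add: tangent_def inner_diff_left)
    have "blinfun_apply (blinfun_apply (riesz o\<^sub>L A) ?v) ?d = blinfun_apply L ?v \<bullet> ?d" using L t d by blast
    then have "?d \<bullet> ?d = 0" by (subst inner_diff_left) simp
    then show "blinfun_apply L v = blinfun_apply A v"
      using A L tangent_op_apply_tproj[of A p v] tangent_op_apply_tproj[of L p v] by (simp add: tangent_op_def)
  qed
qed (use A in auto)

text \<open>A derivative within a subspace says nothing in the normal direction. Precomposition with
  \<open>\<lambda>h. v + tproj p h\<close> yields an ordinary derivative at 0, and membership in
  \<open>tangent_hom p\<close> removes the projection again.\<close>

lemma tangent_derivative_unique:
  fixes F :: "'h::real_inner \<Rightarrow> 'b::real_normed_vector"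
  assumes p: "norm p = 1" and v: "v \<in> tangent p"
    and L: "(F has_derivative blinfun_apply L) (at v within tangent p)" "L \<in> tangent_hom p"
    and L': "(F has_derivative blinfun_apply L') (at v within tangent p)" "L' \<in> tangent_hom p"
  shows "L = L'"
proof -
  have *: "((\<lambda>h. F (v + tproj p h)) has_derivative blinfun_apply L) (at 0)"
    if L: "(F has_derivative blinfun_apply L) (at v within tangent p)" "L \<in> tangent_hom p" for L
  proof -
    have "range (\<lambda>h. v + tproj p h) \<subseteq> tangent p"
      using v tproj_in_tangent[OF p] by (auto simp: tangent_def inner_add_left)
    then have "(F has_derivative blinfun_apply L) (at (v + tproj p 0) within range (\<lambda>h. v + tproj p h))"
      using L(1) by (auto intro: has_derivative_subset simp: blinfun.zero_right)
    moreover have "((\<lambda>h. v + tproj p h) has_derivative (\<lambda>h. tproj p h)) (at 0)"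
      by (auto intro!: derivative_eq_intros)
    ultimately have "((\<lambda>h. F (v + tproj p h)) has_derivative (\<lambda>h. blinfun_apply L (tproj p h))) (at 0)"
      by (rule has_derivative_in_compose[rotated])
    then show ?thesis using L(2) by (simp add: tangent_op_apply_tproj)
  qed
  have "blinfun_apply L = blinfun_apply L'"
    using *[OF L] *[OF L'] by (rule has_derivative_unique)
  then show ?thesis by (simp add: blinfun_apply_inject)
qed

text \<open>Uniqueness is applied twice: first derivatives agree on a small ball of the tangent
  space, so both candidates differentiate the same map at 0.\<close>

lemma has_second_derivative_on_tangent_unique:
  assumes p: "norm p = 1"
    and D: "has_second_derivative_on_tangent p F D" and D': "has_second_derivative_on_tangent p F D'"
  shows "D = D'"
proof -
  from D obtain DF e where DF: "D \<in> tangent_bilin p" "e > 0"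
    "\<And>v. v \<in> tangent p \<Longrightarrow> norm v < e \<Longrightarrow> DF v \<in> tangent_hom p \<and> (F has_derivative blinfun_apply (DF v)) (at v within tangent p)"
    "(DF has_derivative blinfun_apply D) (at 0 within tangent p)"
    unfolding has_second_derivative_on_tangent_def by blast
  from D' obtain DF' e' where DF': "D' \<in> tangent_bilin p" "e' > 0"
    "\<And>v. v \<in> tangent p \<Longrightarrow> norm v < e' \<Longrightarrow> DF' v \<in> tangent_hom p \<and> (F has_derivative blinfun_apply (DF' v)) (at v within tangent p)"
    "(DF' has_derivative blinfun_apply D') (at 0 within tangent p)"
    unfolding has_second_derivative_on_tangent_def by blast
  have eq: "DF' v = DF v" if "v \<in> tangent p" "dist v 0 < min e e'" for v
    using DF(3)[of v] DF'(3)[of v] that tangent_derivative_unique[OF p, of v F "DF' v" "DF v"] by simp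
  have 0: "0 \<in> tangent p" by (simp add: tangent_def)
  have "(DF has_derivative blinfun_apply D') (at 0 within tangent p)"
    by (rule has_derivative_transform_within[OF DF'(4) _ 0, of "min e e'"]) (use DF(2) DF'(2) eq in auto)
  then show ?thesis
    using DF(1,4) DF'(1) by (intro tangent_derivative_unique[OF p 0]) (auto simp: tangent_bilin_def)
qed

text \<open>The norm is not differentiable at 0, but a vanishing slope of \<open>\<phi>\<close>
  makes the difference quotient tend to 0 in every direction.\<close>

lemma has_derivative_radial:
  fixes \<phi> :: "real \<Rightarrow> real"
  assumes "(\<phi> has_real_derivative 0) (at 0)"
  shows "((\<lambda>v::'h::real_inner. \<phi> (norm v)) has_derivative (\<lambda>_. 0)) (at 0 within S)"
proof -
  have lim: "((\<lambda>r. (\<phi> r - \<phi> 0) / r) \<longlongrightarrow> 0) (at 0)" using assms by (simp add: has_field_derivative_iff)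
  have "filterlim (\<lambda>v::'h. norm v) (at 0) (at 0)"
    by (auto simp: filterlim_at eventually_at_filter intro!: tendsto_eq_intros)
  then have "((\<lambda>v::'h. (\<phi> (norm v) - \<phi> 0) / norm v) \<longlongrightarrow> 0) (at 0)"
    by (rule filterlim_compose[OF lim])
  then have "((\<lambda>v::'h. \<phi> (norm v)) has_derivative (\<lambda>_. 0)) (at 0)"
    by (simp add: has_derivative_at2)
  then show ?thesis by (rule has_derivative_at_withinI)
qed

text \<open>A product rule at a zero of \<open>f\<close>: there the scalar factor only needs a
  limit, and its own value at 0 is irrelevant.\<close>

lemma has_derivative_scaleR_continuous:
  fixes k :: "'a::real_normed_vector \<Rightarrow> real" and f :: "'a \<Rightarrow> 'b::real_normed_vector"
  assumes f: "bounded_linear f" and k: "(k \<longlongrightarrow> c) (at 0 within S)"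
  shows "((\<lambda>v. k v *\<^sub>R f v) has_derivative (\<lambda>w. c *\<^sub>R f w)) (at 0 within S)"
proof -
  interpret bounded_linear f by fact
  obtain K where K: "K > 0" "\<And>x. norm (f x) \<le> norm x * K" using pos_bounded by blast
  have "((\<lambda>v. (1 / norm (v - 0)) *\<^sub>R (k v *\<^sub>R f v - (k 0 *\<^sub>R f 0 + c *\<^sub>R f (v - 0)))) \<longlongrightarrow> 0) (at 0 within S)"
  proof (rule Lim_null_comparison)
    show "((\<lambda>v. \<bar>k v - c\<bar> * K) \<longlongrightarrow> 0) (at 0 within S)"
      using tendsto_mult_right[OF tendsto_rabs_zero[OF LIM_zero[OF k]], of K] by simp
    have "norm ((1 / norm (v - 0)) *\<^sub>R (k v *\<^sub>R f v - (k 0 *\<^sub>R f 0 + c *\<^sub>R f (v - 0)))) \<le> \<bar>k v - c\<bar> * K" for v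
    proof (cases "v = 0")
      case False
      have "k v *\<^sub>R f v - (k 0 *\<^sub>R f 0 + c *\<^sub>R f (v - 0)) = (k v - c) *\<^sub>R f v" by (simp add: zero scaleR_diff_left)
      then have "norm ((1 / norm (v - 0)) *\<^sub>R (k v *\<^sub>R f v - (k 0 *\<^sub>R f 0 + c *\<^sub>R f (v - 0)))) = \<bar>k v - c\<bar> * (norm (f v) / norm v)" by simp
      also have "\<dots> \<le> \<bar>k v - c\<bar> * K"
        using K(2)[of v] False by (intro mult_left_mono) (auto simp: field_simps)
      finally show ?thesis .
    qed (use K in simp)
    then show "\<forall>\<^sub>F v in at 0 within S. norm ((1 / norm (v - 0)) *\<^sub>R (k v *\<^sub>R f v - (k 0 *\<^sub>R f 0 + c *\<^sub>R f (v - 0)))) \<le> \<bar>k v - c\<bar> * K"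
      by simp
  qed
  moreover have "bounded_linear (\<lambda>w. c *\<^sub>R f w)"
    by (rule bounded_linear_compose[OF bounded_linear_scaleR_right f])
  ultimately show ?thesis by (simp add: has_derivative_within)
qed

definition snc :: "real \<Rightarrow> real" where
  "snc r = (if r = 0 then 1 else sin r / r)"

text \<open>This is the derivative of sin r / r divided by r, so that the gradient of
  \<open>snc (norm v)\<close> is \<open>snc' (norm v)\<close> times \<open>v\<close>; its limit at 0
  is -1/3.\<close>

definition snc' :: "real \<Rightarrow> real" where
  "snc' r = (if r = 0 then - 1/3 else (cos r - sin r / r) / r\<^sup>2)"

lemma snc_derivative_0: "(snc has_real_derivative 0) (at 0)"
proof -
  have "((\<lambda>r::real. (sin r / r - 1) / r) \<longlongrightarrow> 0) (at 0)" by real_asymp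
  then have "((\<lambda>r. (snc r - snc 0) / r) \<longlongrightarrow> 0) (at 0)"
    by (rule Lim_transform_eventually) (auto simp: eventually_at_filter snc_def)
  then show ?thesis by (simp add: has_field_derivative_iff)
qed

lemma snc_isCont_0: "isCont snc 0" "isCont snc' 0"
proof -
  show "isCont snc 0" using snc_derivative_0 by (rule DERIV_isCont)
  have "((\<lambda>r::real. (cos r - sin r / r) / r\<^sup>2) \<longlongrightarrow> - 1/3) (at 0)" by real_asymp
  from isCont_removable[OF this] show "isCont snc' 0" by (simp add: snc'_def[abs_def])
qed

text \<open>The geodesic coordinate \<open>\<langle>x, exp\<^sub>p v\<rangle>\<close>, in terms of \<open>t = \<langle>x, p\<rangle>\<close> and the tangential part \<open>u\<close> of \<open>x\<close>.\<close>

definition geo_coord :: "real \<Rightarrow> 'h::real_inner \<Rightarrow> 'h \<Rightarrow> real" where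
  "geo_coord t u v = t * cos (norm v) + snc (norm v) * (u \<bullet> v)"

lemma geo_coord_eq:
  assumes "v \<in> tangent p"
  shows "x \<bullet> sexp p v = geo_coord (x \<bullet> p) (tproj p x) v"
  using tproj_inner_tangent[OF assms, of x]
  by (cases "v = 0") (auto simp: sexp_def geo_coord_def snc_def inner_add_right mult.commute)

text \<open>Away from 0 this is the chain rule through the norm. At 0 the cosine is radial with
  vanishing slope, and the second term is a continuous factor times a linear map.\<close>

lemma geo_coord_has_derivative:
  "(geo_coord t u has_derivative
     (\<lambda>w. (- t * snc (norm v) + (u \<bullet> v) * snc' (norm v)) * (v \<bullet> w) + snc (norm v) * (u \<bullet> w))) (at v within S)"
proof (cases "v = 0")
  case True
  have c: "((\<lambda>r::real. cos r) has_real_derivative 0) (at 0)" by (auto intro!: derivative_eq_intros)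
  have s: "((\<lambda>v. snc (norm v)) \<longlongrightarrow> snc 0) (at 0 within S)"
    by (rule isCont_tendsto_compose[OF snc_isCont_0(1)]) (auto intro!: tendsto_eq_intros)
  have "((\<lambda>v. t * cos (norm v) + snc (norm v) *\<^sub>R (u \<bullet> v)) has_derivative (\<lambda>w. t * 0 + snc 0 *\<^sub>R (u \<bullet> w))) (at 0 within S)"
    by (intro has_derivative_add has_derivative_mult_right has_derivative_radial[OF c]
        has_derivative_scaleR_continuous[OF bounded_linear_inner_right s])
  then show ?thesis using True by (simp add: geo_coord_def[abs_def] snc_def)
next
  case False
  have n: "(norm has_derivative (\<lambda>w. w \<bullet> sgn v)) (at v)" by (rule has_derivative_norm[OF False])
  have "((\<lambda>v. t * cos (norm v) + (sin (norm v) / norm v) * (u \<bullet> v)) has_derivative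
     (\<lambda>w. (- t * snc (norm v) + (u \<bullet> v) * snc' (norm v)) * (v \<bullet> w) + snc (norm v) * (u \<bullet> w))) (at v)"
    using False
    by (auto intro!: derivative_eq_intros n
        simp: snc_def snc'_def fun_eq_iff sgn_div_norm inner_commute field_simps power2_eq_square)
  then have "(geo_coord t u has_derivative
     (\<lambda>w. (- t * snc (norm v) + (u \<bullet> v) * snc' (norm v)) * (v \<bullet> w) + snc (norm v) * (u \<bullet> w))) (at v)"
    by (rule has_derivative_transform_within[where d = "norm v"])
       (use False in \<open>auto simp: geo_coord_def snc_def dist_norm\<close>)
  then show ?thesis by (rule has_derivative_at_withinI)
qed

section \<open>Inner products of unit vectors\<close>

lemma inner_sphere_bounds:
  assumes "norm x = 1" "norm y = 1"
  shows "- 1 \<le> x \<bullet> y" "x \<bullet> y \<le> 1"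
  using Cauchy_Schwarz_ineq2[of x y] assms by (auto simp: abs_le_iff)

lemma norm_diff_sphere:
  assumes "norm x = 1" "norm y = 1"
  shows "(norm (x - y))\<^sup>2 = 2 - 2 * (x \<bullet> y)"
  using assms by (simp add: power2_norm_eq_inner inner_diff_left inner_diff_right inner_commute norm_eq_1)

lemma inner_sphere_eq_1:
  assumes "norm x = 1" "norm y = 1" "x \<bullet> y = 1"
  shows "x = y"
  using norm_diff_sphere[OF assms(1,2)] assms(3) by simp

lemma inner_sphere_eq_minus_1:
  assumes "norm x = 1" "norm y = 1" "x \<bullet> y = - 1"
  shows "x = - y"
  using inner_sphere_eq_1[of x "- y"] assms by simp

lemma inner_sphere_gt_minus_1:
  assumes "norm x = 1" "norm y = 1" "x \<noteq> - y"
  shows "- 1 < x \<bullet> y"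
  using inner_sphere_eq_minus_1[OF assms(1,2)] inner_sphere_bounds(1)[OF assms(1,2)] assms(3) by linarith

text \<open>Here the geodesic coordinate reaches 1, where the chain rule through arccos fails;
  instead the squared distance is \<open>v \<bullet> v\<close> exactly, for
  \<open>norm v < pi\<close>.\<close>

lemma has_second_derivative_rho2_self:
  assumes p: "norm p = 1"
  shows "has_second_derivative_on_tangent p (\<lambda>v. (rho p (sexp p v))\<^sup>2) (riesz o\<^sub>L Hess p p)"
  unfolding has_second_derivative_on_tangent_def
proof (intro conjI exI[of _ "\<lambda>v. 2 *\<^sub>R blinfun_apply riesz (tproj p v)"] exI[of _ pi] ballI impI)
  have pp: "p \<bullet> p = 1" using p by (simp add: norm_eq_1)
  have H: "Hess p p = 2 *\<^sub>R tproj p"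
    using p pp by (simp add: Hess_def tproj_self bounded_bilinear.zero_left[OF bounded_bilinear_tensor])
  show "riesz o\<^sub>L Hess p p \<in> tangent_bilin p"
    using p tproj_in_tangent[OF p]
    by (auto simp: tangent_bilin_def tangent_hom_def tangent_def H blinfun.bilinear_simps tproj_self)
  have "((\<lambda>v. 2 *\<^sub>R blinfun_apply riesz (tproj p v)) has_derivative (\<lambda>v. 2 *\<^sub>R blinfun_apply riesz (tproj p v))) (at 0 within tangent p)"
    by (auto intro!: derivative_eq_intros)
  then show "((\<lambda>v. 2 *\<^sub>R blinfun_apply riesz (tproj p v)) has_derivative blinfun_apply (riesz o\<^sub>L Hess p p)) (at 0 within tangent p)"
    by (rule has_derivative_eq_rhs) (auto simp: H blinfun.bilinear_simps)
  fix v assume v: "v \<in> tangent p" "norm v < pi"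
  show "2 *\<^sub>R blinfun_apply riesz (tproj p v) \<in> tangent_hom p"
    using tproj_in_tangent[OF p, of v] by (simp add: tangent_hom_def blinfun.bilinear_simps tangent_def)
  have "((\<lambda>v. v \<bullet> v) has_derivative (\<lambda>w. v \<bullet> w + w \<bullet> v)) (at v within tangent p)"
    by (auto intro!: derivative_eq_intros)
  then have "((\<lambda>v. v \<bullet> v) has_derivative blinfun_apply (2 *\<^sub>R blinfun_apply riesz (tproj p v))) (at v within tangent p)"
    by (rule has_derivative_eq_rhs) (auto simp: blinfun.bilinear_simps tproj_tangent[OF v(1)] inner_commute)
  then show "((\<lambda>v. (rho p (sexp p v))\<^sup>2) has_derivative blinfun_apply (2 *\<^sub>R blinfun_apply riesz (tproj p v))) (at v within tangent p)"
  proof (rule has_derivative_transform_within[OF _ _ v(1), where d = "pi - norm v"])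
    fix w assume w: "w \<in> tangent p" "dist w v < pi - norm v"
    have "norm w \<le> norm v + norm (w - v)" by (metis add.commute diff_add_cancel norm_triangle_ineq)
    then have "norm w < pi" using w(2) by (simp add: dist_norm)
    moreover have "p \<bullet> sexp p w = cos (norm w)"
      using w(1) pp by (simp add: sexp_def inner_add_right tangent_def inner_commute)
    ultimately show "w \<bullet> w = (rho p (sexp p w))\<^sup>2"
      by (simp add: rho_def arccos_cos power2_norm_eq_inner)
  qed (use v in simp)
qed simp

text \<open>Near 0 the geodesic coordinate stays inside (-1, 1), so the chain rule through
  \<open>arccos\<^sup>2\<close> applies on a small ball of tangent vectors.\<close>

lemma has_second_derivative_rho2_other:
  assumes p: "norm p = 1" and t: "- 1 < x \<bullet> p" "x \<bullet> p < 1"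
  shows "has_second_derivative_on_tangent p (\<lambda>v. (rho x (sexp p v))\<^sup>2) (riesz o\<^sub>L Hess p x)"
proof -
  define t where "t = x \<bullet> p"
  define u where "u = tproj p x"
  define c where "c = geo_coord t u"
  define a where "a v = - t * snc (norm v) + (u \<bullet> v) * snc' (norm v)" for v
  \<comment> \<open>The projection in the first term keeps the form in \<open>tangent_hom p\<close>.
    That term is a scalar times a map vanishing at 0, so its derivative needs only a limit of the
    scalar; the second has a fixed vector, so its scalar is differentiated.\<close>
  define DF where "DF v = (- 2 * ag (c v) * a v) *\<^sub>R blinfun_apply riesz (tproj p v) + (- 2 * ag (c v) * snc (norm v)) *\<^sub>R blinfun_apply riesz u" for v
  have t1: "- 1 < t" "t < 1" using assms by (auto simp: t_def)
  have up: "u \<bullet> p = 0" using tproj_in_tangent[OF p, of x] by (simp add: u_def tangent_def)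
  have c0: "c 0 = t" by (simp add: c_def geo_coord_def)
  have cd: "(c has_derivative (\<lambda>w. a v * (v \<bullet> w) + snc (norm v) * (u \<bullet> w))) (at v within S)" for v S
    unfolding c_def a_def by (rule geo_coord_has_derivative)
  have cd0: "(c has_derivative (\<lambda>w. u \<bullet> w)) (at 0 within S)" for S
    using cd[of 0 S] by (simp add: snc_def)
  have cc: "isCont c 0" using cd0[of UNIV] has_derivative_continuous by blast
  have "\<forall>\<^sub>F v in nhds 0. c v \<in> {-1<..<1}"
  proof -
    have "(c \<longlongrightarrow> c 0) (nhds 0)" using cc unfolding isCont_def tendsto_at_iff_tendsto_nhds .
    then have "(c \<longlongrightarrow> t) (nhds 0)" by (simp only: c0)
    from eventually_conj[OF order_tendstoD(1)[OF this t1(1)] order_tendstoD(2)[OF this t1(2)]]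
    show ?thesis by simp
  qed
  then obtain e where e: "e > 0" "\<And>v. norm v < e \<Longrightarrow> - 1 < c v \<and> c v < 1"
    by (auto simp: eventually_nhds_metric)
  have Hb: "riesz o\<^sub>L Hess p x \<in> tangent_bilin p"
    using Hess_tangent_op[OF p, of x]
    by (auto simp: tangent_bilin_def tangent_hom_def tangent_op_def tangent_def blinfun.bilinear_simps)
  have DFt: "DF v \<in> tangent_hom p" for v
    using up tproj_in_tangent[OF p, of v] by (simp add: DF_def tangent_hom_def tangent_def blinfun.bilinear_simps)
  have F: "((\<lambda>v. (rho x (sexp p v))\<^sup>2) has_derivative blinfun_apply (DF v)) (at v within tangent p)"
    if v: "v \<in> tangent p" "norm v < e" for v
  proof -
    have "((\<lambda>s. (arccos s)\<^sup>2) has_derivative (*) (- 2 * ag (c v))) (at (c v))"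
      using arccos_sq_has_derivative_interior[of "c v"] e(2)[OF v(2)] by (simp add: has_field_derivative_def)
    from has_derivative_compose[OF cd this]
    have "((\<lambda>v. (arccos (c v))\<^sup>2) has_derivative (\<lambda>w. - 2 * ag (c v) * (a v * (v \<bullet> w) + snc (norm v) * (u \<bullet> w)))) (at v within tangent p)" .
    moreover have "(\<lambda>w. - 2 * ag (c v) * (a v * (v \<bullet> w) + snc (norm v) * (u \<bullet> w))) = blinfun_apply (DF v)"
      by (auto simp: DF_def blinfun.bilinear_simps tproj_tangent[OF v(1)] algebra_simps)
    ultimately have "((\<lambda>v. (arccos (c v))\<^sup>2) has_derivative blinfun_apply (DF v)) (at v within tangent p)" by simp
    then show ?thesis
      by (rule has_derivative_transform_within[OF _ zero_less_one v(1)])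
         (simp add: rho_def geo_coord_eq c_def t_def u_def)
  qed
  have snc_lim: "((\<lambda>v::'a. snc (norm v)) \<longlongrightarrow> 1) (at 0 within tangent p)" "((\<lambda>v::'a. snc' (norm v)) \<longlongrightarrow> - 1/3) (at 0 within tangent p)"
  proof -
    have n: "((\<lambda>v::'a. norm v) \<longlongrightarrow> 0) (at 0 within tangent p)" by (auto intro!: tendsto_eq_intros)
    show "((\<lambda>v::'a. snc (norm v)) \<longlongrightarrow> 1) (at 0 within tangent p)" "((\<lambda>v::'a. snc' (norm v)) \<longlongrightarrow> - 1/3) (at 0 within tangent p)"
      using isCont_tendsto_compose[OF snc_isCont_0(1) n] isCont_tendsto_compose[OF snc_isCont_0(2) n]
      by (simp_all add: snc_def snc'_def)
  qed
  have agc: "((\<lambda>v. ag (c v)) has_derivative (\<lambda>w. - akap t * (u \<bullet> w))) (at 0 within tangent p)"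
  proof -
    have "(ag has_derivative (*) (- akap t)) (at (c 0))"
      using ag_has_derivative_interior[OF t1] by (simp add: has_field_derivative_def c0)
    from has_derivative_compose[OF cd0 this] show ?thesis .
  qed
  have agl: "((\<lambda>v. ag (c v)) \<longlongrightarrow> ag t) (at 0 within tangent p)"
    using has_derivative_continuous[OF agc] by (simp add: continuous_within c0)
  have al: "((\<lambda>v. - 2 * ag (c v) * a v) \<longlongrightarrow> - 2 * ag t * (- t * 1 + (u \<bullet> 0) * (- 1/3))) (at 0 within tangent p)"
    unfolding a_def by (intro tendsto_intros agl snc_lim)
  have d1: "((\<lambda>v. (- 2 * ag (c v) * a v) *\<^sub>R blinfun_apply riesz (tproj p v)) has_derivative
      (\<lambda>w. (- 2 * ag t * (- t * 1 + (u \<bullet> 0) * (- 1/3))) *\<^sub>R blinfun_apply riesz (tproj p w))) (at 0 within tangent p)"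
    by (rule has_derivative_scaleR_continuous[OF _ al]) (intro bounded_linear_intros)
  have snc_0: "snc 0 = 1" by (simp add: snc_def)
  have d2: "((\<lambda>v. (- 2 * ag (c v) * snc (norm v)) *\<^sub>R blinfun_apply riesz u) has_derivative
      (\<lambda>w. (2 * akap t * (u \<bullet> w)) *\<^sub>R blinfun_apply riesz u)) (at 0 within tangent p)"
    by (auto intro!: derivative_eq_intros agc has_derivative_radial[OF snc_derivative_0] simp: snc_0)
  have "(DF has_derivative blinfun_apply (riesz o\<^sub>L Hess p x)) (at 0 within tangent p)"
    unfolding DF_def
  proof (rule has_derivative_eq_rhs[OF has_derivative_add[OF d1 d2]])
    show "(\<lambda>w. (- 2 * ag t * (- t * 1 + (u \<bullet> 0) * (- 1/3))) *\<^sub>R blinfun_apply riesz (tproj p w) + (2 * akap t * (u \<bullet> w)) *\<^sub>R blinfun_apply riesz u)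
      = blinfun_apply (riesz o\<^sub>L Hess p x)"
      by (auto intro!: blinfun_eqI simp: Hess_apply blinfun.bilinear_simps t_def[symmetric] u_def[symmetric] algebra_simps)
  qed
  then show ?thesis
    unfolding has_second_derivative_on_tangent_def using Hb DFt F e(1) by blast
qed

lemma D2_rho2_eq:
  assumes p: "norm p = 1" and x: "norm x = 1" and "x \<noteq> - p"
  shows "D2_rho2 p x = riesz o\<^sub>L Hess p x"
proof -
  have "has_second_derivative_on_tangent p (\<lambda>v. (rho x (sexp p v))\<^sup>2) (riesz o\<^sub>L Hess p x)"
  proof (cases "x = p")
    case True then show ?thesis using has_second_derivative_rho2_self[OF p] by simp
  next
    case False
    then have "x \<bullet> p < 1" using inner_sphere_eq_1[OF x p] inner_sphere_bounds[OF x p] by linarith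
    then show ?thesis using inner_sphere_gt_minus_1[OF x p assms(3)] by (intro has_second_derivative_rho2_other[OF p])
  qed
  then show ?thesis unfolding D2_rho2_def
    by (intro the_equality) (auto intro: has_second_derivative_on_tangent_unique[OF p])
qed

lemma Lambda_pt_eq:
  assumes "norm p = 1" "norm x = 1" "x \<noteq> - p"
  shows "Lambda_pt p x = Hess p x"
  unfolding Lambda_pt_def D2_rho2_eq[OF assms] by (rule riesz_op_riesz[OF assms(1) Hess_tangent_op[OF assms(1)]])

section \<open>Transported logarithms\<close>

lemma slog_eq_ag:
  assumes "norm p = 1" "norm x = 1"
  shows "slog p x = ag (p \<bullet> x) *\<^sub>R (x - (p \<bullet> x) *\<^sub>R p)"
proof (cases "p \<bullet> x = 1")
  case True
  then show ?thesis using inner_sphere_eq_1[OF assms] by (simp add: slog_def Let_def)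
next
  case False
  have "(norm (x - (p \<bullet> x) *\<^sub>R p))\<^sup>2 = 1 - (p \<bullet> x)\<^sup>2"
    unfolding power2_norm_eq_inner
    using assms by (simp add: inner_diff_left inner_diff_right inner_commute norm_eq_1 power2_eq_square)
  then have "norm (x - (p \<bullet> x) *\<^sub>R p) = sqrt (1 - (p \<bullet> x)\<^sup>2)" by (metis norm_ge_zero real_sqrt_unique)
  then show ?thesis using False by (simp add: slog_def Let_def ag_def)
qed

lemma slog_norm_le:
  assumes "norm p = 1" "norm x = 1"
  shows "norm (slog p x) \<le> pi"
proof -
  have "\<bar>arccos (p \<bullet> x)\<bar> \<le> pi"
    using inner_sphere_bounds[OF assms] arccos_lbound arccos_ubound by (auto simp: abs_le_iff intro: order_trans)
  moreover have "norm ((a / norm u) *\<^sub>R u) \<le> \<bar>a\<bar>" for a and u :: 'a by (cases "u = 0") auto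
  ultimately show ?thesis unfolding slog_def Let_def by (meson order_trans)
qed

lemma slog_tangent: "norm p = 1 \<Longrightarrow> slog p x \<in> tangent p"
  by (simp add: slog_def Let_def tangent_def inner_diff_left inner_commute[of x p] norm_eq_1)

text \<open>The identity |p + q|^2 = 2 (1 + p \<bullet> q) cancels the denominator. At antipodes
  division by 0 returns \<open>w\<close> itself. The bound serves only far from
  \<open>\<mu>\<close>, where the constant does not matter.\<close>

lemma ptransport_norm_le:
  assumes p: "norm p = 1" and q: "norm q = 1" and w: "w \<in> tangent p"
  shows "norm (ptransport p q w) \<le> 3 * norm w"
proof (cases "p \<bullet> q = - 1")
  case True
  then show ?thesis by (simp add: ptransport_def)
next
  case False
  then have pos: "0 < 1 + p \<bullet> q" using inner_sphere_bounds[OF p q] by linarith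
  have s: "(norm (p + q))\<^sup>2 = 2 * (1 + p \<bullet> q)"
    using p q by (simp add: power2_norm_eq_inner inner_add_left inner_add_right inner_commute norm_eq_1)
  have "\<bar>w \<bullet> q\<bar> = \<bar>w \<bullet> (p + q)\<bar>" using w by (simp add: tangent_def inner_add_right)
  also have "\<dots> \<le> norm w * norm (p + q)" by (rule Cauchy_Schwarz_ineq2)
  finally have "\<bar>w \<bullet> q\<bar> * norm (p + q) \<le> norm w * norm (p + q) * norm (p + q)" by (intro mult_right_mono) auto
  also have "\<dots> = (2 * norm w) * (1 + p \<bullet> q)" using s by (simp add: power2_eq_square)
  finally have "(\<bar>w \<bullet> q\<bar> * norm (p + q)) / (1 + p \<bullet> q) \<le> 2 * norm w" using pos by (simp add: field_simps)
  then have "norm (((w \<bullet> q) / (1 + p \<bullet> q)) *\<^sub>R (p + q)) \<le> 2 * norm w" using pos by simp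
  then show ?thesis
    unfolding ptransport_def using norm_triangle_ineq4[of w "((w \<bullet> q) / (1 + p \<bullet> q)) *\<^sub>R (p + q)"] by linarith
qed

text \<open>The logarithm at \<open>\<mu>\<close> is orthogonal to \<open>\<mu>\<close>, so
  variations of the denominator and of \<open>p + \<mu>\<close> drop out; transport contributes just
  the projection of the derivative of the logarithm.\<close>

lemma ptransport_slog_has_derivative:
  assumes m: "norm \<mu> = 1" and x: "norm x = 1" and "x \<noteq> - \<mu>"
  shows "((\<lambda>p. ptransport p \<mu> (slog p x)) has_derivative
    (\<lambda>w. - (akap (\<mu> \<bullet> x) * (w \<bullet> x)) *\<^sub>R tproj \<mu> x - (ag (\<mu> \<bullet> x) * (\<mu> \<bullet> x)) *\<^sub>R tproj \<mu> w)) (at \<mu> within sphere 0 1)"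
proof -
  define t where "t = \<mu> \<bullet> x"
  have mm: "\<mu> \<bullet> \<mu> = 1" using m by (simp add: norm_eq_1)
  have t: "t \<in> {-1<..1}"
    using inner_sphere_gt_minus_1[OF x m assms(3)] inner_sphere_bounds[OF x m] by (simp add: t_def inner_commute)
  have mS: "\<mu> \<in> sphere 0 1 \<inter> {p. p \<noteq> - x}" using m assms(3) by auto
  \<comment> \<open>Removing \<open>- x\<close> keeps the inner product with \<open>x\<close> above
    -1; since \<open>\<mu>\<close> differs from \<open>- x\<close>, the filter at
    \<open>\<mu>\<close> is unchanged.\<close>
  define S where "S = sphere 0 1 \<inter> {p. p \<noteq> - x}"
  have "(ag has_derivative (*) (- akap t)) (at (\<mu> \<bullet> x) within (\<lambda>p. p \<bullet> x) ` S)"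
  proof (rule has_derivative_subset)
    show "(ag has_derivative (*) (- akap t)) (at (\<mu> \<bullet> x) within {-1<..1})"
      using ag_has_derivative_within[OF t] by (simp add: has_field_derivative_def t_def)
    show "(\<lambda>p. p \<bullet> x) ` S \<subseteq> {-1<..1}"
      using inner_sphere_gt_minus_1[of _ x] inner_sphere_bounds[of _ x] x by (auto simp: S_def)
  qed
  moreover have "((\<lambda>p. p \<bullet> x) has_derivative (\<lambda>w. w \<bullet> x)) (at \<mu> within S)"
    by (auto intro!: derivative_eq_intros)
  ultimately have agd: "((\<lambda>p. ag (p \<bullet> x)) has_derivative (\<lambda>w. - akap t * (w \<bullet> x))) (at \<mu> within S)"
    by (rule has_derivative_in_compose[rotated])
  define L where "L p = ag (p \<bullet> x) *\<^sub>R (x - (p \<bullet> x) *\<^sub>R p)" for p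
  define L' where "L' w = (- akap t * (w \<bullet> x)) *\<^sub>R (x - t *\<^sub>R \<mu>) - ag t *\<^sub>R ((w \<bullet> x) *\<^sub>R \<mu> + t *\<^sub>R w)" for w
  have Ld: "(L has_derivative L') (at \<mu> within S)"
    unfolding L_def[abs_def] L'_def[abs_def]
    by (auto intro!: derivative_eq_intros agd simp: t_def[symmetric] algebra_simps)
  have L0: "L \<mu> \<bullet> \<mu> = 0" by (simp add: L_def inner_diff_left mm inner_commute[of x \<mu>])
  have "((\<lambda>p. L p - ((L p \<bullet> \<mu>) / (1 + p \<bullet> \<mu>)) *\<^sub>R (p + \<mu>)) has_derivative
      (\<lambda>w. L' w - ((L' w \<bullet> \<mu>) / 2) *\<^sub>R (\<mu> + \<mu>))) (at \<mu> within S)"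
    using mm by (auto intro!: derivative_eq_intros Ld simp: L0)
  then have "((\<lambda>p. L p - ((L p \<bullet> \<mu>) / (1 + p \<bullet> \<mu>)) *\<^sub>R (p + \<mu>)) has_derivative
    (\<lambda>w. - (akap t * (w \<bullet> x)) *\<^sub>R tproj \<mu> x - (ag t * t) *\<^sub>R tproj \<mu> w)) (at \<mu> within S)"
  proof (rule has_derivative_eq_rhs)
    show "(\<lambda>w. L' w - ((L' w \<bullet> \<mu>) / 2) *\<^sub>R (\<mu> + \<mu>)) = (\<lambda>w. - (akap t * (w \<bullet> x)) *\<^sub>R tproj \<mu> x - (ag t * t) *\<^sub>R tproj \<mu> w)"
    proof
      fix w
      have e1: "L' w \<bullet> \<mu> = - ag t * ((w \<bullet> x) + t * (w \<bullet> \<mu>))"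
        by (simp add: L'_def inner_diff_left inner_add_left mm t_def inner_commute[of x \<mu>])
      have e2: "L' w - ((L' w \<bullet> \<mu>) / 2) *\<^sub>R (\<mu> + \<mu>) = L' w - (L' w \<bullet> \<mu>) *\<^sub>R \<mu>"
        by (simp add: scaleR_add_right flip: scaleR_add_left)
      show "L' w - ((L' w \<bullet> \<mu>) / 2) *\<^sub>R (\<mu> + \<mu>) = - (akap t * (w \<bullet> x)) *\<^sub>R tproj \<mu> x - (ag t * t) *\<^sub>R tproj \<mu> w"
        unfolding e2 unfolding e1 by (simp add: L'_def tproj_apply t_def[symmetric] inner_commute[of \<mu> w] algebra_simps)
    qed
  qed
  then have d: "((\<lambda>p. ptransport p \<mu> (slog p x)) has_derivative
    (\<lambda>w. - (akap t * (w \<bullet> x)) *\<^sub>R tproj \<mu> x - (ag t * t) *\<^sub>R tproj \<mu> w)) (at \<mu> within S)"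
    by (rule has_derivative_transform_within[OF _ zero_less_one])
       (use mS x in \<open>auto simp: S_def ptransport_def slog_eq_ag L_def\<close>)
  have "at \<mu> within S = at \<mu> within sphere 0 1"
    by (rule at_within_nhd[of _ "- {- x}"]) (use mS in \<open>auto simp: S_def\<close>)
  then show ?thesis using d by (simp add: t_def)
qed

text \<open>\<open>T\<close> pairs the chord with \<open>x\<close> while the Hessian pairs it with
  the tangential part of \<open>x\<close>; the discrepancy is the normal component of the chord and
  hence quadratic. Away from \<open>\<mu>\<close> everything is bounded and absorbed in
  \<open>C\<close>.\<close>

lemma ptransport_slog_expansion:
  assumes m: "norm \<mu> = 1" and x: "norm x = 1" and "x \<noteq> - \<mu>" and \<eta>: "\<eta> > 0"
  obtains C where "C \<ge> 0" "\<And>p. norm p = 1 \<Longrightarrow>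
    norm (ptransport p \<mu> (slog p x) - slog \<mu> x + (1/2) *\<^sub>R Hess \<mu> x (p - \<mu>)) \<le> \<eta> * norm (p - \<mu>) + C * (norm (p - \<mu>))\<^sup>2"
proof -
  define \<Psi> where "\<Psi> p = ptransport p \<mu> (slog p x) - slog \<mu> x" for p
  define T where "T w = - (akap (\<mu> \<bullet> x) * (w \<bullet> x)) *\<^sub>R tproj \<mu> x - (ag (\<mu> \<bullet> x) * (\<mu> \<bullet> x)) *\<^sub>R tproj \<mu> w" for w
  have mm: "\<mu> \<bullet> \<mu> = 1" using m by (simp add: norm_eq_1)
  have \<Psi>0: "ptransport \<mu> \<mu> (slog \<mu> x) = slog \<mu> x"
    using slog_tangent[OF m, of x] by (simp add: ptransport_def tangent_def)
  obtain d where d: "d > 0" "\<And>p. p \<in> sphere 0 1 \<Longrightarrow> norm (p - \<mu>) < d \<Longrightarrow> norm (\<Psi> p - T (p - \<mu>)) \<le> \<eta> * norm (p - \<mu>)"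
    using ptransport_slog_has_derivative[OF assms(1-3)] \<eta> \<Psi>0
    unfolding has_derivative_within_alt T_def[symmetric] \<Psi>_def by metis
  have TH: "T (p - \<mu>) + (1/2) *\<^sub>R Hess \<mu> x (p - \<mu>) = (akap (\<mu> \<bullet> x) * (\<mu> \<bullet> x) * (norm (p - \<mu>))\<^sup>2 / 2) *\<^sub>R tproj \<mu> x" if "norm p = 1" for p
  proof -
    have "\<mu> \<bullet> (p - \<mu>) = - ((norm (p - \<mu>))\<^sup>2 / 2)"
      using norm_diff_sphere[OF that m] mm inner_diff_right[of \<mu> p \<mu>] inner_commute[of \<mu> p] by linarith
    then have "tproj \<mu> x \<bullet> (p - \<mu>) = (p - \<mu>) \<bullet> x + (\<mu> \<bullet> x) * ((norm (p - \<mu>))\<^sup>2 / 2)"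
      by (simp add: tproj_apply inner_diff_left[of x "(\<mu> \<bullet> x) *\<^sub>R \<mu>" "p - \<mu>"] inner_commute[of x "p - \<mu>"])
    then have "T (p - \<mu>) + (1/2) *\<^sub>R Hess \<mu> x (p - \<mu>)
      = (akap (\<mu> \<bullet> x) * ((p - \<mu>) \<bullet> x + (\<mu> \<bullet> x) * ((norm (p - \<mu>))\<^sup>2 / 2)) - akap (\<mu> \<bullet> x) * ((p - \<mu>) \<bullet> x)) *\<^sub>R tproj \<mu> x"
      unfolding T_def Hess_apply by (simp add: inner_commute[of x \<mu>] scaleR_add_right scaleR_diff_left)
    also have "\<dots> = (akap (\<mu> \<bullet> x) * (\<mu> \<bullet> x) * (norm (p - \<mu>))\<^sup>2 / 2) *\<^sub>R tproj \<mu> x"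
      by (simp add: algebra_simps)
    finally show ?thesis .
  qed
  define A where "A = norm ((akap (\<mu> \<bullet> x) * (\<mu> \<bullet> x) / 2) *\<^sub>R tproj \<mu> x)"
  define H where "H = norm (Hess \<mu> x)"
  \<comment> \<open>\<open>A\<close> covers the normal component near \<open>\<mu>\<close>. The
    value 4 pi bounds the logarithm at \<open>\<mu>\<close> plus three times that at
    \<open>p\<close>, and the last two terms apply where the chord is at least
    \<open>d\<close>.\<close>
  define C where "C = A + 4 * pi / d\<^sup>2 + H / (2 * d)"
  have C: "A \<le> C" "4 * pi / d\<^sup>2 + H / (2 * d) \<le> C" "C \<ge> 0" using d(1) by (auto simp: C_def A_def H_def)
  have "norm (\<Psi> p + (1/2) *\<^sub>R Hess \<mu> x (p - \<mu>)) \<le> \<eta> * norm (p - \<mu>) + C * (norm (p - \<mu>))\<^sup>2" if p: "norm p = 1" for p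
  proof (cases "norm (p - \<mu>) < d")
    case True
    have "\<Psi> p + (1/2) *\<^sub>R Hess \<mu> x (p - \<mu>) = (\<Psi> p - T (p - \<mu>)) + (norm (p - \<mu>))\<^sup>2 *\<^sub>R ((akap (\<mu> \<bullet> x) * (\<mu> \<bullet> x) / 2) *\<^sub>R tproj \<mu> x)"
      using TH[OF p] by (simp add: algebra_simps)
    then have "norm (\<Psi> p + (1/2) *\<^sub>R Hess \<mu> x (p - \<mu>)) \<le> norm (\<Psi> p - T (p - \<mu>)) + (norm (p - \<mu>))\<^sup>2 * A"
      unfolding A_def by (metis norm_triangle_ineq norm_scaleR abs_power2)
    also have "\<dots> \<le> \<eta> * norm (p - \<mu>) + (norm (p - \<mu>))\<^sup>2 * C"
      using d(2)[of p] True p C by (intro add_mono mult_left_mono) auto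
    finally show ?thesis by (simp add: mult.commute)
  next
    case False
    let ?n = "norm (p - \<mu>)"
    have "norm (\<Psi> p) \<le> 4 * pi"
      unfolding \<Psi>_def
      using norm_triangle_ineq4[of "ptransport p \<mu> (slog p x)" "slog \<mu> x"] ptransport_norm_le[OF p m slog_tangent[OF p, of x]]
        slog_norm_le[OF p x] slog_norm_le[OF m x] by linarith
    moreover have "norm ((1/2) *\<^sub>R Hess \<mu> x (p - \<mu>)) \<le> H * ?n / 2"
      using norm_blinfun[of "Hess \<mu> x" "p - \<mu>"] by (simp add: H_def)
    ultimately have "norm (\<Psi> p + (1/2) *\<^sub>R Hess \<mu> x (p - \<mu>)) \<le> 4 * pi + H * ?n / 2"
      using norm_triangle_ineq[of "\<Psi> p" "(1/2) *\<^sub>R Hess \<mu> x (p - \<mu>)"] by linarith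
    also have "\<dots> \<le> (4 * pi / d\<^sup>2) * ?n\<^sup>2 + (H / (2 * d)) * ?n\<^sup>2"
    proof (rule add_mono)
      have "d\<^sup>2 \<le> ?n\<^sup>2" using False d(1) by (intro power_mono) auto
      then have "4 * pi * d\<^sup>2 \<le> 4 * pi * ?n\<^sup>2" by (intro mult_left_mono) auto
      then show "4 * pi \<le> (4 * pi / d\<^sup>2) * ?n\<^sup>2" using d(1) by (simp add: field_simps)
      have "H * ?n * d \<le> H * ?n * ?n" using False by (intro mult_left_mono) (auto simp: H_def)
      then show "H * ?n / 2 \<le> (H / (2 * d)) * ?n\<^sup>2" using d(1) by (simp add: field_simps power2_eq_square)
    qed
    also have "\<dots> = (4 * pi / d\<^sup>2 + H / (2 * d)) * ?n\<^sup>2" by (rule distrib_right[symmetric])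
    also have "\<dots> \<le> C * ?n\<^sup>2" using C by (intro mult_right_mono) auto
    finally show ?thesis using \<eta> by (simp add: add_increasing)
  qed
  then show thesis using that[OF C(3)] by (simp add: \<Psi>_def)
qed

section \<open>Inverses of coercive operators\<close>

text \<open>For small \<open>\<tau>\<close> the map \<open>v \<mapsto> v - \<tau> (A v - y)\<close> is a contraction.\<close>

lemma coercive_surjective:
  fixes A :: "'h::{real_inner, banach} \<Rightarrow>\<^sub>L 'h"
  assumes c: "c > 0" and co: "\<And>v. c * (norm v)\<^sup>2 \<le> A v \<bullet> v"
  shows "\<exists>v. A v = y"
proof -
  define K where "K = max (norm A) c"
  have K: "K > 0" "norm A \<le> K" "c \<le> K" using c by (auto simp: K_def)
  \<comment> \<open>The minimizer of 1 - 2 \<tau> c + \<tau>^2 K^2, with minimum 1 - c^2 / K^2; this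
    is nonnegative as \<open>K\<close> is at least \<open>c\<close>.\<close>
  define \<tau> where "\<tau> = c / K\<^sup>2"
  have tau: "\<tau> > 0" using c K by (simp add: \<tau>_def)
  define q where "q = sqrt (1 - c\<^sup>2 / K\<^sup>2)"
  have ck: "0 < c\<^sup>2 / K\<^sup>2" "c\<^sup>2 / K\<^sup>2 \<le> 1" using c K by (auto intro!: power_mono)
  have q: "0 \<le> q" "q < 1" "q\<^sup>2 = 1 - c\<^sup>2 / K\<^sup>2" using ck by (auto simp: q_def real_sqrt_lt_1_iff)
  have contr: "norm (v - \<tau> *\<^sub>R A v) \<le> q * norm v" for v
  proof (rule power2_le_imp_le)
    have "(norm (v - \<tau> *\<^sub>R A v))\<^sup>2 = (norm v)\<^sup>2 - 2 * \<tau> * (A v \<bullet> v) + \<tau>\<^sup>2 * (norm (A v))\<^sup>2"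
      unfolding power2_norm_eq_inner
      by (simp add: inner_diff_left inner_diff_right inner_commute power2_eq_square)
    also have "\<dots> \<le> (norm v)\<^sup>2 - 2 * \<tau> * (c * (norm v)\<^sup>2) + \<tau>\<^sup>2 * (K * norm v)\<^sup>2"
    proof -
      have "norm (A v) \<le> K * norm v" using norm_blinfun[of A v] mult_right_mono[OF K(2), of "norm v"] by simp
      then have "(norm (A v))\<^sup>2 \<le> (K * norm v)\<^sup>2" by (intro power_mono) auto
      then have "\<tau>\<^sup>2 * (norm (A v))\<^sup>2 \<le> \<tau>\<^sup>2 * (K * norm v)\<^sup>2" by (intro mult_left_mono) auto
      moreover have "2 * \<tau> * (c * (norm v)\<^sup>2) \<le> 2 * \<tau> * (A v \<bullet> v)" using co tau by (intro mult_left_mono) auto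
      ultimately show ?thesis by linarith
    qed
    also have "\<dots> = (q * norm v)\<^sup>2"
    proof -
      have "\<tau>\<^sup>2 * (K * norm v)\<^sup>2 = (c\<^sup>2 / K\<^sup>2) * (norm v)\<^sup>2"
      proof -
        have \<tau>2: "\<tau>\<^sup>2 = c\<^sup>2 / (K\<^sup>2 * K\<^sup>2)" by (simp add: \<tau>_def power_divide power2_eq_square)
        have gen: "x / (a * a) * (a * n) = x / a * n" if "a \<noteq> 0" for x a n :: real
          using that by simp
        show ?thesis unfolding power_mult_distrib \<tau>2 by (rule gen) (use K(1) in simp)
      qed
      moreover have "2 * \<tau> * (c * (norm v)\<^sup>2) = 2 * ((c\<^sup>2 / K\<^sup>2) * (norm v)\<^sup>2)"
        by (simp add: \<tau>_def power2_eq_square[of c])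
      ultimately show ?thesis by (simp add: power_mult_distrib q(3) left_diff_distrib)
    qed
    finally show "(norm (v - \<tau> *\<^sub>R A v))\<^sup>2 \<le> (q * norm v)\<^sup>2" .
  qed (use q in simp)
  have "\<exists>!v. v - \<tau> *\<^sub>R (A v - y) = v"
  proof (rule banach_fix_type[OF q(1,2)])
    show "\<forall>v w. dist (v - \<tau> *\<^sub>R (A v - y)) (w - \<tau> *\<^sub>R (A w - y)) \<le> q * dist v w"
    proof (intro allI)
      fix v w
      have eq: "(v - \<tau> *\<^sub>R (A v - y)) - (w - \<tau> *\<^sub>R (A w - y)) = (v - w) - \<tau> *\<^sub>R A (v - w)"
        by (simp add: blinfun.bilinear_simps algebra_simps)
      show "dist (v - \<tau> *\<^sub>R (A v - y)) (w - \<tau> *\<^sub>R (A w - y)) \<le> q * dist v w"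
        unfolding dist_norm eq by (rule contr)
    qed
  qed
  then obtain v where "v - \<tau> *\<^sub>R (A v - y) = v" by blast
  then have "\<tau> *\<^sub>R (A v - y) = 0" by simp
  then show ?thesis using tau by auto
qed

text \<open>Coercivity bounds the norm of \<open>A v\<close> below by c |v|, which gives injectivity
  and a bound 1 / c for the inverse.\<close>

lemma coercive_inverse:
  fixes A :: "'h::{real_inner, banach} \<Rightarrow>\<^sub>L 'h"
  assumes c: "c > 0" and co: "\<And>v. c * (norm v)\<^sup>2 \<le> A v \<bullet> v"
  obtains B where "\<And>v. blinfun_apply A (blinfun_apply B v) = v" "\<And>v. blinfun_apply B (blinfun_apply A v) = v"
proof -
  have lower: "c * norm v \<le> norm (A v)" for v
  proof (cases "v = 0")
    case False
    have "c * norm v * norm v \<le> norm (A v) * norm v"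
      using co[of v] norm_cauchy_schwarz[of "A v" v] by (simp add: power2_eq_square mult.assoc)
    then show ?thesis using False by simp
  qed simp
  have inj: "v = w" if "blinfun_apply A v = blinfun_apply A w" for v w
    using lower[of "v - w"] that c by (simp add: blinfun.bilinear_simps mult_le_0_iff)
  define b where "b y = (SOME v. A v = y)" for y
  have Ab: "A (b y) = y" for y unfolding b_def by (rule someI_ex[OF coercive_surjective[OF c co]])
  have bl: "bounded_linear b"
  proof (rule bounded_linear_intro[where K = "1 / c"])
    show "b (x + y) = b x + b y" for x y by (rule inj) (simp add: Ab blinfun.bilinear_simps)
    show "b (r *\<^sub>R x) = r *\<^sub>R b x" for r x by (rule inj) (simp add: Ab blinfun.bilinear_simps)
    show "norm (b x) \<le> norm x * (1 / c)" for x using lower[of "b x"] c by (simp add: Ab field_simps)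
  qed
  show thesis
  proof (rule that[of "Blinfun b"])
    show "blinfun_apply A (blinfun_apply (Blinfun b) v) = v" for v by (simp add: bounded_linear_Blinfun_apply[OF bl] Ab)
    show "blinfun_apply (Blinfun b) (blinfun_apply A v) = v" for v
      by (rule inj) (simp add: bounded_linear_Blinfun_apply[OF bl] Ab)
  qed
qed

text \<open>Adding c times the projection onto \<open>p\<close> makes the operator coercive on the
  whole space with the same constant. Its inverse preserves the tangent space, and composing it with
  \<open>tproj p\<close> gives the representative that vanishes at \<open>p\<close>.\<close>

lemma tangent_inverse_coercive:
  fixes A :: "'h::{real_inner, banach} \<Rightarrow>\<^sub>L 'h"
  assumes p: "norm p = 1" and A: "A \<in> tangent_op p" and c: "c > 0"
    and co: "\<And>v. v \<in> tangent p \<Longrightarrow> c * (norm v)\<^sup>2 \<le> A v \<bullet> v"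
  shows "tangent_inverse p A \<in> tangent_op p"
    and "\<And>v. v \<in> tangent p \<Longrightarrow> blinfun_apply A (blinfun_apply (tangent_inverse p A) v) = v"
    and "\<And>v. v \<in> tangent p \<Longrightarrow> blinfun_apply (tangent_inverse p A) (blinfun_apply A v) = v"
proof -
  have pp: "p \<bullet> p = 1" using p by (simp add: norm_eq_1)
  have Ap: "A p = 0" and At: "\<And>v. A v \<bullet> p = 0"
    using A by (auto simp: tangent_op_def tangent_hom_def tangent_def)
  define A' where "A' = A + c *\<^sub>R tensor p p"
  have A'_apply: "A' v = A v + (c * (p \<bullet> v)) *\<^sub>R p" for v by (simp add: A'_def blinfun.bilinear_simps)
  have "c * (norm v)\<^sup>2 \<le> A' v \<bullet> v" for v
  proof -
    let ?w = "tproj p v"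
    have w: "?w \<in> tangent p" by (rule tproj_in_tangent[OF p])
    have v: "v = ?w + (p \<bullet> v) *\<^sub>R p" by (simp add: tproj_apply)
    have wp: "?w \<bullet> p = 0" "p \<bullet> ?w = 0" using w by (auto simp: tangent_def inner_commute)
    have "(norm v)\<^sup>2 = (norm ?w)\<^sup>2 + (p \<bullet> v)\<^sup>2"
      unfolding power2_norm_eq_inner
      by (subst (1 2) v) (simp add: inner_add_left inner_add_right wp pp power2_eq_square)
    moreover have "A v = A ?w" using A tangent_op_apply_tproj[of A p v] by (simp add: tangent_op_def)
    then have "A v \<bullet> v = A ?w \<bullet> ?w" using At[of ?w] by (subst (2) v) (simp add: inner_add_right)
    then have "A' v \<bullet> v = A ?w \<bullet> ?w + c * (p \<bullet> v)\<^sup>2" by (simp add: A'_apply inner_add_left power2_eq_square)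
    ultimately show ?thesis using co[OF w] by (simp add: distrib_left)
  qed
  then obtain B where B: "\<And>v. blinfun_apply A' (blinfun_apply B v) = v" "\<And>v. blinfun_apply B (blinfun_apply A' v) = v"
    using coercive_inverse[OF c, of A'] by blast
  have Bt: "B v \<in> tangent p" if "v \<in> tangent p" for v
  proof -
    have "0 = A' (B v) \<bullet> p" using B(1)[of v] that by (simp add: tangent_def)
    also have "\<dots> = c * (p \<bullet> B v)" by (simp add: A'_apply inner_add_left At pp)
    finally show ?thesis using c by (simp add: tangent_def inner_commute)
  qed
  have A'A: "A' v = A v" if "v \<in> tangent p" for v using that by (simp add: A'_apply tangent_def inner_commute)
  define B' where "B' = B o\<^sub>L tproj p"
  have B': "B' \<in> tangent_op p"
    using Bt tproj_in_tangent[OF p] by (auto simp: B'_def tangent_op_def tangent_hom_def tproj_self[OF p] blinfun.bilinear_simps)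
  have AB: "A (B' v) = v" if "v \<in> tangent p" for v
    using B(1)[of v] A'A[OF Bt[OF that]] that by (simp add: B'_def tproj_tangent)
  have BA: "B' (A v) = v" if "v \<in> tangent p" for v
  proof -
    have "A v \<in> tangent p" using At by (simp add: tangent_def)
    then show ?thesis using B(2)[of v] A'A[OF that] by (simp add: B'_def tproj_tangent)
  qed
  have "tangent_inverse p A = B'"
    unfolding tangent_inverse_def
  proof (rule the_equality)
    fix C assume C: "C \<in> tangent_op p \<and> (\<forall>v\<in>tangent p. A (blinfun_apply C v) = v \<and> blinfun_apply C (A v) = v)"
    show "C = B'"
    proof (rule blinfun_eqI)
      fix v
      have w: "tproj p v \<in> tangent p" by (rule tproj_in_tangent[OF p])
      have "B' (tproj p v) \<in> tangent p" using B' by (auto simp: tangent_op_def)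
      then have "C (A (B' (tproj p v))) = B' (tproj p v)" using C by blast
      then have "C (tproj p v) = B' (tproj p v)" by (simp add: AB[OF w])
      then show "blinfun_apply C v = blinfun_apply B' v"
        using C B' tangent_op_apply_tproj[of C p v] tangent_op_apply_tproj[of B' p v] by (simp add: tangent_op_def)
    qed
  qed (use B' AB BA in auto)
  then show "tangent_inverse p A \<in> tangent_op p"
    "\<And>v. v \<in> tangent p \<Longrightarrow> blinfun_apply A (blinfun_apply (tangent_inverse p A) v) = v"
    "\<And>v. v \<in> tangent p \<Longrightarrow> blinfun_apply (tangent_inverse p A) (blinfun_apply A v) = v"
    using B' AB BA by auto
qed

section \<open>First-order condition and stability of intrinsic means\<close>

text \<open>Under the support condition only arguments in \<open>[0, 1]\<close> matter; clamping to that interval makes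
  the functions continuous on the whole line.\<close>

definition unit_clamp :: "real \<Rightarrow> real" where
  "unit_clamp t = max 0 (min 1 t)"

definition agc :: "real \<Rightarrow> real" where
  "agc t = ag (unit_clamp t)"

definition akc :: "real \<Rightarrow> real" where
  "akc t = akap (unit_clamp t)"

lemma unit_clamp_id: "0 \<le> t \<Longrightarrow> t \<le> 1 \<Longrightarrow> unit_clamp t = t"
  by (simp add: unit_clamp_def)

lemma unit_clamp_range: "0 \<le> unit_clamp t" "unit_clamp t \<le> 1"
  by (auto simp: unit_clamp_def)

lemma continuous_on_clamped:
  assumes "continuous_on {-1<..1} f"
  shows "continuous_on UNIV (\<lambda>t. f (unit_clamp t))"
proof (rule continuous_on_compose2[OF assms])
  show "continuous_on UNIV unit_clamp" unfolding unit_clamp_def by (intro continuous_intros)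
  show "range unit_clamp \<subseteq> {-1<..1}"
    using unit_clamp_range by (force intro: less_le_trans[of "-1" 0])
qed

lemma continuous_on_agc: "continuous_on UNIV agc" and continuous_on_akc: "continuous_on UNIV akc"
  unfolding agc_def[abs_def] akc_def[abs_def]
  by (intro continuous_on_clamped continuous_on_ag continuous_on_akap)+

lemma agc_measurable [measurable]: "agc \<in> borel_measurable borel"
  by (rule borel_measurable_continuous_onI[OF continuous_on_agc])

lemma agc_bounds: "1 \<le> agc t" "agc t \<le> 2"
proof -
  have "- 1 < unit_clamp t" using unit_clamp_range(1)[of t] by linarith
  then show "1 \<le> agc t" "agc t \<le> 2"
    using unit_clamp_range[of t] by (auto simp: agc_def intro: ag_ge_1 ag_le_2)
qed

lemma agc_eq: "0 \<le> t \<Longrightarrow> t \<le> 1 \<Longrightarrow> agc t = ag t"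
  by (simp add: agc_def unit_clamp_id)

lemma akc_eq: "0 \<le> t \<Longrightarrow> t \<le> 1 \<Longrightarrow> akc t = akap t"
  by (simp add: akc_def unit_clamp_id)

text \<open>Kept free of the sampling model: it is used both for the population and for the uniform
  law on the indices of a sample.\<close>

locale sphere_variable = prob_space Q for Q :: "'w measure" +
  fixes Y :: "'w \<Rightarrow> 'h::{real_inner, banach, second_countable_topology}"
  assumes Y [measurable]: "Y \<in> borel_measurable Q"
    and norm_Y: "\<omega> \<in> space Q \<Longrightarrow> norm (Y \<omega>) = 1"
begin

text \<open>Where the inner products lie in [0, 1], this is -1/2 times the ambient gradient of the
  mean squared distance.\<close>

definition grad :: "'h \<Rightarrow> 'h" where
  "grad p = (\<integral>\<omega>. agc (Y \<omega> \<bullet> p) *\<^sub>R Y \<omega> \<partial>Q)"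

lemma integrable_Y: "integrable Q Y"
  using norm_Y by (intro integrable_const_bound[of _ 1]) auto

lemma integrable_grad: "integrable Q (\<lambda>\<omega>. agc (Y \<omega> \<bullet> p) *\<^sub>R Y \<omega>)"
proof (rule integrable_const_bound[of _ 2])
  show "AE \<omega> in Q. norm (agc (Y \<omega> \<bullet> p) *\<^sub>R Y \<omega>) \<le> 2"
    using norm_Y agc_bounds by (intro AE_I2) (simp add: abs_le_iff order_trans[OF _ agc_bounds(1)])
qed simp

lemma grad_inner: "grad p \<bullet> w = (\<integral>\<omega>. agc (Y \<omega> \<bullet> p) * (Y \<omega> \<bullet> w) \<partial>Q)"
  and integrable_grad_inner: "integrable Q (\<lambda>\<omega>. agc (Y \<omega> \<bullet> p) * (Y \<omega> \<bullet> w))"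
  using integral_inner_left[OF integrable_grad[of p], of w] integrable_inner_left[OF integrable_grad[of p], of w]
  by (auto simp: grad_def)

lemma integrable_rho2:
  assumes "norm p = 1"
  shows "integrable Q (\<lambda>\<omega>. (rho (Y \<omega>) p)\<^sup>2)"
proof -
  have "continuous_on UNIV (\<lambda>t::real. arccos (max (-1) (min 1 t)))"
    by (rule continuous_on_compose2[OF continuous_on_arccos']) (auto intro!: continuous_intros)
  then have [measurable]: "(\<lambda>t::real. arccos (max (-1) (min 1 t))) \<in> borel_measurable borel"
    by (rule borel_measurable_continuous_onI)
  have *: "arccos (max (-1) (min 1 (Y \<omega> \<bullet> p))) = rho (Y \<omega>) p" if "\<omega> \<in> space Q" for \<omega>
    using inner_sphere_bounds[OF norm_Y[OF that] assms] by (simp add: rho_def)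
  have "integrable Q (\<lambda>\<omega>. (arccos (max (-1) (min 1 (Y \<omega> \<bullet> p))))\<^sup>2)"
  proof (rule integrable_const_bound[of _ "pi\<^sup>2"])
    have "\<bar>arccos (max (-1) (min 1 t))\<bar> \<le> pi" for t :: real
      using arccos_lbound[of "max (-1) (min 1 t)"] arccos_ubound[of "max (-1) (min 1 t)"] by auto
    then have "\<bar>arccos (max (-1) (min 1 t))\<bar>\<^sup>2 \<le> pi\<^sup>2" for t :: real by (intro power_mono) auto
    then show "AE \<omega> in Q. norm ((arccos (max (-1) (min 1 (Y \<omega> \<bullet> p))))\<^sup>2) \<le> pi\<^sup>2" by simp
  qed measurable
  also have "?this \<longleftrightarrow> ?thesis" by (rule Bochner_Integration.integrable_cong) (simp_all add: *)
  finally show ?thesis .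
qed

lemma intrinsic_mean_le:
  assumes "is_intrinsic_mean Q Y p" "norm q = 1"
  shows "(\<integral>\<omega>. (rho (Y \<omega>) p)\<^sup>2 \<partial>Q) \<le> (\<integral>\<omega>. (rho (Y \<omega>) q)\<^sup>2 \<partial>Q)"
  using assms unfolding is_intrinsic_mean_def unique_minimizer_def is_arg_min_def by (auto simp: not_less)

lemma intrinsic_mean_norm: "is_intrinsic_mean Q Y p \<Longrightarrow> norm p = 1"
  unfolding is_intrinsic_mean_def unique_minimizer_def is_arg_min_def by auto

text \<open>Reflecting the mean at a support point with which it had a negative inner product would bring
  it closer to all the other support points.\<close>

lemma intrinsic_mean_inner_nonneg:
  assumes U: "U \<subseteq> sphere 0 1" "\<forall>u\<in>U. \<forall>v\<in>U. 0 \<le> u \<bullet> v"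
    and YU: "AE \<omega> in Q. Y \<omega> \<in> U" and p: "is_intrinsic_mean Q Y p" and u: "u \<in> U"
  shows "0 \<le> p \<bullet> u"
proof (rule ccontr)
  assume "\<not> 0 \<le> p \<bullet> u"
  then have neg: "p \<bullet> u < 0" by simp
  define p' where "p' = p - (2 * (p \<bullet> u)) *\<^sub>R u"
  have np: "norm p = 1" by (rule intrinsic_mean_norm[OF p])
  have nu: "norm u = 1" using u U by auto
  have np': "norm p' = 1"
    using np nu by (simp add: norm_eq_1 p'_def inner_diff_left inner_diff_right inner_commute algebra_simps)
  have "(\<integral>\<omega>. (rho (Y \<omega>) p')\<^sup>2 \<partial>Q) \<le> (\<integral>\<omega>. (rho (Y \<omega>) p)\<^sup>2 \<partial>Q)"
  proof (intro integral_mono_AE integrable_rho2 np np')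
    show "AE \<omega> in Q. (rho (Y \<omega>) p')\<^sup>2 \<le> (rho (Y \<omega>) p)\<^sup>2"
      using YU AE_space
    proof eventually_elim
      case (elim \<omega>)
      have nY: "norm (Y \<omega>) = 1" using elim(2) by (rule norm_Y)
      have "(p \<bullet> u) * (Y \<omega> \<bullet> u) \<le> 0" using U(2)[rule_format, OF elim(1) u] neg by (intro mult_nonpos_nonneg) auto
      then have "Y \<omega> \<bullet> p \<le> Y \<omega> \<bullet> p'" by (simp add: p'_def inner_diff_right)
      then have "rho (Y \<omega>) p' \<le> rho (Y \<omega>) p"
        using inner_sphere_bounds[OF nY np] inner_sphere_bounds[OF nY np'] by (simp add: rho_def arccos_le_arccos)
      then show ?case
        using inner_sphere_bounds[OF nY np'] by (intro power_mono) (auto simp: rho_def arccos_lbound)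
    qed
  qed
  \<comment> \<open>The reflection need not decrease the objective strictly; uniqueness of the
    minimizer gives the contradiction.\<close>
  then have "is_arg_min (\<lambda>p. \<integral>\<omega>. (rho (Y \<omega>) p)\<^sup>2 \<partial>Q) (\<lambda>p. p \<in> sphere 0 1) p'"
    using intrinsic_mean_le[OF p] np' unfolding is_arg_min_def by (force simp: not_less)
  then have "p' = p" using p unfolding is_intrinsic_mean_def unique_minimizer_def by blast
  then show False using neg nu by (auto simp: p'_def)
qed

text \<open>Convexity of \<open>arccos\<^sup>2\<close> and the Lipschitz bound for \<open>ag\<close>
  replace differentiation under the integral: minimality yields a one-sided inequality with
  quadratic error, tested along great circles through \<open>p\<close>.\<close>

lemma first_order_condition:
  assumes Yp: "AE \<omega> in Q. 0 \<le> Y \<omega> \<bullet> p" and p: "is_intrinsic_mean Q Y p"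
  shows "grad p = (grad p \<bullet> p) *\<^sub>R p"
proof -
  have np: "norm p = 1" by (rule intrinsic_mean_norm[OF p])
  have pp: "p \<bullet> p = 1" using np by (simp add: norm_eq_1)
  obtain K where K: "K > 0" "\<And>s t. s \<in> {-1/2..1} \<Longrightarrow> t \<in> {-1/2..1} \<Longrightarrow> \<bar>ag s - ag t\<bar> \<le> K * \<bar>s - t\<bar>"
    using ag_lipschitz by blast
  have key: "grad p \<bullet> (q - p) \<le> K * (norm (q - p))\<^sup>2" if q: "norm q = 1" "norm (q - p) \<le> 1/2" for q
  proof -
    have "0 \<le> (\<integral>\<omega>. (rho (Y \<omega>) q)\<^sup>2 \<partial>Q) - (\<integral>\<omega>. (rho (Y \<omega>) p)\<^sup>2 \<partial>Q)"
      using intrinsic_mean_le[OF p q(1)] by simp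
    also have "\<dots> = (\<integral>\<omega>. (rho (Y \<omega>) q)\<^sup>2 - (rho (Y \<omega>) p)\<^sup>2 \<partial>Q)"
      using integrable_rho2[OF q(1)] integrable_rho2[OF np] by simp
    also have "\<dots> \<le> (\<integral>\<omega>. 2 * K * (norm (q - p))\<^sup>2 - 2 * (agc (Y \<omega> \<bullet> p) * (Y \<omega> \<bullet> (q - p))) \<partial>Q)"
    proof (rule integral_mono_AE)
      show "integrable Q (\<lambda>\<omega>. (rho (Y \<omega>) q)\<^sup>2 - (rho (Y \<omega>) p)\<^sup>2)"
        using integrable_rho2[OF q(1)] integrable_rho2[OF np] by simp
      show "integrable Q (\<lambda>\<omega>. 2 * K * (norm (q - p))\<^sup>2 - 2 * (agc (Y \<omega> \<bullet> p) * (Y \<omega> \<bullet> (q - p))))"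
        by (intro Bochner_Integration.integrable_diff integrable_mult_right integrable_grad_inner) simp
      show "AE \<omega> in Q. (rho (Y \<omega>) q)\<^sup>2 - (rho (Y \<omega>) p)\<^sup>2 \<le> 2 * K * (norm (q - p))\<^sup>2 - 2 * (agc (Y \<omega> \<bullet> p) * (Y \<omega> \<bullet> (q - p)))"
        using Yp AE_space
      proof eventually_elim
        case (elim \<omega>)
        have nY: "norm (Y \<omega>) = 1" using elim(2) by (rule norm_Y)
        define s where "s = Y \<omega> \<bullet> q"
        define t where "t = Y \<omega> \<bullet> p"
        have st: "s - t = Y \<omega> \<bullet> (q - p)" by (simp add: s_def t_def inner_diff_right)
        have stn: "\<bar>s - t\<bar> \<le> norm (q - p)" using Cauchy_Schwarz_ineq2[of "Y \<omega>" "q - p"] nY st by simp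
        have t: "0 \<le> t" "t \<le> 1" using elim(1) inner_sphere_bounds[OF nY np] by (auto simp: t_def)
        have s: "- 1/2 \<le> s" "s \<le> 1" using stn q(2) t inner_sphere_bounds[OF nY q(1)] by (auto simp: s_def)
        have "(arccos s)\<^sup>2 - (arccos t)\<^sup>2 \<le> - 2 * ag s * (s - t)"
          using s t by (intro arccos_sq_convex) auto
        also have "\<dots> = - 2 * (ag s - ag t) * (s - t) - 2 * (ag t * (s - t))" by (simp add: algebra_simps)
        also have "- 2 * (ag s - ag t) * (s - t) \<le> 2 * K * (norm (q - p))\<^sup>2"
        proof -
          have "\<bar>ag s - ag t\<bar> * \<bar>s - t\<bar> \<le> (K * \<bar>s - t\<bar>) * \<bar>s - t\<bar>"
            using s t by (intro mult_right_mono K) auto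
          also have "\<dots> = K * \<bar>s - t\<bar>\<^sup>2" by (simp add: power2_eq_square mult.assoc)
          also have "\<dots> \<le> K * (norm (q - p))\<^sup>2" using stn K(1) by (intro mult_left_mono power_mono) auto
          finally have "\<bar>(ag s - ag t) * (s - t)\<bar> \<le> K * (norm (q - p))\<^sup>2" by (simp add: abs_mult)
          then show ?thesis unfolding mult.assoc abs_le_iff by linarith
        qed
        finally show ?case using t by (simp add: s_def[symmetric] t_def[symmetric] st[symmetric] rho_def agc_eq)
      qed
    qed
    also have "\<dots> = 2 * K * (norm (q - p))\<^sup>2 - 2 * (grad p \<bullet> (q - p))"
      unfolding grad_inner using integrable_grad_inner by (simp add: prob_space)
    finally show ?thesis by simp
  qed
  have orth: "grad p \<bullet> w = 0" if w: "norm w = 1" "w \<bullet> p = 0" for w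
  proof -
    \<comment> \<open>On the great circle from \<open>p\<close> in direction \<open>w\<close>, the
      squared chord is 2 - 2 cos \<tau>, and \<phi> is the gap in \<open>key\<close>: nonnegative
      near 0 and zero at 0. For |\<tau>| < 1/2 the chord stays below 1/2.\<close>
    define \<phi> where "\<phi> \<tau> = K * (2 - 2 * cos \<tau>) - ((grad p \<bullet> p) * (cos \<tau> - 1) + (grad p \<bullet> w) * sin \<tau>)" for \<tau>
    have "(\<phi> has_real_derivative - (grad p \<bullet> w)) (at 0)"
      unfolding \<phi>_def by (auto intro!: derivative_eq_intros)
    moreover have "\<forall>\<tau>. \<bar>0 - \<tau>\<bar> < 1/2 \<longrightarrow> \<phi> 0 \<le> \<phi> \<tau>"
    proof (intro allI impI)
      fix \<tau> :: real assume t: "\<bar>0 - \<tau>\<bar> < 1/2"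
      define q where "q = cos \<tau> *\<^sub>R p + sin \<tau> *\<^sub>R w"
      have ww: "w \<bullet> w = 1" using w(1) by (simp add: norm_eq_1)
      have "q \<bullet> q = (cos \<tau>)\<^sup>2 + (sin \<tau>)\<^sup>2"
        using w(2) pp ww by (simp add: q_def inner_add_left inner_add_right inner_commute power2_eq_square)
      then have nq: "norm q = 1" by (simp add: norm_eq_1)
      have d2: "(norm (q - p))\<^sup>2 = 2 - 2 * cos \<tau>"
        unfolding norm_diff_sphere[OF nq np] using w(2) pp by (simp add: q_def inner_add_left)
      have "cos \<tau> = 1 - 2 * (sin (\<tau> / 2))\<^sup>2" using cos_double_sin[of "\<tau> / 2"] by simp
      then have "2 - 2 * cos \<tau> = (2 * sin (\<tau> / 2))\<^sup>2" by (simp add: power_mult_distrib)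
      also have "\<dots> = (2 * \<bar>sin (\<tau> / 2)\<bar>)\<^sup>2" by (simp add: power_mult_distrib)
      also have "\<dots> \<le> (1/2)\<^sup>2" using abs_sin_x_le_abs_x[of "\<tau> / 2"] t by (intro power_mono) auto
      finally have "norm (q - p) \<le> 1/2" unfolding d2[symmetric] by (rule power2_le_imp_le) simp
      then have "grad p \<bullet> (q - p) \<le> K * (2 - 2 * cos \<tau>)" using key[OF nq] d2 by simp
      moreover have "grad p \<bullet> (q - p) = (grad p \<bullet> p) * (cos \<tau> - 1) + (grad p \<bullet> w) * sin \<tau>"
        by (simp add: q_def inner_diff_right inner_add_right algebra_simps)
      ultimately show "\<phi> 0 \<le> \<phi> \<tau>" by (simp add: \<phi>_def)
    qed
    ultimately have "- (grad p \<bullet> w) = 0" by (intro DERIV_local_min[of \<phi> _ 0 "1/2"]) auto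
    then show ?thesis by simp
  qed
  define w where "w = tproj p (grad p)"
  have wp: "w \<bullet> p = 0" using tproj_in_tangent[OF np, of "grad p"] by (simp add: w_def tangent_def)
  have "w = 0"
  proof (rule ccontr)
    assume w: "w \<noteq> 0"
    then have "grad p \<bullet> ((1 / norm w) *\<^sub>R w) = 0" using wp by (intro orth) auto
    then have "grad p \<bullet> w = 0" using w by simp
    moreover have "grad p = w + (p \<bullet> grad p) *\<^sub>R p" by (simp add: w_def tproj_apply)
    then have "grad p \<bullet> w = w \<bullet> w" using wp by (metis add.right_neutral inner_add_left inner_commute inner_scaleR_left mult_zero_right)
    ultimately show False using w by simp
  qed
  then show ?thesis by (simp add: w_def tproj_apply inner_commute)
qed

lemma multiplier_nonneg:
  assumes Yp: "AE \<omega> in Q. 0 \<le> Y \<omega> \<bullet> p"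
  shows "0 \<le> grad p \<bullet> p"
  unfolding grad_inner
proof (rule integral_nonneg_AE)
  show "AE \<omega> in Q. 0 \<le> agc (Y \<omega> \<bullet> p) * (Y \<omega> \<bullet> p)"
    using Yp by eventually_elim (auto intro!: mult_nonneg_nonneg order_trans[OF zero_le_one agc_bounds(1)])
qed

text \<open>If the multiplier vanishes, then \<open>Y\<close> is almost surely orthogonal to
  \<open>p\<close>, so \<open>grad p\<close> is \<open>agc 0\<close> times the mean of
  \<open>Y\<close>; yet the first-order condition gives \<open>grad p = 0\<close>.\<close>

lemma multiplier_pos:
  assumes Yp: "AE \<omega> in Q. 0 \<le> Y \<omega> \<bullet> p" and p: "is_intrinsic_mean Q Y p" and m: "expectation Y \<noteq> 0"
  shows "0 < grad p \<bullet> p"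
proof (rule ccontr)
  assume "\<not> 0 < grad p \<bullet> p"
  then have 0: "grad p \<bullet> p = 0" using multiplier_nonneg[OF Yp] by simp
  have nn: "AE \<omega> in Q. 0 \<le> agc (Y \<omega> \<bullet> p) * (Y \<omega> \<bullet> p)"
    using Yp by eventually_elim (auto intro!: mult_nonneg_nonneg order_trans[OF zero_le_one agc_bounds(1)])
  have "AE \<omega> in Q. agc (Y \<omega> \<bullet> p) * (Y \<omega> \<bullet> p) = 0"
    using integral_nonneg_eq_0_iff_AE[OF integrable_grad_inner nn] 0 by (simp add: grad_inner)
  then have "AE \<omega> in Q. agc (Y \<omega> \<bullet> p) *\<^sub>R Y \<omega> = agc 0 *\<^sub>R Y \<omega>"
  proof eventually_elim
    case (elim \<omega>)
    then have "Y \<omega> \<bullet> p = 0" using agc_bounds(1)[of "Y \<omega> \<bullet> p"] by auto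
    then show ?case by simp
  qed
  then have "grad p = expectation (\<lambda>\<omega>. agc 0 *\<^sub>R Y \<omega>)" unfolding grad_def by (intro integral_cong_AE) auto
  then have "grad p = agc 0 *\<^sub>R expectation Y" using integrable_Y by simp
  moreover have "grad p = 0" using first_order_condition[OF Yp p] 0 by simp
  ultimately show False using m agc_bounds(1)[of 0] by auto
qed

text \<open>As \<open>ag\<close> decreases, \<open>(grad p - grad q) \<bullet> (p - q) \<le> 0\<close>; this turns the first-order
  condition at \<open>p\<close> into a bound of the distance from any \<open>q\<close> that almost satisfies it.\<close>

lemma critical_point_stability:
  assumes Yp: "AE \<omega> in Q. 0 \<le> Y \<omega> \<bullet> p" and Yq: "AE \<omega> in Q. 0 \<le> Y \<omega> \<bullet> q"
    and np: "norm p = 1" and nq: "norm q = 1" and g: "grad p = k *\<^sub>R p" and k: "0 \<le> k"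
  shows "l / 2 * norm (q - p) \<le> norm (grad q - l *\<^sub>R q)"
proof (cases "q = p")
  case False
  let ?n = "norm (q - p)"
  have "(grad q - grad p) \<bullet> (q - p) = (\<integral>\<omega>. agc (Y \<omega> \<bullet> q) * (Y \<omega> \<bullet> (q - p)) - agc (Y \<omega> \<bullet> p) * (Y \<omega> \<bullet> (q - p)) \<partial>Q)"
    unfolding inner_diff_left grad_inner using integrable_grad_inner by simp
  also have "\<dots> \<le> (\<integral>\<omega>. 0 \<partial>Q)"
  proof (rule integral_mono_AE)
    show "AE \<omega> in Q. agc (Y \<omega> \<bullet> q) * (Y \<omega> \<bullet> (q - p)) - agc (Y \<omega> \<bullet> p) * (Y \<omega> \<bullet> (q - p)) \<le> 0"
      using Yp Yq AE_space
    proof eventually_elim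
      case (elim \<omega>)
      have nY: "norm (Y \<omega>) = 1" using elim(3) by (rule norm_Y)
      show ?case
        using ag_monotone[of "Y \<omega> \<bullet> q" "Y \<omega> \<bullet> p"] elim inner_sphere_bounds[OF nY np] inner_sphere_bounds[OF nY nq]
        by (simp add: agc_eq inner_diff_right left_diff_distrib)
    qed
  qed (auto intro!: Bochner_Integration.integrable_diff integrable_grad_inner)
  finally have 1: "(grad q - k *\<^sub>R p) \<bullet> (q - p) \<le> 0" using g by simp
  \<comment> \<open>On the unit sphere both are half the squared chord up to sign, which is where
    the factor 1/2 of the bound originates.\<close>
  have pq: "p \<bullet> (q - p) = - (?n\<^sup>2 / 2)" "q \<bullet> (q - p) = ?n\<^sup>2 / 2"
    using norm_diff_sphere[OF nq np] np nq by (simp_all add: norm_eq_1 inner_diff_right inner_commute diff_divide_distrib)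
  have "0 \<le> k * (?n\<^sup>2 / 2)" using k by simp
  then have "grad q \<bullet> (q - p) \<le> 0" using 1 pq(1) by (simp add: inner_diff_left)
  moreover have "(grad q - l *\<^sub>R q) \<bullet> (q - p) = grad q \<bullet> (q - p) - l * (?n\<^sup>2 / 2)"
    by (simp only: inner_diff_left[of "grad q"] inner_scaleR_left pq(2))
  ultimately have "l * (?n\<^sup>2 / 2) \<le> - ((grad q - l *\<^sub>R q) \<bullet> (q - p))" by linarith
  also have "\<dots> \<le> norm (grad q - l *\<^sub>R q) * ?n"
    using Cauchy_Schwarz_ineq2[of "grad q - l *\<^sub>R q" "q - p"] by (simp add: abs_le_iff)
  finally have "(l / 2 * ?n) * ?n \<le> norm (grad q - l *\<^sub>R q) * ?n" by (simp add: power2_eq_square)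
  then show ?thesis using False by simp
qed simp

end

section \<open>Sample means\<close>

definition sample_grad :: "nat \<Rightarrow> (nat \<Rightarrow> 'h::real_inner) \<Rightarrow> 'h \<Rightarrow> 'h" where
  "sample_grad n xs p = (1 / real n) *\<^sub>R (\<Sum>i<n. agc (xs i \<bullet> p) *\<^sub>R xs i)"

section \<open>Samples as uniform laws on their indices\<close>

lemma integral_uniform_pmf:
  fixes f :: "nat \<Rightarrow> 'b::{banach, second_countable_topology}"
  assumes "n \<ge> 1"
  shows "(\<integral>i. f i \<partial>measure_pmf (pmf_of_set {..<n})) = (1 / real n) *\<^sub>R (\<Sum>i<n. f i)"
proof -
  have ne: "{..<n} \<noteq> {}" using assms by (auto simp: lessThan_empty_iff)
  have "(\<integral>i. f i \<partial>measure_pmf (pmf_of_set {..<n})) = (\<Sum>i<n. pmf (pmf_of_set {..<n}) i *\<^sub>R f i)"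
    by (rule integral_measure_pmf) (use ne in \<open>auto simp: set_pmf_of_set\<close>)
  also have "\<dots> = (\<Sum>i<n. (1 / real n) *\<^sub>R f i)" using ne by (intro sum.cong) auto
  finally show ?thesis by (simp add: scaleR_sum_right)
qed

lemma is_sample_intrinsic_mean_iff:
  fixes xs :: "nat \<Rightarrow> 'h::real_inner"
  assumes "n \<ge> 1"
  shows "is_sample_intrinsic_mean n xs p \<longleftrightarrow> is_intrinsic_mean (measure_pmf (pmf_of_set {..<n})) xs p"
  unfolding is_sample_intrinsic_mean_def is_intrinsic_mean_def using assms
  by (simp add: integral_uniform_pmf divide_inverse mult.commute)

text \<open>The population arguments apply to the uniform law on the indices. The last clause is the
  stability bound with the sample mean as exact critical point and an arbitrary \<open>q\<close> as
  comparison.\<close>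

lemma sample_mean_properties:
  fixes xs :: "nat \<Rightarrow> 'h::{real_inner, banach, second_countable_topology}"
  assumes n: "n \<ge> 1" and U: "U \<subseteq> sphere 0 1" "\<forall>u\<in>U. \<forall>v\<in>U. 0 \<le> u \<bullet> v"
    and xs: "\<And>i. xs i \<in> U" and p: "is_sample_intrinsic_mean n xs p"
  shows "norm p = 1" and "\<And>u. u \<in> U \<Longrightarrow> 0 \<le> p \<bullet> u"
    and "sample_grad n xs p = (sample_grad n xs p \<bullet> p) *\<^sub>R p" and "0 < sample_grad n xs p \<bullet> p"
    and "\<And>q l. norm q = 1 \<Longrightarrow> (\<forall>u\<in>U. 0 \<le> q \<bullet> u) \<Longrightarrow>
      l / 2 * norm (q - p) \<le> norm (sample_grad n xs q - l *\<^sub>R q)"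
proof -
  let ?Q = "measure_pmf (pmf_of_set {..<n})"
  interpret sphere_variable ?Q xs
  proof (intro sphere_variable.intro sphere_variable_axioms.intro prob_space_measure_pmf)
    fix i
    have "xs i \<in> sphere 0 1" using U(1) xs by (rule subsetD)
    then show "norm (xs i) = 1" by simp
  qed simp
  have g: "grad q = sample_grad n xs q" for q
    unfolding grad_def sample_grad_def by (rule integral_uniform_pmf[OF n])
  have p': "is_intrinsic_mean ?Q xs p" using p is_sample_intrinsic_mean_iff[OF n] by blast
  have AEU: "AE i in ?Q. xs i \<in> U" using xs by simp
  show np: "norm p = 1" by (rule intrinsic_mean_norm[OF p'])
  show pu: "0 \<le> p \<bullet> u" if "u \<in> U" for u
    by (rule intrinsic_mean_inner_nonneg[OF U AEU p' that])
  have xp: "AE i in ?Q. 0 \<le> xs i \<bullet> p" using pu[OF xs] by (simp add: inner_commute)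
  show foc: "sample_grad n xs p = (sample_grad n xs p \<bullet> p) *\<^sub>R p"
    using first_order_condition[OF xp p'] by (simp only: g)
  \<comment> \<open>Paired with one observation, all terms are nonnegative and its own is 1, so the
    sample average is not 0.\<close>
  have "(\<integral>i. xs i \<partial>?Q) \<bullet> xs 0 = (1 / real n) * (\<Sum>i<n. xs i \<bullet> xs 0)"
    by (simp add: integral_uniform_pmf[OF n] inner_sum_left)
  moreover have "(\<Sum>i<n. xs i \<bullet> xs 0) \<ge> xs 0 \<bullet> xs 0"
    using n U(2)[rule_format, OF xs xs] by (intro member_le_sum[of 0 "{..<n}" "\<lambda>i. xs i \<bullet> xs 0"]) auto
  moreover have "xs 0 \<bullet> xs 0 = 1" using xs[of 0] U(1) by (auto simp: norm_eq_1[symmetric])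
  ultimately have "(\<integral>i. xs i \<partial>?Q) \<bullet> xs 0 > 0" using n by simp
  then have "(\<integral>i. xs i \<partial>?Q) \<noteq> 0" by auto
  from multiplier_pos[OF xp p' this] show "0 < sample_grad n xs p \<bullet> p" by (simp only: g)
  then have k: "0 \<le> sample_grad n xs p \<bullet> p" by simp
  show "l / 2 * norm (q - p) \<le> norm (sample_grad n xs q - l *\<^sub>R q)"
    if q: "norm q = 1" "\<forall>u\<in>U. 0 \<le> q \<bullet> u" for q l
  proof -
    have "AE i in ?Q. 0 \<le> xs i \<bullet> q" using q(2)[rule_format, OF xs] by (simp add: inner_commute)
    from critical_point_stability[OF xp this np q(1) _ k] foc show ?thesis by (simp only: g)
  qed
qed

text \<open>Stability with the mean of \<open>ys\<close> as comparison point bounds the distance of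
  the two means by a continuous function of \<open>xs\<close> that vanishes at \<open>ys\<close>.
  Continuity refers to the product topology on sequences.\<close>

lemma sample_mean_continuous:
  fixes U :: "'h::{real_inner, banach, second_countable_topology} set"
  assumes n: "n \<ge> 1" and U: "U \<subseteq> sphere 0 1" "\<forall>u\<in>U. \<forall>v\<in>U. 0 \<le> u \<bullet> v"
    and am: "\<And>xs. xs \<in> S \<Longrightarrow> (\<forall>i. xs i \<in> U) \<and> is_sample_intrinsic_mean n xs (am xs)"
  shows "continuous_on S am"
  unfolding continuous_on_def
proof
  fix ys assume ys: "ys \<in> S"
  define q where "q = am ys"
  define l where "l = sample_grad n ys q \<bullet> q"
  have y: "\<And>i. ys i \<in> U" "is_sample_intrinsic_mean n ys q" using am[OF ys] by (auto simp: q_def)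
  note py = sample_mean_properties[OF n U y]
  have q: "norm q = 1" "\<forall>u\<in>U. 0 \<le> q \<bullet> u" "sample_grad n ys q = l *\<^sub>R q" "0 < l"
    using py by (auto simp: l_def)
  have "continuous_on UNIV (\<lambda>xs. norm (sample_grad n xs q - l *\<^sub>R q))"
    unfolding sample_grad_def
    by (intro continuous_intros continuous_on_compose2[OF continuous_on_agc]
        continuous_on_product_coordinates) auto
  then have "((\<lambda>xs. norm (sample_grad n xs q - l *\<^sub>R q)) \<longlongrightarrow> norm (sample_grad n ys q - l *\<^sub>R q)) (at ys within S)"
    by (auto simp: continuous_on_def intro: tendsto_within_subset)
  then have lim: "((\<lambda>xs. (2 / l) * norm (sample_grad n xs q - l *\<^sub>R q)) \<longlongrightarrow> (2 / l) * 0) (at ys within S)"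
    using q(3) by (intro tendsto_mult_left) simp
  have "\<forall>\<^sub>F xs in at ys within S. xs \<in> S" by (simp add: eventually_at_filter)
  then have "\<forall>\<^sub>F xs in at ys within S. norm (am xs - q) \<le> (2 / l) * norm (sample_grad n xs q - l *\<^sub>R q)"
  proof eventually_elim
    case (elim xs)
    then have "l / 2 * norm (q - am xs) \<le> norm (sample_grad n xs q - l *\<^sub>R q)"
      using am by (intro sample_mean_properties(5)[OF n U] q) auto
    then show ?case using q(4) by (simp add: field_simps norm_minus_commute)
  qed
  from Lim_null_comparison[OF this] lim have "((\<lambda>xs. am xs - q) \<longlongrightarrow> 0) (at ys within S)" by simp
  then show "(am \<longlongrightarrow> am ys) (at ys within S)" unfolding q_def by (rule LIM_zero_cancel)
qed

lemma (in complete_measure) borel_measurable_AE_eq: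
  fixes f g :: "'a \<Rightarrow> 'b::topological_space"
  assumes g: "g \<in> borel_measurable M" and eq: "AE x in M. f x = g x"
  shows "f \<in> borel_measurable M"
proof (rule measurableI)
  fix A :: "'b set" assume A: "A \<in> sets borel"
  have "g -` A \<inter> space M \<in> sets M" using g A by (rule measurable_sets)
  moreover have "AE x in M. x \<in> f -` A \<inter> space M \<longleftrightarrow> x \<in> g -` A \<inter> space M" using eq by eventually_elim simp
  ultimately show "f -` A \<inter> space M \<in> sets M" by (subst in_sets_AE) auto
qed simp

text \<open>Uniqueness makes the sample mean a function of the observations off a null set, and
  continuity makes that function measurable relative to its domain \<open>S\<close>. Completeness
  extends the measurability across the null set.\<close>

lemma sample_mean_measurable:
  fixes Xs :: "nat \<Rightarrow> 'w \<Rightarrow> 'h::{real_inner, banach, second_countable_topology}"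
  assumes M: "complete_measure M" and n: "n \<ge> 1"
    and U: "U \<subseteq> sphere 0 1" "\<forall>u\<in>U. \<forall>v\<in>U. 0 \<le> u \<bullet> v"
    and Xs: "\<And>i. Xs i \<in> borel_measurable M" and XU: "AE \<omega> in M. \<forall>i. Xs i \<omega> \<in> U"
    and m: "AE \<omega> in M. is_sample_intrinsic_mean n (\<lambda>i. Xs i \<omega>) (\<mu>hat \<omega>)"
  shows "\<mu>hat \<in> borel_measurable M"
proof -
  interpret complete_measure M by fact
  have "AE \<omega> in M. (\<forall>i. Xs i \<omega> \<in> U) \<and> is_sample_intrinsic_mean n (\<lambda>i. Xs i \<omega>) (\<mu>hat \<omega>)"
    using XU m by eventually_elim simp
  then obtain N where N: "N \<in> null_sets M"
    "\<And>\<omega>. \<omega> \<in> space M - N \<Longrightarrow> (\<forall>i. Xs i \<omega> \<in> U) \<and> is_sample_intrinsic_mean n (\<lambda>i. Xs i \<omega>) (\<mu>hat \<omega>)"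
    by (rule AE_E3) blast
  define S where "S = {xs. (\<forall>i. xs i \<in> U) \<and> (\<exists>p. is_sample_intrinsic_mean n xs p)}"
  define am where "am xs = (SOME p. is_sample_intrinsic_mean n xs p)" for xs :: "nat \<Rightarrow> 'h"
  have am: "(\<forall>i. xs i \<in> U) \<and> is_sample_intrinsic_mean n xs (am xs)" if "xs \<in> S" for xs
    using that unfolding S_def am_def by (auto intro: someI_ex)
  have uniq: "p = am xs" if "is_sample_intrinsic_mean n xs p" for xs p
    using that someI[of "is_sample_intrinsic_mean n xs", OF that]
    unfolding am_def is_sample_intrinsic_mean_def unique_minimizer_def by blast
  define R where "R = restrict_space M (space M - N)"
  have X: "(\<lambda>\<omega> i. Xs i \<omega>) \<in> borel_measurable M"
    using Xs by (rule measurable_coordinatewise_then_product)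
  have spR: "space R = space M - N" by (auto simp: R_def space_restrict_space)
  have "(\<lambda>\<omega> i. Xs i \<omega>) \<in> R \<rightarrow>\<^sub>M restrict_space borel S"
  proof (rule measurable_restrict_space2)
    show "(\<lambda>\<omega> i. Xs i \<omega>) \<in> space R \<rightarrow> S" using N(2) by (auto simp: spR S_def)
    show "(\<lambda>\<omega> i. Xs i \<omega>) \<in> borel_measurable R" unfolding R_def using X by (rule measurable_restrict_space1)
  qed
  moreover have "am \<in> borel_measurable (restrict_space borel S)"
    by (rule borel_measurable_continuous_on_restrict[OF sample_mean_continuous[OF n U am]])
  ultimately have "(\<lambda>\<omega>. am (\<lambda>i. Xs i \<omega>)) \<in> borel_measurable R" by (rule measurable_compose)
  also have "?this \<longleftrightarrow> \<mu>hat \<in> borel_measurable R"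
  proof (rule measurable_cong)
    fix \<omega> assume "\<omega> \<in> space R"
    then show "am (\<lambda>i. Xs i \<omega>) = \<mu>hat \<omega>" using uniq[of "\<lambda>i. Xs i \<omega>" "\<mu>hat \<omega>"] N(2)[of \<omega>] by (simp add: spR)
  qed
  finally have R: "\<mu>hat \<in> borel_measurable (restrict_space M (space M - N))" by (simp add: R_def)
  have Ns: "space M - N \<in> sets M" using N(1) by auto
  have "(\<lambda>\<omega>. if \<omega> \<in> space M - N then \<mu>hat \<omega> else 0) \<in> borel_measurable M"
    using measurable_If_restrict_space_iff[of M "\<lambda>\<omega>. \<omega> \<in> space M - N" \<mu>hat "\<lambda>_. 0" borel] R Ns
    by (simp add: Int_def Collect_conj_eq[symmetric] set_diff_eq)
  then show ?thesis
    by (rule borel_measurable_AE_eq) (use AE_not_in[OF N(1)] AE_space in eventually_elim, simp)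
qed

section \<open>The Borel structure of the sphere\<close>

text \<open>The chord is 2 sin(rho / 2), at most the arc. Hence norm-open sets have
  \<open>rho_open\<close> traces on the sphere.\<close>

lemma norm_diff_le_rho:
  assumes x: "norm x = 1" and y: "norm y = 1"
  shows "norm (x - y) \<le> rho x y"
proof (rule power2_le_imp_le)
  have b: "- 1 \<le> x \<bullet> y" "x \<bullet> y \<le> 1" using inner_sphere_bounds[OF x y] by auto
  have "(norm (x - y))\<^sup>2 = 2 - 2 * cos (rho x y)" using norm_diff_sphere[OF x y] b by (simp add: rho_def)
  also have "\<dots> = (2 * sin (rho x y / 2))\<^sup>2"
    using cos_double_sin[of "rho x y / 2"] by (simp add: power_mult_distrib)
  also have "\<dots> = (2 * \<bar>sin (rho x y / 2)\<bar>)\<^sup>2" by (simp add: power_mult_distrib)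
  also have "\<dots> \<le> (rho x y)\<^sup>2"
    using abs_sin_x_le_abs_x[of "rho x y / 2"] b by (intro power_mono) (auto simp: rho_def arccos_lbound)
  finally show "(norm (x - y))\<^sup>2 \<le> (rho x y)\<^sup>2" .
  show "0 \<le> rho x y" using b by (simp add: rho_def arccos_lbound)
qed

lemma rho_open_Int_sphere:
  assumes "open O'"
  shows "rho_open (O' \<inter> sphere 0 1)"
  unfolding rho_open_def
proof (intro conjI ballI)
  fix x assume x: "x \<in> O' \<inter> sphere 0 1"
  then obtain e where e: "e > 0" "\<And>y. dist y x < e \<Longrightarrow> y \<in> O'" using assms unfolding open_dist by blast
  show "\<exists>e>0. \<forall>y\<in>sphere 0 1. rho x y < e \<longrightarrow> y \<in> O' \<inter> sphere 0 1"
  proof (intro exI[of _ e] conjI ballI impI e(1))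
    fix y assume y: "y \<in> sphere 0 1" "rho x y < e"
    then have "norm (x - y) < e" using norm_diff_le_rho[of x y] x by simp
    then show "y \<in> O' \<inter> sphere 0 1" using e(2)[of y] y(1) by (simp add: dist_norm norm_minus_commute)
  qed
qed auto

lemma sets_sphere_borel: "rho_open G \<Longrightarrow> G \<in> sets sphere_borel"
  and space_sphere_borel: "space sphere_borel = sphere 0 1"
proof -
  have sub: "Collect rho_open \<subseteq> Pow (sphere 0 1)" unfolding rho_open_def by blast
  show "space sphere_borel = sphere 0 1"
    unfolding sphere_borel_def using sub by (rule space_measure_of)
  show "G \<in> sets sphere_borel" if "rho_open G"
    unfolding sphere_borel_def using sub that by (auto simp: sets_measure_of)
qed

lemma id_sphere_borel: "(\<lambda>x. x) \<in> borel_measurable sphere_borel"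
proof (rule borel_measurableI)
  fix S :: "'a set" assume "open S"
  then show "(\<lambda>x. x) -` S \<inter> space sphere_borel \<in> sets sphere_borel"
    by (simp add: space_sphere_borel sets_sphere_borel rho_open_Int_sphere)
qed

text \<open>Makes the complement of the support measurable, so that lying in the support depends
  only on the law.\<close>

lemma rho_open_minus_support: "rho_open (sphere 0 1 - rv_support M X)"
  unfolding rho_open_def
proof (intro conjI ballI)
  fix x assume x: "x \<in> sphere 0 1 - rv_support M X"
  then obtain G where G: "rho_open G" "x \<in> G" "\<not> measure M {\<omega> \<in> space M. X \<omega> \<in> G} > 0"
    by (auto simp: rv_support_def)
  then obtain e where "e > 0" "\<forall>y\<in>sphere 0 1. rho x y < e \<longrightarrow> y \<in> G" unfolding rho_open_def by blast
  then show "\<exists>e>0. \<forall>y\<in>sphere 0 1. rho x y < e \<longrightarrow> y \<in> sphere 0 1 - rv_support M X"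
    using G by (auto simp: rv_support_def)
qed auto

lemma support_inner_nonneg:
  assumes s: "(SUP (y, z)\<in>U \<times> U. rho y z) \<le> pi / 2" and U: "U \<subseteq> sphere 0 1" and y: "y \<in> U" and z: "z \<in> U"
  shows "0 \<le> y \<bullet> z"
proof -
  have n: "norm y = 1" "norm z = 1" using U y z by auto
  have "bdd_above ((\<lambda>(y, z). rho y z) ` (U \<times> U))"
  proof (rule bdd_aboveI2[of _ _ pi])
    fix q assume "q \<in> U \<times> U"
    then obtain a b where ab: "q = (a, b)" "a \<in> U" "b \<in> U" by blast
    then have q: "q = (a, b)" "norm a = 1" "norm b = 1" using subsetD[OF U] by auto
    show "(case q of (y, z) \<Rightarrow> rho y z) \<le> pi"
      using inner_sphere_bounds[OF q(2,3)] by (simp add: q(1) rho_def arccos_ubound)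
  qed
  from cSUP_upper[OF _ this, of "(y, z)"] s y z have "rho y z \<le> pi / 2" by auto
  moreover have "0 \<le> rho y z" using inner_sphere_bounds[OF n] by (simp add: rho_def arccos_lbound)
  ultimately have "0 \<le> cos (rho y z)" by (intro cos_ge_zero) auto
  then show ?thesis using inner_sphere_bounds[OF n] by (simp add: rho_def)
qed

text \<open>If the mean were 0, the nonnegative variable \<open>X \<bullet> y\<close> would vanish
  almost surely for a support point \<open>y\<close>. But the points with positive inner product
  with \<open>y\<close> form a neighborhood of \<open>y\<close>, which has positive
  probability.\<close>

lemma support_expectation_nonzero:
  assumes M: "sphere_variable M X" and U: "U = rv_support M X"
    and Unn: "\<forall>u\<in>U. \<forall>v\<in>U. 0 \<le> u \<bullet> v" and XU: "AE \<omega> in M. X \<omega> \<in> U"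
  shows "(\<integral>\<omega>. X \<omega> \<partial>M) \<noteq> 0"
proof
  interpret sphere_variable M X by fact
  assume 0: "(\<integral>\<omega>. X \<omega> \<partial>M) = 0"
  have "U \<noteq> {}"
  proof
    assume "U = {}"
    then have "AE \<omega> in M. False" using XU by simp
    then show False by simp
  qed
  then obtain y where y: "y \<in> U" by blast
  have ny: "norm y = 1" using y U by (simp add: rv_support_def)
  have i: "integrable M (\<lambda>\<omega>. X \<omega> \<bullet> y)" using integrable_Y by simp
  have nn: "AE \<omega> in M. 0 \<le> X \<omega> \<bullet> y" using XU by eventually_elim (rule Unn[rule_format, OF _ y])
  have "(\<integral>\<omega>. X \<omega> \<bullet> y \<partial>M) = 0" using 0 integrable_Y by simp
  then have z: "AE \<omega> in M. X \<omega> \<bullet> y = 0" using integral_nonneg_eq_0_iff_AE[OF i nn] by simp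
  define G where "G = {z. 0 < z \<bullet> y} \<inter> sphere 0 1"
  have op: "open {z. 0 < z \<bullet> y}" by (intro open_Collect_less continuous_intros)
  then have "rho_open G" unfolding G_def by (rule rho_open_Int_sphere)
  moreover have "y \<in> G" using ny by (simp add: G_def norm_eq_1)
  ultimately have "measure M {\<omega> \<in> space M. X \<omega> \<in> G} > 0" using y U by (simp add: rv_support_def)
  moreover have "measure M {\<omega> \<in> space M. X \<omega> \<in> G} = measure M {}"
  proof (rule measure_eq_AE)
    show "AE \<omega> in M. \<omega> \<in> {\<omega> \<in> space M. X \<omega> \<in> G} \<longleftrightarrow> \<omega> \<in> {}" using z by eventually_elim (simp add: G_def)
    have "{\<omega> \<in> space M. X \<omega> \<in> G} = {\<omega> \<in> space M. 0 < X \<omega> \<bullet> y}"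
      using norm_Y by (auto simp: G_def)
    then show "{\<omega> \<in> space M. X \<omega> \<in> G} \<in> sets M" by simp
  qed simp
  ultimately show False by simp
qed

section \<open>Gaussian random elements of a tangent space\<close>

lemma normal_law_eq_distr:
  assumes "0 \<le> s"
  shows "normal_law 0 s = distr std_normal_distribution borel (\<lambda>x. s * x)"
proof (cases "s = 0")
  case True
  interpret S: prob_space std_normal_distribution by (rule prob_space_normal_density) simp
  have "distr std_normal_distribution borel (\<lambda>x. 0 :: real) = return borel 0" by (rule S.distr_const) simp
  then show ?thesis using True by (simp add: normal_law_def)
next
  case False
  interpret S: prob_space std_normal_distribution by (rule prob_space_normal_density) simp
  have "distributed std_normal_distribution lborel (\<lambda>x. x) std_normal_density"
    by (auto simp: distributed_def distr_id2)
  from S.normal_density_affine[OF this, of s 0] False assms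
  have "distributed std_normal_distribution lborel (\<lambda>x. s * x) (normal_density 0 s)" by simp
  then have "distr std_normal_distribution lborel (\<lambda>x. s * x) = density lborel (normal_density 0 s)"
    by (simp add: distributed_def)
  moreover have "distr std_normal_distribution lborel (\<lambda>x. s * x) = distr std_normal_distribution borel (\<lambda>x. s * x)"
    by (rule distr_cong) auto
  ultimately show ?thesis using False by (simp add: normal_law_def)
qed

text \<open>The characteristic function identifies the law with that of \<open>s\<close> times one
  coordinate of \<open>gauss_space\<close>, including s = 0; the moments are read off there.\<close>

lemma distr_eq_of_gaussian_iexp:
  assumes [measurable]: "Z \<in> borel_measurable gauss_space" and s: "0 \<le> s"
    and ch: "\<And>t. (\<integral>\<omega>. iexp (t * Z \<omega>) \<partial>gauss_space) = complex_of_real (exp (- (s\<^sup>2 * t\<^sup>2) / 2))"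
  shows "distr gauss_space borel Z = normal_law 0 s"
    and "integrable gauss_space Z" "(\<integral>\<omega>. Z \<omega> \<partial>gauss_space) = 0" "(\<integral>\<omega>. (Z \<omega>)\<^sup>2 \<partial>gauss_space) = s\<^sup>2"
proof -
  interpret S: real_distribution std_normal_distribution by (rule real_dist_normal_dist)
  have eq: "distr gauss_space borel Z = distr std_normal_distribution borel (\<lambda>x. s * x)"
  proof (rule Levy_uniqueness)
    show "char (distr gauss_space borel Z) = char (distr std_normal_distribution borel (\<lambda>x. s * x))"
    proof
      fix t
      have "char (distr std_normal_distribution borel (\<lambda>x. s * x)) t = char std_normal_distribution (s * t)"
        unfolding char_def by (subst integral_distr) (auto simp: mult_ac)
      moreover have "char (distr gauss_space borel Z) t = (\<integral>\<omega>. iexp (t * Z \<omega>) \<partial>gauss_space)"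
        unfolding char_def by (subst integral_distr) auto
      ultimately show "char (distr gauss_space borel Z) t = char (distr std_normal_distribution borel (\<lambda>x. s * x)) t"
        by (simp only: ch char_std_normal_distribution power_mult_distrib)
    qed
  qed (auto intro!: gauss.real_distribution_distr S.real_distribution_distr)
  then show "distr gauss_space borel Z = normal_law 0 s" by (simp add: normal_law_eq_distr[OF s])
  have eq': "distr gauss_space borel Z = distr gauss_space borel (\<lambda>\<omega>. s * \<omega> 0)"
    unfolding eq gauss_coord_distr[symmetric, of 0] by (subst distr_distr) (auto simp: comp_def)
  have "integrable (distr gauss_space borel Z) (\<lambda>x. x)"
    unfolding eq' by (subst integrable_distr_eq) (auto intro!: integrable_mult_right gauss_coord_integrable)
  then show "integrable gauss_space Z" by (subst (asm) integrable_distr_eq) auto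
  have "(\<integral>\<omega>. g (Z \<omega>) \<partial>gauss_space) = (\<integral>\<omega>. g (s * \<omega> 0) \<partial>gauss_space)"
    if [measurable]: "g \<in> borel_measurable borel" for g :: "real \<Rightarrow> real"
  proof -
    have "(\<integral>\<omega>. g (Z \<omega>) \<partial>gauss_space) = (\<integral>x. g x \<partial>distr gauss_space borel Z)" by (subst integral_distr) auto
    also have "\<dots> = (\<integral>\<omega>. g (s * \<omega> 0) \<partial>gauss_space)" unfolding eq' by (subst integral_distr) auto
    finally show ?thesis .
  qed
  from this[of "\<lambda>x. x"] this[of "\<lambda>x. x\<^sup>2"]
  show "(\<integral>\<omega>. Z \<omega> \<partial>gauss_space) = 0" "(\<integral>\<omega>. (Z \<omega>)\<^sup>2 \<partial>gauss_space) = s\<^sup>2"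
    by (simp_all add: power_mult_distrib gauss_coord_moments)
qed

section \<open>Operators determined by their matrix entries\<close>

lemma inner_ext:
  fixes x y :: "'a::real_inner"
  assumes "\<And>w. x \<bullet> w = y \<bullet> w"
  shows "x = y"
proof -
  have "(x - y) \<bullet> (x - y) = 0" using assms[of "x - y"] by (subst inner_diff_left) simp
  then show ?thesis by simp
qed

lemma bounded_linear_blinfun_apply_inner: "bounded_linear (\<lambda>A. blinfun_apply A v \<bullet> w)"
  by (rule bounded_linear_compose[OF bounded_linear_inner_left blinfun.bounded_linear_left])

lemma has_expectation_inner:
  assumes "has_expectation M f m"
  shows "integrable M (\<lambda>\<omega>. blinfun_apply (f \<omega>) v \<bullet> w)" "blinfun_apply m v \<bullet> w = (\<integral>\<omega>. blinfun_apply (f \<omega>) v \<bullet> w \<partial>M)"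
  using has_expectation_integral[OF assms bounded_linear_blinfun_apply_inner[of v w]] by auto

lemma op_expectation_eqI:
  fixes m :: "'h::real_inner \<Rightarrow>\<^sub>L 'h"
  assumes "has_expectation M f m"
  shows "op_expectation M f = m"
proof (rule has_expectation_blinfun_unique[OF _ assms])
  fix m' v assume m': "has_expectation M f m'"
  show "blinfun_apply m' v = blinfun_apply m v"
    by (rule inner_ext) (simp only: has_expectation_inner(2)[OF m'] has_expectation_inner(2)[OF assms])
qed

text \<open>The law of \<open>Z\<close> on the Hilbert space becomes the probability space, with
  \<open>tproj p\<close> as random element: it is tangent-valued everywhere and fixes all values of
  \<open>Z\<close>. The covariance follows from \<open>q\<close> by polarization.\<close>

lemma gaussian_element_of_gauss_space:
  fixes Z :: "(nat \<Rightarrow> real) \<Rightarrow> 'h::{real_inner, banach, second_countable_topology}"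
  assumes p: "norm p = 1" and Z[measurable]: "Z \<in> borel_measurable gauss_space"
    and Z2: "integrable gauss_space (\<lambda>\<omega>. (norm (Z \<omega>))\<^sup>2)"
    and ch: "\<And>h. (\<integral>\<omega>. iexp (Z \<omega> \<bullet> h) \<partial>gauss_space) = complex_of_real (exp (- q h / 2))"
    and q0: "\<And>h. 0 \<le> q h" and qs: "\<And>r h. q (r *\<^sub>R h) = r\<^sup>2 * q h"
    and Zp: "\<And>\<omega>. Z \<omega> \<bullet> p = 0"
    and C: "\<And>v w. blinfun_apply C v \<bullet> w = (q (v + w) - q (v - w)) / 4"
  shows "gaussian_element p (distr gauss_space borel Z) (tproj p) 0 C"
proof -
  define N where "N = distr gauss_space borel Z"
  have sN[measurable_cong, simp]: "sets N = sets borel" and "space N = UNIV" by (auto simp: N_def)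
  interpret N: prob_space N unfolding N_def by (rule gauss.prob_space_distr) simp
  have tZ: "blinfun_apply (tproj p) (Z \<omega>) = Z \<omega>" for \<omega> using Zp by (intro tproj_tangent) (simp add: tangent_def)
  have tm[measurable]: "blinfun_apply (tproj p) \<in> borel_measurable borel"
    by (intro borel_measurable_continuous_onI continuous_intros)
  have ch': "(\<integral>\<omega>. iexp (t * (Z \<omega> \<bullet> h)) \<partial>gauss_space) = complex_of_real (exp (- ((sqrt (q h))\<^sup>2 * t\<^sup>2) / 2))" for t h
    using ch[of "t *\<^sub>R h"] q0[of h] by (simp add: qs mult.commute)
  have gs: "distr gauss_space borel (\<lambda>\<omega>. Z \<omega> \<bullet> h) = normal_law 0 (sqrt (q h))"
    "integrable gauss_space (\<lambda>\<omega>. Z \<omega> \<bullet> h)" "(\<integral>\<omega>. Z \<omega> \<bullet> h \<partial>gauss_space) = 0" "(\<integral>\<omega>. (Z \<omega> \<bullet> h)\<^sup>2 \<partial>gauss_space) = q h" for h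
  proof -
    have m: "(\<lambda>\<omega>. Z \<omega> \<bullet> h) \<in> borel_measurable gauss_space" by simp
    have s0: "0 \<le> sqrt (q h)" using q0 by simp
    note g = distr_eq_of_gaussian_iexp[OF m s0 ch']
    show "distr gauss_space borel (\<lambda>\<omega>. Z \<omega> \<bullet> h) = normal_law 0 (sqrt (q h))"
      "integrable gauss_space (\<lambda>\<omega>. Z \<omega> \<bullet> h)" "(\<integral>\<omega>. Z \<omega> \<bullet> h \<partial>gauss_space) = 0" by (fact g)+
    show "(\<integral>\<omega>. (Z \<omega> \<bullet> h)\<^sup>2 \<partial>gauss_space) = q h" using g(4) q0[of h] by simp
  qed
  have nt: "norm (blinfun_apply (tproj p) z) \<le> norm (tproj p) * norm z" for z by (rule norm_blinfun)
  have "integrable N (\<lambda>z. (norm z)\<^sup>2)" unfolding N_def using Z2 by (subst integrable_distr_eq) auto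
  note N2 = this
  have tN2: "integrable N (\<lambda>z. (norm (tproj p z))\<^sup>2)"
  proof (rule Bochner_Integration.integrable_bound[of N "\<lambda>z. (norm (tproj p))\<^sup>2 * (norm z)\<^sup>2"])
    show "integrable N (\<lambda>z. (norm (tproj p))\<^sup>2 * (norm z)\<^sup>2)" using N2 by simp
    show "AE z in N. norm ((norm (tproj p z))\<^sup>2) \<le> norm ((norm (tproj p))\<^sup>2 * (norm z)\<^sup>2)"
      using nt by (intro AE_I2) (simp add: power_mult_distrib[symmetric] power_mono)
  qed simp
  have tNi: "integrable N (tproj p)" by (rule N.expectation_norm_le_sqrt(1)[OF _ tN2]) simp
  have tN0: "(\<integral>z. tproj p z \<partial>N) = 0"
  proof (rule inner_ext)
    fix w
    have "(\<integral>z. tproj p z \<partial>N) \<bullet> w = (\<integral>z. tproj p z \<bullet> w \<partial>N)" using tNi by simp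
    also have "\<dots> = (\<integral>\<omega>. Z \<omega> \<bullet> w \<partial>gauss_space)" unfolding N_def by (subst integral_distr) (auto simp: tZ)
    finally show "(\<integral>z. tproj p z \<partial>N) \<bullet> w = 0 \<bullet> w" by (simp add: gs(3))
  qed
  have "\<exists>m. has_expectation N (\<lambda>z. tensor (tproj p z - 0) (tproj p z - 0)) m"
  proof (rule has_expectation_compose_continuous[where Z = "\<lambda>z. z" and q = "\<lambda>z. tensor (tproj p z - 0) (tproj p z - 0)"
        and C = "norm (tproj p) * norm (tproj p)"])
    show "continuous_on UNIV (\<lambda>z. tensor (tproj p z - 0) (tproj p z - 0))"
      by (intro bounded_bilinear.continuous_on[OF bounded_bilinear_tensor] continuous_intros)
    show "norm (tensor (tproj p z - 0) (tproj p z - 0)) \<le> norm (tproj p) * norm (tproj p) * (1 + (norm z)\<^sup>2)" for z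
    proof -
      have "norm (tensor (tproj p z - 0) (tproj p z - 0)) \<le> norm (tproj p z) * norm (tproj p z)"
        using norm_tensor_le[of "tproj p z - 0" "tproj p z - 0"] by simp
      also have "\<dots> \<le> (norm (tproj p) * norm z) * (norm (tproj p) * norm z)" by (intro mult_mono nt) auto
      also have "\<dots> = norm (tproj p) * norm (tproj p) * (norm z)\<^sup>2" by (simp add: power2_eq_square)
      also have "\<dots> \<le> norm (tproj p) * norm (tproj p) * (1 + (norm z)\<^sup>2)" by (intro mult_left_mono) auto
      finally show ?thesis .
    qed
  qed (use N2 N.finite_measure_axioms in auto)
  then obtain m where m: "has_expectation N (\<lambda>z. tensor (tproj p z - 0) (tproj p z - 0)) m" ..
  have "m = C"
  proof (rule blinfun_eqI, rule inner_ext)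
    fix v w
    have "blinfun_apply m v \<bullet> w = (\<integral>z. (tproj p z \<bullet> v) * (tproj p z \<bullet> w) \<partial>N)"
      using has_expectation_inner(2)[OF m, of v w] by simp
    also have "\<dots> = (\<integral>\<omega>. (Z \<omega> \<bullet> v) * (Z \<omega> \<bullet> w) \<partial>gauss_space)"
      unfolding N_def by (subst integral_distr) (auto simp: tZ)
    also have "\<dots> = (\<integral>\<omega>. ((Z \<omega> \<bullet> (v + w))\<^sup>2 - (Z \<omega> \<bullet> (v - w))\<^sup>2) / 4 \<partial>gauss_space)"
      by (intro Bochner_Integration.integral_cong refl)
         (simp add: inner_add_right inner_diff_right power2_eq_square algebra_simps)
    also have "\<dots> = (q (v + w) - q (v - w)) / 4"
    proof -
      have "integrable gauss_space (\<lambda>\<omega>. (Z \<omega> \<bullet> h)\<^sup>2)" for h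
      proof (rule Bochner_Integration.integrable_bound[of gauss_space "\<lambda>\<omega>. (norm (Z \<omega>))\<^sup>2 * (norm h)\<^sup>2"])
        show "AE \<omega> in gauss_space. norm ((Z \<omega> \<bullet> h)\<^sup>2) \<le> norm ((norm (Z \<omega>))\<^sup>2 * (norm h)\<^sup>2)"
          using Cauchy_Schwarz_ineq[of _ h] by (intro AE_I2) (simp add: power2_norm_eq_inner)
      qed (use Z2 in auto)
      then show ?thesis by (simp add: gs(4))
    qed
    finally show "blinfun_apply m v \<bullet> w = blinfun_apply C v \<bullet> w" by (simp add: C)
  qed
  moreover have "blinfun_apply (tproj p) \<in> N \<rightarrow>\<^sub>M restrict_space borel (tangent p)"
    by (rule measurable_restrict_space2) (use tproj_in_tangent[OF p] in auto)
  moreover have "\<exists>a s. s \<ge> 0 \<and> distr N borel (\<lambda>\<omega>. tproj p \<omega> \<bullet> h) = normal_law a s" for h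
  proof -
    have "distr N borel (\<lambda>\<omega>. tproj p \<omega> \<bullet> h) = distr gauss_space borel (\<lambda>\<omega>. Z \<omega> \<bullet> h)"
      unfolding N_def by (subst distr_distr) (auto simp: comp_def tZ)
    then have "distr N borel (\<lambda>\<omega>. tproj p \<omega> \<bullet> h) = normal_law 0 (sqrt (q h))" by (simp add: gs(1))
    moreover have "0 \<le> sqrt (q h)" using q0 by simp
    ultimately show ?thesis by blast
  qed
  ultimately show ?thesis
    unfolding gaussian_element_def N_def[symmetric]
    using N.prob_space_axioms tNi tN0 m by (auto simp: has_bochner_integral_iff)
qed

lemma (in complete_measure) has_expectation_cong_AE:
  assumes g: "has_expectation M g m" and eq: "AE \<omega> in M. f \<omega> = g \<omega>"
  shows "has_expectation M f m"
proof -
  obtain s where s: "g \<in> borel_measurable M" "\<And>i. Bochner_Integration.simple_bochner_integrable M (s i)"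
    "(\<lambda>i. \<integral>\<^sup>+\<omega>. ennreal (norm (g \<omega> - s i \<omega>)) \<partial>M) \<longlonglongrightarrow> 0"
    "(\<lambda>i. Bochner_Integration.simple_bochner_integral M (s i)) \<longlonglongrightarrow> m"
    using g unfolding has_expectation_def by blast
  have "(\<integral>\<^sup>+\<omega>. ennreal (norm (f \<omega> - s i \<omega>)) \<partial>M) = (\<integral>\<^sup>+\<omega>. ennreal (norm (g \<omega> - s i \<omega>)) \<partial>M)" for i
  proof (rule nn_integral_cong_AE)
    show "AE \<omega> in M. ennreal (norm (f \<omega> - s i \<omega>)) = ennreal (norm (g \<omega> - s i \<omega>))"
      using eq by eventually_elim simp
  qed
  then show ?thesis
    unfolding has_expectation_def using s borel_measurable_AE_eq[OF s(1) eq] by (intro conjI exI[of _ s]) auto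
qed

section \<open>Linearization of the first-order condition\<close>

text \<open>The clamped Hessian is continuous in \<open>x\<close> on the whole space and grows at
  most quadratically, so its expectation exists without regard to the support.\<close>

definition cHess :: "'h::real_inner \<Rightarrow> 'h \<Rightarrow> 'h \<Rightarrow>\<^sub>L 'h" where
  "cHess p x = (2 * akc (x \<bullet> p)) *\<^sub>R tensor (tproj p x) (tproj p x) + (2 * agc (x \<bullet> p) * (x \<bullet> p)) *\<^sub>R tproj p"

lemma cHess_eq: "0 \<le> x \<bullet> p \<Longrightarrow> x \<bullet> p \<le> 1 \<Longrightarrow> cHess p x = Hess p x"
  by (simp add: cHess_def Hess_def agc_eq akc_eq)

lemma cHess_apply: "blinfun_apply (cHess p x) v =
    (2 * akc (x \<bullet> p) * (tproj p x \<bullet> v)) *\<^sub>R tproj p x + (2 * agc (x \<bullet> p) * (x \<bullet> p)) *\<^sub>R tproj p v"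
  by (simp add: cHess_def blinfun.bilinear_simps)

lemma akc_bounds:
  obtains K where "K > 0" "\<And>t. 0 \<le> akc t" "\<And>t. akc t \<le> K"
proof -
  obtain K where K: "K > 0" "\<And>t. - 1/2 \<le> t \<Longrightarrow> t \<le> 1 \<Longrightarrow> akap t \<le> K" by (rule akap_bounded) (rule that)
  have "0 \<le> akc t" "akc t \<le> K" for t
    unfolding akc_def using unit_clamp_range[of t] by (auto intro!: akap_nonneg K)
  then show thesis using that K(1) by blast
qed

lemma norm_tproj_le:
  assumes "norm p = 1"
  shows "norm (blinfun_apply (tproj p) v) \<le> norm v"
proof (rule power2_le_imp_le)
  have "p \<bullet> p = 1" using assms by (simp add: norm_eq_1)
  then have "tproj p v \<bullet> tproj p v = v \<bullet> v - (p \<bullet> v)\<^sup>2"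
    by (simp add: tproj_apply inner_diff_left inner_diff_right inner_commute power2_eq_square)
  then show "(norm (blinfun_apply (tproj p) v))\<^sup>2 \<le> (norm v)\<^sup>2" by (simp add: power2_norm_eq_inner)
qed simp

lemma continuous_on_cHess: "continuous_on UNIV (cHess p)"
  unfolding cHess_def[abs_def]
  by (intro continuous_intros bounded_bilinear.continuous_on[OF bounded_bilinear_tensor]
      continuous_on_compose2[OF continuous_on_agc] continuous_on_compose2[OF continuous_on_akc]) auto

lemma cHess_bound:
  assumes p: "norm p = 1"
  obtains C where "C \<ge> 0" "\<And>x. norm (cHess p x) \<le> C * (1 + (norm x)\<^sup>2)"
proof -
  obtain K where K: "K > 0" "\<And>t. 0 \<le> akc t" "\<And>t. akc t \<le> K" using akc_bounds by blast
  have "norm (cHess p x) \<le> (2 * K + 4 * norm (tproj p)) * (1 + (norm x)\<^sup>2)" for x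
  proof -
    have nx: "norm x \<le> 1 + (norm x)\<^sup>2"
    proof -
      have "0 \<le> (norm x - 1)\<^sup>2" by simp
      then have "2 * norm x \<le> 1 + (norm x)\<^sup>2" by (simp add: power2_diff)
      then show ?thesis using norm_ge_zero[of x] by linarith
    qed
    have "norm (tensor (tproj p x) (tproj p x)) \<le> norm x * norm x"
      by (rule order_trans[OF norm_tensor_le]) (intro mult_mono norm_tproj_le[OF p], auto)
    then have "norm (tensor (tproj p x) (tproj p x)) \<le> 1 + (norm x)\<^sup>2" by (simp add: power2_eq_square)
    then have 1: "(2 * akc (x \<bullet> p)) * norm (tensor (tproj p x) (tproj p x)) \<le> (2 * K) * (1 + (norm x)\<^sup>2)"
      using K by (intro mult_mono) auto
    have "\<bar>x \<bullet> p\<bar> \<le> norm x" using Cauchy_Schwarz_ineq2[of x p] p by simp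
    then have "(2 * agc (x \<bullet> p)) * \<bar>x \<bullet> p\<bar> \<le> 4 * (1 + (norm x)\<^sup>2)"
      using nx agc_bounds[of "x \<bullet> p"] by (intro mult_mono) auto
    then have "\<bar>2 * agc (x \<bullet> p) * (x \<bullet> p)\<bar> * norm (tproj p) \<le> (4 * (1 + (norm x)\<^sup>2)) * norm (tproj p)"
      using agc_bounds[of "x \<bullet> p"] by (intro mult_right_mono) (auto simp: abs_mult)
    with 1 show ?thesis
      unfolding cHess_def using K(2)[of "x \<bullet> p"]
      by (intro order_trans[OF norm_triangle_ineq]) (simp add: algebra_simps)
  qed
  then show thesis using that[of "2 * K + 4 * norm (tproj p)"] K(1) by simp
qed

section \<open>Averages over a sample\<close>

definition average :: "nat \<Rightarrow> (nat \<Rightarrow> 'a::real_vector) \<Rightarrow> 'a" where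
  "average n f = (1 / real n) *\<^sub>R (\<Sum>i<n. f i)"

lemma average_add: "average n (\<lambda>i. f i + g i) = average n f + average n g"
  by (simp add: average_def sum.distrib scaleR_add_right)

lemma average_diff: "average n (\<lambda>i. f i - g i) = average n f - average n g"
  by (simp add: average_def sum_subtractf scaleR_diff_right)

lemma average_scaleR_left: "average n (\<lambda>i. c i *\<^sub>R v) = average n c *\<^sub>R v"
  by (simp add: average_def flip: scaleR_sum_left)

lemma average_linear: "linear h \<Longrightarrow> h (average n f) = average n (\<lambda>i. h (f i))"
  by (simp add: average_def linear_scale linear_sum)

lemma average_blinfun: "blinfun_apply A (average n f) = average n (\<lambda>i. blinfun_apply A (f i))"
  by (rule average_linear) (simp add: blinfun.bounded_linear_right bounded_linear.linear)

lemma average_inner: "average n f \<bullet> w = average n (\<lambda>i. f i \<bullet> w)"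
  by (simp add: average_def inner_sum_left)

lemma average_cong: "(\<And>i. f i = g i) \<Longrightarrow> average n f = average n g"
  by (simp add: average_def)

lemma norm_average_le:
  fixes f :: "nat \<Rightarrow> 'a::real_normed_vector"
  assumes "n \<ge> 1" "\<And>i. norm (f i) \<le> c"
  shows "norm (average n f) \<le> c"
proof -
  have "norm (\<Sum>i<n. f i) \<le> real n * c" using sum_norm_bound[of "{..<n}" f c] assms(2) by simp
  then show ?thesis using assms(1) by (simp add: average_def field_simps)
qed

text \<open>The first-order condition at \<open>p\<close> is projected to the tangent space at
  \<open>\<mu>\<close>. Its left side is expanded around \<open>\<mu>\<close>; its right side is
  \<open>l *\<^sub>R P d\<close>, as the projection kills \<open>\<mu>\<close>. Left over are the
  Taylor error \<open>r\<close>, the normal part of the chord in \<open>\<rho>\<close>, and the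
  change of the multiplier.\<close>

lemma sample_grad_expansion:
  fixes U :: "'h::{real_inner, banach, second_countable_topology} set"
  assumes U: "U \<subseteq> sphere 0 1" "\<forall>u\<in>U. \<forall>v\<in>U. 0 \<le> u \<bullet> v"
    and m: "norm \<mu> = 1" "\<forall>u\<in>U. 0 \<le> \<mu> \<bullet> u" and \<eta>: "\<eta> > 0"
  obtains C where "C \<ge> 0" "\<And>n xs p. n \<ge> 1 \<Longrightarrow> (\<And>i. xs i \<in> U) \<Longrightarrow> is_sample_intrinsic_mean n xs p \<Longrightarrow>
    norm ((1/2) *\<^sub>R average n (\<lambda>i. cHess \<mu> (xs i)) (p - \<mu>) - tproj \<mu> (sample_grad n xs \<mu>))
      \<le> \<eta> * norm (p - \<mu>) + C * (norm (p - \<mu>))\<^sup>2"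
proof -
  obtain K where K: "K > 0" "\<And>t. 0 \<le> akc t" "\<And>t. akc t \<le> K" using akc_bounds by blast
  obtain L where L: "L > 0" "\<And>s t. s \<in> {-1/2..1} \<Longrightarrow> t \<in> {-1/2..1} \<Longrightarrow> \<bar>ag s - ag t\<bar> \<le> L * \<bar>s - t\<bar>"
    using ag_lipschitz by blast
  obtain C1 where C1: "C1 \<ge> 0"
    "\<And>s t. s \<in> {0..1} \<Longrightarrow> t \<in> {0..1} \<Longrightarrow> \<bar>ag s - ag t + akap t * (s - t)\<bar> \<le> \<eta> * \<bar>s - t\<bar> + C1 * (s - t)\<^sup>2"
    using ag_linearization[OF \<eta>] by blast
  have "norm ((1/2) *\<^sub>R average n (\<lambda>i. cHess \<mu> (xs i)) (p - \<mu>) - tproj \<mu> (sample_grad n xs \<mu>))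
      \<le> \<eta> * norm (p - \<mu>) + (C1 + K / 2 + L + 2) * (norm (p - \<mu>))\<^sup>2"
    if n: "n \<ge> 1" and xs: "\<And>i. xs i \<in> U" and p: "is_sample_intrinsic_mean n xs p" for n xs p
  proof -
    note sp = sample_mean_properties[OF n U xs p]
    define d where "d = p - \<mu>"
    define s where "s i = xs i \<bullet> p" for i
    define t where "t i = xs i \<bullet> \<mu>" for i
    have nx: "norm (xs i) = 1" for i
      using subsetD[OF U(1) xs[of i]] by simp
    have t: "0 \<le> t i" "t i \<le> 1" for i
      using m(2)[rule_format, OF xs[of i]] inner_sphere_bounds[OF nx[of i] m(1)] by (auto simp: t_def inner_commute)
    have s: "0 \<le> s i" "s i \<le> 1" for i
      using sp(2)[OF xs[of i]] inner_sphere_bounds[OF nx[of i] sp(1)] by (auto simp: s_def inner_commute)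
    have st: "s i - t i = xs i \<bullet> d" for i by (simp add: s_def t_def d_def inner_diff_right)
    have std: "\<bar>s i - t i\<bar> \<le> norm d" for i
      using Cauchy_Schwarz_ineq2[of "xs i" d] nx[of i] by (simp add: st)
    have sg: "sample_grad n xs q = average n (\<lambda>i. agc (xs i \<bullet> q) *\<^sub>R xs i)" for q
      by (simp add: sample_grad_def average_def)
    define P where "P = blinfun_apply (tproj \<mu>)"
    have Pav: "P (average n f) = average n (\<lambda>i. P (f i))" for f unfolding P_def by (rule average_blinfun)
    have P_lin: "P (a + b) = P a + P b" "P (a - b) = P a - P b" "P (c *\<^sub>R a) = c *\<^sub>R P a" for a b c
      by (auto simp: P_def blinfun.bilinear_simps)
    have nP: "norm (P v) \<le> norm v" for v unfolding P_def by (rule norm_tproj_le[OF m(1)])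
    have P\<mu>: "P \<mu> = 0" unfolding P_def by (rule tproj_self[OF m(1)])
    define r where "r = average n (\<lambda>i. (ag (s i) - ag (t i) + akap (t i) * (s i - t i)) *\<^sub>R xs i)"
    define \<rho> where "\<rho> = average n (\<lambda>i. (akap (t i) * t i) *\<^sub>R P (xs i))"
    \<comment> \<open>\<open>a\<close> is the coefficient of \<open>P d\<close> in the averaged
      Hessian, \<open>l\<close> the multiplier at the sample mean. They differ by O(|d|), so the
      mismatch applied to \<open>P d\<close> is quadratic.\<close>
    define a where "a = sample_grad n xs \<mu> \<bullet> \<mu>"
    define l where "l = sample_grad n xs p \<bullet> p"
    have nr: "norm r \<le> \<eta> * norm d + C1 * (norm d)\<^sup>2"
      unfolding r_def
    proof (rule norm_average_le[OF n])
      fix i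
      have "norm ((ag (s i) - ag (t i) + akap (t i) * (s i - t i)) *\<^sub>R xs i) = \<bar>ag (s i) - ag (t i) + akap (t i) * (s i - t i)\<bar>"
        using nx by simp
      also have "\<dots> \<le> \<eta> * \<bar>s i - t i\<bar> + C1 * (s i - t i)\<^sup>2" using s t by (intro C1) auto
      also have "\<dots> \<le> \<eta> * norm d + C1 * (norm d)\<^sup>2"
      proof -
          have "(s i - t i)\<^sup>2 \<le> (norm d)\<^sup>2" using std[of i] by (simp add: abs_le_square_iff[symmetric])
          then show ?thesis using std[of i] \<eta> C1(1) by (intro add_mono mult_left_mono) auto
        qed
      finally show "norm ((ag (s i) - ag (t i) + akap (t i) * (s i - t i)) *\<^sub>R xs i) \<le> \<eta> * norm d + C1 * (norm d)\<^sup>2" .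
    qed
    have n\<rho>: "norm \<rho> \<le> K"
      unfolding \<rho>_def
    proof (rule norm_average_le[OF n])
      fix i
      have "akap (t i) = akc (t i)" using t[of i] by (simp add: akc_eq)
      then have k: "0 \<le> akap (t i)" "akap (t i) \<le> K" using K(2,3)[of "t i"] by simp_all
      have "norm (P (xs i)) \<le> 1" using nP[of "xs i"] nx[of i] by simp
      then have "akap (t i) * t i * norm (P (xs i)) \<le> K * 1 * 1"
        using k t[of i] K(1) by (intro mult_mono) auto
      then show "norm ((akap (t i) * t i) *\<^sub>R P (xs i)) \<le> K" using k t[of i] by (simp add: abs_mult)
    qed
    have al: "\<bar>a - l\<bar> \<le> (L + 2) * norm d"
    proof -
      have "sample_grad n xs p - sample_grad n xs \<mu> = average n (\<lambda>i. (ag (s i) - ag (t i)) *\<^sub>R xs i)"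
        unfolding sg average_diff[symmetric] using s t
        by (intro average_cong) (simp add: s_def[symmetric] t_def[symmetric] agc_eq scaleR_diff_left)
      moreover have "norm \<dots> \<le> L * norm d"
      proof (rule norm_average_le[OF n])
        fix i
        have "\<bar>ag (s i) - ag (t i)\<bar> \<le> L * \<bar>s i - t i\<bar>"
          using s[of i] t[of i] by (intro L) auto
        also have "\<dots> \<le> L * norm d" using std[of i] L(1) by (intro mult_left_mono) auto
        finally show "norm ((ag (s i) - ag (t i)) *\<^sub>R xs i) \<le> L * norm d" using nx[of i] by simp
      qed
      ultimately have 1: "norm (sample_grad n xs p - sample_grad n xs \<mu>) \<le> L * norm d" by simp
      have 2: "norm (sample_grad n xs \<mu>) \<le> 2"
        unfolding sg
      proof (rule norm_average_le[OF n])
        show "norm (agc (xs i \<bullet> \<mu>) *\<^sub>R xs i) \<le> 2" for i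
          using agc_bounds[of "xs i \<bullet> \<mu>"] nx[of i] by simp
      qed
      have "l - a = (sample_grad n xs p - sample_grad n xs \<mu>) \<bullet> p + sample_grad n xs \<mu> \<bullet> d"
        by (simp add: l_def a_def d_def inner_diff_left inner_diff_right)
      then have "\<bar>l - a\<bar> \<le> norm (sample_grad n xs p - sample_grad n xs \<mu>) * norm p + norm (sample_grad n xs \<mu>) * norm d"
        using Cauchy_Schwarz_ineq2[of "sample_grad n xs p - sample_grad n xs \<mu>" p] Cauchy_Schwarz_ineq2[of "sample_grad n xs \<mu>" d]
        by linarith
      also have "\<dots> \<le> L * norm d * 1 + 2 * norm d"
        using 1 2 sp(1) L(1) by (intro add_mono mult_mono) auto
      finally show ?thesis by (simp add: algebra_simps abs_minus_commute)
    qed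
    have \<mu>d: "\<mu> \<bullet> d = - ((norm d)\<^sup>2 / 2)"
    proof -
      have "\<mu> \<bullet> \<mu> = 1" using m(1) by (simp add: norm_eq_1)
      then have "\<mu> \<bullet> d = \<mu> \<bullet> p - 1" by (simp add: d_def inner_diff_right)
      then show ?thesis using norm_diff_sphere[OF sp(1) m(1)] by (simp add: d_def inner_commute diff_divide_distrib)
    qed
    have Pd: "P (xs i) \<bullet> d = xs i \<bullet> d + t i * ((norm d)\<^sup>2 / 2)" for i
      unfolding P_def tproj_apply inner_diff_left inner_scaleR_left \<mu>d by (simp add: t_def inner_commute)
    have e1: "P (sample_grad n xs p) = P (sample_grad n xs \<mu>) + P r - average n (\<lambda>i. (akap (t i) * (xs i \<bullet> d)) *\<^sub>R P (xs i))"
    proof -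
      have "agc (xs i \<bullet> p) *\<^sub>R xs i = agc (xs i \<bullet> \<mu>) *\<^sub>R xs i + (ag (s i) - ag (t i) + akap (t i) * (s i - t i)) *\<^sub>R xs i - (akap (t i) * (xs i \<bullet> d)) *\<^sub>R xs i" for i
        using s[of i] t[of i] by (simp add: s_def[symmetric] t_def[symmetric] agc_eq st algebra_simps)
      then have "sample_grad n xs p = sample_grad n xs \<mu> + r - average n (\<lambda>i. (akap (t i) * (xs i \<bullet> d)) *\<^sub>R xs i)"
        unfolding sg r_def average_add[symmetric] average_diff[symmetric] by (rule average_cong)
      then show ?thesis by (simp add: P_lin Pav)
    qed
    have e2: "average n (\<lambda>i. (akap (t i) * (xs i \<bullet> d)) *\<^sub>R P (xs i))
        = average n (\<lambda>i. (akap (t i) * (P (xs i) \<bullet> d)) *\<^sub>R P (xs i)) - ((norm d)\<^sup>2 / 2) *\<^sub>R \<rho>"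
    proof -
      have "((norm d)\<^sup>2 / 2) *\<^sub>R \<rho> = average n (\<lambda>i. ((norm d)\<^sup>2 / 2) *\<^sub>R ((akap (t i) * t i) *\<^sub>R P (xs i)))"
        unfolding \<rho>_def by (rule average_linear) (simp add: linear_scale_self)
      then show ?thesis
        unfolding average_diff[symmetric] by (simp only:, simp add: average_diff[symmetric])
          (intro average_cong, simp add: Pd algebra_simps)
    qed
    have e3: "(1/2) *\<^sub>R average n (\<lambda>i. cHess \<mu> (xs i)) d
        = average n (\<lambda>i. (akap (t i) * (P (xs i) \<bullet> d)) *\<^sub>R P (xs i)) + a *\<^sub>R P d"
    proof -
      have "linear (\<lambda>A. (1/2) *\<^sub>R blinfun_apply A d)"
        by (intro bounded_linear.linear bounded_linear_scaleR_right[THEN bounded_linear_compose] blinfun.bounded_linear_left)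
      then have "(1/2) *\<^sub>R average n (\<lambda>i. cHess \<mu> (xs i)) d = average n (\<lambda>i. (1/2) *\<^sub>R cHess \<mu> (xs i) d)"
        by (rule average_linear)
      also have "\<dots> = average n (\<lambda>i. (akap (t i) * (P (xs i) \<bullet> d)) *\<^sub>R P (xs i) + (agc (t i) * t i) *\<^sub>R P d)"
        using t by (intro average_cong) (simp add: cHess_apply t_def[symmetric] P_def[symmetric] akc_eq scaleR_add_right)
      also have "\<dots> = average n (\<lambda>i. (akap (t i) * (P (xs i) \<bullet> d)) *\<^sub>R P (xs i)) + average n (\<lambda>i. agc (t i) * t i) *\<^sub>R P d"
        by (simp only: average_add average_scaleR_left)
      also have "average n (\<lambda>i. agc (t i) * t i) = a" by (simp add: a_def sg average_inner t_def)
      finally show ?thesis .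
    qed
    have e4: "P (sample_grad n xs p) = l *\<^sub>R P d"
      using sp(3) P\<mu> by (metis P_lin(2,3) d_def diff_zero l_def)
    have "(1/2) *\<^sub>R average n (\<lambda>i. cHess \<mu> (xs i)) d - P (sample_grad n xs \<mu>) = P r + ((norm d)\<^sup>2 / 2) *\<^sub>R \<rho> + (a - l) *\<^sub>R P d"
      using e1 unfolding e2 e3 e4 by (simp add: algebra_simps)
    also have "norm \<dots> \<le> norm (P r) + norm (((norm d)\<^sup>2 / 2) *\<^sub>R \<rho>) + norm ((a - l) *\<^sub>R P d)"
      by (intro norm_triangle_le add_mono norm_triangle_ineq order_refl)
    also have "\<dots> \<le> (\<eta> * norm d + C1 * (norm d)\<^sup>2) + (norm d)\<^sup>2 / 2 * K + ((L + 2) * norm d) * norm d"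
    proof (intro add_mono)
      show "norm (P r) \<le> \<eta> * norm d + C1 * (norm d)\<^sup>2" using nP[of r] nr by linarith
      show "norm (((norm d)\<^sup>2 / 2) *\<^sub>R \<rho>) \<le> (norm d)\<^sup>2 / 2 * K" using n\<rho> by (simp add: mult_left_mono)
      show "norm ((a - l) *\<^sub>R P d) \<le> ((L + 2) * norm d) * norm d"
        unfolding norm_scaleR using al nP[of d] by (intro mult_mono) auto
    qed
    also have "\<dots> = \<eta> * norm d + (C1 + K / 2 + L + 2) * (norm d)\<^sup>2" by (simp add: power2_eq_square algebra_simps)
    finally show ?thesis by (simp add: d_def P_def)
  qed
  then show thesis using that[of "C1 + K / 2 + L + 2"] C1(1) K(1) L(1) by simp
qed

text \<open>As \<open>I\<close> undoes \<open>B\<close> on tangent vectors, the Hessian at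
  \<open>x\<close> of the chord is \<open>A\<close> applied to \<open>B\<close> of the chord, and
  half of the latter is the projected sample gradient up to the linearization error and the
  deviation of the averaged Hessian from \<open>B\<close>. Stability converts chord lengths into the
  norm of the centered gradient.\<close>

lemma sample_mean_expansion:
  fixes U :: "'h::{real_inner, banach, second_countable_topology} set"
  assumes U: "U \<subseteq> sphere 0 1" "\<forall>u\<in>U. \<forall>v\<in>U. 0 \<le> u \<bullet> v"
    and m: "norm \<mu> = 1" "\<forall>u\<in>U. 0 \<le> \<mu> \<bullet> u" and lam: "lam > 0"
    and x: "norm x = 1" "x \<noteq> - \<mu>"
    and B: "B \<in> tangent_op \<mu>" and I: "\<And>v. v \<in> tangent \<mu> \<Longrightarrow> blinfun_apply I (blinfun_apply B v) = v"
    and \<eta>: "\<eta> > 0"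
  obtains C where "C \<ge> 0" "\<And>n xs p. n \<ge> 1 \<Longrightarrow> (\<And>i. xs i \<in> U) \<Longrightarrow> is_sample_intrinsic_mean n xs p \<Longrightarrow>
    norm (ptransport p \<mu> (slog p x) - slog \<mu> x + Hess \<mu> x (I (tproj \<mu> (sample_grad n xs \<mu>))))
      \<le> \<eta> * norm (sample_grad n xs \<mu> - lam *\<^sub>R \<mu>) + C * (norm (sample_grad n xs \<mu> - lam *\<^sub>R \<mu>))\<^sup>2
        + C * norm (average n (\<lambda>i. cHess \<mu> (xs i)) - B) * norm (sample_grad n xs \<mu> - lam *\<^sub>R \<mu>)"
proof -
  define A where "A = Hess \<mu> x o\<^sub>L I"
  define k where "k = 2 / lam"
  \<comment> \<open>\<open>k\<close> is the stability constant 2 / lam; the linear errors of both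
    expansions then add up to exactly \<eta>.\<close>
  define \<eta>' where "\<eta>' = \<eta> / (k * (1 + norm A))"
  have k: "k > 0" using lam by (simp add: k_def)
  have A0: "0 < 1 + norm A" by (simp add: add_pos_nonneg)
  have eta': "\<eta>' > 0" using \<eta> k A0 by (simp add: \<eta>'_def)
  obtain C1 where C1: "C1 \<ge> 0" "\<And>n xs p. n \<ge> 1 \<Longrightarrow> (\<And>i. xs i \<in> U) \<Longrightarrow> is_sample_intrinsic_mean n xs p \<Longrightarrow>
    norm ((1/2) *\<^sub>R average n (\<lambda>i. cHess \<mu> (xs i)) (p - \<mu>) - tproj \<mu> (sample_grad n xs \<mu>))
      \<le> \<eta>' * norm (p - \<mu>) + C1 * (norm (p - \<mu>))\<^sup>2"
    using sample_grad_expansion[OF U m eta'] by blast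
  obtain C2 where C2: "C2 \<ge> 0" "\<And>p. norm p = 1 \<Longrightarrow>
    norm (ptransport p \<mu> (slog p x) - slog \<mu> x + (1/2) *\<^sub>R Hess \<mu> x (p - \<mu>)) \<le> \<eta>' * norm (p - \<mu>) + C2 * (norm (p - \<mu>))\<^sup>2"
    using ptransport_slog_expansion[OF m(1) x eta'] by blast
  define C where "C = max (k\<^sup>2 * (C2 + norm A * C1)) (norm A * k / 2)"
  have C: "k\<^sup>2 * (C2 + norm A * C1) \<le> C" "norm A * k / 2 \<le> C" "0 \<le> C"
    using k C1(1) C2(1) by (auto simp: C_def le_max_iff_disj)
  have "norm (ptransport p \<mu> (slog p x) - slog \<mu> x + Hess \<mu> x (I (tproj \<mu> (sample_grad n xs \<mu>))))
      \<le> \<eta> * norm (sample_grad n xs \<mu> - lam *\<^sub>R \<mu>) + C * (norm (sample_grad n xs \<mu> - lam *\<^sub>R \<mu>))\<^sup>2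
        + C * norm (average n (\<lambda>i. cHess \<mu> (xs i)) - B) * norm (sample_grad n xs \<mu> - lam *\<^sub>R \<mu>)"
    if n: "n \<ge> 1" and xs: "\<And>i. xs i \<in> U" and p: "is_sample_intrinsic_mean n xs p" for n xs p
  proof -
    note sp = sample_mean_properties[OF n U xs p]
    define d where "d = p - \<mu>"
    define e where "e = norm (sample_grad n xs \<mu> - lam *\<^sub>R \<mu>)"
    define Bn where "Bn = average n (\<lambda>i. cHess \<mu> (xs i))"
    define \<beta> where "\<beta> = norm (Bn - B)"
    define w where "w = (1/2) *\<^sub>R Bn d - tproj \<mu> (sample_grad n xs \<mu>)"
    define \<Psi> where "\<Psi> = ptransport p \<mu> (slog p x) - slog \<mu> x"
    have e0: "e \<ge> 0" and \<beta>0: "\<beta> \<ge> 0" by (auto simp: e_def \<beta>_def)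
    have "lam / 2 * norm (\<mu> - p) \<le> e" unfolding e_def by (rule sp(5)[OF m])
    then have de: "norm d \<le> k * e" using lam by (simp add: d_def k_def norm_minus_commute field_simps)
    have w: "norm w \<le> \<eta>' * norm d + C1 * (norm d)\<^sup>2"
      unfolding w_def d_def Bn_def by (rule C1(2)[OF n xs p])
    have \<Psi>: "norm (\<Psi> + (1/2) *\<^sub>R Hess \<mu> x d) \<le> \<eta>' * norm d + C2 * (norm d)\<^sup>2"
      unfolding \<Psi>_def d_def by (rule C2(2)[OF sp(1)])
    have "I (B d) = tproj \<mu> d"
      using I[OF tproj_in_tangent[OF m(1), of d]] tangent_op_apply_tproj[of B \<mu> d] B by (simp add: tangent_op_def)
    then have "A (B d) = Hess \<mu> x d"
      using tangent_op_apply_tproj[of "Hess \<mu> x" \<mu> d] Hess_tangent_op[OF m(1), of x] by (simp add: A_def tangent_op_def)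
    moreover have "(1/2) *\<^sub>R B d = tproj \<mu> (sample_grad n xs \<mu>) + (w - (1/2) *\<^sub>R (Bn - B) d)"
      by (simp add: w_def blinfun.bilinear_simps algebra_simps)
    ultimately have "(1/2) *\<^sub>R Hess \<mu> x d = A (tproj \<mu> (sample_grad n xs \<mu>)) + A (w - (1/2) *\<^sub>R (Bn - B) d)"
      by (metis blinfun.add_right blinfun.scaleR_right)
    then have "\<Psi> + Hess \<mu> x (I (tproj \<mu> (sample_grad n xs \<mu>))) = (\<Psi> + (1/2) *\<^sub>R Hess \<mu> x d) - A (w - (1/2) *\<^sub>R (Bn - B) d)"
      by (simp add: A_def)
    then have "norm (\<Psi> + Hess \<mu> x (I (tproj \<mu> (sample_grad n xs \<mu>)))) \<le> norm (\<Psi> + (1/2) *\<^sub>R Hess \<mu> x d) + norm (A (w - (1/2) *\<^sub>R (Bn - B) d))"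
      by (simp only: norm_triangle_ineq4)
    also have "norm (A (w - (1/2) *\<^sub>R (Bn - B) d)) \<le> norm A * (norm w + \<beta> * norm d / 2)"
    proof (rule order_trans[OF norm_blinfun], rule mult_left_mono)
      have "norm ((1/2) *\<^sub>R (Bn - B) d) \<le> \<beta> * norm d / 2" using norm_blinfun[of "Bn - B" d] by (simp add: \<beta>_def)
      then show "norm (w - (1/2) *\<^sub>R (Bn - B) d) \<le> norm w + \<beta> * norm d / 2"
        by (intro order_trans[OF norm_triangle_ineq4] add_left_mono)
    qed simp
    also have "norm (\<Psi> + (1/2) *\<^sub>R Hess \<mu> x d) + norm A * (norm w + \<beta> * norm d / 2)
      \<le> (\<eta>' * norm d + C2 * (norm d)\<^sup>2) + norm A * ((\<eta>' * norm d + C1 * (norm d)\<^sup>2) + \<beta> * norm d / 2)"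
      by (intro add_mono mult_left_mono \<Psi> w) auto
    also have "\<dots> = \<eta>' * (1 + norm A) * norm d + (C2 + norm A * C1) * (norm d)\<^sup>2 + norm A * \<beta> / 2 * norm d"
      by (simp add: algebra_simps)
    also have "\<dots> \<le> \<eta>' * (1 + norm A) * (k * e) + (C2 + norm A * C1) * (k * e)\<^sup>2 + norm A * \<beta> / 2 * (k * e)"
      using de eta' A0 C1(1) C2(1) \<beta>0 by (intro add_mono mult_left_mono power_mono) auto
    also have "\<eta>' * (1 + norm A) * (k * e) = \<eta> * e" using k A0 by (simp add: \<eta>'_def)
    also have "(C2 + norm A * C1) * (k * e)\<^sup>2 = (k\<^sup>2 * (C2 + norm A * C1)) * e\<^sup>2" by (simp add: power_mult_distrib)
    also have "norm A * \<beta> / 2 * (k * e) = (norm A * k / 2) * (\<beta> * e)" by simp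
    also have "\<eta> * e + (k\<^sup>2 * (C2 + norm A * C1)) * e\<^sup>2 + (norm A * k / 2) * (\<beta> * e) \<le> \<eta> * e + C * e\<^sup>2 + C * (\<beta> * e)"
      using e0 \<beta>0 by (intro add_mono mult_right_mono C order_refl) auto
    finally show ?thesis by (simp add: \<Psi>_def e_def \<beta>_def Bn_def mult.assoc)
  qed
  then show thesis using that[OF C(3)] by blast
qed

lemma slog_ptransport_measurable:
  fixes x q :: "'h::{real_inner, banach, second_countable_topology}"
  shows "(\<lambda>p. ptransport p q ((arccos (max (- 1) (min 1 (p \<bullet> x))) / norm (x - (p \<bullet> x) *\<^sub>R p)) *\<^sub>R (x - (p \<bullet> x) *\<^sub>R p)))
    \<in> borel_measurable borel"
proof -
  have "continuous_on UNIV (\<lambda>t. arccos (max (- 1) (min 1 t)))"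
    by (intro continuous_intros) auto
  then have [measurable]: "(\<lambda>t. arccos (max (- 1) (min 1 t))) \<in> borel_measurable borel"
    by (rule borel_measurable_continuous_onI)
  have "(\<lambda>p. arccos (max (- 1) (min 1 (p \<bullet> x)))) \<in> borel_measurable borel"
    by (rule measurable_compose[where g="\<lambda>t. arccos (max (- 1) (min 1 t))"]) measurable
  note [measurable] = this
  show ?thesis unfolding ptransport_def by measurable
qed

text \<open>Separates the factors before taking expectations: Young's inequality splits the product
  of \<open>b\<close> and \<open>e\<close>, and \<open>b \<le> K\<close> makes b^2 linear. What is
  known is that s^2 e^2 is bounded in L1 and that \<open>b\<close> tends to 0 in L1.\<close>

lemma weighted_error_bound:
  fixes e b K C \<eta> s :: real
  assumes "0 \<le> e" "0 \<le> b" "b \<le> K" "0 \<le> C" "0 < \<eta>" "0 < s"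
  shows "s * (\<eta> * e + C * e\<^sup>2 + C * b * e)
    \<le> \<eta> + (2 * \<eta> + C / s) * (s\<^sup>2 * e\<^sup>2) + (C\<^sup>2 * K / (4 * \<eta>)) * b"
proof -
  have "s * e \<le> 1 + s\<^sup>2 * e\<^sup>2"
  proof -
    have "0 \<le> (s * e - 1)\<^sup>2" by simp
    then have "2 * (s * e) \<le> 1 + s\<^sup>2 * e\<^sup>2" by (simp add: power2_diff power_mult_distrib)
    moreover have "0 \<le> s * e" using assms by simp
    ultimately show ?thesis by linarith
  qed
  then have 1: "\<eta> * (s * e) \<le> \<eta> * (1 + s\<^sup>2 * e\<^sup>2)" using assms by (intro mult_left_mono) auto
  have 2: "s * (C * e\<^sup>2) = C / s * (s\<^sup>2 * e\<^sup>2)" using assms by (simp add: power2_eq_square)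
  have "(C * b) * (s * e) \<le> \<eta> * (s * e)\<^sup>2 + (C * b)\<^sup>2 / (4 * \<eta>)"
  proof -
    have "0 \<le> (2 * \<eta> * (s * e) - C * b)\<^sup>2 / (4 * \<eta>)" using assms by simp
    also have "\<dots> = \<eta> * (s * e)\<^sup>2 + (C * b)\<^sup>2 / (4 * \<eta>) - (C * b) * (s * e)"
      using assms by (simp add: field_simps power2_eq_square)
    finally show ?thesis by simp
  qed
  moreover have "(C * b)\<^sup>2 / (4 * \<eta>) \<le> (C\<^sup>2 * K / (4 * \<eta>)) * b"
  proof -
    have "(C * b)\<^sup>2 / (4 * \<eta>) = C\<^sup>2 * (b * b) / (4 * \<eta>)" by (simp add: power2_eq_square mult_ac)
    also have "\<dots> \<le> C\<^sup>2 * (K * b) / (4 * \<eta>)"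
      using assms by (intro divide_right_mono mult_left_mono mult_right_mono) auto
    finally show ?thesis by (simp add: mult.assoc)
  qed
  ultimately have 3: "s * (C * b * e) \<le> \<eta> * (s\<^sup>2 * e\<^sup>2) + (C\<^sup>2 * K / (4 * \<eta>)) * b"
    by (simp add: power_mult_distrib mult.commute mult.left_commute)
  show ?thesis using 1 2 3 by (simp add: algebra_simps)
qed

section \<open>The linearized problem and its limit law\<close>

locale sphere_sample = prob_space M + complete_measure M for M :: "'w measure" +
  fixes X :: "'w \<Rightarrow> 'h::{real_inner, banach, second_countable_topology}"
    and Xs :: "nat \<Rightarrow> 'w \<Rightarrow> 'h" and U :: "'h set" and \<mu> :: 'h
  assumes X_measurable: "X \<in> M \<rightarrow>\<^sub>M sphere_borel"
    and U_def: "U = rv_support M X" and X_in_U: "AE \<omega> in M. X \<omega> \<in> U"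
    and U_diameter: "(SUP (y, z)\<in>U \<times> U. rho y z) \<le> pi / 2"
    and mean: "is_intrinsic_mean M X \<mu>"
    and indep: "indep_vars (\<lambda>_. sphere_borel) Xs UNIV"
    and identical: "\<And>i. distr M sphere_borel (Xs i) = distr M sphere_borel X"
begin

section \<open>From the sphere to the ambient space\<close>

lemma Xs_measurable: "Xs i \<in> M \<rightarrow>\<^sub>M sphere_borel"
  using indep by (simp add: indep_vars_def)

lemma sphere_valued:
  assumes "f \<in> M \<rightarrow>\<^sub>M sphere_borel"
  shows "f \<in> borel_measurable M" "\<omega> \<in> space M \<Longrightarrow> norm (f \<omega>) = 1"
  using measurable_compose[OF assms id_sphere_borel] measurable_space[OF assms, of \<omega>]
  by (auto simp: space_sphere_borel)

lemma X_borel [measurable]: "X \<in> borel_measurable M" and Xs_borel [measurable]: "Xs i \<in> borel_measurable M"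
  using X_measurable Xs_measurable by (auto intro: sphere_valued)

lemma norm_X: "\<omega> \<in> space M \<Longrightarrow> norm (X \<omega>) = 1" and norm_Xs: "\<omega> \<in> space M \<Longrightarrow> norm (Xs i \<omega>) = 1"
  using X_measurable Xs_measurable by (auto intro: sphere_valued)

sublocale sphere_variable M X
  by unfold_locales (auto simp: norm_X)

lemma U_sphere: "U \<subseteq> sphere 0 1"
  by (auto simp: U_def rv_support_def)

lemma U_nonneg: "\<forall>u\<in>U. \<forall>v\<in>U. 0 \<le> u \<bullet> v"
  using support_inner_nonneg[OF U_diameter U_sphere] by blast

text \<open>The complement of the support is measurable, so its probability is the same for
  \<open>X\<close> and each \<open>Xs i\<close>.\<close>

lemma Xs_in_U: "AE \<omega> in M. \<forall>i. Xs i \<omega> \<in> U"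
proof (subst AE_all_countable, rule allI)
  fix i
  have S: "sphere 0 1 - U \<in> sets sphere_borel"
    unfolding U_def by (rule sets_sphere_borel[OF rho_open_minus_support])
  have eq: "measure (distr M sphere_borel (Xs i)) (sphere 0 1 - U) = measure (distr M sphere_borel X) (sphere 0 1 - U)"
    by (simp add: identical)
  have ev: "Y -` (sphere 0 1 - U) \<inter> space M \<in> events" if "Y \<in> M \<rightarrow>\<^sub>M sphere_borel" for Y
    by (rule measurable_sets[OF that S])
  have AEU: "(AE \<omega> in M. Y \<omega> \<in> U) \<longleftrightarrow> prob (Y -` (sphere 0 1 - U) \<inter> space M) = 0"
    if Y: "Y \<in> M \<rightarrow>\<^sub>M sphere_borel" for Y
  proof -
    have "(AE \<omega> in M. Y \<omega> \<in> U) \<longleftrightarrow> (AE \<omega> in M. \<omega> \<notin> Y -` (sphere 0 1 - U) \<inter> space M)"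
      using sphere_valued(2)[OF Y] by (intro AE_cong) auto
    also have "\<dots> \<longleftrightarrow> prob (Y -` (sphere 0 1 - U) \<inter> space M) = 0"
      using ev[OF Y] by (simp add: prob_eq_0)
    finally show ?thesis .
  qed
  show "AE \<omega> in M. Xs i \<omega> \<in> U"
    using eq X_in_U unfolding AEU[OF X_measurable] AEU[OF Xs_measurable]
    by (simp add: measure_distr[OF X_measurable S] measure_distr[OF Xs_measurable S])
qed

lemma norm_mu: "norm \<mu> = 1"
  using mean by (rule intrinsic_mean_norm)

lemma mu_nonneg: "\<forall>u\<in>U. 0 \<le> \<mu> \<bullet> u"
  using intrinsic_mean_inner_nonneg[OF U_sphere U_nonneg X_in_U mean] by blast

lemma X_mu: "AE \<omega> in M. 0 \<le> X \<omega> \<bullet> \<mu> \<and> X \<omega> \<bullet> \<mu> \<le> 1"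
  using X_in_U AE_space
proof eventually_elim
  case (elim \<omega>)
  then show ?case
    using mu_nonneg inner_sphere_bounds(2)[OF norm_X norm_mu] by (auto simp: inner_commute)
qed

definition lam :: real where
  "lam = grad \<mu> \<bullet> \<mu>"

lemma lam_pos: "lam > 0"
  unfolding lam_def
proof (rule multiplier_pos[OF _ mean])
  show "AE \<omega> in M. 0 \<le> X \<omega> \<bullet> \<mu>" using X_mu by eventually_elim simp
  show "expectation X \<noteq> 0"
    by (rule support_expectation_nonzero[OF _ U_def U_nonneg X_in_U]) (rule sphere_variable_axioms)
qed

lemma grad_mu: "grad \<mu> = lam *\<^sub>R \<mu>"
  unfolding lam_def using X_mu by (intro first_order_condition[OF _ mean]) auto

lemma distr_Xs: "distr M borel (Xs i) = distr M borel X"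
proof -
  have "distr (distr M sphere_borel (Xs i)) borel (\<lambda>x. x) = distr (distr M sphere_borel X) borel (\<lambda>x. x)"
    by (simp add: identical)
  then show ?thesis
    by (simp add: distr_distr[OF id_sphere_borel] X_measurable Xs_measurable comp_def)
qed

lemma indep_Xs: "indep_vars (\<lambda>_. borel) Xs UNIV"
  using indep_vars_compose2[OF indep, of "\<lambda>_ x. x" "\<lambda>_. borel"] id_sphere_borel by simp

lemma expectation_Xs:
  fixes f :: "'h \<Rightarrow> 'c::{banach, second_countable_topology}"
  assumes [measurable]: "f \<in> borel_measurable borel"
  shows "expectation (\<lambda>\<omega>. f (Xs i \<omega>)) = expectation (\<lambda>\<omega>. f (X \<omega>))"
proof -
  have "(\<integral>y. f y \<partial>distr M borel (Xs i)) = (\<integral>y. f y \<partial>distr M borel X)" by (simp add: distr_Xs)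
  then show ?thesis by (simp add: integral_distr)
qed

definition score :: "'h \<Rightarrow> 'h" where
  "score y = agc (y \<bullet> \<mu>) *\<^sub>R y - lam *\<^sub>R \<mu>"

lemma score_measurable [measurable]: "score \<in> borel_measurable borel"
  unfolding score_def[abs_def] by measurable

lemma norm_score: "norm y = 1 \<Longrightarrow> norm (score y) \<le> 2 + lam"
  unfolding score_def using agc_bounds[of "y \<bullet> \<mu>"] norm_mu lam_pos
  by (intro order_trans[OF norm_triangle_ineq4] add_mono) auto

lemma expectation_score: "expectation (\<lambda>\<omega>. score (X \<omega>)) = 0"
proof -
  have "expectation (\<lambda>\<omega>. score (X \<omega>)) = grad \<mu> - lam *\<^sub>R \<mu>"
    unfolding score_def grad_def using integrable_grad[of \<mu>] by (simp add: prob_space)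
  then show ?thesis by (simp add: grad_mu)
qed

lemma average_score:
  "n \<ge> 1 \<Longrightarrow> average n (\<lambda>i. score (xs i)) = sample_grad n xs \<mu> - lam *\<^sub>R \<mu>"
  by (simp add: average_def sample_grad_def score_def sum_subtractf scaleR_diff_right sum_constant_scaleR)

definition mean_Hess :: "'h \<Rightarrow>\<^sub>L 'h" where
  "mean_Hess = op_expectation M (\<lambda>\<omega>. cHess \<mu> (X \<omega>))"

text \<open>The covariance formula integrates over \<open>M\<close>, the law of large numbers under
  the law of \<open>X\<close>; matrix entries show that both give the same operator.\<close>

lemma has_expectation_Hess:
  shows "has_expectation M (\<lambda>\<omega>. cHess \<mu> (X \<omega>)) mean_Hess"
    and "has_expectation (distr M borel X) (cHess \<mu>) mean_Hess"
proof -
  obtain C where C: "\<And>x. norm (cHess \<mu> x) \<le> C * (1 + (norm x)\<^sup>2)" using cHess_bound[OF norm_mu] by blast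
  have X2: "integrable M (\<lambda>\<omega>. (norm (X \<omega>))\<^sup>2)"
    by (rule integrable_const_bound[where B=1]) (auto simp: norm_X)
  obtain B where B: "has_expectation M (\<lambda>\<omega>. cHess \<mu> (X \<omega>)) B"
    using has_expectation_compose_continuous[OF finite_measure_axioms X_borel X2 continuous_on_cHess C] by blast
  interpret D: prob_space "distr M borel X" by (rule prob_space_distr) simp
  have "integrable (distr M borel X) (\<lambda>y. (norm y)\<^sup>2)" using X2 by (simp add: integrable_distr_eq)
  then obtain B' where B': "has_expectation (distr M borel X) (cHess \<mu>) B'"
    using has_expectation_compose_continuous[OF D.finite_measure_axioms _ _ continuous_on_cHess C, of "\<lambda>y. y"] by auto
  have m: "(\<lambda>y. cHess \<mu> y v \<bullet> w) \<in> borel_measurable borel" for v w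
    by (intro borel_measurable_continuous_onI continuous_intros
        bounded_linear.continuous_on[OF blinfun.bounded_linear_left] continuous_on_cHess)
  have "B' = B"
    by (rule blinfun_eqI, rule inner_ext)
      (simp add: has_expectation_inner(2)[OF B] has_expectation_inner(2)[OF B'] integral_distr m)
  moreover have "mean_Hess = B" unfolding mean_Hess_def by (rule op_expectation_eqI[OF B])
  ultimately show "has_expectation M (\<lambda>\<omega>. cHess \<mu> (X \<omega>)) mean_Hess"
    and "has_expectation (distr M borel X) (cHess \<mu>) mean_Hess" using B B' by auto
qed

lemmas mean_Hess_inner = has_expectation_inner[OF has_expectation_Hess(1)]

lemma cHess_symmetric: "cHess \<mu> y v \<bullet> w = v \<bullet> cHess \<mu> y w"
  using tproj_inner[of \<mu> v w] by (simp add: cHess_apply inner_add_left inner_add_right inner_commute)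

lemma mean_Hess_symmetric: "mean_Hess v \<bullet> w = v \<bullet> mean_Hess w"
proof -
  have "mean_Hess v \<bullet> w = expectation (\<lambda>\<omega>. cHess \<mu> (X \<omega>) v \<bullet> w)" by (rule mean_Hess_inner(2))
  also have "\<dots> = expectation (\<lambda>\<omega>. cHess \<mu> (X \<omega>) w \<bullet> v)"
    by (simp only: cHess_symmetric[of _ v w] inner_commute[of v])
  also have "\<dots> = mean_Hess w \<bullet> v" by (rule mean_Hess_inner(2)[symmetric])
  finally show ?thesis by (simp only: inner_commute[of v])
qed

lemma mean_Hess_tangent_op: "mean_Hess \<in> tangent_op \<mu>"
proof -
  have 0: "mean_Hess \<mu> = 0"
    by (rule inner_ext) (simp add: mean_Hess_inner(2) cHess_apply tproj_self[OF norm_mu] tproj_inner)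
  then have "mean_Hess v \<bullet> \<mu> = 0" for v by (simp add: mean_Hess_symmetric)
  then show ?thesis using 0 by (auto simp: tangent_op_def tangent_hom_def tangent_def)
qed

text \<open>The \<open>akap\<close> term is nonnegative, and the other averages to 2 lam |v|^2
  because \<open>lam\<close> is the mean of ag(t) t for t =
  \<open>X \<omega> \<bullet> \<mu>\<close>. Invertibility of the mean Hessian is thereby
  proved.\<close>

lemma mean_Hess_coercive:
  assumes v: "v \<in> tangent \<mu>"
  shows "2 * lam * (norm v)\<^sup>2 \<le> mean_Hess v \<bullet> v"
proof -
  have "2 * lam * (norm v)\<^sup>2 = expectation (\<lambda>\<omega>. agc (X \<omega> \<bullet> \<mu>) * (X \<omega> \<bullet> \<mu>) * (2 * (norm v)\<^sup>2))"
    unfolding lam_def grad_inner by simp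
  also have "\<dots> \<le> expectation (\<lambda>\<omega>. cHess \<mu> (X \<omega>) v \<bullet> v)"
  proof (rule integral_mono)
    show "integrable M (\<lambda>\<omega>. agc (X \<omega> \<bullet> \<mu>) * (X \<omega> \<bullet> \<mu>) * (2 * (norm v)\<^sup>2))"
      using integrable_grad_inner by simp
    show "integrable M (\<lambda>\<omega>. cHess \<mu> (X \<omega>) v \<bullet> v)" by (rule mean_Hess_inner(1))
    obtain K where K: "\<And>t. 0 \<le> akc t" using akc_bounds by blast
    fix \<omega>
    have "cHess \<mu> (X \<omega>) v \<bullet> v = 2 * akc (X \<omega> \<bullet> \<mu>) * (tproj \<mu> (X \<omega>) \<bullet> v)\<^sup>2 + agc (X \<omega> \<bullet> \<mu>) * (X \<omega> \<bullet> \<mu>) * (2 * (norm v)\<^sup>2)"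
      unfolding power2_norm_eq_inner
      by (simp add: cHess_apply inner_add_left tproj_tangent[OF v] power2_eq_square)
    then show "agc (X \<omega> \<bullet> \<mu>) * (X \<omega> \<bullet> \<mu>) * (2 * (norm v)\<^sup>2) \<le> cHess \<mu> (X \<omega>) v \<bullet> v"
      using K[of "X \<omega> \<bullet> \<mu>"] by simp
  qed
  also have "\<dots> = mean_Hess v \<bullet> v" by (simp add: mean_Hess_inner(2))
  finally show ?thesis .
qed

definition inv_Hess :: "'h \<Rightarrow>\<^sub>L 'h" where
  "inv_Hess = tangent_inverse \<mu> mean_Hess"

lemma inv_Hess:
  shows "inv_Hess \<in> tangent_op \<mu>"
    and "v \<in> tangent \<mu> \<Longrightarrow> mean_Hess (inv_Hess v) = v" and "v \<in> tangent \<mu> \<Longrightarrow> inv_Hess (mean_Hess v) = v"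
  unfolding inv_Hess_def
  using tangent_inverse_coercive[OF norm_mu mean_Hess_tangent_op _ mean_Hess_coercive] lam_pos by auto

lemma inv_Hess_symmetric: "inv_Hess a \<bullet> b = a \<bullet> inv_Hess b"
proof -
  have t: "inv_Hess v \<in> tangent \<mu>" for v using inv_Hess(1) by (auto simp: tangent_op_def)
  have P: "inv_Hess (tproj \<mu> v) = inv_Hess v" for v
    using inv_Hess(1) by (intro tangent_op_apply_tproj) (simp add: tangent_op_def)
  have B: "mean_Hess (inv_Hess v) = tproj \<mu> v" for v
    using inv_Hess(2)[OF tproj_in_tangent[OF norm_mu, of v]] by (simp add: P)
  have "inv_Hess a \<bullet> b = inv_Hess a \<bullet> tproj \<mu> b"
    by (simp add: tproj_inner[symmetric] tproj_tangent[OF t])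
  also have "\<dots> = tproj \<mu> a \<bullet> inv_Hess b"
    unfolding B[symmetric] by (simp add: mean_Hess_symmetric)
  also have "\<dots> = a \<bullet> inv_Hess b"
    by (simp add: tproj_inner tproj_tangent[OF t])
  finally show ?thesis .
qed

text \<open>Almost surely the clamped and the true Hessian agree, and composition with
  \<open>riesz\<close> is bounded linear, hence passes through the expectation.\<close>

lemma Lambda_mean_eq: "Lambda_mean M X \<mu> = mean_Hess"
proof -
  define R where "R = (\<lambda>A::'h \<Rightarrow>\<^sub>L 'h. riesz o\<^sub>L A)"
  have R: "bounded_linear R"
    unfolding R_def by (rule bounded_bilinear.bounded_linear_right[OF bounded_bilinear_blinfun_compose])
  have eq: "AE \<omega> in M. D2_rho2 \<mu> (X \<omega>) = R (cHess \<mu> (X \<omega>))"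
    using X_mu AE_space
  proof eventually_elim
    case (elim \<omega>)
    have "X \<omega> \<noteq> - \<mu>"
    proof
      assume "X \<omega> = - \<mu>"
      then have "X \<omega> \<bullet> \<mu> = - 1" using norm_mu by (simp add: norm_eq_1)
      with elim show False by simp
    qed
    then show ?case
      using elim D2_rho2_eq[OF norm_mu norm_X] by (simp add: R_def cHess_eq)
  qed
  have E: "has_expectation M (\<lambda>\<omega>. D2_rho2 \<mu> (X \<omega>)) (R mean_Hess)"
    by (rule has_expectation_cong_AE[OF has_expectation_bounded_linear[OF R has_expectation_Hess(1)] eq])
  have "op_expectation M (\<lambda>\<omega>. D2_rho2 \<mu> (X \<omega>)) = R mean_Hess"
  proof (rule has_expectation_blinfun_unique[OF _ E])
    fix m v
    assume m: "has_expectation M (\<lambda>\<omega>. D2_rho2 \<mu> (X \<omega>)) m"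
    show "blinfun_apply m v = blinfun_apply (R mean_Hess) v"
    proof (rule blinfun_eqI)
      fix w
      have l: "bounded_linear (\<lambda>A::'h \<Rightarrow>\<^sub>L 'h \<Rightarrow>\<^sub>L real. A v w)"
        by (intro bounded_linear_compose[OF blinfun.bounded_linear_left] blinfun.bounded_linear_left)
      show "m v w = R mean_Hess v w"
        using has_expectation_integral(2)[OF m l] has_expectation_integral(2)[OF E l] by simp
    qed
  qed
  then show ?thesis
    using riesz_op_riesz[OF norm_mu mean_Hess_tangent_op] by (simp add: Lambda_mean_def R_def)
qed

text \<open>The logarithm at \<open>\<mu>\<close> in clamped form; it is also the tangential part of
  \<open>score\<close>, which links the limit of the averages to the covariance of V.\<close>

definition log_vec :: "'h \<Rightarrow> 'h" where
  "log_vec y = agc (y \<bullet> \<mu>) *\<^sub>R tproj \<mu> y"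

lemma continuous_on_log_vec: "continuous_on UNIV log_vec"
  unfolding log_vec_def[abs_def]
  by (intro continuous_intros continuous_on_compose2[OF continuous_on_agc]) auto

lemma tproj_score: "tproj \<mu> (score y) = log_vec y"
  by (simp add: score_def log_vec_def blinfun.bilinear_simps tproj_self[OF norm_mu])

lemma norm_log_vec: "norm (log_vec y) \<le> 2 * norm y"
  unfolding log_vec_def norm_scaleR
  using agc_bounds[of "y \<bullet> \<mu>"] norm_tproj_le[OF norm_mu, of y] by (intro mult_mono) auto

lemma slog_X: "AE \<omega> in M. slog \<mu> (X \<omega>) = log_vec (X \<omega>)"
  using X_mu AE_space
proof eventually_elim
  case (elim \<omega>)
  then show ?case
    using slog_eq_ag[OF norm_mu norm_X] by (simp add: log_vec_def tproj_apply agc_eq inner_commute)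
qed

lemma covariance_inner:
  "op_expectation M (\<lambda>\<omega>. tensor (slog \<mu> (X \<omega>)) (slog \<mu> (X \<omega>))) v \<bullet> w
    = expectation (\<lambda>\<omega>. (log_vec (X \<omega>) \<bullet> v) * (log_vec (X \<omega>) \<bullet> w))"
proof -
  define q where "q y = tensor (log_vec y) (log_vec y)" for y
  have q: "continuous_on UNIV q"
    unfolding q_def by (intro bounded_bilinear.continuous_on[OF bounded_bilinear_tensor] continuous_on_log_vec)
  have qb: "norm (q y) \<le> 4 * (1 + (norm y)\<^sup>2)" for y
  proof -
    have "norm (q y) \<le> (2 * norm y) * (2 * norm y)"
      unfolding q_def by (rule order_trans[OF norm_tensor_le]) (intro mult_mono norm_log_vec, auto)
    also have "\<dots> \<le> 4 * (1 + (norm y)\<^sup>2)" by (simp add: power2_eq_square)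
    finally show ?thesis .
  qed
  have X2: "integrable M (\<lambda>\<omega>. (norm (X \<omega>))\<^sup>2)"
    by (rule integrable_const_bound[where B=1]) (auto simp: norm_X)
  obtain S where S: "has_expectation M (\<lambda>\<omega>. q (X \<omega>)) S"
    using has_expectation_compose_continuous[OF finite_measure_axioms X_borel X2 q qb] by blast
  have "has_expectation M (\<lambda>\<omega>. tensor (slog \<mu> (X \<omega>)) (slog \<mu> (X \<omega>))) S"
    by (rule has_expectation_cong_AE[OF S]) (use slog_X in \<open>eventually_elim, simp add: q_def\<close>)
  then have "op_expectation M (\<lambda>\<omega>. tensor (slog \<mu> (X \<omega>)) (slog \<mu> (X \<omega>))) = S" by (rule op_expectation_eqI)
  then show ?thesis by (simp add: has_expectation_inner(2)[OF S] q_def)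
qed

definition limit_op :: "'h \<Rightarrow> 'h \<Rightarrow>\<^sub>L 'h" where
  "limit_op x = Hess \<mu> x o\<^sub>L inv_Hess"

lemma limit_op_hom: "limit_op x \<in> tangent_hom \<mu>" and limit_op_tangent: "limit_op x v \<bullet> \<mu> = 0"
  using inv_Hess(1) Hess_tangent_op[OF norm_mu, of x]
  by (auto simp: limit_op_def tangent_op_def tangent_hom_def tangent_def blinfun.zero_right)

text \<open>Both Hessians are symmetric, so the two outer operators on each side of the covariance
  move onto the vectors, and then onto the logarithm.\<close>

lemma limit_covariance_inner:
  assumes x: "norm x = 1" "x \<noteq> - \<mu>"
  shows "limit_covariance M X \<mu> x v \<bullet> w
    = expectation (\<lambda>\<omega>. (limit_op x (score (X \<omega>)) \<bullet> v) * (limit_op x (score (X \<omega>)) \<bullet> w))"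
proof -
  have A: "log_vec y \<bullet> inv_Hess (Hess \<mu> x v) = limit_op x (score y) \<bullet> v" for y v
  proof -
    have "limit_op x (score y) = limit_op x (log_vec y)"
      by (simp add: tproj_score[symmetric] tangent_op_apply_tproj[OF limit_op_hom])
    then show ?thesis
      by (simp add: limit_op_def Hess_symmetric inv_Hess_symmetric)
  qed
  have "limit_covariance M X \<mu> x v \<bullet> w
      = op_expectation M (\<lambda>\<omega>. tensor (slog \<mu> (X \<omega>)) (slog \<mu> (X \<omega>))) (inv_Hess (Hess \<mu> x v)) \<bullet> inv_Hess (Hess \<mu> x w)"
    unfolding limit_covariance_def Lambda_mean_eq Lambda_pt_eq[OF norm_mu x] inv_Hess_def[symmetric]
    by (simp add: Hess_symmetric inv_Hess_symmetric)
  then show ?thesis unfolding covariance_inner A .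
qed

text \<open>The central limit theorem is applied to the images of the scores under
  \<open>- limit_op x\<close>. They are orthogonal to \<open>\<mu>\<close>, so the support clause
  makes the limit tangent-valued.\<close>

lemma linearized_limit:
  assumes x: "norm x = 1" "x \<noteq> - \<mu>"
  obtains Z where "gaussian_element \<mu> (distr gauss_space borel Z) (tproj \<mu>) 0 (limit_covariance M X \<mu> x)"
    "converges_in_distribution M (\<lambda>n \<omega>. - sqrt (real n) *\<^sub>R limit_op x (average n (\<lambda>i. score (Xs i \<omega>))))
       (distr gauss_space borel Z) (tproj \<mu>)"
proof -
  define g where "g y = - limit_op x (score y)" for y
  define W where "W i \<omega> = g (Xs i \<omega>)" for i \<omega>
  have g[measurable]: "g \<in> borel_measurable borel"
    unfolding g_def[abs_def]
    by (intro borel_measurable_uminus measurable_compose[OF score_measurable] borel_measurable_continuous_onI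
        continuous_intros)
  have ind: "indep_vars (\<lambda>_. borel) W UNIV"
    unfolding W_def[abs_def] using indep_vars_compose2[OF indep_Xs, of "\<lambda>_. g" "\<lambda>_. borel"] by simp
  have D: "distr M borel (W i) = distr (distr M borel X) borel g" for i
    unfolding W_def[abs_def] distr_Xs[of i, symmetric] by (simp add: distr_distr comp_def)
  have ng: "norm (g y) \<le> norm (limit_op x) * (2 + lam)" if "norm y = 1" for y
    unfolding g_def norm_minus_cancel
    by (rule order_trans[OF norm_blinfun]) (intro mult_left_mono norm_score[OF that], simp)
  have b: "AE \<omega> in M. norm (W 0 \<omega>) \<le> norm (limit_op x) * (2 + lam)"
    unfolding W_def by (rule AE_I2) (intro ng norm_Xs)
  have iS: "integrable M (\<lambda>\<omega>. score (X \<omega>))"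
    by (rule integrable_const_bound[where B="2 + lam"]) (auto simp: norm_X intro!: norm_score)
  have "expectation (W 0) = expectation (\<lambda>\<omega>. g (X \<omega>))"
    unfolding W_def[abs_def] by (rule expectation_Xs) simp
  also have "\<dots> = - limit_op x (expectation (\<lambda>\<omega>. score (X \<omega>)))"
    unfolding g_def by (simp add: integral_bounded_linear[OF blinfun.bounded_linear_right iS])
  finally have m: "expectation (W 0) = 0" by (simp add: expectation_score blinfun.zero_right)
  define q where "q h = expectation (\<lambda>\<omega>. (W 0 \<omega> \<bullet> h)\<^sup>2)" for h
  have q: "q h = expectation (\<lambda>\<omega>. (limit_op x (score (X \<omega>)) \<bullet> h)\<^sup>2)" for h
  proof -
    have "(\<lambda>y. (g y \<bullet> h)\<^sup>2) \<in> borel_measurable borel" by measurable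
    from expectation_Xs[OF this, of 0] show ?thesis by (simp add: q_def W_def g_def)
  qed
  from hilbert_CLT[OF ind D b m] obtain Z where Z[measurable]: "Z \<in> borel_measurable gauss_space"
    and Z2: "integrable gauss_space (\<lambda>\<omega>. (norm (Z \<omega>))\<^sup>2)"
    and ch: "\<And>h. (\<integral>\<omega>. iexp (Z \<omega> \<bullet> h) \<partial>gauss_space) = complex_of_real (exp (- q h / 2))"
    and Zp: "\<And>h \<omega>. AE \<omega> in M. W 0 \<omega> \<bullet> h = 0 \<Longrightarrow> Z \<omega> \<bullet> h = 0"
    and conv: "converges_in_distribution M (\<lambda>n \<omega>. (1 / sqrt (real n)) *\<^sub>R (\<Sum>i<n. W i \<omega>)) gauss_space Z"
    unfolding q_def by blast
  have Z\<mu>: "Z \<omega> \<bullet> \<mu> = 0" for \<omega>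
    by (rule Zp) (simp add: W_def g_def limit_op_tangent)
  let ?N = "distr gauss_space borel Z"
  have "gaussian_element \<mu> ?N (tproj \<mu>) 0 (limit_covariance M X \<mu> x)"
  proof (rule gaussian_element_of_gauss_space[OF norm_mu Z Z2 ch _ _ Z\<mu>])
    show "0 \<le> q h" for h unfolding q_def by simp
    show "q (r *\<^sub>R h) = r\<^sup>2 * q h" for r h unfolding q_def by (simp add: power_mult_distrib)
    fix v w
    have i2: "integrable M (\<lambda>\<omega>. (limit_op x (score (X \<omega>)) \<bullet> h)\<^sup>2)" for h
    proof (rule integrable_const_bound[where B="(norm (limit_op x) * (2 + lam) * norm h)\<^sup>2"])
      show "AE \<omega> in M. norm ((limit_op x (score (X \<omega>)) \<bullet> h)\<^sup>2) \<le> (norm (limit_op x) * (2 + lam) * norm h)\<^sup>2"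
      proof (rule AE_I2)
        fix \<omega> assume "\<omega> \<in> space M"
        then have "norm (limit_op x (score (X \<omega>))) \<le> norm (limit_op x) * (2 + lam)"
          using ng[OF norm_X] by (simp add: g_def)
        then have "\<bar>limit_op x (score (X \<omega>)) \<bullet> h\<bar> \<le> norm (limit_op x) * (2 + lam) * norm h"
          by (intro order_trans[OF Cauchy_Schwarz_ineq2] mult_right_mono) auto
        then have "\<bar>limit_op x (score (X \<omega>)) \<bullet> h\<bar>\<^sup>2 \<le> (norm (limit_op x) * (2 + lam) * norm h)\<^sup>2"
          by (rule power_mono) simp
        then show "norm ((limit_op x (score (X \<omega>)) \<bullet> h)\<^sup>2) \<le> (norm (limit_op x) * (2 + lam) * norm h)\<^sup>2" by simp
      qed
      have "(\<lambda>\<omega>. (g (X \<omega>) \<bullet> h)\<^sup>2) \<in> borel_measurable M" by measurable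
      then show "(\<lambda>\<omega>. (limit_op x (score (X \<omega>)) \<bullet> h)\<^sup>2) \<in> borel_measurable M" by (simp add: g_def)
    qed
    have "(q (v + w) - q (v - w)) / 4 = expectation (\<lambda>\<omega>. ((limit_op x (score (X \<omega>)) \<bullet> (v + w))\<^sup>2 - (limit_op x (score (X \<omega>)) \<bullet> (v - w))\<^sup>2) / 4)"
      unfolding q by (simp add: i2 Bochner_Integration.integral_diff)
    also have "\<dots> = expectation (\<lambda>\<omega>. (limit_op x (score (X \<omega>)) \<bullet> v) * (limit_op x (score (X \<omega>)) \<bullet> w))"
      by (rule Bochner_Integration.integral_cong) (simp_all add: inner_add_right inner_diff_right power2_eq_square field_simps)
    finally show "limit_covariance M X \<mu> x v \<bullet> w = (q (v + w) - q (v - w)) / 4"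
      by (simp add: limit_covariance_inner[OF x])
  qed
  moreover have "converges_in_distribution M (\<lambda>n \<omega>. - sqrt (real n) *\<^sub>R limit_op x (average n (\<lambda>i. score (Xs i \<omega>)))) ?N (tproj \<mu>)"
  proof -
    have T: "- sqrt (real n) *\<^sub>R limit_op x (average n (\<lambda>i. score (Xs i \<omega>))) = (1 / sqrt (real n)) *\<^sub>R (\<Sum>i<n. W i \<omega>)" for n \<omega>
    proof -
      have "(\<Sum>i<n. W i \<omega>) = - limit_op x (\<Sum>i<n. score (Xs i \<omega>))"
        by (simp add: W_def g_def sum_negf blinfun.sum_right)
      moreover have "sqrt (real n) / real n = 1 / sqrt (real n)"
        using sqrt_divide_self_eq[of "real n"] by (simp add: inverse_eq_divide)
      ultimately show ?thesis
        by (simp add: average_def blinfun.scaleR_right)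
    qed
    have p: "tproj \<mu> (Z \<omega>) = Z \<omega>" for \<omega>
      using Z\<mu>[of \<omega>] by (simp add: tproj_apply inner_commute)
    have tm: "blinfun_apply (tproj \<mu>) \<in> borel_measurable borel"
      by (intro borel_measurable_continuous_onI continuous_intros)
    have "(\<integral>\<omega>. f (tproj \<mu> \<omega>) \<partial>?N) = (\<integral>\<omega>. f (Z \<omega>) \<partial>gauss_space)" if "continuous_on UNIV f" for f :: "'h \<Rightarrow> real"
    proof -
      have "(\<lambda>y. f (tproj \<mu> y)) \<in> borel_measurable borel"
        using borel_measurable_continuous_onI[OF that] tm by measurable
      then show ?thesis by (simp add: integral_distr p)
    qed
    then show ?thesis
      using conv tm unfolding converges_in_distribution_def T by simp
  qed
  ultimately show thesis by (rule that)
qed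

section \<open>Consistency of sample means and moment bounds\<close>

lemma sample_mean_good:
  assumes "\<forall>n\<ge>1. AE \<omega> in M. is_sample_intrinsic_mean n (\<lambda>i. Xs i \<omega>) (\<mu>hat n \<omega>)"
  shows "AE \<omega> in M. \<omega> \<in> space M \<and> (\<forall>i. Xs i \<omega> \<in> U) \<and> (\<forall>n\<ge>1. is_sample_intrinsic_mean n (\<lambda>i. Xs i \<omega>) (\<mu>hat n \<omega>))"
proof -
  have "AE \<omega> in M. \<forall>n. n \<ge> 1 \<longrightarrow> is_sample_intrinsic_mean n (\<lambda>i. Xs i \<omega>) (\<mu>hat n \<omega>)"
    using assms by (simp add: AE_all_countable)
  with Xs_in_U AE_space show ?thesis by eventually_elim simp
qed

lemma expectation_score_Xs: "expectation (\<lambda>\<omega>. score (Xs i \<omega>)) = 0"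
  using expectation_Xs[OF score_measurable, of i] expectation_score by simp

lemma indep_score: "indep_vars (\<lambda>_. borel) (\<lambda>i \<omega>. score (Xs i \<omega>)) UNIV"
  using indep_vars_compose2[OF indep_Xs, of "\<lambda>_. score" "\<lambda>_. borel"] by simp

text \<open>Stability with \<open>q = \<mu>\<close> bounds the distance by a multiple of the average
  score, which tends to 0 by the strong law.\<close>

lemma sample_mean_consistent:
  assumes mh: "\<forall>n\<ge>1. AE \<omega> in M. is_sample_intrinsic_mean n (\<lambda>i. Xs i \<omega>) (\<mu>hat n \<omega>)"
  shows "AE \<omega> in M. (\<lambda>n. \<mu>hat n \<omega>) \<longlonglongrightarrow> \<mu>"
proof -
  have b: "AE \<omega> in M. norm (score (Xs i \<omega>)) \<le> 2 + lam" for i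
    by (rule AE_I2) (intro norm_score norm_Xs)
  have "AE \<omega> in M. (\<lambda>n. average n (\<lambda>i. score (Xs i \<omega>))) \<longlonglongrightarrow> 0"
    unfolding average_def by (rule SLLN_bounded_mean_0[OF indep_score b expectation_score_Xs])
  with sample_mean_good[OF mh] show ?thesis
  proof eventually_elim
    case (elim \<omega>)
    then have xs: "\<And>i. Xs i \<omega> \<in> U" and p: "\<And>n. n \<ge> 1 \<Longrightarrow> is_sample_intrinsic_mean n (\<lambda>i. Xs i \<omega>) (\<mu>hat n \<omega>)"
      and lim: "(\<lambda>n. average n (\<lambda>i. score (Xs i \<omega>))) \<longlonglongrightarrow> 0" by auto
    have le: "norm (\<mu>hat n \<omega> - \<mu>) \<le> (2 / lam) * norm (average n (\<lambda>i. score (Xs i \<omega>)))" if n: "n \<ge> 1" for n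
      using sample_mean_properties(5)[OF n U_sphere U_nonneg xs p[OF n] norm_mu mu_nonneg, of lam] lam_pos
      unfolding average_score[OF n] by (simp add: norm_minus_commute field_simps)
    have "(\<lambda>n. (2 / lam) * norm (average n (\<lambda>i. score (Xs i \<omega>)))) \<longlonglongrightarrow> 0"
      using tendsto_mult_right_zero[OF tendsto_norm_zero[OF lim]] by blast
    then have "(\<lambda>n. \<mu>hat n \<omega> - \<mu>) \<longlonglongrightarrow> 0"
      by (rule Lim_null_comparison[rotated]) (use le in \<open>auto simp: eventually_sequentially\<close>)
    then show ?case by (simp add: LIM_zero_iff)
  qed
qed

lemma sample_log_domain:
  assumes mh: "\<forall>n\<ge>1. AE \<omega> in M. is_sample_intrinsic_mean n (\<lambda>i. Xs i \<omega>) (\<mu>hat n \<omega>)"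
    and x: "norm x = 1" "x \<noteq> - \<mu>"
  shows "AE \<omega> in M. eventually (\<lambda>n. x \<in> slog_domain (\<mu>hat n \<omega>)) sequentially"
  using sample_mean_consistent[OF mh]
proof eventually_elim
  case (elim \<omega>)
  then have "(\<lambda>n. - \<mu>hat n \<omega>) \<longlonglongrightarrow> - \<mu>" by (rule tendsto_minus)
  moreover have "- \<mu> \<noteq> x" using x(2) by auto
  ultimately have "eventually (\<lambda>n. - \<mu>hat n \<omega> \<noteq> x) sequentially" by (rule tendsto_imp_eventually_ne)
  then show ?case by eventually_elim (use x(1) in \<open>auto simp: slog_domain_def\<close>)
qed

lemma average_score_moments:
  shows "integrable M (\<lambda>\<omega>. real n * (norm (average n (\<lambda>i. score (Xs i \<omega>))))\<^sup>2)"
    and "expectation (\<lambda>\<omega>. real n * (norm (average n (\<lambda>i. score (Xs i \<omega>))))\<^sup>2) \<le> (2 + lam)\<^sup>2"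
proof -
  have b: "AE \<omega> in M. norm (score (Xs i \<omega>)) \<le> 2 + lam" for i
    by (rule AE_I2) (intro norm_score norm_Xs)
  have c: "expectation (\<lambda>\<omega>. (norm (score (Xs i \<omega>)))\<^sup>2) \<le> (2 + lam)\<^sup>2" for i
  proof (rule integral_le_const)
    show "AE \<omega> in M. (norm (score (Xs i \<omega>)))\<^sup>2 \<le> (2 + lam)\<^sup>2"
      using b[of i] by eventually_elim (simp add: power_mono)
    then show "integrable M (\<lambda>\<omega>. (norm (score (Xs i \<omega>)))\<^sup>2)"
      by (intro integrable_const_bound[where B="(2 + lam)\<^sup>2"]) auto
  qed
  have eq: "real n * (norm (average n (\<lambda>i. score (Xs i \<omega>))))\<^sup>2 = (1 / real n) * (norm (\<Sum>i<n. score (Xs i \<omega>)))\<^sup>2" for \<omega>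
    by (simp add: average_def power_divide power2_eq_square)
  note sq = expectation_norm_sum_square_le[OF indep_score b expectation_score_Xs c, of n]
  show "integrable M (\<lambda>\<omega>. real n * (norm (average n (\<lambda>i. score (Xs i \<omega>))))\<^sup>2)"
    unfolding eq using sq(1) by simp
  show "expectation (\<lambda>\<omega>. real n * (norm (average n (\<lambda>i. score (Xs i \<omega>))))\<^sup>2) \<le> (2 + lam)\<^sup>2"
    unfolding eq using sq(2) by (cases "n = 0") (simp_all add: field_simps)
qed

lemma average_Hess_deviation:
  obtains K where "K \<ge> 0"
    and "\<And>n \<omega>. n \<ge> 1 \<Longrightarrow> \<omega> \<in> space M \<Longrightarrow> norm (average n (\<lambda>i. cHess \<mu> (Xs i \<omega>)) - mean_Hess) \<le> K"
    and "\<And>n. n \<ge> 1 \<Longrightarrow> integrable M (\<lambda>\<omega>. norm (average n (\<lambda>i. cHess \<mu> (Xs i \<omega>)) - mean_Hess))"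
    and "(\<lambda>n. expectation (\<lambda>\<omega>. norm (average n (\<lambda>i. cHess \<mu> (Xs i \<omega>)) - mean_Hess))) \<longlonglongrightarrow> 0"
proof -
  obtain C where C: "C \<ge> 0" "\<And>x. norm (cHess \<mu> x) \<le> C * (1 + (norm x)\<^sup>2)" using cHess_bound[OF norm_mu] by blast
  define b where "b n \<omega> = norm (average n (\<lambda>i. cHess \<mu> (Xs i \<omega>)) - mean_Hess)" for n \<omega>
  \<comment> \<open>The norm is a continuous real function of the whole sequence of observations;
    this avoids adding measurable maps into a non-separable space.\<close>
  have bm[measurable]: "b n \<in> borel_measurable M" for n
  proof -
    have "continuous_on UNIV (\<lambda>xs::nat \<Rightarrow> 'h. norm (average n (\<lambda>i. cHess \<mu> (xs i)) - mean_Hess))"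
      unfolding average_def
      by (intro continuous_intros continuous_on_compose2[OF continuous_on_cHess] continuous_on_product_coordinates) auto
    then have "(\<lambda>xs::nat \<Rightarrow> 'h. norm (average n (\<lambda>i. cHess \<mu> (xs i)) - mean_Hess)) \<in> borel_measurable borel"
      by (rule borel_measurable_continuous_onI)
    moreover have "(\<lambda>\<omega> i. Xs i \<omega>) \<in> borel_measurable M"
      by (rule measurable_coordinatewise_then_product) simp
    ultimately show ?thesis unfolding b_def[abs_def] by (rule measurable_compose[rotated])
  qed
  have bK: "b n \<omega> \<le> 2 * C + norm mean_Hess" if "\<omega> \<in> space M" for n \<omega>
  proof -
    have c: "norm (cHess \<mu> (Xs i \<omega>)) \<le> 2 * C" for i
      using C(2)[of "Xs i \<omega>"] norm_Xs[OF that, of i] by simp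
    have "norm (average n (\<lambda>i. cHess \<mu> (Xs i \<omega>))) \<le> 2 * C"
    proof (cases "n = 0")
      case True then show ?thesis using C(1) by (simp add: average_def)
    next
      case False then show ?thesis using c by (intro norm_average_le) auto
    qed
    then show ?thesis unfolding b_def by (intro order_trans[OF norm_triangle_ineq4]) simp
  qed
  have bi: "integrable M (b n)" for n
    by (rule integrable_const_bound[where B="2 * C + norm mean_Hess"]) (use bK in \<open>auto simp: b_def\<close>)
  have nn: "(\<integral>\<^sup>+\<omega>. ennreal (b n \<omega>) \<partial>M) = ennreal (expectation (b n))" for n
    by (rule nn_integral_eq_integral[OF bi]) (simp add: b_def)
  have "(\<lambda>n. \<integral>\<^sup>+\<omega>. ennreal (b n \<omega>) \<partial>M) \<longlonglongrightarrow> 0"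
    unfolding b_def average_def by (rule LLN_L1_has_expectation[OF indep_Xs distr_Xs has_expectation_Hess(2)])
  then have "(\<lambda>n. ennreal (expectation (b n))) \<longlonglongrightarrow> 0"
    by (simp add: nn)
  then have "(\<lambda>n. expectation (b n)) \<longlonglongrightarrow> 0"
    by (subst (asm) ennreal_tendsto_0_iff) (auto simp: b_def)
  then show thesis
    using that[of "2 * C + norm mean_Hess"] C(1) bK bi unfolding b_def[abs_def] by simp
qed

lemma sample_mean_transport_measurable:
  assumes mh: "\<forall>n\<ge>1. AE \<omega> in M. is_sample_intrinsic_mean n (\<lambda>i. Xs i \<omega>) (\<mu>hat n \<omega>)"
    and x: "norm x = 1" and n: "n \<ge> 1"
  shows "(\<lambda>\<omega>. ptransport (\<mu>hat n \<omega>) \<mu> (slog (\<mu>hat n \<omega>) x)) \<in> borel_measurable M"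
proof (rule borel_measurable_AE_eq)
  have "\<mu>hat n \<in> borel_measurable M"
    by (rule sample_mean_measurable[OF complete_measure_axioms n U_sphere U_nonneg Xs_borel Xs_in_U mh[rule_format, OF n]])
  from measurable_compose[OF this slog_ptransport_measurable[of \<mu> x]]
  show "(\<lambda>\<omega>. ptransport (\<mu>hat n \<omega>) \<mu> ((arccos (max (- 1) (min 1 (\<mu>hat n \<omega> \<bullet> x))) / norm (x - (\<mu>hat n \<omega> \<bullet> x) *\<^sub>R \<mu>hat n \<omega>)) *\<^sub>R (x - (\<mu>hat n \<omega> \<bullet> x) *\<^sub>R \<mu>hat n \<omega>))) \<in> borel_measurable M" .
  show "AE \<omega> in M. ptransport (\<mu>hat n \<omega>) \<mu> (slog (\<mu>hat n \<omega>) x) =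
      ptransport (\<mu>hat n \<omega>) \<mu> ((arccos (max (- 1) (min 1 (\<mu>hat n \<omega> \<bullet> x))) / norm (x - (\<mu>hat n \<omega> \<bullet> x) *\<^sub>R \<mu>hat n \<omega>)) *\<^sub>R (x - (\<mu>hat n \<omega> \<bullet> x) *\<^sub>R \<mu>hat n \<omega>))"
    using sample_mean_good[OF mh]
  proof eventually_elim
    case (elim \<omega>)
    then have xs: "\<And>i. Xs i \<omega> \<in> U" and p: "is_sample_intrinsic_mean n (\<lambda>i. Xs i \<omega>) (\<mu>hat n \<omega>)" using n by auto
    have "norm (\<mu>hat n \<omega>) = 1" by (rule sample_mean_properties(1)[OF n U_sphere U_nonneg xs p])
    from inner_sphere_bounds[OF this x] show ?case by (simp add: slog_def Let_def)
  qed
qed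

lemma transported_log_limit:
  assumes mh: "\<forall>n\<ge>1. AE \<omega> in M. is_sample_intrinsic_mean n (\<lambda>i. Xs i \<omega>) (\<mu>hat n \<omega>)"
    and x: "norm x = 1" "x \<noteq> - \<mu>"
  obtains N :: "'h measure" and Z where "gaussian_element \<mu> N Z 0 (limit_covariance M X \<mu> x)"
    "converges_in_distribution M (\<lambda>n \<omega>. sqrt (real n) *\<^sub>R
        (ptransport (\<mu>hat n \<omega>) \<mu> (slog (\<mu>hat n \<omega>) x) - slog \<mu> x)) N Z"
proof -
  define Y where "Y n \<omega> = sqrt (real n) *\<^sub>R (ptransport (\<mu>hat n \<omega>) \<mu> (slog (\<mu>hat n \<omega>) x) - slog \<mu> x)" for n \<omega>
  define T where "T n \<omega> = - sqrt (real n) *\<^sub>R limit_op x (average n (\<lambda>i. score (Xs i \<omega>)))" for n \<omega>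
  define e where "e n \<omega> = norm (average n (\<lambda>i. score (Xs i \<omega>)))" for n \<omega>
  define b where "b n \<omega> = norm (average n (\<lambda>i. cHess \<mu> (Xs i \<omega>)) - mean_Hess)" for n \<omega>
  obtain Z where Z: "gaussian_element \<mu> (distr gauss_space borel Z) (tproj \<mu>) 0 (limit_covariance M X \<mu> x)"
    "converges_in_distribution M T (distr gauss_space borel Z) (tproj \<mu>)"
    unfolding T_def using linearized_limit[OF x] by blast
  obtain K where K: "K \<ge> 0" "\<And>n \<omega>. n \<ge> 1 \<Longrightarrow> \<omega> \<in> space M \<Longrightarrow> b n \<omega> \<le> K"
    "\<And>n. n \<ge> 1 \<Longrightarrow> integrable M (b n)" "(\<lambda>n. expectation (b n)) \<longlonglongrightarrow> 0"
    unfolding b_def using average_Hess_deviation by blast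
  have e2: "integrable M (\<lambda>\<omega>. real n * (e n \<omega>)\<^sup>2)" "expectation (\<lambda>\<omega>. real n * (e n \<omega>)\<^sup>2) \<le> (2 + lam)\<^sup>2" for n
    unfolding e_def by (rule average_score_moments)+
  have [measurable]: "T n \<in> borel_measurable M" for n
    using Z(2) by (simp add: converges_in_distribution_def)
  \<comment> \<open>For \<open>n = 0\<close> no sample mean is given, and the factor sqrt 0 makes
    the term vanish.\<close>
  have [measurable]: "Y n \<in> borel_measurable M" for n
  proof (cases "n = 0")
    case False
    then have [measurable]: "(\<lambda>\<omega>. ptransport (\<mu>hat n \<omega>) \<mu> (slog (\<mu>hat n \<omega>) x)) \<in> borel_measurable M"
      by (intro sample_mean_transport_measurable[OF mh x(1)]) auto
    show ?thesis unfolding Y_def[abs_def] by measurable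
  qed (simp add: Y_def[abs_def])
  \<comment> \<open>In expectation, the middle factor is bounded with coefficient tending to 2
    \<eta>, and the last term tends to 0 for fixed \<eta>, whatever the size of
    \<open>C\<close>.\<close>
  have dev: "\<exists>C\<ge>0. \<forall>n\<ge>1. AE \<omega> in M. norm (Y n \<omega> - T n \<omega>)
      \<le> \<eta> + (2 * \<eta> + C / sqrt (real n)) * (real n * (e n \<omega>)\<^sup>2) + C\<^sup>2 * K / (4 * \<eta>) * b n \<omega>"
    if \<eta>: "\<eta> > 0" for \<eta>
  proof -
    obtain C where C: "C \<ge> 0" "\<And>n xs p. n \<ge> 1 \<Longrightarrow> (\<And>i. xs i \<in> U) \<Longrightarrow> is_sample_intrinsic_mean n xs p \<Longrightarrow>
      norm (ptransport p \<mu> (slog p x) - slog \<mu> x + Hess \<mu> x (inv_Hess (tproj \<mu> (sample_grad n xs \<mu>))))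
      \<le> \<eta> * norm (sample_grad n xs \<mu> - lam *\<^sub>R \<mu>) + C * (norm (sample_grad n xs \<mu> - lam *\<^sub>R \<mu>))\<^sup>2
        + C * norm (average n (\<lambda>i. cHess \<mu> (xs i)) - mean_Hess) * norm (sample_grad n xs \<mu> - lam *\<^sub>R \<mu>)"
      using sample_mean_expansion[OF U_sphere U_nonneg norm_mu mu_nonneg lam_pos x mean_Hess_tangent_op inv_Hess(3) \<eta>] by blast
    have "AE \<omega> in M. norm (Y n \<omega> - T n \<omega>)
      \<le> \<eta> + (2 * \<eta> + C / sqrt (real n)) * (real n * (e n \<omega>)\<^sup>2) + C\<^sup>2 * K / (4 * \<eta>) * b n \<omega>" if n: "n \<ge> 1" for n
      using sample_mean_good[OF mh]
    proof eventually_elim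
      case (elim \<omega>)
      then have xs: "\<And>i. Xs i \<omega> \<in> U" and p: "is_sample_intrinsic_mean n (\<lambda>i. Xs i \<omega>) (\<mu>hat n \<omega>)"
        and sp: "\<omega> \<in> space M" using n by auto
      define g where "g = sample_grad n (\<lambda>i. Xs i \<omega>) \<mu>"
      have av: "average n (\<lambda>i. score (Xs i \<omega>)) = g - lam *\<^sub>R \<mu>" unfolding g_def by (rule average_score[OF n])
      have A: "limit_op x (g - lam *\<^sub>R \<mu>) = Hess \<mu> x (inv_Hess (tproj \<mu> g))"
      proof -
        have "limit_op x (g - lam *\<^sub>R \<mu>) = limit_op x (tproj \<mu> (g - lam *\<^sub>R \<mu>))"
          by (rule tangent_op_apply_tproj[OF limit_op_hom, symmetric])
        also have "tproj \<mu> (g - lam *\<^sub>R \<mu>) = tproj \<mu> g"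
          by (simp add: blinfun.bilinear_simps tproj_self[OF norm_mu])
        finally show ?thesis by (simp add: limit_op_def)
      qed
      have "Y n \<omega> - T n \<omega> = sqrt (real n) *\<^sub>R (ptransport (\<mu>hat n \<omega>) \<mu> (slog (\<mu>hat n \<omega>) x) - slog \<mu> x + Hess \<mu> x (inv_Hess (tproj \<mu> g)))"
        unfolding Y_def T_def av A by (simp add: scaleR_add_right)
      then have "norm (Y n \<omega> - T n \<omega>) = sqrt (real n) * norm (ptransport (\<mu>hat n \<omega>) \<mu> (slog (\<mu>hat n \<omega>) x) - slog \<mu> x + Hess \<mu> x (inv_Hess (tproj \<mu> g)))"
        by simp
      also have "\<dots> \<le> sqrt (real n) * (\<eta> * e n \<omega> + C * (e n \<omega>)\<^sup>2 + C * b n \<omega> * e n \<omega>)"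
        unfolding e_def b_def av using C(2)[OF n xs p] by (intro mult_left_mono) (auto simp: g_def)
      also have "\<dots> \<le> \<eta> + (2 * \<eta> + C / sqrt (real n)) * ((sqrt (real n))\<^sup>2 * (e n \<omega>)\<^sup>2) + C\<^sup>2 * K / (4 * \<eta>) * b n \<omega>"
        using n by (intro weighted_error_bound K(2)[OF n sp] C(1) \<eta>) (auto simp: e_def b_def)
      finally show ?case by simp
    qed
    then show ?thesis using C(1) by blast
  qed
  have int: "integrable M (\<lambda>\<omega>. norm (Y n \<omega> - T n \<omega>))" for n
  proof (cases "n = 0")
    case False
    then have n: "n \<ge> 1" by simp
    obtain C where "AE \<omega> in M. norm (Y n \<omega> - T n \<omega>)
      \<le> 1 + (2 * 1 + C / sqrt (real n)) * (real n * (e n \<omega>)\<^sup>2) + C\<^sup>2 * K / (4 * 1) * b n \<omega>"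
      using dev[of 1] n by auto
    then have AE1: "AE \<omega> in M. norm (norm (Y n \<omega> - T n \<omega>))
      \<le> norm (1 + (2 * 1 + C / sqrt (real n)) * (real n * (e n \<omega>)\<^sup>2) + C\<^sup>2 * K / (4 * 1) * b n \<omega>)"
      by eventually_elim simp
    show ?thesis
    proof (rule Bochner_Integration.integrable_bound[OF _ _ AE1])
      show "integrable M (\<lambda>\<omega>. 1 + (2 * 1 + C / sqrt (real n)) * (real n * (e n \<omega>)\<^sup>2) + C\<^sup>2 * K / (4 * 1) * b n \<omega>)"
        by (intro Bochner_Integration.integrable_add integrable_mult_right e2(1) K(3)[OF n]) simp
    qed measurable
  qed (simp add: Y_def T_def)
  have lim: "(\<lambda>n. expectation (\<lambda>\<omega>. norm (Y n \<omega> - T n \<omega>))) \<longlonglongrightarrow> 0"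
  proof (rule LIMSEQ_I)
    fix r :: real assume r: "r > 0"
    define c0 where "c0 = (2 + lam)\<^sup>2"
    \<comment> \<open>The bound \<open>B n\<close> tends to \<eta> (1 + 2 c0), which this choice
      makes r / 2.\<close>
    define \<eta> where "\<eta> = r / (2 * (1 + 2 * c0))"
    have c0: "c0 \<ge> 0" by (simp add: c0_def)
    have \<eta>: "\<eta> > 0" using r c0 by (simp add: \<eta>_def add_pos_nonneg)
    obtain C where C: "C \<ge> 0" "\<And>n. n \<ge> 1 \<Longrightarrow> AE \<omega> in M. norm (Y n \<omega> - T n \<omega>)
      \<le> \<eta> + (2 * \<eta> + C / sqrt (real n)) * (real n * (e n \<omega>)\<^sup>2) + C\<^sup>2 * K / (4 * \<eta>) * b n \<omega>"
      using dev[OF \<eta>] by blast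
    define B where "B n = \<eta> + (2 * \<eta> + C / sqrt (real n)) * c0 + C\<^sup>2 * K / (4 * \<eta>) * expectation (b n)" for n
    have le: "expectation (\<lambda>\<omega>. norm (Y n \<omega> - T n \<omega>)) \<le> B n" if n: "n \<ge> 1" for n
    proof -
      have i1: "integrable M (\<lambda>\<omega>. (2 * \<eta> + C / sqrt (real n)) * (real n * (e n \<omega>)\<^sup>2))"
        and i2: "integrable M (\<lambda>\<omega>. C\<^sup>2 * K / (4 * \<eta>) * b n \<omega>)"
        by (intro integrable_mult_right e2(1) K(3)[OF n])+
      have "expectation (\<lambda>\<omega>. norm (Y n \<omega> - T n \<omega>))
        \<le> expectation (\<lambda>\<omega>. \<eta> + (2 * \<eta> + C / sqrt (real n)) * (real n * (e n \<omega>)\<^sup>2) + C\<^sup>2 * K / (4 * \<eta>) * b n \<omega>)"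
        by (rule integral_mono_AE[OF int _ C(2)[OF n]])
          (intro Bochner_Integration.integrable_add i1 i2, simp)
      also have "\<dots> = \<eta> + (2 * \<eta> + C / sqrt (real n)) * expectation (\<lambda>\<omega>. real n * (e n \<omega>)\<^sup>2) + C\<^sup>2 * K / (4 * \<eta>) * expectation (b n)"
      proof -
        have "expectation (\<lambda>\<omega>. \<eta> + (2 * \<eta> + C / sqrt (real n)) * (real n * (e n \<omega>)\<^sup>2) + C\<^sup>2 * K / (4 * \<eta>) * b n \<omega>)
          = expectation (\<lambda>\<omega>. \<eta> + (2 * \<eta> + C / sqrt (real n)) * (real n * (e n \<omega>)\<^sup>2)) + expectation (\<lambda>\<omega>. C\<^sup>2 * K / (4 * \<eta>) * b n \<omega>)"
          by (rule Bochner_Integration.integral_add[OF _ i2]) (intro Bochner_Integration.integrable_add i1, simp)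
        also have "expectation (\<lambda>\<omega>. \<eta> + (2 * \<eta> + C / sqrt (real n)) * (real n * (e n \<omega>)\<^sup>2))
          = expectation (\<lambda>\<omega>. \<eta>) + expectation (\<lambda>\<omega>. (2 * \<eta> + C / sqrt (real n)) * (real n * (e n \<omega>)\<^sup>2))"
          by (rule Bochner_Integration.integral_add[OF _ i1]) simp
        finally show ?thesis by (simp only: integral_mult_right_zero) (simp add: prob_space)
      qed
      also have "\<dots> \<le> B n"
        unfolding B_def using e2(2)[of n] \<eta> C(1) by (intro add_mono mult_left_mono order_refl) (auto simp: c0_def)
      finally show ?thesis .
    qed
    have Cn: "(\<lambda>n. C / sqrt (real n)) \<longlonglongrightarrow> 0" by real_asymp
    have "B \<longlonglongrightarrow> \<eta> + (2 * \<eta> + 0) * c0 + C\<^sup>2 * K / (4 * \<eta>) * 0"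
      unfolding B_def
      by (intro tendsto_intros K(4) Cn)
    moreover have "\<eta> + (2 * \<eta> + 0) * c0 + C\<^sup>2 * K / (4 * \<eta>) * 0 < r"
    proof -
      have "\<eta> * (1 + 2 * c0) = r / 2" using c0 by (simp add: \<eta>_def field_simps)
      then show ?thesis using r by (simp add: algebra_simps)
    qed
    ultimately have "eventually (\<lambda>n. B n < r) sequentially" by (rule order_tendstoD(2))
    then obtain n0 where n0: "\<And>n. n \<ge> n0 \<Longrightarrow> B n < r" by (auto simp: eventually_sequentially)
    show "\<exists>no. \<forall>n\<ge>no. norm (expectation (\<lambda>\<omega>. norm (Y n \<omega> - T n \<omega>)) - 0) < r"
    proof (intro exI allI impI)
      fix n assume n: "max 1 n0 \<le> n"
      have "0 \<le> expectation (\<lambda>\<omega>. norm (Y n \<omega> - T n \<omega>))" by simp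
      with le[of n] n0[of n] n show "norm (expectation (\<lambda>\<omega>. norm (Y n \<omega> - T n \<omega>)) - 0) < r" by simp
    qed
  qed
  have N: "prob_space (distr gauss_space borel Z)" using Z(1) by (simp add: gaussian_element_def)
  have "converges_in_distribution M Y (distr gauss_space borel Z) (tproj \<mu>)"
    by (rule converges_in_distribution_L1_perturbation[OF prob_space_axioms N Z(2) _ int lim]) simp
  with Z(1) show thesis using that unfolding Y_def by blast
qed

end

theorem corollary3p2:
  fixes M :: "'w measure"
    and X :: "'w \<Rightarrow> 'h::{real_inner, banach, second_countable_topology}"
    and Xs :: "nat \<Rightarrow> 'w \<Rightarrow> 'h"
    and U :: "'h set"
    and \<mu> x :: 'h
    and \<mu>hat :: "nat \<Rightarrow> 'w \<Rightarrow> 'h"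
  assumes "infinite_dimensional TYPE('h)"
    and "prob_space M" and "complete_measure M"
    and "X \<in> M \<rightarrow>\<^sub>M sphere_borel"
    and "U = rv_support M X"
    and "AE \<omega> in M. X \<omega> \<in> U"
    and "(SUP (y, z)\<in>U \<times> U. rho y z) \<le> pi / 2"
    and "is_intrinsic_mean M X \<mu>"
    and "prob_space.indep_vars M (\<lambda>_. sphere_borel) Xs UNIV"
    and "\<And>i. distr M sphere_borel (Xs i) = distr M sphere_borel X"
    and "\<And>n. n \<ge> 1 \<Longrightarrow> AE \<omega> in M. is_sample_intrinsic_mean n (\<lambda>i. Xs i \<omega>) (\<mu>hat n \<omega>)"
    and "x \<in> sphere 0 1" and "rho x \<mu> < pi"
  shows "x \<in> slog_domain \<mu> \<and>
    (AE \<omega> in M. eventually (\<lambda>n. x \<in> slog_domain (\<mu>hat n \<omega>)) sequentially) \<and>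
    (\<exists>(N :: 'h measure) Z.
       gaussian_element \<mu> N Z 0 (limit_covariance M X \<mu> x) \<and>
       converges_in_distribution M
         (\<lambda>n \<omega>. sqrt (real n) *\<^sub>R
            (ptransport (\<mu>hat n \<omega>) \<mu> (slog (\<mu>hat n \<omega>) x) - slog \<mu> x)) N Z)"
proof -
  interpret prob_space M by (rule assms(2))
  interpret complete_measure M by (rule assms(3))
  interpret sphere_sample M X Xs U \<mu>
    by unfold_locales (fact assms)+
  have mh: "\<forall>n\<ge>1. AE \<omega> in M. is_sample_intrinsic_mean n (\<lambda>i. Xs i \<omega>) (\<mu>hat n \<omega>)"
    using assms(11) by blast
  have x: "norm x = 1" using assms(12) by simp
  have x': "x \<noteq> - \<mu>"
  proof
    assume "x = - \<mu>"
    then have "x \<bullet> \<mu> = - 1" using norm_mu by (simp add: norm_eq_1)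
    then show False using assms(13) by (simp add: rho_def)
  qed
  have "x \<in> slog_domain \<mu>" using x x' by (simp add: slog_domain_def)
  moreover have "AE \<omega> in M. eventually (\<lambda>n. x \<in> slog_domain (\<mu>hat n \<omega>)) sequentially"
    by (rule sample_log_domain[OF mh x x'])
  moreover obtain N :: "'h measure" and Z where "gaussian_element \<mu> N Z 0 (limit_covariance M X \<mu> x)"
    "converges_in_distribution M (\<lambda>n \<omega>. sqrt (real n) *\<^sub>R
        (ptransport (\<mu>hat n \<omega>) \<mu> (slog (\<mu>hat n \<omega>) x) - slog \<mu> x)) N Z"
    using transported_log_limit[OF mh x x'] by blast
  ultimately show ?thesis by blast
qed

end
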